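(* Let $\vartheta>0$, let $P\subset\mathbb{R}^p$, $Q\subset\mathbb{R}^q$ and $\Omega$ (a subset of a finite-dimensional Euclidean space) be compact, let $f:\mathbb{R}^n\times P\times Q\to\mathbb{R}^n$ and $g:\mathbb{R}^n\times\Omega\to\mathbb{R}^n$ satisfy the regularity assumptions of the context, let $M\subset[0,\vartheta]\times\mathbb{R}^n$ be closed, and put $F=M[\vartheta]$ and $M^*=\{\vartheta\}\times F$. Assume that $M$ is the controllability set of the system $\dot x=g(x,\omega)$, $\omega\in\Omega$, with respect to the target set $M^*$, i.e. $$M=\{(t,x)\in[0,\vartheta]\times\mathbb{R}^n:\ \exists x_0\in F\ \exists\mu\in\mathcal{R}_\Omega:\ x=\varphi_g(t,\vartheta,x_0,\mu)\}.$$ Assume moreover that for all $u\in P$, $v\in Q$, $\omega\in\Omega$ and all $\tau',\tau''\ge 0$ the flows commute: $$\mathcal{F}^{\tau'}_{u,v}\circ\mathcal{G}^{\tau''}_\omega=\mathcal{G}^{\tau''}_\omega\circ\mathcal{F}^{\tau'}_{u,v}.$$ Then: (1) $W_k=W_k^*$ for all $k\in\mathbb{N}\cup\{0\}$; (2) $\mathfrak{W}=\mathfrak{W}^*$; (3) if the system $\dot x=f(x,u,v)$ satisfies the Isaacs condition $$\forall s,x\in\mathbb{R}^n:\ \min_{u\in P}\max_{v\in Q}\langle s,f(x,u,v)\rangle=\max_{v\in Q}\min_{u\in P}\langle s,f(x,u,v)\rangle,$$ then the system $\dot x=f^*(x,\nu,u,\omega,v)$ also satisfies the Isaacs condition $$\forall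 s,x\in\mathbb{R}^n:\ \min_{(\nu,u,\omega)\in P^*}\max_{v\in Q}\langle s,f^*(x,\nu,u,\omega,v)\rangle=\max_{v\in Q}\min_{(\nu,u,\omega)\in P^*}\langle s,f^*(x,\nu,u,\omega,v)\rangle.$$
   Context: Standing assumptions: $f$ is continuous, locally Lipschitz in $x$, and has sublinear growth ($\|f(x,u,v)\|\le c(1+\|x\|)$); $g$ is assumed to have the same properties (so that all motions below are defined). For $E\subset[0,\vartheta]\times\mathbb{R}^n$ and $t\in[0,\vartheta]$, $E[t]=\{x:(t,x)\in E\}$. Slide controls: for a compact set $\Lambda$, $\mathcal{R}_\Lambda$ denotes the set of Borel measures on $[0,\vartheta]\times\Lambda$ (relaxed controls, with projection onto $[0,\vartheta]$ equal to Lebesgue measure). For $h:\mathbb{R}^n\times\Lambda\to\mathbb{R}^n$, a position $(t_*,x_* )\in[0,\vartheta]\times\mathbb{R}^n$ and $\mu\in\mathcal{R}_\Lambda$, the motion $\varphi_h(\cdot,t_*,x_*,\mu)$ on $[0,\vartheta]$ is the solution of $x(t)=x_*+\int_{[t_*,t]\times\Lambda}h(x(\xi),b)\,\mu(d(\xi,b))$ for $t\ge t_*$ and $x(t)=x_*-\int_{[t,t_*]\times\Lambda}h(x(\xi),b)\,\mu(d(\xi,b))$ for $t\le t_*$. For $v\in Q$ let $f_v(x,u)=f(x,u,v)$. Let $P^*=\{0,1\}\times P\times\Omega$ and $f^*(x,\nu,u,\omega,v)=\nu f(x,u,v)+(1-\nu)g(x,\omega)$; for $v\in Q$ let $f^*_v(x,(\nu,u,\omega))=f^*(x,\nu,u,\omega,v)$.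 Flows: $\mathcal{F}^\tau_{u,v}$ is the time-$\tau$ flow map of $\dot x=f(x,u,v)$ (constant $u,v$), and $\mathcal{G}^\tau_\omega$ is the time-$\tau$ flow map of $\dot x=g(x,\omega)$ (constant $\omega$). Program absorption operators: for $E\subset[0,\vartheta]\times\mathbb{R}^n$, $A(E)=\{(t_*,x_* )\in E:\ \forall v\in Q\ \exists\mu\in\mathcal{R}_P\ \exists\xi\in[t_*,\vartheta]:\ \varphi_{f_v}(\xi,t_*,x_*,\mu)\in M[\xi]\text{ and }\varphi_{f_v}(t,t_*,x_*,\mu)\in E[t]\ \forall t\in[t_*,\xi]\}$, and $A^*(E)$ is defined by the same formula with $f_v$, $\mathcal{R}_P$, $M$ replaced by $f^*_v$, $\mathcal{R}_{P^*}$, $M^*=\{\vartheta\}\times F$. Set $W_0=W_0^*=[0,\vartheta]\times\mathbb{R}^n$, $W_k=A(W_{k-1})$, $W_k^*=A^*(W_{k-1}^* )$ for $k\in\mathbb{N}$. Solvability sets (Krasovskii–Subbotin formalization): a counterstrategy of the first player is a function $U:[0,\vartheta]\times\mathbb{R}^n\times Q\to P$ measurable in the third argument. Given $(t_*,x_* )$, a measurable $v(\cdot)$ with values in $Q$ and a partition $t_*=\tau_0<\dots<\tau_r=\vartheta$, the step-by-step motion is $x[t]=x[\tau_{k-1}]+\int_{\tau_{k-1}}^t f(x[\theta],U(\tau_{k-1},x[\tau_{k-1}],v(\theta)),v(\theta))d\theta$ for $t\in[\tau_{k-1},\tau_k]$, $x[\tau_0]=x_*$; constructive motions are uniform limits of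 step-by-step motions as the mesh of the partition tends to $0$. $\mathfrak{W}$ is the set of positions $(t_*,x_* )$ from which the first player can guarantee the $M$-approach problem, i.e. there is a counterstrategy $U$ such that every constructive motion $x[\cdot]$ from $(t_*,x_* )$ satisfies $(\xi,x[\xi])\in M$ for some $\xi\in[t_*,\vartheta]$. $\mathfrak{W}^*$ is defined the same way for the system $\dot x=f^*(x,\nu,u,\omega,v)$ with first-player control $(\nu,u,\omega)\in P^*$, second-player control $v\in Q$, and target set $M^*$. *)

theory Defs
  imports "HOL-Analysis.Analysis"
begin

definition sect :: "(real \<times> 'x) set \<Rightarrow> real \<Rightarrow> 'x set" where
  "sect E t = {x. (t, x) \<in> E}"

definition regular_rhs :: "('x::euclidean_space \<Rightarrow> 'a::euclidean_space \<Rightarrow> 'x) \<Rightarrow> 'a set \<Rightarrow> bool" where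
  "regular_rhs h Lam \<longleftrightarrow>
     continuous_on (UNIV \<times> Lam) (\<lambda>(x, a). h x a) \<and>
     (\<forall>x0. \<exists>r>0. \<exists>L. \<forall>x\<in>ball x0 r. \<forall>y\<in>ball x0 r. \<forall>a\<in>Lam.
         norm (h x a - h y a) \<le> L * dist x y) \<and>
     (\<exists>c. \<forall>x. \<forall>a\<in>Lam. norm (h x a) \<le> c * (1 + norm x))"

definition relaxed_controls :: "real \<Rightarrow> 'a::euclidean_space set \<Rightarrow> (real \<times> 'a) measure set" where
  "relaxed_controls \<theta> Lam = {\<mu>. sets \<mu> = sets (borel :: (real \<times> 'a) measure) \<and>
      emeasure \<mu> (- ({0..\<theta>} \<times> Lam)) = 0 \<and>
      (\<forall>A \<in> sets (borel :: real measure). emeasure \<mu> (A \<times> UNIV) = emeasure lborel (A \<inter> {0..\<theta>}))}"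

definition is_motion ::
  "real \<Rightarrow> 'a::euclidean_space set \<Rightarrow> ('x::euclidean_space \<Rightarrow> 'a \<Rightarrow> 'x) \<Rightarrow> real \<Rightarrow> 'x
     \<Rightarrow> (real \<times> 'a) measure \<Rightarrow> (real \<Rightarrow> 'x) \<Rightarrow> bool" where
  "is_motion \<theta> Lam h t0 x0 \<mu> x \<longleftrightarrow>
     continuous_on {0..\<theta>} x \<and>
     (\<forall>t\<in>{0..\<theta>}. t0 \<le> t \<longrightarrow>
        set_integrable \<mu> ({t0..t} \<times> Lam) (\<lambda>p. h (x (fst p)) (snd p)) \<and>
        x t = x0 + (LINT p : {t0..t} \<times> Lam | \<mu>. h (x (fst p)) (snd p))) \<and>
     (\<forall>t\<in>{0..\<theta>}. t \<le> t0 \<longrightarrow>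
        set_integrable \<mu> ({t..t0} \<times> Lam) (\<lambda>p. h (x (fst p)) (snd p)) \<and>
        x t = x0 - (LINT p : {t..t0} \<times> Lam | \<mu>. h (x (fst p)) (snd p)))"

definition absorb ::
  "real \<Rightarrow> 'v set \<Rightarrow> 'a::euclidean_space set \<Rightarrow> ('x::euclidean_space \<Rightarrow> 'a \<Rightarrow> 'v \<Rightarrow> 'x)
     \<Rightarrow> (real \<times> 'x) set \<Rightarrow> (real \<times> 'x) set \<Rightarrow> (real \<times> 'x) set" where
  "absorb \<theta> Q Lam h M E = {(t0, x0) \<in> E. \<forall>v\<in>Q. \<exists>\<mu>\<in>relaxed_controls \<theta> Lam. \<exists>\<xi>\<in>{t0..\<theta>}.
      \<exists>x. is_motion \<theta> Lam (\<lambda>y a. h y a v) t0 x0 \<mu> x \<and> x \<xi> \<in> sect M \<xi> \<and>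
          (\<forall>t\<in>{t0..\<xi>}. x t \<in> sect E t)}"

definition W_seq ::
  "real \<Rightarrow> 'v set \<Rightarrow> 'a::euclidean_space set \<Rightarrow> ('x::euclidean_space \<Rightarrow> 'a \<Rightarrow> 'v \<Rightarrow> 'x)
     \<Rightarrow> (real \<times> 'x) set \<Rightarrow> nat \<Rightarrow> (real \<times> 'x) set" where
  "W_seq \<theta> Q Lam h M k = (absorb \<theta> Q Lam h M ^^ k) ({0..\<theta>} \<times> UNIV)"

definition fstar :: "('x::euclidean_space \<Rightarrow> 'u \<Rightarrow> 'v \<Rightarrow> 'x) \<Rightarrow> ('x \<Rightarrow> 'w \<Rightarrow> 'x)
     \<Rightarrow> 'x \<Rightarrow> real \<times> 'u \<times> 'w \<Rightarrow> 'v \<Rightarrow> 'x" where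
  "fstar f g x z v = (case z of (\<nu>, u, \<omega>) \<Rightarrow> \<nu> *\<^sub>R f x u v + (1 - \<nu>) *\<^sub>R g x \<omega>)"

definition Pstar :: "'u set \<Rightarrow> 'w set \<Rightarrow> (real \<times> 'u \<times> 'w) set" where
  "Pstar P \<Omega> = {0, 1} \<times> P \<times> \<Omega>"

definition is_forward_sol :: "('x::real_normed_vector \<Rightarrow> 'x) \<Rightarrow> 'x \<Rightarrow> (real \<Rightarrow> 'x) \<Rightarrow> bool" where
  "is_forward_sol h x y \<longleftrightarrow> y 0 = x \<and>
     (\<forall>t\<ge>0. (y has_vector_derivative h (y t)) (at t within {0..}))"

definition flow :: "('x::real_normed_vector \<Rightarrow> 'x) \<Rightarrow> real \<Rightarrow> 'x \<Rightarrow> 'x" where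
  "flow h \<tau> x = (THE z. \<exists>y. is_forward_sol h x y \<and> y \<tau> = z)"

definition isaacs :: "('x::real_inner \<Rightarrow> 'a \<Rightarrow> 'v \<Rightarrow> 'x) \<Rightarrow> 'a set \<Rightarrow> 'v set \<Rightarrow> bool" where
  "isaacs h P Q \<longleftrightarrow> (\<forall>s x. (INF u\<in>P. SUP v\<in>Q. s \<bullet> h x u v) = (SUP v\<in>Q. INF u\<in>P. s \<bullet> h x u v))"

definition counterstrategy :: "'a set \<Rightarrow> 'v::topological_space set \<Rightarrow> (real \<Rightarrow> 'x \<Rightarrow> 'v \<Rightarrow> 'a::topological_space) \<Rightarrow> bool" where
  "counterstrategy P Q U \<longleftrightarrow>
     (\<forall>t x. (\<forall>v\<in>Q. U t x v \<in> P) \<and> U t x \<in> borel_measurable (restrict_space borel Q))"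

definition is_partition :: "real \<Rightarrow> real \<Rightarrow> real list \<Rightarrow> bool" where
  "is_partition t0 \<theta> ts \<longleftrightarrow> ts \<noteq> [] \<and> hd ts = t0 \<and> last ts = \<theta> \<and> sorted_wrt (<) ts"

definition mesh :: "real list \<Rightarrow> real" where
  "mesh ts = Max (insert 0 {ts ! (k + 1) - ts ! k | k. k + 1 < length ts})"

definition step_motion ::
  "('x::euclidean_space \<Rightarrow> 'a \<Rightarrow> 'v \<Rightarrow> 'x) \<Rightarrow> (real \<Rightarrow> 'x \<Rightarrow> 'v \<Rightarrow> 'a) \<Rightarrow> real \<Rightarrow> 'x
     \<Rightarrow> (real \<Rightarrow> 'v) \<Rightarrow> real list \<Rightarrow> (real \<Rightarrow> 'x) \<Rightarrow> bool" where
  "step_motion h U t0 x0 v ts x \<longleftrightarrow> x t0 = x0 \<and>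
     (\<forall>k. k + 1 < length ts \<longrightarrow> (\<forall>t\<in>{ts ! k..ts ! (k + 1)}.
        ((\<lambda>s. h (x s) (U (ts ! k) (x (ts ! k)) (v s)) (v s)) has_integral (x t - x (ts ! k))) {ts ! k..t}))"

definition admissible_v :: "real \<Rightarrow> real \<Rightarrow> 'v::euclidean_space set \<Rightarrow> (real \<Rightarrow> 'v) \<Rightarrow> bool" where
  "admissible_v t0 \<theta> Q v \<longleftrightarrow> v \<in> borel_measurable lebesgue \<and> (\<forall>t\<in>{t0..\<theta>}. v t \<in> Q)"

definition constructive_motion ::
  "real \<Rightarrow> 'v::euclidean_space set \<Rightarrow> ('x::euclidean_space \<Rightarrow> 'a \<Rightarrow> 'v \<Rightarrow> 'x) \<Rightarrow> (real \<Rightarrow> 'x \<Rightarrow> 'v \<Rightarrow> 'a)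
     \<Rightarrow> real \<Rightarrow> 'x \<Rightarrow> (real \<Rightarrow> 'x) \<Rightarrow> bool" where
  "constructive_motion \<theta> Q h U t0 x0 x \<longleftrightarrow>
     (\<exists>tss vs xs. (\<forall>j. is_partition t0 \<theta> (tss j) \<and> admissible_v t0 \<theta> Q (vs j) \<and>
                      step_motion h U t0 x0 (vs j) (tss j) (xs j)) \<and>
        (\<lambda>j. mesh (tss j)) \<longlonglongrightarrow> 0 \<and>
        uniform_limit {t0..\<theta>} xs x sequentially)"

definition solvability_set ::
  "real \<Rightarrow> 'a::topological_space set \<Rightarrow> 'v::euclidean_space set \<Rightarrow> ('x::euclidean_space \<Rightarrow> 'a \<Rightarrow> 'v \<Rightarrow> 'x)
     \<Rightarrow> (real \<times> 'x) set \<Rightarrow> (real \<times> 'x) set" where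
  "solvability_set \<theta> P Q h M = {(t0, x0). t0 \<in> {0..\<theta>} \<and>
     (\<exists>U. counterstrategy P Q U \<and>
        (\<forall>x. constructive_motion \<theta> Q h U t0 x0 x \<longrightarrow> (\<exists>\<xi>\<in>{t0..\<theta>}. (\<xi>, x \<xi>) \<in> M)))}"

end

theory Submission
  imports Defs "HOL-Complex_Analysis.Great_Picard"
begin

text \<open>
Any relaxed motion is a limit of compositions of flows with constant controls, all systems driven by the
same relaxed control being approximated by the same sequence of controls. Since the flows of \<open>f\<close> and
\<open>g\<close> commute, in a composition for \<open>f\<^sup>*\<close> all \<open>f\<close>-pieces can be moved to the front. Hence a relaxed
\<open>f\<^sup>*\<close>-motion can be replaced by an \<open>f\<close>-motion followed by a \<open>g\<close>-motion, where the
\<open>f\<close>-motion at time \<open>s\<close> is joined by a \<open>g\<close>-motion to the original motion at a later time. The sets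
\<open>W\<^sub>k\<close> contain \<open>M\<close> and are closed under running \<open>g\<close> backwards, which makes both absorption operators agree
on them.

The solvability set is the largest closed stable set: extremal aiming at a closed stable set wins the
game, and conversely the positions from which the second player cannot keep a fixed distance from the target, in
a discretized game with fine partitions, form a closed stable set. Stability is
transferred between the two systems by the same rearrangement, now applied to limits of compositions of flows.
\<close>

section \<open>Gronwall estimates and regular right-hand sides\<close>

text \<open>The commutation hypothesis concerns forward flows with constant controls, while the
  claims concern relaxed controls and measurable strategies. Everything is therefore reduced to
  finite lists of constant pieces, where reordering is an exact identity, and limits are taken
  afterwards. For \<open>W_seq\<close> the reordered control must again be a relaxed control, so
  time is reparametrized by the time spent on \<open>f\<close>-values; the lists only verify that
  the resulting motions meet. For the solvability sets the closed relation \<open>reach\<close>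
  replaces controls. Stability of positions at single instants is enough there, since extremal
  aiming consults the set only at partition points, and it survives a reordering that shifts
  positions in time. In the discretized game the second player is constant on each interval; a
  counterstrategy frozen at the left end then answers with a constant, so every move is a flow. The
  transfer back to \<open>f\<close> is not a single reordering: the \<open>f\<close>-time contained
  in a reordered piece is not known beforehand, so the required \<open>f\<close>-time is attained by
  maximizing progress over a compact set.\<close>

lemma gronwall:
  fixes u :: "real \<Rightarrow> real"
  assumes cont: "continuous_on {a..b} u" and L: "0 \<le> L"
    and le: "\<And>t. t \<in> {a..b} \<Longrightarrow> u t \<le> A + L * integral {a..t} u"
    and t: "t \<in> {a..b}"
  shows "u t \<le> A * exp (L * (t - a))"
proof -
  \<comment> \<open>The integrating factor turns the hypothesis into monotonicity of
    \<open>G\<close>: its derivative is \<open>L\<close> times the nonpositive defect of the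
    inequality, times an exponential.\<close>
  define G where "G = (\<lambda>t. (A + L * integral {a..t} u) * exp (- L * (t - a)))"
  have der: "(G has_real_derivative (L * u s - L * (A + L * integral {a..s} u)) * exp (- L * (s - a)))
      (at s within {a..b})" if "s \<in> {a..b}" for s
  proof -
    have "((\<lambda>x. integral {a..x} u) has_real_derivative u s) (at s within {a..b})"
      using cont that by (rule integral_has_real_derivative)
    then show ?thesis
      unfolding G_def by (auto intro!: derivative_eq_intros simp: algebra_simps)
  qed
  have "G t \<le> G a"
  proof (rule DERIV_nonpos_imp_decreasing_open[of a t G])
    show "a \<le> t" using t by simp
    show "\<exists>y. (G has_real_derivative y) (at x) \<and> y \<le> 0" if "a < x" "x < t" for x
    proof -
      have "(G has_real_derivative (L * u x - L * (A + L * integral {a..x} u)) * exp (- L * (x - a))) (at x)"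
        using der[of x] that t at_within_interior[of x "{a..b}"] by auto
      moreover have "L * u x - L * (A + L * integral {a..x} u) \<le> 0"
        using mult_left_mono[OF le L, of x] that t by auto
      ultimately show ?thesis by (meson exp_ge_zero mult_nonpos_nonneg)
    qed
    have "continuous_on {a..b} G"
      by (rule DERIV_continuous_on[OF der])
    then show "continuous_on {a..t} G" using t by (auto intro: continuous_on_subset)
  qed
  then have "(A + L * integral {a..t} u) * exp (- L * (t - a)) \<le> A" by (simp add: G_def)
  then have "(A + L * integral {a..t} u) \<le> A * exp (L * (t - a))"
    by (simp add: exp_minus divide_simps mult.commute)
  with le[OF t] show ?thesis by linarith
qed

text \<open>Instantiated below with \<open>f\<close> at fixed \<open>v\<close>, with
  \<open>g\<close>, with the combined system and its two parts, with negated right-hand sides, and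
  with both players taken as one control, so that each estimate is proved once.\<close>

locale rhs_system =
  fixes h :: "'x::euclidean_space \<Rightarrow> 'a::euclidean_space \<Rightarrow> 'x" and Lam :: "'a set"
  assumes compact_Lam: "compact Lam" and regular: "regular_rhs h Lam"
begin

lemma cont: "continuous_on (UNIV \<times> Lam) (\<lambda>(x, a). h x a)"
  using regular by (auto simp: regular_rhs_def)

lemma cont_comp:
  assumes "continuous_on S F" "continuous_on S G" "G ` S \<subseteq> Lam"
  shows "continuous_on S (\<lambda>p. h (F p) (G p))"
proof -
  have "continuous_on S (\<lambda>p. (\<lambda>(x, a). h x a) (F p, G p))"
    using assms by (intro continuous_on_compose2[OF cont]) (auto intro!: continuous_intros)
  then show ?thesis by simp
qed

lemma ex_growth: "\<exists>c\<ge>0. \<forall>x. \<forall>a\<in>Lam. norm (h x a) \<le> c * (1 + norm x)"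
proof -
  obtain c where c: "\<forall>x. \<forall>a\<in>Lam. norm (h x a) \<le> c * (1 + norm x)"
    using regular by (auto simp: regular_rhs_def)
  have "norm (h x a) \<le> max c 0 * (1 + norm x)" if "a \<in> Lam" for x a
  proof -
    have "c * (1 + norm x) \<le> max c 0 * (1 + norm x)" by (intro mult_right_mono) auto
    then show ?thesis using c that by (meson order_trans)
  qed
  then show ?thesis by (intro exI[of _ "max c 0"]) auto
qed

text \<open>Fixed once, as \<open>lip_const\<close> below, so that estimates from different lemmas
  combine without tracking witnesses. A radius enters only the Lipschitz constant.\<close>

definition growth_const :: real where
  "growth_const = (SOME c. c \<ge> 0 \<and> (\<forall>x. \<forall>a\<in>Lam. norm (h x a) \<le> c * (1 + norm x)))"

lemma growth_const_nonneg: "0 \<le> growth_const" and growth: "a \<in> Lam \<Longrightarrow> norm (h x a) \<le> growth_const * (1 + norm x)"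
proof -
  have "growth_const \<ge> 0 \<and> (\<forall>x. \<forall>a\<in>Lam. norm (h x a) \<le> growth_const * (1 + norm x))"
    unfolding growth_const_def by (rule someI_ex) (use ex_growth in blast)
  then show "0 \<le> growth_const" "a \<in> Lam \<Longrightarrow> norm (h x a) \<le> growth_const * (1 + norm x)" by auto
qed

text \<open>Pairs violating the bound with constant \<open>n\<close> are at distance O(1/n), because
  \<open>h\<close> is bounded on the ball. Along a subsequence both points tend to the same limit,
  where the local Lipschitz condition contradicts the violation.\<close>

lemma ex_lipschitz:
  "\<exists>L\<ge>0. \<forall>x\<in>cball 0 R. \<forall>y\<in>cball 0 R. \<forall>a\<in>Lam. norm (h x a - h y a) \<le> L * norm (x - y)"
proof (rule ccontr)
  assume neg: "\<not> ?thesis"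
  have "\<exists>x y a. x \<in> cball 0 R \<and> y \<in> cball 0 R \<and> a \<in> Lam \<and> norm (h x a - h y a) > real n * norm (x - y)" for n
  proof -
    have "\<not> (\<forall>x\<in>cball 0 R. \<forall>y\<in>cball 0 R. \<forall>a\<in>Lam. norm (h x a - h y a) \<le> real n * norm (x - y))"
      using neg of_nat_0_le_iff by blast
    then obtain x y a where "x \<in> cball 0 R" "y \<in> cball 0 R" "a \<in> Lam" "\<not> norm (h x a - h y a) \<le> real n * norm (x - y)"
      by blast
    then show ?thesis by (metis not_le)
  qed
  then obtain X Y A where X: "\<And>n. X n \<in> cball 0 R" and Y: "\<And>n. Y n \<in> cball 0 R"
    and A: "\<And>n. A n \<in> Lam" and gt: "\<And>n. norm (h (X n) (A n) - h (Y n) (A n)) > real n * norm (X n - Y n)"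
    by metis
  define B where "B = growth_const * (1 + R)"
  have bd: "norm (h x a) \<le> B" if "x \<in> cball 0 R" "a \<in> Lam" for x a
    using growth[OF that(2), of x] mult_left_mono[of "1 + norm x" "1 + R" growth_const] growth_const_nonneg that(1)
    unfolding B_def by auto
  have small: "real n * norm (X n - Y n) \<le> 2 * B" for n
    using gt[of n] norm_triangle_ineq4[of "h (X n) (A n)" "h (Y n) (A n)"] bd[OF X A, of n n] bd[OF Y A, of n n]
    by linarith
  have "compact (cball (0::'x) R)" by simp
  then obtain x0 r where x0: "strict_mono r" "(X \<circ> r) \<longlonglongrightarrow> x0"
    using X unfolding compact_def by meson
  obtain \<rho> L where \<rho>: "\<rho> > 0" and L: "\<forall>x\<in>ball x0 \<rho>. \<forall>y\<in>ball x0 \<rho>. \<forall>a\<in>Lam. norm (h x a - h y a) \<le> L * dist x y"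
    using regular unfolding regular_rhs_def by meson
  have "(\<lambda>n. X n - Y n) \<longlonglongrightarrow> 0"
  proof (rule Lim_null_comparison)
    show "\<forall>\<^sub>F n in sequentially. norm (X n - Y n) \<le> 2 * B * inverse (real n)"
      using eventually_gt_at_top[of 0] by eventually_elim (use small in \<open>simp add: field_simps\<close>)
    show "(\<lambda>n. 2 * B * inverse (real n)) \<longlonglongrightarrow> 0"
      using tendsto_mult_right_zero[OF lim_inverse_n] by auto
  qed
  then have "((\<lambda>n. X n - Y n) \<circ> r) \<longlonglongrightarrow> 0" using x0(1) by (rule LIMSEQ_subseq_LIMSEQ)
  from tendsto_diff[OF x0(2) this] have yl: "(\<lambda>n. Y (r n)) \<longlonglongrightarrow> x0" by (simp add: o_def)
  have xl: "(\<lambda>n. X (r n)) \<longlonglongrightarrow> x0" using x0(2) by (simp add: o_def)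
  have "\<forall>\<^sub>F n in sequentially. X (r n) \<in> ball x0 \<rho>" "\<forall>\<^sub>F n in sequentially. Y (r n) \<in> ball x0 \<rho>"
    using topological_tendstoD[OF xl, of "ball x0 \<rho>"] topological_tendstoD[OF yl, of "ball x0 \<rho>"] \<rho> by auto
  moreover have "\<forall>\<^sub>F n in sequentially. real (r n) > L"
    using filterlim_compose[OF filterlim_real_sequentially filterlim_subseq[OF x0(1)]]
    by (rule filterlim_at_top_dense[THEN iffD1, rule_format])
  ultimately have "\<forall>\<^sub>F n in sequentially. False"
  proof eventually_elim
    case (elim n)
    then have "norm (h (X (r n)) (A (r n)) - h (Y (r n)) (A (r n))) \<le> L * norm (X (r n) - Y (r n))"
      using L A by (metis dist_norm)
    also have "\<dots> \<le> real (r n) * norm (X (r n) - Y (r n))"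
      using elim by (intro mult_right_mono) auto
    finally show False using gt[of "r n"] by linarith
  qed
  then show False by simp
qed

definition lip_const :: "real \<Rightarrow> real" where
  "lip_const R = (SOME L. L \<ge> 0 \<and> (\<forall>x\<in>cball 0 R. \<forall>y\<in>cball 0 R. \<forall>a\<in>Lam. norm (h x a - h y a) \<le> L * norm (x - y)))"

lemma lip_const_nonneg: "0 \<le> lip_const R"
  and lipschitz: "norm x \<le> R \<Longrightarrow> norm y \<le> R \<Longrightarrow> a \<in> Lam \<Longrightarrow> norm (h x a - h y a) \<le> lip_const R * norm (x - y)"
proof -
  have "lip_const R \<ge> 0 \<and> (\<forall>x\<in>cball 0 R. \<forall>y\<in>cball 0 R. \<forall>a\<in>Lam. norm (h x a - h y a) \<le> lip_const R * norm (x - y))"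
    unfolding lip_const_def by (rule someI_ex) (use ex_lipschitz in blast)
  then show "0 \<le> lip_const R"
    "norm x \<le> R \<Longrightarrow> norm y \<le> R \<Longrightarrow> a \<in> Lam \<Longrightarrow> norm (h x a - h y a) \<le> lip_const R * norm (x - y)" by auto
qed

end

section \<open>Integration against relaxed controls\<close>

lemma relaxed_sets: "\<mu> \<in> relaxed_controls \<theta> Lam \<Longrightarrow> sets \<mu> = sets borel"
  and relaxed_space: "\<mu> \<in> relaxed_controls \<theta> Lam \<Longrightarrow> space \<mu> = UNIV"
  unfolding relaxed_controls_def by (auto dest: sets_eq_imp_space_eq)

text \<open>The marginal condition is given on sets; as an equality of measures it yields a change
  of variables for functions of time alone.\<close>

lemma relaxed_distr_fst:
  fixes \<mu> :: "(real \<times> 'a::euclidean_space) measure"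
  assumes "\<mu> \<in> relaxed_controls \<theta> Lam"
  shows "distr \<mu> borel fst = density lborel (indicator {0..\<theta>})"
proof (rule measure_eqI)
  note [measurable_cong] = relaxed_sets[OF assms]
  fix A :: "real set" assume A: "A \<in> sets (distr \<mu> borel fst)"
  then have [measurable]: "A \<in> sets borel" by simp
  have "emeasure (distr \<mu> borel fst) A = emeasure \<mu> (fst -` A \<inter> space \<mu>)"
    by (rule emeasure_distr) (auto simp: measurable_cong_sets[OF relaxed_sets[OF assms] refl] borel_measurable_continuous_onI continuous_on_fst)
  also have "fst -` A \<inter> space \<mu> = A \<times> UNIV" using relaxed_space[OF assms] by auto
  also have "emeasure \<mu> (A \<times> UNIV) = emeasure lborel (A \<inter> {0..\<theta>})"
    using assms by (auto simp: relaxed_controls_def)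
  finally show "emeasure (distr \<mu> borel fst) A = emeasure (density lborel (indicator {0..\<theta>})) A"
    by (simp add: emeasure_density_const emeasure_restricted Int_commute)
qed simp

lemma relaxed_fst_measurable: "\<mu> \<in> relaxed_controls \<theta> Lam \<Longrightarrow> fst \<in> measurable \<mu> borel"
  by (simp add: measurable_cong_sets[OF relaxed_sets refl] borel_measurable_continuous_onI continuous_on_fst)

lemma relaxed_finite:
  assumes "\<mu> \<in> relaxed_controls \<theta> Lam" shows "finite_measure \<mu>"
proof
  have "emeasure \<mu> (UNIV \<times> UNIV) = emeasure lborel (UNIV \<inter> {0..\<theta>})"
    using assms by (auto simp: relaxed_controls_def simp del: UNIV_Times_UNIV)
  also have "\<dots> < \<infinity>" by (cases "0 \<le> \<theta>") auto
  finally show "emeasure \<mu> (space \<mu>) \<noteq> \<infinity>" using relaxed_space[OF assms] by simp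
qed

lemma relaxed_AE:
  assumes "\<mu> \<in> relaxed_controls \<theta> Lam" "closed Lam"
  shows "AE p in \<mu>. p \<in> {0..\<theta>} \<times> Lam"
proof (rule AE_I')
  have "- ({0..\<theta>} \<times> Lam) \<in> sets \<mu>"
    using assms by (auto simp: relaxed_sets[OF assms(1)] intro!: borel_open open_Compl closed_Times)
  then show "- ({0..\<theta>} \<times> Lam) \<in> null_sets \<mu>"
    using assms by (auto simp: relaxed_controls_def null_sets_def)
qed auto

text \<open>The time marginal is Lebesgue, so single instants carry no mass. This lets adjacent
  closed intervals share an end point when integrals are split.\<close>

lemma relaxed_time_null:
  assumes "\<mu> \<in> relaxed_controls \<theta> Lam"
  shows "AE p in \<mu>. fst p \<noteq> c"
proof (rule AE_I')
  have "emeasure \<mu> ({c} \<times> UNIV) = emeasure lborel ({c} \<inter> {0..\<theta>})"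
    using assms by (auto simp: relaxed_controls_def)
  also have "\<dots> = 0" by (simp add: emeasure_lborel_countable)
  finally have "emeasure \<mu> ({c} \<times> UNIV) = 0" .
  moreover have "{c} \<times> UNIV \<in> sets \<mu>"
    by (simp add: relaxed_sets[OF assms] closed_Times)
  ultimately show "{c} \<times> UNIV \<in> null_sets \<mu>" by auto
qed (use relaxed_space[OF assms] in auto)

lemma relaxed_integrable:
  fixes F :: "real \<times> 'a::euclidean_space \<Rightarrow> 'x::euclidean_space"
  assumes \<mu>: "\<mu> \<in> relaxed_controls \<theta> Lam" and Lam: "compact Lam"
    and F: "continuous_on ({a..b} \<times> Lam) F"
  shows "set_integrable \<mu> ({a..b} \<times> Lam) F"
proof -
  interpret finite_measure \<mu> using \<mu> by (rule relaxed_finite)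
  have cp: "compact ({a..b} \<times> Lam)" using Lam by (auto intro: compact_Times)
  then have "compact (F ` ({a..b} \<times> Lam))" using F by (rule compact_continuous_image[rotated])
  then obtain B where B: "\<And>p. p \<in> {a..b} \<times> Lam \<Longrightarrow> norm (F p) \<le> B"
    by (metis bounded_iff compact_imp_bounded imageI)
  show ?thesis unfolding set_integrable_def
  proof (rule integrable_const_bound)
    show "AE p in \<mu>. norm (indicat_real ({a..b} \<times> Lam) p *\<^sub>R F p) \<le> max B 0"
      using B by (intro AE_I2) (force simp: indicator_def)
    have "(\<lambda>x. indicat_real ({a..b} \<times> Lam) x *\<^sub>R F x) \<in> borel_measurable borel"
      using cp F by (intro borel_measurable_continuous_on_indicator) (auto simp: compact_imp_closed)
    then show "(\<lambda>x. indicat_real ({a..b} \<times> Lam) x *\<^sub>R F x) \<in> borel_measurable \<mu>"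
      by (simp add: measurable_cong_sets[OF relaxed_sets[OF \<mu>] refl])
  qed
qed

lemma relaxed_integral_fst:
  fixes \<phi> :: "real \<Rightarrow> real"
  assumes \<mu>: "\<mu> \<in> relaxed_controls \<theta> Lam" and Lam: "compact Lam"
    and F: "continuous_on {a..b} \<phi>" and ab: "0 \<le> a" "b \<le> \<theta>"
  shows "(LINT p : {a..b} \<times> Lam | \<mu>. \<phi> (fst p)) = integral {a..b} \<phi>"
proof -
  note fm = relaxed_fst_measurable[OF \<mu>]
  have m: "(\<lambda>t. indicator {a..b} t *\<^sub>R \<phi> t) \<in> borel_measurable borel"
    using F by (intro borel_measurable_continuous_on_indicator) auto
  have "(LINT p : {a..b} \<times> Lam | \<mu>. \<phi> (fst p)) = (LINT p | \<mu>. indicator {a..b} (fst p) *\<^sub>R \<phi> (fst p))"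
    unfolding set_lebesgue_integral_def
  proof (rule integral_cong_AE)
    have "continuous_on ({a..b} \<times> Lam) (\<lambda>p. \<phi> (fst p))"
      by (rule continuous_on_compose2[OF F]) (auto intro!: continuous_intros)
    from relaxed_integrable[OF \<mu> Lam this]
    show "(\<lambda>x. indicat_real ({a..b} \<times> Lam) x *\<^sub>R \<phi> (fst x)) \<in> borel_measurable \<mu>"
      by (simp add: set_integrable_def)
    show "(\<lambda>x. indicat_real {a..b} (fst x) *\<^sub>R \<phi> (fst x)) \<in> borel_measurable \<mu>"
      by (rule measurable_compose[OF fm m])
    show "AE x in \<mu>. indicat_real ({a..b} \<times> Lam) x *\<^sub>R \<phi> (fst x) = indicat_real {a..b} (fst x) *\<^sub>R \<phi> (fst x)"
      using relaxed_AE[OF \<mu> compact_imp_closed[OF Lam]] by eventually_elim (auto simp: indicator_def)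
  qed
  also have "\<dots> = (LINT t | distr \<mu> borel fst. indicator {a..b} t *\<^sub>R \<phi> t)"
    by (rule integral_distr[OF fm m, symmetric])
  also have "\<dots> = (LINT t | lborel. indicator {0..\<theta>} t *\<^sub>R (indicator {a..b} t *\<^sub>R \<phi> t))"
    unfolding relaxed_distr_fst[OF \<mu>]
    using integral_density[of "\<lambda>t. indicator {a..b} t *\<^sub>R \<phi> t" lborel "indicator {0..\<theta>}"] m
    by (simp add: ennreal_indicator)
  also have "\<dots> = (LINT t : {a..b} | lborel. \<phi> t)"
    unfolding set_lebesgue_integral_def using ab by (intro Bochner_Integration.integral_cong) (auto simp: indicator_def)
  also have "\<dots> = integral {a..b} \<phi>"
    by (rule set_borel_integral_eq_integral) (rule borel_integrable_atLeastAtMost', rule F)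
  finally show ?thesis .
qed

text \<open>Dominating by a function of time alone leaves an ordinary integral, which is the form
  that the Gronwall lemmas accept.\<close>

lemma relaxed_integral_norm_le:
  fixes F :: "real \<times> 'a::euclidean_space \<Rightarrow> 'x::euclidean_space"
  assumes \<mu>: "\<mu> \<in> relaxed_controls \<theta> Lam" and Lam: "compact Lam"
    and F: "continuous_on ({a..b} \<times> Lam) F" and ab: "0 \<le> a" "b \<le> \<theta>"
    and \<phi>: "continuous_on {a..b} \<phi>" and le: "\<And>t l. t \<in> {a..b} \<Longrightarrow> l \<in> Lam \<Longrightarrow> norm (F (t, l)) \<le> \<phi> t"
  shows "norm (LINT p : {a..b} \<times> Lam | \<mu>. F p) \<le> integral {a..b} \<phi>"
proof -
  have "continuous_on ({a..b} \<times> Lam) (\<lambda>p. \<phi> (fst p))"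
    by (rule continuous_on_compose2[OF \<phi>]) (auto intro!: continuous_intros)
  note i2 = relaxed_integrable[OF \<mu> Lam this] and i1 = relaxed_integrable[OF \<mu> Lam F]
  have "norm (LINT p : {a..b} \<times> Lam | \<mu>. F p) \<le> (LINT p : {a..b} \<times> Lam | \<mu>. norm (F p))"
    by (rule set_integral_norm_bound[OF i1])
  also have "\<dots> \<le> (LINT p : {a..b} \<times> Lam | \<mu>. \<phi> (fst p))"
    using le by (intro set_integral_mono i2 set_integrable_norm i1) auto
  finally show ?thesis using relaxed_integral_fst[OF \<mu> Lam \<phi> ab] by simp
qed

lemma relaxed_integral_split:
  fixes F :: "real \<times> 'a::euclidean_space \<Rightarrow> 'x::euclidean_space"
  assumes \<mu>: "\<mu> \<in> relaxed_controls \<theta> Lam" and Lam: "compact Lam"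
    and F: "continuous_on ({a..c} \<times> Lam) F" and ab: "a \<le> b" "b \<le> c"
  shows "(LINT p : {a..c} \<times> Lam | \<mu>. F p) = (LINT p : {a..b} \<times> Lam | \<mu>. F p) + (LINT p : {b..c} \<times> Lam | \<mu>. F p)"
proof -
  have eq: "{a..c} \<times> Lam = {a..b} \<times> Lam \<union> {b..c} \<times> Lam" using ab by auto
  have i: "set_integrable \<mu> ({a..b} \<times> Lam) F" "set_integrable \<mu> ({b..c} \<times> Lam) F"
    by (rule relaxed_integrable[OF \<mu> Lam], rule continuous_on_subset[OF F], use ab in auto)+
  show ?thesis unfolding eq
  proof (rule set_integral_Un_AE[OF _ _ _ i])
    show "AE x in \<mu>. \<not> (x \<in> {a..b} \<times> Lam \<and> x \<in> {b..c} \<times> Lam)"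
      using relaxed_time_null[OF \<mu>, of b] by eventually_elim auto
  qed (use Lam in \<open>auto simp: relaxed_sets[OF \<mu>] compact_imp_closed intro!: borel_closed closed_Times\<close>)
qed

section \<open>Existence of motions\<close>

lemma gronwall_backward:
  fixes u :: "real \<Rightarrow> real"
  assumes cont: "continuous_on {a..b} u" and L: "0 \<le> L"
    and le: "\<And>t. t \<in> {a..b} \<Longrightarrow> u t \<le> A + L * integral {t..b} u"
    and t: "t \<in> {a..b}"
  shows "u t \<le> A * exp (L * (b - t))"
proof -
  have "(\<lambda>s. u (- s)) (- t) \<le> A * exp (L * (- t - (- b)))"
  proof (rule gronwall[where b = "- a"])
    show "continuous_on {- b..- a} (\<lambda>s. u (- s))"
      by (rule continuous_on_compose2[OF cont]) (auto intro!: continuous_intros)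
    show "u (- s) \<le> A + L * integral {- b..s} (\<lambda>s. u (- s))" if "s \<in> {- b..- a}" for s
      using le[of "- s"] that Henstock_Kurzweil_Integration.integral_reflect_real[of b "- s" u] by auto
  qed (use L t in auto)
  then show ?thesis by simp
qed

text \<open>The equation in increments, with neither base point nor initial value. It restricts to
  subintervals, treats both time directions alike and concatenates; \<open>is_motion_iff\<close>
  relates it to \<open>is_motion\<close>.\<close>

definition motion_on :: "'a set \<Rightarrow> ('x::euclidean_space \<Rightarrow> 'a::euclidean_space \<Rightarrow> 'x) \<Rightarrow> (real \<times> 'a) measure
    \<Rightarrow> real \<Rightarrow> real \<Rightarrow> (real \<Rightarrow> 'x) \<Rightarrow> bool" where
  "motion_on Lam h \<mu> a b x \<longleftrightarrow> continuous_on {a..b} x \<and>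
     (\<forall>s t. a \<le> s \<longrightarrow> s \<le> t \<longrightarrow> t \<le> b \<longrightarrow>
        x t - x s = (LINT p : {s..t} \<times> Lam | \<mu>. h (x (fst p)) (snd p)))"

lemma motion_onD:
  assumes "motion_on Lam h \<mu> a b x"
  shows "continuous_on {a..b} x"
    and "a \<le> s \<Longrightarrow> s \<le> t \<Longrightarrow> t \<le> b \<Longrightarrow> x t - x s = (LINT p : {s..t} \<times> Lam | \<mu>. h (x (fst p)) (snd p))"
  using assms by (auto simp: motion_on_def)

lemma motion_on_subset:
  "motion_on Lam h \<mu> a b x \<Longrightarrow> a \<le> a' \<Longrightarrow> b' \<le> b \<Longrightarrow> motion_on Lam h \<mu> a' b' x"
  unfolding motion_on_def using continuous_on_subset[of "{a..b}" x "{a'..b'}"] by auto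

lemma relaxed_integral_point:
  fixes F :: "real \<times> 'a::euclidean_space \<Rightarrow> 'x::euclidean_space"
  assumes "\<mu> \<in> relaxed_controls \<theta> Lam" "compact Lam" "continuous_on ({a..a} \<times> Lam) F"
  shows "(LINT p : {a..a} \<times> Lam | \<mu>. F p) = 0"
  using relaxed_integral_split[OF assms, of a] by simp

lemma cont_rhs:
  assumes "continuous_on (UNIV \<times> Lam) (\<lambda>(x, a). F x a)" "continuous_on {a..b} x"
  shows "continuous_on ({a..b} \<times> Lam) (\<lambda>p. F (x (fst p)) (snd p))"
proof -
  have "continuous_on ({a..b} \<times> Lam) (\<lambda>p. x (fst p))"
    by (rule continuous_on_compose2[OF assms(2)]) (auto intro!: continuous_intros)
  then have "continuous_on ({a..b} \<times> Lam) (\<lambda>p. (\<lambda>(x, a). F x a) (x (fst p), snd p))"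
    by (intro continuous_on_compose2[OF assms(1)]) (auto intro!: continuous_intros)
  then show ?thesis by simp
qed

text \<open>For the quantity \<open>1 + norm (x t)\<close> sublinear growth becomes a linear
  integral inequality, so Gronwall applies forward from \<open>s\<close> and backward from
  \<open>t\<close>.\<close>

lemma motion_growth:
  fixes F :: "'x::euclidean_space \<Rightarrow> 'a::euclidean_space \<Rightarrow> 'x"
  assumes \<mu>: "\<mu> \<in> relaxed_controls \<theta> Lam" and Lam: "compact Lam"
    and F: "continuous_on (UNIV \<times> Lam) (\<lambda>(x, a). F x a)"
    and c: "0 \<le> c" "\<And>x a. a \<in> Lam \<Longrightarrow> norm (F x a) \<le> c * (1 + norm x)"
    and x: "motion_on Lam F \<mu> a b x" and ab: "0 \<le> a" "b \<le> \<theta>" and st: "a \<le> s" "s \<le> t" "t \<le> b"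
  shows "1 + norm (x t) \<le> (1 + norm (x s)) * exp (c * (t - s))"
    and "1 + norm (x s) \<le> (1 + norm (x t)) * exp (c * (t - s))"
proof -
  have inc: "norm (x q - x r) \<le> c * integral {r..q} (\<lambda>r. 1 + norm (x r))" if "a \<le> r" "r \<le> q" "q \<le> b" for r q
  proof -
    have cx: "continuous_on {r..q} x" using motion_onD(1)[OF x] that by (auto intro: continuous_on_subset)
    have "norm (x q - x r) \<le> integral {r..q} (\<lambda>r. c * (1 + norm (x r)))"
      unfolding motion_onD(2)[OF x that]
      by (rule relaxed_integral_norm_le[OF \<mu> Lam cont_rhs[OF F cx]])
         (use that ab cx c in \<open>auto intro!: continuous_intros\<close>)
    then show ?thesis by simp
  qed
  have cx: "continuous_on {s..t} (\<lambda>r. 1 + norm (x r))"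
    using motion_onD(1)[OF x] st by (auto intro!: continuous_intros intro: continuous_on_subset)
  show "1 + norm (x t) \<le> (1 + norm (x s)) * exp (c * (t - s))"
  proof (rule gronwall[OF cx c(1)])
    fix q assume q: "q \<in> {s..t}"
    show "1 + norm (x q) \<le> 1 + norm (x s) + c * integral {s..q} (\<lambda>r. 1 + norm (x r))"
      using inc[of s q] q st norm_triangle_ineq2[of "x q" "x s"] by auto
  qed (use st in auto)
  show "1 + norm (x s) \<le> (1 + norm (x t)) * exp (c * (t - s))"
  proof (rule gronwall_backward[OF cx c(1)])
    fix q assume q: "q \<in> {s..t}"
    show "1 + norm (x q) \<le> 1 + norm (x t) + c * integral {q..t} (\<lambda>r. 1 + norm (x r))"
      using inc[of q t] q st norm_triangle_ineq3[of "x q" "x t"] by (auto simp: norm_minus_commute)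
  qed (use st in auto)
qed

text \<open>Both motions stay in the ball of radius \<open>R\<close>, where one Lipschitz constant
  serves; their difference then satisfies a linear integral inequality in both time
  directions.\<close>

lemma motion_lipschitz:
  fixes F :: "'x::euclidean_space \<Rightarrow> 'a::euclidean_space \<Rightarrow> 'x"
  assumes \<mu>: "\<mu> \<in> relaxed_controls \<theta> Lam" and Lam: "compact Lam"
    and F: "continuous_on (UNIV \<times> Lam) (\<lambda>(x, a). F x a)"
    and L: "0 \<le> L" "\<And>x y a. norm x \<le> R \<Longrightarrow> norm y \<le> R \<Longrightarrow> a \<in> Lam \<Longrightarrow> norm (F x a - F y a) \<le> L * norm (x - y)"
    and x: "motion_on Lam F \<mu> a b x" and y: "motion_on Lam F \<mu> a b y"
    and R: "\<And>r. r \<in> {a..b} \<Longrightarrow> norm (x r) \<le> R" "\<And>r. r \<in> {a..b} \<Longrightarrow> norm (y r) \<le> R"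
    and ab: "0 \<le> a" "b \<le> \<theta>" and st: "a \<le> s" "s \<le> t" "t \<le> b"
  shows "norm (x t - y t) \<le> norm (x s - y s) * exp (L * (t - s))"
    and "norm (x s - y s) \<le> norm (x t - y t) * exp (L * (t - s))"
proof -
  have inc: "norm ((x q - x r) - (y q - y r)) \<le> L * integral {r..q} (\<lambda>r. norm (x r - y r))"
    if "a \<le> r" "r \<le> q" "q \<le> b" for r q
  proof -
    have cx: "continuous_on {r..q} x" "continuous_on {r..q} y"
      using motion_onD(1)[OF x] motion_onD(1)[OF y] that by (auto intro: continuous_on_subset)
    have "(x q - x r) - (y q - y r) = (LINT p : {r..q} \<times> Lam | \<mu>. F (x (fst p)) (snd p) - F (y (fst p)) (snd p))"
      unfolding motion_onD(2)[OF x that] motion_onD(2)[OF y that]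
      by (intro set_integral_diff(2)[symmetric] relaxed_integrable[OF \<mu> Lam] cont_rhs[OF F] cx)
    also have "norm \<dots> \<le> integral {r..q} (\<lambda>r. L * norm (x r - y r))"
      by (rule relaxed_integral_norm_le[OF \<mu> Lam])
         (use that ab cx L R in \<open>auto intro!: continuous_intros cont_rhs[OF F]\<close>)
    finally show ?thesis by simp
  qed
  have cx: "continuous_on {s..t} (\<lambda>r. norm (x r - y r))"
    using motion_onD(1)[OF x] motion_onD(1)[OF y] st by (auto intro!: continuous_intros intro: continuous_on_subset)
  show "norm (x t - y t) \<le> norm (x s - y s) * exp (L * (t - s))"
  proof (rule gronwall[OF cx L(1)])
    fix q assume q: "q \<in> {s..t}"
    have "norm (x q - y q) \<le> norm (x s - y s) + norm ((x q - x s) - (y q - y s))"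
      using norm_triangle_ineq[of "x s - y s" "(x q - x s) - (y q - y s)"] by (simp add: algebra_simps)
    then show "norm (x q - y q) \<le> norm (x s - y s) + L * integral {s..q} (\<lambda>r. norm (x r - y r))"
      using inc[of s q] q st by auto
  qed (use st in auto)
  show "norm (x s - y s) \<le> norm (x t - y t) * exp (L * (t - s))"
  proof (rule gronwall_backward[OF cx L(1)])
    fix q assume q: "q \<in> {s..t}"
    have "norm (x q - y q) \<le> norm (x t - y t) + norm ((x t - x q) - (y t - y q))"
      using norm_triangle_ineq4[of "x t - y t" "(x t - x q) - (y t - y q)"] by (simp add: algebra_simps)
    then show "norm (x q - y q) \<le> norm (x t - y t) + L * integral {q..t} (\<lambda>r. norm (x r - y r))"
      using inc[of q t] q st by auto
  qed (use st in auto)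
qed

text \<open>Picard iteration in a weighted norm: with the weight
  \<open>exp (2 * L * \<bar>t - t0\<bar>)\<close> the integral operator contracts by 1/2 on the
  whole interval, so short solutions need not be glued. The unknown \<open>u\<close> is the motion
  divided by the weight, which turns the weighted norm into the sup norm of bounded continuous
  functions.\<close>

lemma picard_global:
  fixes F :: "'x::euclidean_space \<Rightarrow> 'a::euclidean_space \<Rightarrow> 'x"
  assumes \<mu>: "\<mu> \<in> relaxed_controls \<theta> Lam" and Lam: "compact Lam"
    and F: "continuous_on (UNIV \<times> Lam) (\<lambda>(x, a). F x a)"
    and L: "0 < L" "\<And>x y a. a \<in> Lam \<Longrightarrow> norm (F x a - F y a) \<le> L * norm (x - y)"
    and B: "\<And>x a. a \<in> Lam \<Longrightarrow> norm (F x a) \<le> B"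
    and t0: "t0 \<in> {0..\<theta>}"
  shows "\<exists>x. x t0 = x0 \<and> motion_on Lam F \<mu> 0 \<theta> x"
proof -
  define e where "e = (\<lambda>t. exp (2 * L * \<bar>t - t0\<bar>))"
  define G where "G = (\<lambda>(u :: real \<Rightarrow>\<^sub>C 'x) p. F (e (fst p) *\<^sub>R u (fst p)) (snd p))"
  define J where "J = (\<lambda>u t. if t0 \<le> t then LINT p : {t0..t} \<times> Lam | \<mu>. G u p else - (LINT p : {t..t0} \<times> Lam | \<mu>. G u p))"
  have e_cont: "continuous_on S e" for S unfolding e_def by (intro continuous_intros)
  have G_cont: "continuous_on ({s..t} \<times> Lam) (G u)" for s t u
    unfolding G_def by (rule cont_rhs[OF F]) (intro continuous_intros e_cont continuous_on_apply_bcontfun)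
  note split = relaxed_integral_split[OF \<mu> Lam G_cont]
  have J_diff: "J u t - J u s = (LINT p : {s..t} \<times> Lam | \<mu>. G u p)" if "s \<le> t" for u s t
  proof -
    consider "t0 \<le> s" | "s < t0" "t0 \<le> t" | "t < t0" by linarith
    then show ?thesis
    proof cases
      case 1 then show ?thesis using split[of t0 s t u] that by (simp add: J_def)
    next
      case 2 then show ?thesis using split[of s t0 t u] that by (simp add: J_def)
    next
      case 3 then show ?thesis using split[of s t t0 u] that by (simp add: J_def)
    qed
  qed
  have J_bd: "norm (J u t - J u s) \<le> B * \<bar>t - s\<bar>" if "s \<in> {0..\<theta>}" "t \<in> {0..\<theta>}" for u s t
  proof -
    have *: "norm (J u t - J u s) \<le> B * (t - s)" if "0 \<le> s" "s \<le> t" "t \<le> \<theta>" for s t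
    proof -
      have "norm (LINT p : {s..t} \<times> Lam | \<mu>. G u p) \<le> integral {s..t} (\<lambda>_. B)"
        by (rule relaxed_integral_norm_le[OF \<mu> Lam G_cont]) (use that B in \<open>auto simp: G_def\<close>)
      then show ?thesis using that J_diff by (simp add: mult.commute)
    qed
    show ?thesis using *[of s t] *[of t s] that by (cases "s \<le> t") (auto simp: norm_minus_commute)
  qed
  \<comment> \<open>Bounded continuous functions live on the whole real line, so time is clamped to
    the interval before the operator is evaluated.\<close>
  define cl where "cl = (\<lambda>t. max 0 (min \<theta> t))"
  have cl: "cl t \<in> {0..\<theta>}" for t using t0 by (auto simp: cl_def)
  define T where "T = (\<lambda>u t. (x0 + J u (cl t)) /\<^sub>R e (cl t))"
  have J_cont: "continuous_on {0..\<theta>} (J u)" for u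
  proof (rule lipschitz_on_continuous_on[of "max B 0"], rule lipschitz_onI)
    fix s t assume "s \<in> {0..\<theta>}" "t \<in> {0..\<theta>}"
    then have "norm (J u s - J u t) \<le> B * \<bar>s - t\<bar>" by (rule J_bd[rotated])
    also have "\<dots> \<le> max B 0 * \<bar>s - t\<bar>" by (intro mult_right_mono) auto
    finally show "dist (J u s) (J u t) \<le> max B 0 * dist s t" by (simp add: dist_norm)
  qed simp
  have T_bc: "T u \<in> bcontfun" for u
  proof -
    have c0: "continuous_on {0..\<theta>} (\<lambda>t. (x0 + J u t) /\<^sub>R e t)"
      by (intro continuous_intros J_cont e_cont) (simp add: e_def)
    have "continuous_on UNIV (T u)"
      unfolding T_def by (rule continuous_on_compose2[OF c0]) (use cl in \<open>auto intro!: continuous_intros simp: cl_def\<close>)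
    moreover have "bounded (range (T u))"
      by (rule bounded_subset[OF compact_imp_bounded[OF compact_continuous_image[OF c0 compact_Icc]]])
         (use cl in \<open>auto simp: T_def\<close>)
    ultimately show ?thesis by (simp add: bcontfun_def)
  qed
  have contr: "norm (J u t - J w t) \<le> e t * (dist u w / 2)" if t: "t \<in> {0..\<theta>}" for u w t
  proof -
    have le: "norm (G u (s, l) - G w (s, l)) \<le> L * (e s * dist u w)" if "l \<in> Lam" for s l
    proof -
      have "norm (G u (s, l) - G w (s, l)) \<le> L * norm (e s *\<^sub>R u s - e s *\<^sub>R w s)"
        unfolding G_def using L(2)[OF that] by simp
      also have "\<dots> = L * (e s * dist (u s) (w s))"
        by (simp add: scaleR_diff_right[symmetric] dist_norm e_def del: scaleR_diff_right)
      also have "\<dots> \<le> L * (e s * dist u w)"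
        using L(1) dist_bounded[of u s w] by (intro mult_left_mono) (auto simp: e_def)
      finally show ?thesis .
    qed
    have main: "norm ((LINT p : {r..q} \<times> Lam | \<mu>. G u p) - (LINT p : {r..q} \<times> Lam | \<mu>. G w p)) \<le> integral {r..q} (\<lambda>s. L * (e s * dist u w))"
      if "0 \<le> r" "q \<le> \<theta>" for r q
    proof -
      have "(LINT p : {r..q} \<times> Lam | \<mu>. G u p) - (LINT p : {r..q} \<times> Lam | \<mu>. G w p) = (LINT p : {r..q} \<times> Lam | \<mu>. G u p - G w p)"
        by (intro set_integral_diff(2)[symmetric] relaxed_integrable[OF \<mu> Lam] G_cont)
      also have "norm \<dots> \<le> integral {r..q} (\<lambda>s. L * (e s * dist u w))"
        by (rule relaxed_integral_norm_le[OF \<mu> Lam])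
           (use that le in \<open>auto intro!: continuous_intros G_cont e_cont\<close>)
      finally show ?thesis .
    qed
    show ?thesis
    proof (cases "t0 \<le> t")
      case True
      \<comment> \<open>The integral is \<open>(e t - 1) / 2 * dist u w\<close>; dropping the 1
        gives the contraction factor 1/2.\<close>
      have "((\<lambda>s. L * (e s * dist u w)) has_integral (exp (2 * L * (t - t0)) * dist u w / 2 - exp (2 * L * (t0 - t0)) * dist u w / 2)) {t0..t}"
      proof (rule fundamental_theorem_of_calculus[OF True])
        fix s assume "s \<in> {t0..t}"
        then show "((\<lambda>s. exp (2 * L * (s - t0)) * dist u w / 2) has_vector_derivative L * (e s * dist u w)) (at s within {t0..t})"
          by (auto simp: e_def has_real_derivative_iff_has_vector_derivative[symmetric] intro!: derivative_eq_intros)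
      qed
      then have "integral {t0..t} (\<lambda>s. L * (e s * dist u w)) \<le> e t * (dist u w / 2)"
        using True by (auto simp: e_def dest!: integral_unique)
      then show ?thesis using main[of t0 t] t t0 True by (simp add: J_def)
    next
      case False
      have "((\<lambda>s. L * (e s * dist u w)) has_integral (- (exp (2 * L * (t0 - t0)) * dist u w / 2) - - (exp (2 * L * (t0 - t)) * dist u w / 2))) {t..t0}"
      proof (rule fundamental_theorem_of_calculus)
        fix s assume "s \<in> {t..t0}"
        then show "((\<lambda>s. - (exp (2 * L * (t0 - s)) * dist u w / 2)) has_vector_derivative L * (e s * dist u w)) (at s within {t..t0})"
          by (auto simp: e_def has_real_derivative_iff_has_vector_derivative[symmetric] intro!: derivative_eq_intros)
      qed (use False in auto)
      then have "integral {t..t0} (\<lambda>s. L * (e s * dist u w)) \<le> e t * (dist u w / 2)"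
        using False by (auto simp: e_def dest!: integral_unique)
      then show ?thesis using main[of t t0] t t0 False by (simp add: J_def norm_minus_commute)
    qed
  qed
  have "\<exists>!u. Bcontfun (T u) = u"
  proof (rule banach_fix_type[of "1/2"])
    have "dist (Bcontfun (T u) t) (Bcontfun (T w) t) \<le> 1/2 * dist u w" for u w t
    proof -
      have "dist (Bcontfun (T u) t) (Bcontfun (T w) t) = norm (J u (cl t) - J w (cl t)) / e (cl t)"
        unfolding Bcontfun_inverse[OF T_bc] by (simp add: T_def dist_norm scaleR_diff_right[symmetric] e_def divide_inverse_commute
            del: scaleR_diff_right)
      also have "\<dots> \<le> 1/2 * dist u w"
        using contr[OF cl, of u t w] by (simp add: e_def field_simps)
      finally show ?thesis .
    qed
    then show "\<forall>u w. dist (Bcontfun (T u)) (Bcontfun (T w)) \<le> 1/2 * dist u w"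
      by (intro allI dist_bound)
  qed auto
  then obtain u where u: "Bcontfun (T u) = u" by blast
  have ut: "u t = T u t" for t using Bcontfun_inverse[OF T_bc, of u] u by simp
  define x where "x = (\<lambda>t. e t *\<^sub>R u t)"
  have x: "x t = x0 + J u t" if "t \<in> {0..\<theta>}" for t
  proof -
    have "cl t = t" using that by (auto simp: cl_def)
    then show ?thesis unfolding x_def ut T_def by (simp add: e_def)
  qed
  have "x t0 = x0"
    using x[OF t0] J_diff[of t0 t0 u] by (simp add: J_def relaxed_integral_point[OF \<mu> Lam G_cont])
  moreover have "motion_on Lam F \<mu> 0 \<theta> x"
    unfolding motion_on_def
  proof (intro conjI allI impI)
    show "continuous_on {0..\<theta>} x" unfolding x_def by (intro continuous_intros e_cont continuous_on_apply_bcontfun)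
    fix s t :: real assume "0 \<le> s" "s \<le> t" "t \<le> \<theta>"
    then show "x t - x s = (LINT p : {s..t} \<times> Lam | \<mu>. F (x (fst p)) (snd p))"
      using x[of s] x[of t] J_diff[of s t u] by (simp add: G_def x_def)
  qed
  ultimately show ?thesis by blast
qed

context rhs_system
begin

text \<open>The right-hand side is cut off by projecting the state onto the ball of radius
  \<open>M\<close>. The projection is 1-Lipschitz and does not increase norms, so the cut-off system
  is globally Lipschitz and keeps the same growth constant. \<open>M\<close> is the a priori bound
  for that constant, hence the solution never leaves the region where both systems agree.\<close>

lemma motion_exists:
  assumes \<mu>: "\<mu> \<in> relaxed_controls \<theta> Lam" and t0: "t0 \<in> {0..\<theta>}"
  shows "\<exists>x. x t0 = x0 \<and> motion_on Lam h \<mu> 0 \<theta> x"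
proof -
  define M where "M = (1 + norm x0) * exp (growth_const * \<theta>)"
  have M: "0 \<le> M" unfolding M_def by simp
  define pr where "pr = closest_point (cball (0::'x) M)"
  have pr_in: "norm (pr x) \<le> M" for x
    unfolding pr_def using closest_point_in_set[of "cball (0::'x) M" x] M by auto
  have pr_lip: "norm (pr x - pr y) \<le> norm (x - y)" for x y
    unfolding pr_def using closest_point_lipschitz[of "cball (0::'x) M" x y] M by (auto simp: dist_norm)
  have pr_id: "pr x = x" if "norm x \<le> M" for x
    unfolding pr_def using that by (intro closest_point_self) auto
  have pr_le: "norm (pr x) \<le> norm x" for x using pr_lip[of x 0] pr_id[of 0] M by simp
  have pr_cont: "continuous_on S pr" for S
    by (rule lipschitz_on_continuous_on[of 1], rule lipschitz_onI) (use pr_lip in \<open>auto simp: dist_norm\<close>)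
  define F where "F = (\<lambda>x. h (pr x))"
  have F: "continuous_on (UNIV \<times> Lam) (\<lambda>(x, a). F x a)"
    unfolding F_def case_prod_beta
    by (rule cont_comp) (auto intro!: continuous_intros continuous_on_compose2[OF pr_cont])
  have Fg: "norm (F x a) \<le> growth_const * (1 + norm x)" if "a \<in> Lam" for x a
    using growth[OF that, of "pr x"] pr_le[of x] growth_const_nonneg unfolding F_def
    by (meson add_left_mono mult_left_mono order_trans)
  have "\<exists>x. x t0 = x0 \<and> motion_on Lam F \<mu> 0 \<theta> x"
  proof (rule picard_global[OF \<mu> compact_Lam F _ _ _ t0])
    \<comment> \<open>The \<open>+ 1\<close> supplies the strictly positive constant required by
      \<open>picard_global\<close>.\<close>
    show "0 < lip_const M + 1" using lip_const_nonneg[of M] by simp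
    show "norm (F x a - F y a) \<le> (lip_const M + 1) * norm (x - y)" if "a \<in> Lam" for x y a
    proof -
      have "norm (F x a - F y a) \<le> lip_const M * norm (pr x - pr y)"
        unfolding F_def by (rule lipschitz) (use pr_in that in auto)
      also have "\<dots> \<le> (lip_const M + 1) * norm (x - y)"
        using pr_lip lip_const_nonneg[of M] by (intro mult_mono) auto
      finally show ?thesis .
    qed
    show "norm (F x a) \<le> growth_const * (1 + M)" if "a \<in> Lam" for x a
      using growth[OF that, of "pr x"] pr_in[of x] growth_const_nonneg unfolding F_def
      by (meson add_left_mono mult_left_mono order_trans)
  qed
  then obtain x where x0: "x t0 = x0" and x: "motion_on Lam F \<mu> 0 \<theta> x" by blast
  note g = motion_growth[OF \<mu> compact_Lam F growth_const_nonneg Fg x]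
  have xM: "norm (x t) \<le> M" if "t \<in> {0..\<theta>}" for t
  proof -
    have "1 + norm (x t) \<le> (1 + norm x0) * exp (growth_const * \<bar>t - t0\<bar>)"
      using g(1)[of t0 t] g(2)[of t t0] t0 that x0 by (cases "t0 \<le> t") auto
    also have "\<dots> \<le> M" unfolding M_def
      using t0 that growth_const_nonneg by (intro mult_left_mono) (auto intro!: mult_left_mono)
    finally show ?thesis by simp
  qed
  have "motion_on Lam h \<mu> 0 \<theta> x"
    unfolding motion_on_def
  proof (intro conjI allI impI)
    show "continuous_on {0..\<theta>} x" by (rule motion_onD(1)[OF x])
    fix s t :: real assume st: "0 \<le> s" "s \<le> t" "t \<le> \<theta>"
    have "x t - x s = (LINT p : {s..t} \<times> Lam | \<mu>. F (x (fst p)) (snd p))"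
      by (rule motion_onD(2)[OF x st])
    also have "\<dots> = (LINT p : {s..t} \<times> Lam | \<mu>. h (x (fst p)) (snd p))"
    proof (rule set_lebesgue_integral_cong)
      show "{s..t} \<times> Lam \<in> sets \<mu>" unfolding relaxed_sets[OF \<mu>] using compact_Lam
        by (auto intro!: borel_closed closed_Times dest: compact_imp_closed)
      show "\<forall>p. p \<in> {s..t} \<times> Lam \<longrightarrow> F (x (fst p)) (snd p) = h (x (fst p)) (snd p)"
        using xM st by (auto simp: F_def pr_id)
    qed
    finally show "x t - x s = (LINT p : {s..t} \<times> Lam | \<mu>. h (x (fst p)) (snd p))" .
  qed
  with x0 show ?thesis by blast
qed

lemma is_motion_iff:
  assumes \<mu>: "\<mu> \<in> relaxed_controls \<theta> Lam" and t0: "t0 \<in> {0..\<theta>}"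
  shows "is_motion \<theta> Lam h t0 x0 \<mu> x \<longleftrightarrow> x t0 = x0 \<and> motion_on Lam h \<mu> 0 \<theta> x"
proof
  assume m: "is_motion \<theta> Lam h t0 x0 \<mu> x"
  let ?I = "\<lambda>s t. LINT p : {s..t} \<times> Lam | \<mu>. h (x (fst p)) (snd p)"
  have cx: "continuous_on {0..\<theta>} x" using m by (simp add: is_motion_def)
  have c: "continuous_on ({s..t} \<times> Lam) (\<lambda>p. h (x (fst p)) (snd p))" if "0 \<le> s" "t \<le> \<theta>" for s t
    by (rule cont_rhs[OF cont]) (use cx that in \<open>auto intro: continuous_on_subset\<close>)
  have f: "x t = x0 + ?I t0 t" if "t0 \<le> t" "t \<le> \<theta>" for t
    using m that t0 by (auto simp: is_motion_def)
  have b: "x t = x0 - ?I t t0" if "0 \<le> t" "t \<le> t0" for t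
    using m that t0 by (auto simp: is_motion_def)
  have "x t0 = x0" using f[of t0] t0 relaxed_integral_point[OF \<mu> compact_Lam c, of t0] by simp
  moreover have "x t - x s = ?I s t" if "0 \<le> s" "s \<le> t" "t \<le> \<theta>" for s t
  proof -
    note sp = relaxed_integral_split[OF \<mu> compact_Lam c]
    consider "t0 \<le> s" | "s < t0" "t0 \<le> t" | "t < t0" by linarith
    then show ?thesis
    proof cases
      case 1 then show ?thesis using sp[of t0 t s] f[of s] f[of t] that t0 by simp
    next
      case 2 then show ?thesis using sp[of s t t0] b[of s] f[of t] that by simp
    next
      case 3 then show ?thesis using sp[of s t0 t] b[of s] b[of t] that t0 by simp
    qed
  qed
  ultimately show "x t0 = x0 \<and> motion_on Lam h \<mu> 0 \<theta> x"
    using cx by (simp add: motion_on_def)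
next
  assume m: "x t0 = x0 \<and> motion_on Lam h \<mu> 0 \<theta> x"
  then have m': "motion_on Lam h \<mu> 0 \<theta> x" and x0: "x t0 = x0" by auto
  have c: "continuous_on ({s..t} \<times> Lam) (\<lambda>p. h (x (fst p)) (snd p))" if "0 \<le> s" "t \<le> \<theta>" for s t
    by (rule cont_rhs[OF cont]) (use motion_onD(1)[OF m'] that in \<open>auto intro: continuous_on_subset\<close>)
  show "is_motion \<theta> Lam h t0 x0 \<mu> x"
    unfolding is_motion_def
    using motion_onD(1)[OF m'] relaxed_integrable[OF \<mu> compact_Lam c] t0 x0
      motion_onD(2)[OF m', of t0] motion_onD(2)[OF m', of _ t0]
    by (auto simp: algebra_simps)
qed

end

section \<open>Flows and piecewise constant controls\<close>

text \<open>Makes trajectories with constant control a special case of relaxed motions, so that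
  existence, uniqueness and growth estimates carry over to flows.\<close>

definition const_control :: "real \<Rightarrow> 'a::euclidean_space \<Rightarrow> (real \<times> 'a) measure" where
  "const_control T a = distr (density lborel (indicator {0..T})) borel (\<lambda>t. (t, a))"

lemma const_control_measurable: "(\<lambda>t. (t, a)) \<in> measurable (density lborel (indicator {0..T})) borel"
  by (simp add: borel_measurable_continuous_onI continuous_on_Pair)

lemma const_control_relaxed:
  assumes "closed Lam" "a \<in> Lam"
  shows "const_control T a \<in> relaxed_controls T Lam"
proof -
  have em: "emeasure (const_control T a) A = emeasure lborel ({0..T} \<inter> (\<lambda>t. (t, a)) -` A)" if "A \<in> sets borel" for A
  proof -
    have m: "(\<lambda>t. (t, a)) -` A \<in> sets borel"
      using measurable_sets[OF const_control_measurable that, of a T] by simp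
    have "emeasure (const_control T a) A = emeasure (density lborel (indicator {0..T})) ((\<lambda>t. (t, a)) -` A)"
      unfolding const_control_def using that
      by (subst emeasure_distr[OF const_control_measurable]) auto
    also have "\<dots> = emeasure lborel ({0..T} \<inter> (\<lambda>t. (t, a)) -` A)"
      using m by (simp add: emeasure_restricted)
    finally show ?thesis .
  qed
  show ?thesis unfolding relaxed_controls_def
  proof (intro CollectI conjI ballI)
    show "sets (const_control T a) = sets borel" by (simp add: const_control_def)
    have "- ({0..T} \<times> Lam) \<in> sets borel" using assms by (auto intro!: borel_open open_Compl closed_Times)
    moreover have "{0..T} \<inter> (\<lambda>t. (t, a)) -` (- ({0..T} \<times> Lam)) = {}" using assms by auto
    ultimately show "emeasure (const_control T a) (- ({0..T} \<times> Lam)) = 0" by (simp only: em emeasure_empty)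
    fix A :: "real set" assume A: "A \<in> sets borel"
    have "A \<times> (UNIV :: 'a set) \<in> sets (borel \<Otimes>\<^sub>M borel)"
      using A by (intro pair_measureI) auto
    then have "A \<times> UNIV \<in> sets (borel :: (real \<times> 'a) measure)" unfolding borel_prod .
    moreover have "{0..T} \<inter> (\<lambda>t. (t, a)) -` (A \<times> UNIV) = A \<inter> {0..T}" by auto
    ultimately show "emeasure (const_control T a) (A \<times> UNIV) = emeasure lborel (A \<inter> {0..T})" by (simp only: em)
  qed
qed

lemma const_control_integral:
  fixes F :: "real \<times> 'a::euclidean_space \<Rightarrow> 'x::euclidean_space"
  assumes Lam: "compact Lam" "a \<in> Lam" and F: "continuous_on ({s..t} \<times> Lam) F" and st: "0 \<le> s" "t \<le> T"
  shows "(LINT p : {s..t} \<times> Lam | const_control T a. F p) = integral {s..t} (\<lambda>r. F (r, a))"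
proof -
  have m: "(\<lambda>x. indicat_real ({s..t} \<times> Lam) x *\<^sub>R F x) \<in> borel_measurable borel"
    using F Lam by (intro borel_measurable_continuous_on_indicator) (auto intro!: borel_closed closed_Times dest: compact_imp_closed)
  have c: "continuous_on {s..t} (\<lambda>r. F (r, a))"
    by (rule continuous_on_compose2[OF F]) (use Lam in \<open>auto intro!: continuous_intros\<close>)
  have m2: "(\<lambda>r. indicator {s..t} r *\<^sub>R F (r, a)) \<in> borel_measurable borel"
    using c by (intro borel_measurable_continuous_on_indicator) auto
  have "(LINT p : {s..t} \<times> Lam | const_control T a. F p)
      = (LINT r | density lborel (indicator {0..T}). indicator ({s..t} \<times> Lam) (r, a) *\<^sub>R F (r, a))"
    unfolding set_lebesgue_integral_def const_control_def by (rule integral_distr[OF const_control_measurable m])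
  also have "\<dots> = (LINT r | density lborel (indicator {0..T}). indicator {s..t} r *\<^sub>R F (r, a))"
    using Lam by (intro Bochner_Integration.integral_cong) (auto simp: indicator_def)
  also have "\<dots> = (LINT r | lborel. indicator {0..T} r *\<^sub>R (indicator {s..t} r *\<^sub>R F (r, a)))"
    using integral_density[of "\<lambda>r. indicator {s..t} r *\<^sub>R F (r, a)" lborel "indicator {0..T}"] m2
    by (simp add: ennreal_indicator)
  also have "\<dots> = (LINT r : {s..t} | lborel. F (r, a))"
    unfolding set_lebesgue_integral_def using st by (intro Bochner_Integration.integral_cong) (auto simp: indicator_def)
  also have "\<dots> = integral {s..t} (\<lambda>r. F (r, a))"
    by (rule set_borel_integral_eq_integral) (rule borel_integrable_atLeastAtMost', rule c)
  finally show ?thesis .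
qed

text \<open>Solutions on a bounded interval with one-sided derivatives at its ends: the common form
  of forward solutions and of motions under a constant relaxed control.\<close>

definition local_sol :: "('x::real_normed_vector \<Rightarrow> 'x) \<Rightarrow> real \<Rightarrow> (real \<Rightarrow> 'x) \<Rightarrow> bool" where
  "local_sol F T y \<longleftrightarrow> (\<forall>t\<in>{0..T}. (y has_vector_derivative F (y t)) (at t within {0..T}))"

lemma local_sol_mono: "local_sol F T y \<Longrightarrow> T' \<le> T \<Longrightarrow> local_sol F T' y"
  unfolding local_sol_def
  using has_vector_derivative_within_subset[of y _ _ "{0..T}" "{0..T'}"] by auto

lemma forward_sol_local: "is_forward_sol F x y \<Longrightarrow> local_sol F T y"
  unfolding local_sol_def is_forward_sol_def
  using has_vector_derivative_within_subset[of y _ _ "{0..}" "{0..T}"] by auto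

context rhs_system
begin

lemmas Lam_closed = compact_imp_closed[OF compact_Lam]
lemmas growth_motion = motion_growth[OF _ compact_Lam cont growth_const_nonneg growth]
lemmas lipschitz_motion = motion_lipschitz[OF _ compact_Lam cont lip_const_nonneg lipschitz]

lemma local_sol_iff_motion:
  assumes a: "a \<in> Lam"
  shows "local_sol (\<lambda>x. h x a) T y \<longleftrightarrow> motion_on Lam h (const_control T a) 0 T y"
proof
  assume y: "local_sol (\<lambda>x. h x a) T y"
  then have cy: "continuous_on {0..T} y"
    unfolding local_sol_def by (meson continuous_on_eq_continuous_within has_vector_derivative_continuous)
  show "motion_on Lam h (const_control T a) 0 T y"
    unfolding motion_on_def
  proof (intro conjI allI impI cy)
    fix s t :: real assume st: "0 \<le> s" "s \<le> t" "t \<le> T"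
    have "((\<lambda>r. h (y r) a) has_integral (y t - y s)) {s..t}"
    proof (rule fundamental_theorem_of_calculus[OF st(2)])
      fix r assume "r \<in> {s..t}"
      then show "(y has_vector_derivative h (y r) a) (at r within {s..t})"
        using y st has_vector_derivative_within_subset[of y _ _ "{0..T}" "{s..t}"] unfolding local_sol_def by auto
    qed
    moreover have "(LINT p : {s..t} \<times> Lam | const_control T a. h (y (fst p)) (snd p)) = integral {s..t} (\<lambda>r. h (y (fst (r, a))) (snd (r, a)))"
      by (rule const_control_integral[OF compact_Lam a cont_rhs[OF cont]])
         (use st cy in \<open>auto intro: continuous_on_subset\<close>)
    ultimately show "y t - y s = (LINT p : {s..t} \<times> Lam | const_control T a. h (y (fst p)) (snd p))"
      by (simp add: integral_unique)
  qed
next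
  assume m: "motion_on Lam h (const_control T a) 0 T y"
  have cy: "continuous_on {0..T} y" by (rule motion_onD[OF m])
  have eq: "y t = y 0 + integral {0..t} (\<lambda>r. h (y r) a)" if "t \<in> {0..T}" for t
  proof -
    have "(LINT p : {0..t} \<times> Lam | const_control T a. h (y (fst p)) (snd p)) = integral {0..t} (\<lambda>r. h (y (fst (r, a))) (snd (r, a)))"
      by (rule const_control_integral[OF compact_Lam a cont_rhs[OF cont]])
         (use that cy in \<open>auto intro: continuous_on_subset\<close>)
    then show ?thesis using motion_onD(2)[OF m, of 0 t] that by (simp add: algebra_simps)
  qed
  show "local_sol (\<lambda>x. h x a) T y" unfolding local_sol_def
  proof
    fix t assume t: "t \<in> {0..T}"
    have "continuous_on {0..T} (\<lambda>r. h (y r) a)"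
      by (rule cont_comp) (use cy a in \<open>auto intro!: continuous_intros\<close>)
    from integral_has_vector_derivative[OF this t]
    have "((\<lambda>u. y 0 + integral {0..u} (\<lambda>r. h (y r) a)) has_vector_derivative h (y t) a) (at t within {0..T})"
      by (auto intro!: derivative_eq_intros)
    then show "(y has_vector_derivative h (y t) a) (at t within {0..T})"
      by (rule has_vector_derivative_transform[OF t eq, rotated])
  qed
qed

lemma local_sol_unique:
  assumes a: "a \<in> Lam" and y: "local_sol (\<lambda>x. h x a) T y" and z: "local_sol (\<lambda>x. h x a) T z"
    and eq: "y 0 = z 0" and t: "t \<in> {0..T}"
  shows "y t = z t"
proof -
  note \<mu> = const_control_relaxed[OF Lam_closed a, of T]
  note my = y[unfolded local_sol_iff_motion[OF a]] and mz = z[unfolded local_sol_iff_motion[OF a]]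
  define R where "R = (1 + norm (y 0)) * exp (growth_const * T)"
  have bd: "norm (w r) \<le> R" if "motion_on Lam h (const_control T a) 0 T w" "w 0 = y 0" "r \<in> {0..T}" for w r
  proof -
    have "1 + norm (w r) \<le> (1 + norm (w 0)) * exp (growth_const * (r - 0))"
      by (rule growth_motion(1)[OF \<mu> _ that(1)]) (use that in auto)
    also have "\<dots> \<le> R" unfolding R_def using that growth_const_nonneg by (auto intro!: mult_left_mono)
    finally show ?thesis by simp
  qed
  have "norm (y t - z t) \<le> norm (y 0 - z 0) * exp (lip_const R * (t - 0))"
    by (rule lipschitz_motion(1)[OF \<mu> _ _ _ my mz]) (use bd[OF my] bd[OF mz] eq t in auto)
  then show ?thesis using eq by simp
qed

text \<open>Relaxed controls live on bounded intervals; the solutions on \<open>{0..n}\<close> agree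
  by uniqueness and are glued to one on the half-line.\<close>

lemma forward_sol_exists:
  assumes a: "a \<in> Lam" shows "\<exists>y. is_forward_sol (\<lambda>x. h x a) x y"
proof -
  have "\<exists>y. y 0 = x \<and> local_sol (\<lambda>x. h x a) (real n) y" for n
    unfolding local_sol_iff_motion[OF a]
    using motion_exists[OF const_control_relaxed[OF Lam_closed a, of "real n"], of 0 x] by simp
  then obtain Y where Y0: "\<And>n. Y n 0 = x" and Y: "\<And>n. local_sol (\<lambda>x. h x a) (real n) (Y n)"
    by metis
  define y where "y t = Y (nat \<lceil>t\<rceil>) t" for t
  have eq: "y t = Y n t" if "0 \<le> t" "t \<le> real n" for t n
    unfolding y_def
  proof (rule local_sol_unique[OF a, where T = t and t = t and y = "Y (nat \<lceil>t\<rceil>)" and z = "Y n"])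
    show "local_sol (\<lambda>x. h x a) t (Y (nat \<lceil>t\<rceil>))" using Y[of "nat \<lceil>t\<rceil>"] by (rule local_sol_mono) (use that in linarith)
    show "local_sol (\<lambda>x. h x a) t (Y n)" using Y[of n] by (rule local_sol_mono) (use that in linarith)
  qed (use Y0 that in auto)
  have "is_forward_sol (\<lambda>x. h x a) x y" unfolding is_forward_sol_def
  proof (intro conjI allI impI)
    show "y 0 = x" using eq[of 0 0] Y0 by simp
    fix t :: real assume t: "0 \<le> t"
    \<comment> \<open>The extra 1 puts \<open>t\<close> strictly below the end of the interval, so
      that derivatives within it are derivatives within the half-line.\<close>
    define n where "n = Suc (nat \<lceil>t\<rceil>)"
    have tn: "t < real n" unfolding n_def using t by linarith
    have "(Y n has_vector_derivative h (Y n t) a) (at t within {0..real n})"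
      using Y[of n] t tn unfolding local_sol_def by auto
    then have "(Y n has_vector_derivative h (y t) a) (at t within {0..real n})" using eq[of t n] t tn by simp
    then have "(y has_vector_derivative h (y t) a) (at t within {0..real n})"
      by (rule has_vector_derivative_transform[rotated 2]) (use eq[of _ n] t tn in auto)
    moreover have "at t within {0..real n} = at t within {0..}"
      by (rule at_within_nhd[where S = "{..<real n}"]) (use tn in auto)
    ultimately show "(y has_vector_derivative h (y t) a) (at t within {0..})" by simp
  qed
  then show ?thesis by blast
qed

lemma flow_unique:
  assumes a: "a \<in> Lam" and y: "is_forward_sol (\<lambda>x. h x a) x y" and t: "0 \<le> t"
  shows "flow (\<lambda>x. h x a) t x = y t"
  unfolding flow_def
proof (rule the_equality)
  fix z assume "\<exists>y. is_forward_sol (\<lambda>x. h x a) x y \<and> y t = z"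
  then obtain y' where y': "is_forward_sol (\<lambda>x. h x a) x y'" "y' t = z" by blast
  show "z = y t"
    using local_sol_unique[OF a forward_sol_local[OF y'(1)] forward_sol_local[OF y], of t t] y y' t
    by (auto simp: is_forward_sol_def)
qed (use y in blast)

lemma flow_sol:
  assumes a: "a \<in> Lam" shows "is_forward_sol (\<lambda>x. h x a) x (\<lambda>t. flow (\<lambda>x. h x a) t x)"
proof -
  obtain y where y: "is_forward_sol (\<lambda>x. h x a) x y" using forward_sol_exists[OF a] by blast
  have f: "flow (\<lambda>x. h x a) t x = y t" if "0 \<le> t" for t using flow_unique[OF a y that] .
  show ?thesis unfolding is_forward_sol_def
  proof (intro conjI allI impI)
    show "flow (\<lambda>x. h x a) 0 x = x" using f[of 0] y by (simp add: is_forward_sol_def)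
    fix t :: real assume t: "0 \<le> t"
    then have "(y has_vector_derivative h (flow (\<lambda>x. h x a) t x) a) (at t within {0..})"
      using y f by (simp add: is_forward_sol_def)
    then show "((\<lambda>t. flow (\<lambda>x. h x a) t x) has_vector_derivative h (flow (\<lambda>x. h x a) t x) a) (at t within {0..})"
      by (rule has_vector_derivative_transform[rotated 2]) (use t f in auto)
  qed
qed

lemma flow_0: "a \<in> Lam \<Longrightarrow> flow (\<lambda>x. h x a) 0 x = x"
  using flow_sol[of a x] by (simp add: is_forward_sol_def)

lemma flow_motion: "a \<in> Lam \<Longrightarrow> motion_on Lam h (const_control T a) 0 T (\<lambda>t. flow (\<lambda>x. h x a) t x)"
  using forward_sol_local[OF flow_sol] local_sol_iff_motion by blast

lemma flow_add:
  assumes a: "a \<in> Lam" and "0 \<le> s" "0 \<le> t"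
  shows "flow (\<lambda>x. h x a) (s + t) x = flow (\<lambda>x. h x a) t (flow (\<lambda>x. h x a) s x)"
proof -
  have "is_forward_sol (\<lambda>x. h x a) (flow (\<lambda>x. h x a) s x) (\<lambda>t. flow (\<lambda>x. h x a) (s + t) x)"
    unfolding is_forward_sol_def
  proof (intro conjI allI impI)
    fix r :: real assume r: "0 \<le> r"
    have "((\<lambda>t. flow (\<lambda>x. h x a) t x) has_vector_derivative h (flow (\<lambda>x. h x a) (s + r) x) a) (at (s + r) within {0..})"
      using flow_sol[OF a, of x] r assms by (simp add: is_forward_sol_def)
    then have d: "((\<lambda>t. flow (\<lambda>x. h x a) t x) has_vector_derivative h (flow (\<lambda>x. h x a) (s + r) x) a) (at (s + r) within ((+) s) ` {0..})"
      by (rule has_vector_derivative_within_subset) (use assms in auto)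
    have "((\<lambda>t. flow (\<lambda>x. h x a) t x) \<circ> ((+) s) has_vector_derivative (1 *\<^sub>R h (flow (\<lambda>x. h x a) (s + r) x) a)) (at r within {0..})"
      by (rule vector_diff_chain_within[OF _ d]) (auto intro!: derivative_eq_intros)
    then show "((\<lambda>t. flow (\<lambda>x. h x a) (s + t) x) has_vector_derivative h (flow (\<lambda>x. h x a) (s + r) x) a) (at r within {0..})"
      by (simp add: o_def)
  qed simp
  then show ?thesis using flow_unique[OF a _ assms(3)] by simp
qed

lemma flow_growth:
  assumes a: "a \<in> Lam" and t: "0 \<le> t"
  shows "1 + norm (flow (\<lambda>x. h x a) t x) \<le> (1 + norm x) * exp (growth_const * t)"
  using growth_motion(1)[OF const_control_relaxed[OF Lam_closed a] _ flow_motion[OF a, of t x], of 0 t] t flow_0[OF a]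
  by simp

text \<open>The hypothesis on \<open>B\<close> keeps the trajectory in the ball of radius
  \<open>B\<close> up to time \<open>t\<close>. There the speed is at most
  \<open>growth_const * (1 + B)\<close>, so the right-hand side drifts by at most
  \<open>lip_const B\<close> times the distance covered, and the error of one Euler step is
  quadratic.\<close>

lemma flow_first:
  assumes a: "a \<in> Lam" and t: "0 \<le> t" and B: "(1 + norm x) * exp (growth_const * t) \<le> 1 + B"
  shows "norm (flow (\<lambda>x. h x a) t x - x) \<le> growth_const * (1 + B) * t"
    and "norm (flow (\<lambda>x. h x a) t x - x - t *\<^sub>R h x a) \<le> lip_const B * (growth_const * (1 + B)) * t\<^sup>2"
proof -
  let ?y = "\<lambda>t. flow (\<lambda>x. h x a) t x"
  have ls: "local_sol (\<lambda>x. h x a) t ?y" by (rule forward_sol_local[OF flow_sol[OF a]])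
  have bd: "norm (?y r) \<le> B" if "0 \<le> r" "r \<le> t" for r
  proof -
    have "1 + norm (?y r) \<le> (1 + norm x) * exp (growth_const * r)" by (rule flow_growth[OF a that(1)])
    also have "\<dots> \<le> (1 + norm x) * exp (growth_const * t)" using that growth_const_nonneg by (auto intro!: mult_left_mono)
    finally show ?thesis using B by simp
  qed
  have B0: "norm x \<le> B" "0 \<le> B" using bd[of 0] t flow_0[OF a, of x] order_trans[OF norm_ge_zero[of x], of B] by auto
  have int: "((\<lambda>r. h (?y r) a) has_integral (?y r - x)) {0..r}" if "0 \<le> r" "r \<le> t" for r
  proof -
    have "((\<lambda>r. h (?y r) a) has_integral (?y r - ?y 0)) {0..r}"
      by (rule fundamental_theorem_of_calculus[OF that(1)])
         (use ls that has_vector_derivative_within_subset[of ?y _ _ "{0..t}" "{0..r}"] in \<open>auto simp: local_sol_def\<close>)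
    then show ?thesis by (simp add: flow_0[OF a])
  qed
  have le: "norm (h (?y r) a) \<le> growth_const * (1 + B)" if "0 \<le> r" "r \<le> t" for r
    using growth[OF a, of "?y r"] bd[OF that] growth_const_nonneg by (meson add_left_mono mult_left_mono order_trans)
  have mv: "norm (?y r - x) \<le> growth_const * (1 + B) * r" if "0 \<le> r" "r \<le> t" for r
    using has_integral_bound[OF _ int[OF that, folded box_real(2)], of "growth_const * (1 + B)"] le that growth_const_nonneg B0 by auto
  then show "norm (?y t - x) \<le> growth_const * (1 + B) * t" using t by simp
  have c0: "((\<lambda>r. h x a) has_integral (t *\<^sub>R h x a)) {0..t}"
    using has_integral_const_real[of "h x a" 0 t] t by simp
  have "norm (?y t - x - t *\<^sub>R h x a) \<le> lip_const B * (growth_const * (1 + B) * t) * t"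
  proof -
    have "((\<lambda>r. h (?y r) a - h x a) has_integral (?y t - x - t *\<^sub>R h x a)) (cbox 0 t)"
      using has_integral_diff[OF int[of t] c0] t by simp
    from has_integral_bound[OF _ this, of "lip_const B * (growth_const * (1 + B) * t)"]
    have "(\<And>r. r \<in> cbox 0 t \<Longrightarrow> norm (h (?y r) a - h x a) \<le> lip_const B * (growth_const * (1 + B) * t)) \<Longrightarrow> ?thesis"
      using t growth_const_nonneg B0 lip_const_nonneg[of B] by auto
    moreover have "norm (h (?y r) a - h x a) \<le> lip_const B * (growth_const * (1 + B) * t)" if "r \<in> cbox 0 t" for r
    proof -
      have r: "0 \<le> r" "r \<le> t" using that by auto
      have "norm (h (?y r) a - h x a) \<le> lip_const B * norm (?y r - x)"
        by (rule lipschitz[OF bd[OF r] B0(1) a])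
      also have "norm (?y r - x) \<le> growth_const * (1 + B) * t"
        using mv[OF r] r mult_left_mono[of r t "growth_const * (1 + B)"] growth_const_nonneg B0 by simp
      finally show ?thesis using lip_const_nonneg[of B] by (simp add: mult_left_mono)
    qed
    ultimately show ?thesis by blast
  qed
  then show "norm (?y t - x - t *\<^sub>R h x a) \<le> lip_const B * (growth_const * (1 + B)) * t\<^sup>2" by (simp add: power2_eq_square mult_ac)
qed

lemma flow_lipschitz:
  assumes a: "a \<in> Lam" and t: "0 \<le> t"
    and B: "(1 + norm x) * exp (growth_const * t) \<le> 1 + B" "(1 + norm y) * exp (growth_const * t) \<le> 1 + B"
  shows "norm (flow (\<lambda>x. h x a) t x - flow (\<lambda>x. h x a) t y) \<le> exp (lip_const B * t) * norm (x - y)"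
proof -
  have bd: "norm (flow (\<lambda>x. h x a) r z) \<le> B" if "0 \<le> r" "r \<le> t" "(1 + norm z) * exp (growth_const * t) \<le> 1 + B" for r z
  proof -
    have "1 + norm (flow (\<lambda>x. h x a) r z) \<le> (1 + norm z) * exp (growth_const * r)" by (rule flow_growth[OF a that(1)])
    also have "\<dots> \<le> (1 + norm z) * exp (growth_const * t)" using that growth_const_nonneg by (auto intro!: mult_left_mono)
    finally show ?thesis using that by simp
  qed
  show ?thesis
    using lipschitz_motion(1)[OF const_control_relaxed[OF Lam_closed a] _ _ _ flow_motion[OF a, of t x] flow_motion[OF a, of t y],
      where R = B and s = 0 and t = t] bd B t flow_0[OF a] by (simp add: mult.commute)
qed

end

text \<open>Piecewise constant controls as lists of durations and values, head first. The systems
  are autonomous, so rearranging a control becomes a permutation of a list of flows.\<close>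

primrec lflow :: "('x::real_normed_vector \<Rightarrow> 'a \<Rightarrow> 'x) \<Rightarrow> (real \<times> 'a) list \<Rightarrow> 'x \<Rightarrow> 'x" where
  "lflow h [] x = x"
| "lflow h (p # l) x = lflow h l (flow (\<lambda>y. h y (snd p)) (fst p) x)"

definition steps_in :: "'a set \<Rightarrow> (real \<times> 'a) list \<Rightarrow> bool" where
  "steps_in Lam l \<longleftrightarrow> (\<forall>p\<in>set l. 0 \<le> fst p \<and> snd p \<in> Lam)"

definition duration :: "(real \<times> 'a) list \<Rightarrow> real" where
  "duration l = sum_list (map fst l)"

lemma steps_in_simps [simp]:
  "steps_in Lam []" "steps_in Lam (p # l) \<longleftrightarrow> 0 \<le> fst p \<and> snd p \<in> Lam \<and> steps_in Lam l"
  "steps_in Lam (l @ l') \<longleftrightarrow> steps_in Lam l \<and> steps_in Lam l'"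
  "steps_in Lam (rev l) \<longleftrightarrow> steps_in Lam l"
  by (auto simp: steps_in_def)

lemma duration_simps [simp]:
  "duration [] = 0" "duration (p # l) = fst p + duration l" "duration (l @ l') = duration l + duration l'"
  "duration (rev l) = duration l"
  by (auto simp: duration_def rev_map[symmetric])

lemma duration_nonneg: "steps_in Lam l \<Longrightarrow> 0 \<le> duration l"
  by (induction l) auto

lemma lflow_append: "lflow h (l @ l') x = lflow h l' (lflow h l x)"
  by (induction l arbitrary: x) auto

context rhs_system
begin

lemma lflow_growth: "steps_in Lam l \<Longrightarrow> 1 + norm (lflow h l x) \<le> (1 + norm x) * exp (growth_const * duration l)"
proof (induction l arbitrary: x)
  case (Cons p l)
  let ?x = "flow (\<lambda>x. h x (snd p)) (fst p) x"
  have "1 + norm (lflow h l ?x) \<le> (1 + norm ?x) * exp (growth_const * duration l)" using Cons by simp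
  also have "\<dots> \<le> ((1 + norm x) * exp (growth_const * fst p)) * exp (growth_const * duration l)"
    using flow_growth[of "snd p" "fst p" x] Cons.prems by (intro mult_right_mono) auto
  finally show ?case by (simp add: exp_add algebra_simps)
qed simp

text \<open>\<open>B\<close> is an a priori bound for the whole run. The budget inequality passes to
  the first piece and, from the new point, to the rest, as the inductions below require.\<close>

lemma growth_step:
  assumes "steps_in Lam (p # l)" "(1 + norm x) * exp (growth_const * duration (p # l)) \<le> 1 + B"
  shows "(1 + norm x) * exp (growth_const * fst p) \<le> 1 + B"
    and "(1 + norm (flow (\<lambda>x. h x (snd p)) (fst p) x)) * exp (growth_const * duration l) \<le> 1 + B"
proof -
  have d: "0 \<le> duration l" using assms(1) duration_nonneg by auto
  have e: "(1 + norm x) * exp (growth_const * duration (p # l)) = ((1 + norm x) * exp (growth_const * fst p)) * exp (growth_const * duration l)"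
    by (simp add: distrib_left exp_add)
  have "(1 + norm x) * exp (growth_const * fst p) * 1 \<le> (1 + norm x) * exp (growth_const * fst p) * exp (growth_const * duration l)"
    using d growth_const_nonneg by (intro mult_left_mono) auto
  then show "(1 + norm x) * exp (growth_const * fst p) \<le> 1 + B" using assms(2)[unfolded e] by linarith
  have "(1 + norm (flow (\<lambda>x. h x (snd p)) (fst p) x)) * exp (growth_const * duration l) \<le> ((1 + norm x) * exp (growth_const * fst p)) * exp (growth_const * duration l)"
    using flow_growth[of "snd p" "fst p" x] assms(1) by (intro mult_right_mono) auto
  then show "(1 + norm (flow (\<lambda>x. h x (snd p)) (fst p) x)) * exp (growth_const * duration l) \<le> 1 + B"
    using assms(2)[unfolded e] by linarith
qed

lemma lflow_lipschitz:
  "steps_in Lam l \<Longrightarrow> (1 + norm x) * exp (growth_const * duration l) \<le> 1 + B \<Longrightarrow> (1 + norm y) * exp (growth_const * duration l) \<le> 1 + B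
    \<Longrightarrow> norm (lflow h l x - lflow h l y) \<le> exp (lip_const B * duration l) * norm (x - y)"
proof (induction l arbitrary: x y)
  case (Cons p l)
  let ?f = "flow (\<lambda>x. h x (snd p)) (fst p)"
  have "norm (lflow h l (?f x) - lflow h l (?f y)) \<le> exp (lip_const B * duration l) * norm (?f x - ?f y)"
    using Cons.prems growth_step(2)[OF Cons.prems(1), of x B] growth_step(2)[OF Cons.prems(1), of y B]
    by (intro Cons.IH) auto
  also have "\<dots> \<le> exp (lip_const B * duration l) * (exp (lip_const B * fst p) * norm (x - y))"
    using Cons.prems(1) growth_step(1)[OF Cons.prems(1,2)] growth_step(1)[OF Cons.prems(1,3)]
    by (intro mult_left_mono flow_lipschitz) auto
  finally show ?case by (simp add: exp_add algebra_simps)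
qed simp

lemma lflow_move:
  "steps_in Lam l \<Longrightarrow> (1 + norm x) * exp (growth_const * duration l) \<le> 1 + B
    \<Longrightarrow> norm (lflow h l x - x) \<le> growth_const * (1 + B) * duration l"
proof (induction l arbitrary: x)
  case (Cons p l)
  let ?x = "flow (\<lambda>x. h x (snd p)) (fst p) x"
  have "norm (lflow h l ?x - ?x) \<le> growth_const * (1 + B) * duration l"
    using Cons.prems growth_step(2)[OF Cons.prems(1,2)] by (intro Cons.IH) auto
  moreover have "norm (?x - x) \<le> growth_const * (1 + B) * fst p"
    using Cons.prems growth_step(1)[OF Cons.prems(1,2)] by (intro flow_first) auto
  ultimately show ?case using norm_triangle_ineq[of "lflow h l ?x - ?x" "?x - x"] by (simp add: algebra_simps)
qed simp

lemma sum_rhs_lipschitz: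
  assumes "steps_in Lam l" "norm x \<le> B" "norm y \<le> B"
  shows "norm ((\<Sum>p\<leftarrow>l. fst p *\<^sub>R h x (snd p)) - (\<Sum>p\<leftarrow>l. fst p *\<^sub>R h y (snd p))) \<le> lip_const B * norm (x - y) * duration l"
  using assms(1)
proof (induction l)
  case (Cons q l)
  have "norm (fst q *\<^sub>R h x (snd q) - fst q *\<^sub>R h y (snd q)) = fst q * norm (h x (snd q) - h y (snd q))"
    using Cons.prems by (simp add: scaleR_diff_right[symmetric] del: scaleR_diff_right)
  also have "\<dots> \<le> fst q * (lip_const B * norm (x - y))"
    using Cons.prems assms by (intro mult_left_mono lipschitz) auto
  finally have 1: "norm (fst q *\<^sub>R h x (snd q) - fst q *\<^sub>R h y (snd q)) \<le> fst q * (lip_const B * norm (x - y))" .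
  have 2: "norm ((\<Sum>p\<leftarrow>l. fst p *\<^sub>R h x (snd p)) - (\<Sum>p\<leftarrow>l. fst p *\<^sub>R h y (snd p))) \<le> lip_const B * norm (x - y) * duration l"
    using Cons by auto
  have "norm ((\<Sum>p\<leftarrow>q # l. fst p *\<^sub>R h x (snd p)) - (\<Sum>p\<leftarrow>q # l. fst p *\<^sub>R h y (snd p)))
      \<le> fst q * (lip_const B * norm (x - y)) + lip_const B * norm (x - y) * duration l"
    using norm_diff_triangle_ineq order_trans add_mono[OF 1 2] by (fastforce simp: add_diff_add intro: norm_triangle_le)
  then show ?case by (simp add: algebra_simps)
qed simp

lemma lflow_first:
  "steps_in Lam l \<Longrightarrow> (1 + norm x) * exp (growth_const * duration l) \<le> 1 + B
    \<Longrightarrow> norm (lflow h l x - x - (\<Sum>p\<leftarrow>l. fst p *\<^sub>R h x (snd p))) \<le> lip_const B * (growth_const * (1 + B)) * (duration l)\<^sup>2"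
proof (induction l arbitrary: x)
  case (Cons p l)
  define y where "y = flow (\<lambda>x. h x (snd p)) (fst p) x"
  define S where "S = (\<lambda>x. \<Sum>p\<leftarrow>l. fst p *\<^sub>R h x (snd p))"
  define K where "K = growth_const * (1 + B)"
  define d where "d = fst p"
  define D where "D = duration l"
  have l: "steps_in Lam l" and p: "0 \<le> d" "snd p \<in> Lam" using Cons.prems by (auto simp: d_def)
  note g1 = growth_step(1)[OF Cons.prems, folded d_def] and g2 = growth_step(2)[OF Cons.prems, folded y_def D_def]
  have D: "0 \<le> D" unfolding D_def by (rule duration_nonneg[OF l])
  have "(1 + norm x) * 1 \<le> (1 + norm x) * exp (growth_const * d)" "(1 + norm y) * 1 \<le> (1 + norm y) * exp (growth_const * D)"
    using D p growth_const_nonneg by (intro mult_left_mono; simp)+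
  then have bd: "norm x \<le> B" "norm y \<le> B" using g1 g2 by auto
  have 1: "norm (lflow h l y - y - S y) \<le> lip_const B * K * D\<^sup>2"
    unfolding S_def K_def D_def by (rule Cons.IH[OF l]) (use g2 in \<open>simp add: D_def\<close>)
  have 2: "norm (y - x - d *\<^sub>R h x (snd p)) \<le> lip_const B * K * d\<^sup>2"
    unfolding y_def K_def d_def[symmetric] by (rule flow_first(2)[OF p(2,1) g1])
  have mv: "norm (y - x) \<le> K * d" unfolding y_def K_def d_def[symmetric] by (rule flow_first(1)[OF p(2,1) g1])
  have "norm (S y - S x) \<le> lip_const B * norm (y - x) * D"
    unfolding S_def D_def by (rule sum_rhs_lipschitz[OF l bd(2,1)])
  also have "\<dots> \<le> lip_const B * (K * d) * D"
    using mv D lip_const_nonneg[of B] by (intro mult_right_mono mult_left_mono) auto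
  finally have 3: "norm (S y - S x) \<le> lip_const B * K * (d * D)" by (simp add: mult_ac)
  have "lflow h (p # l) x - x - (\<Sum>p\<leftarrow>p # l. fst p *\<^sub>R h x (snd p))
      = lflow h l y - x - (d *\<^sub>R h x (snd p) + S x)" by (simp add: y_def d_def S_def)
  also have "\<dots> = (lflow h l y - y - S y) + (y - x - d *\<^sub>R h x (snd p)) + (S y - S x)"
    by (simp add: algebra_simps)
  also have "norm \<dots> \<le> lip_const B * K * D\<^sup>2 + lip_const B * K * d\<^sup>2 + lip_const B * K * (d * D)"
    by (intro norm_triangle_le add_mono 1 2 3)
  also have "\<dots> = lip_const B * K * (D\<^sup>2 + d\<^sup>2 + d * D)" by (simp add: algebra_simps)
  also have "\<dots> \<le> lip_const B * K * (d + D)\<^sup>2"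
  proof (rule mult_left_mono)
    have "0 \<le> B" using bd(1) norm_ge_zero[of x] by linarith
    then show "0 \<le> lip_const B * K" unfolding K_def using lip_const_nonneg[of B] growth_const_nonneg by simp
    show "D\<^sup>2 + d\<^sup>2 + d * D \<le> (d + D)\<^sup>2"
      using mult_nonneg_nonneg[OF p(1) D] unfolding power2_eq_square by (simp add: algebra_simps)
  qed
  finally show ?case by (simp add: K_def D_def d_def)
qed simp

lemma rhs_system_uminus: "rhs_system (\<lambda>x a. - h x a) Lam"
proof
  have c: "continuous_on (UNIV \<times> Lam) (\<lambda>(x, a). - h x a)"
    using continuous_on_minus[OF cont] by (simp add: case_prod_beta)
  show "regular_rhs (\<lambda>x a. - h x a) Lam"
    using regular unfolding regular_rhs_def
    by (intro conjI c) (auto simp: norm_minus_commute)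
qed (rule compact_Lam)

text \<open>\<open>flow\<close> runs forward only, so its inverse is expressed as the forward flow
  of the negated right-hand side; the reversed trajectory solves that equation.\<close>

lemma flow_uminus_flow:
  assumes a: "a \<in> Lam" and t: "0 \<le> t"
  shows "flow (\<lambda>x. - h x a) t (flow (\<lambda>x. h x a) t x) = x"
proof -
  interpret N: rhs_system "\<lambda>x a. - h x a" Lam by (rule rhs_system_uminus)
  let ?y = "\<lambda>s. flow (\<lambda>x. h x a) s x"
  have "local_sol (\<lambda>x. - h x a) t (\<lambda>s. ?y (t - s))" unfolding local_sol_def
  proof
    fix s assume s: "s \<in> {0..t}"
    have "(?y has_vector_derivative h (?y (t - s)) a) (at (t - s) within (\<lambda>s. t - s) ` {0..t})"
      using forward_sol_local[OF flow_sol[OF a, of x], of t] s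
      by (auto simp: local_sol_def intro: has_vector_derivative_within_subset)
    then have "(?y \<circ> (\<lambda>s. t - s) has_vector_derivative (- 1) *\<^sub>R h (?y (t - s)) a) (at s within {0..t})"
    proof (rule vector_diff_chain_within[rotated])
      show "((\<lambda>s. t - s) has_vector_derivative - 1) (at s within {0..t})" by (auto intro!: derivative_eq_intros)
    qed
    then show "((\<lambda>s. ?y (t - s)) has_vector_derivative - h (?y (t - s)) a) (at s within {0..t})"
      by (simp add: o_def)
  qed
  from N.local_sol_unique[OF a forward_sol_local[OF N.flow_sol[OF a, of "?y t"]] this, of t]
  show ?thesis using t by (simp add: N.flow_0[OF a] flow_0[OF a])
qed

lemma lflow_uminus_lflow:
  "steps_in Lam l \<Longrightarrow> lflow (\<lambda>x a. - h x a) (rev l) (lflow h l x) = x"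
  by (induction l arbitrary: x) (auto simp: lflow_append flow_uminus_flow)

lemma lflow_lflow_uminus:
  assumes "steps_in Lam l" shows "lflow h l (lflow (\<lambda>x a. - h x a) (rev l) x) = x"
proof -
  interpret N: rhs_system "\<lambda>x a. - h x a" Lam by (rule rhs_system_uminus)
  show ?thesis using N.lflow_uminus_lflow[of "rev l" x] assms by simp
qed

text \<open>The piece in which time \<open>t\<close> falls is cut by the semigroup law. Used to drop
  an initial excess of duration in \<open>target_backward_reach\<close>.\<close>

lemma lflow_split:
  assumes "steps_in Lam l" "0 \<le> t" "t \<le> duration l"
  shows "\<exists>l1 l2. steps_in Lam l1 \<and> steps_in Lam l2 \<and> duration l1 = t \<and> duration l2 = duration l - t \<and>
     (\<forall>x. lflow h l x = lflow h l2 (lflow h l1 x))"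
  using assms
proof (induction l arbitrary: t)
  case Nil then show ?case by (intro exI[of _ "[]"]) auto
next
  case (Cons p l)
  have p: "0 \<le> fst p" "snd p \<in> Lam" using Cons.prems by auto
  show ?case
  proof (cases "t \<le> fst p")
    case True
    have "flow (\<lambda>y. h y (snd p)) (fst p) x = flow (\<lambda>y. h y (snd p)) (fst p - t) (flow (\<lambda>y. h y (snd p)) t x)" for x
      using flow_add[OF p(2), of t "fst p - t" x] True Cons.prems by simp
    then show ?thesis using True Cons.prems
      by (intro exI[of _ "[(t, snd p)]"] exI[of _ "(fst p - t, snd p) # l"]) auto
  next
    case False
    have "\<exists>l1 l2. steps_in Lam l1 \<and> steps_in Lam l2 \<and> duration l1 = t - fst p \<and> duration l2 = duration l - (t - fst p) \<and>
     (\<forall>x. lflow h l x = lflow h l2 (lflow h l1 x))"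
      using Cons.prems False by (intro Cons.IH) auto
    then obtain l1 l2 where "steps_in Lam l1" "steps_in Lam l2" "duration l1 = t - fst p" "duration l2 = duration l - (t - fst p)"
     "\<forall>x. lflow h l x = lflow h l2 (lflow h l1 x)" by blast
    then show ?thesis using p by (intro exI[of _ "p # l1"] exI[of _ l2]) auto
  qed
qed

end

section \<open>Approximation of relaxed controls and reachability\<close>

text \<open>A finite net with a Borel selection: the induction adds one ball at a time and prefers
  its centre, so \<open>q\<close> is a finite case distinction over open balls.\<close>

lemma finite_borel_approximation:
  fixes Lam :: "'a::euclidean_space set"
  assumes "compact Lam" "0 < \<eta>"
  shows "\<exists>q T. q \<in> borel_measurable borel \<and> finite T \<and> T \<subseteq> Lam \<and> (\<forall>a\<in>Lam. q a \<in> T \<and> dist (q a) a < \<eta>)"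
proof -
  obtain T where T: "finite T" "T \<subseteq> Lam" "Lam \<subseteq> (\<Union>t\<in>T. ball t \<eta>)"
    using compactE_image[OF assms(1), of Lam "\<lambda>t. ball t \<eta>"] assms(2) by (metis UN_I centre_in_ball open_ball subsetI)
  have "\<exists>q. q \<in> borel_measurable borel \<and> (\<forall>a\<in>(\<Union>t\<in>T. ball t \<eta>). q a \<in> T \<and> dist (q a) a < \<eta>)"
    using T(1)
  proof (induction T)
    case empty
    show ?case by (intro exI[of _ "\<lambda>_. 0"]) auto
  next
    case (insert t T)
    then obtain q where q: "q \<in> borel_measurable borel" "\<forall>a\<in>(\<Union>t\<in>T. ball t \<eta>). q a \<in> T \<and> dist (q a) a < \<eta>" by blast
    have "(\<lambda>a. if dist t a < \<eta> then t else q a) \<in> borel_measurable borel"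
      using q(1) by (intro measurable_If) (auto simp: pred_def intro!: borel_open open_Collect_less continuous_intros)
    then show ?case using q(2) by (intro exI[of _ "\<lambda>a. if dist t a < \<eta> then t else q a"]) auto
  qed
  with T show ?thesis by blast
qed

lemma relaxed_integral_finite_range:
  fixes v :: "'a::euclidean_space \<Rightarrow> 'x::euclidean_space"
  assumes \<mu>: "\<mu> \<in> relaxed_controls \<theta> Lam" and Lam: "closed Lam"
    and q: "q \<in> borel_measurable borel" "finite T" "\<And>a. a \<in> Lam \<Longrightarrow> q a \<in> T"
  shows "set_integrable \<mu> ({s..t} \<times> Lam) (\<lambda>p. v (q (snd p)))"
    and "(LINT p : {s..t} \<times> Lam | \<mu>. v (q (snd p))) = (\<Sum>b\<in>T. measure \<mu> ({s..t} \<times> (q -` {b} \<inter> Lam)) *\<^sub>R v b)"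
proof -
  interpret finite_measure \<mu> using \<mu> by (rule relaxed_finite)
  let ?A = "\<lambda>b. {s..t} \<times> (q -` {b} \<inter> Lam)"
  have A: "?A b \<in> sets \<mu>" for b
  proof -
    have "q -` {b} \<inter> Lam \<in> sets borel"
      using measurable_sets[OF q(1), of "{b}"] Lam by auto
    then have "?A b \<in> sets (borel \<Otimes>\<^sub>M borel)" by (intro pair_measureI) auto
    then show ?thesis unfolding relaxed_sets[OF \<mu>] borel_prod .
  qed
  have eq: "indicat_real ({s..t} \<times> Lam) p *\<^sub>R v (q (snd p)) = (\<Sum>b\<in>T. indicat_real (?A b) p *\<^sub>R v b)" for p
  proof (cases "p \<in> {s..t} \<times> Lam")
    case True
    then have "q (snd p) \<in> T" using q(3) by auto
    have "(\<Sum>b\<in>T. indicat_real (?A b) p *\<^sub>R v b) = (\<Sum>b\<in>T. if b = q (snd p) then v b else 0)"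
      by (rule sum.cong) (use True in \<open>auto simp: indicator_def\<close>)
    then show ?thesis using True \<open>q (snd p) \<in> T\<close> q(2) by (simp add: indicator_def)
  next
    case False
    then have "indicat_real (?A b) p = 0" for b by (auto simp: indicator_def)
    then show ?thesis using False by simp
  qed
  have i: "integrable \<mu> (\<lambda>p. indicat_real (?A b) p *\<^sub>R v b)" for b
    using A[of b] by (auto intro!: integrable_scaleR_left simp: less_top[symmetric])
  show "set_integrable \<mu> ({s..t} \<times> Lam) (\<lambda>p. v (q (snd p)))"
    unfolding set_integrable_def eq using i by (intro Bochner_Integration.integrable_sum) auto
  have "(LINT p | \<mu>. indicat_real (?A b) p *\<^sub>R v b) = measure \<mu> (?A b) *\<^sub>R v b" for b
  proof -
    have "integrable \<mu> (indicat_real (?A b))" using A[of b] by (simp add: less_top[symmetric])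
    then have "(LINT p | \<mu>. indicat_real (?A b) p *\<^sub>R v b) = (LINT p | \<mu>. indicat_real (?A b) p) *\<^sub>R v b"
      by (intro integral_scaleR_left)
    then show ?thesis by (simp add: relaxed_space[OF \<mu>])
  qed
  then show "(LINT p : {s..t} \<times> Lam | \<mu>. v (q (snd p))) = (\<Sum>b\<in>T. measure \<mu> (?A b) *\<^sub>R v b)"
    unfolding set_lebesgue_integral_def eq by (subst Bochner_Integration.integral_sum[OF i]) simp
qed

text \<open>The duration of the value \<open>b\<close> is the mass that \<open>\<mu>\<close> gives
  to the control values rounded to \<open>b\<close>. One list represents the averaged rounded
  control for every function \<open>v\<close> at once.\<close>

lemma relaxed_piecewise:
  fixes Lam :: "'a::euclidean_space set"
  assumes \<mu>: "\<mu> \<in> relaxed_controls \<theta> Lam" and Lam: "compact Lam"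
    and q: "q \<in> borel_measurable borel" "finite T" "T \<subseteq> Lam" "\<And>a. a \<in> Lam \<Longrightarrow> q a \<in> T"
    and st: "0 \<le> s" "s \<le> t" "t \<le> \<theta>"
  shows "\<exists>l. steps_in Lam l \<and> duration l = t - s \<and>
    (\<forall>v :: 'a \<Rightarrow> 'x::euclidean_space. (LINT p : {s..t} \<times> Lam | \<mu>. v (q (snd p))) = (\<Sum>p\<leftarrow>l. fst p *\<^sub>R v (snd p)))"
proof -
  obtain bs where bs: "set bs = T" "distinct bs" using finite_distinct_list[OF q(2)] by blast
  define l where "l = map (\<lambda>b. (measure \<mu> ({s..t} \<times> (q -` {b} \<inter> Lam)), b)) bs"
  have sum: "(\<Sum>p\<leftarrow>l. fst p *\<^sub>R v (snd p)) = (\<Sum>b\<in>T. measure \<mu> ({s..t} \<times> (q -` {b} \<inter> Lam)) *\<^sub>R v b)"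
    for v :: "'a \<Rightarrow> 'z::euclidean_space"
    unfolding l_def using bs by (simp add: o_def sum_list_distinct_conv_sum_set)
  note fr = relaxed_integral_finite_range(2)[OF \<mu> compact_imp_closed[OF Lam] q(1,2,4)]
  \<comment> \<open>Integrating the constant function 1 shows that the durations add up to the
    length of the interval.\<close>
  have "duration l = (\<Sum>p\<leftarrow>l. fst p *\<^sub>R (1::real))" by (simp add: duration_def)
  also have "\<dots> = (LINT p : {s..t} \<times> Lam | \<mu>. (1::real))" using sum[of "\<lambda>_. 1 :: real"] fr[of s t "\<lambda>_. 1 :: real"] by simp
  also have "\<dots> = integral {s..t} (\<lambda>_. 1 :: real)"
    by (rule relaxed_integral_fst[OF \<mu> Lam]) (use st in auto)
  finally have "duration l = t - s" using st by simp
  moreover have "steps_in Lam l" unfolding steps_in_def l_def using bs q(3) by auto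
  ultimately show ?thesis by (intro exI[of _ l] conjI allI) (simp_all only: fr sum)
qed

context rhs_system
begin

lemma bound_nonneg: "(1 + norm x) * exp (growth_const * d) \<le> 1 + B \<Longrightarrow> 0 \<le> d \<Longrightarrow> norm x \<le> B \<and> 0 \<le> B"
proof -
  assume a: "(1 + norm x) * exp (growth_const * d) \<le> 1 + B" "0 \<le> d"
  have "(1 + norm x) * 1 \<le> (1 + norm x) * exp (growth_const * d)" using a growth_const_nonneg by (intro mult_left_mono; simp)
  from order_trans[OF this a(1)] have "norm x \<le> B" by simp
  then show ?thesis using norm_ge_zero[of x] by linarith
qed

lemma motion_move:
  assumes \<mu>: "\<mu> \<in> relaxed_controls \<theta> Lam" and x: "motion_on Lam h \<mu> a b x" and ab: "0 \<le> a" "b \<le> \<theta>"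
    and st: "a \<le> s" "s \<le> t" "t \<le> b" and B: "\<And>r. r \<in> {s..t} \<Longrightarrow> norm (x r) \<le> B"
  shows "norm (x t - x s) \<le> growth_const * (1 + B) * (t - s)"
proof -
  have cx: "continuous_on {s..t} x" using motion_onD(1)[OF x] st by (auto intro: continuous_on_subset)
  have "norm (x t - x s) \<le> integral {s..t} (\<lambda>_. growth_const * (1 + B))"
    unfolding motion_onD(2)[OF x st]
  proof (rule relaxed_integral_norm_le[OF \<mu> compact_Lam cont_rhs[OF cont cx]])
    show "norm (h (x (fst (r, l))) (snd (r, l))) \<le> growth_const * (1 + B)" if "r \<in> {s..t}" "l \<in> Lam" for r l
      using growth[OF that(2), of "x r"] B[OF that(1)] growth_const_nonneg
      by simp (meson add_left_mono mult_left_mono order_trans)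
  qed (use ab st in auto)
  then show ?thesis using st by (simp add: mult_ac)
qed

lemma piecewise_step_error:
  assumes \<mu>: "\<mu> \<in> relaxed_controls \<theta> Lam" and x: "motion_on Lam h \<mu> a b x" and ab: "0 \<le> a" "b \<le> \<theta>"
    and st: "a \<le> s" "s \<le> t" "t \<le> b" and B: "(1 + norm (x s)) * exp (growth_const * (t - s)) \<le> 1 + B"
    and q: "q \<in> borel_measurable borel" "finite T" "T \<subseteq> Lam" "\<And>a. a \<in> Lam \<Longrightarrow> q a \<in> T"
    and \<epsilon>: "\<And>y a. norm y \<le> B \<Longrightarrow> a \<in> Lam \<Longrightarrow> norm (h y a - h y (q a)) \<le> \<epsilon>"
    and l: "steps_in Lam l" "duration l = t - s"
      "\<And>v :: 'a \<Rightarrow> 'x. (LINT p : {s..t} \<times> Lam | \<mu>. v (q (snd p))) = (\<Sum>p\<leftarrow>l. fst p *\<^sub>R v (snd p))"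
  shows "norm (lflow h l (x s) - x t) \<le> (t - s) * (\<epsilon> + 2 * (lip_const B * (growth_const * (1 + B))) * (t - s))"
proof -
  define K where "K = growth_const * (1 + B)"
  have bd: "norm (x r) \<le> B" if "r \<in> {s..t}" for r
  proof -
    have "1 + norm (x r) \<le> (1 + norm (x s)) * exp (growth_const * (r - s))"
      by (rule growth_motion(1)[OF \<mu> _ x]) (use ab st that in auto)
    also have "\<dots> \<le> (1 + norm (x s)) * exp (growth_const * (t - s))" using that growth_const_nonneg by (auto intro!: mult_left_mono)
    finally show ?thesis using B by simp
  qed
  have B0: "norm (x s) \<le> B" "0 \<le> B" using bound_nonneg[OF B] st by auto
  have cx: "continuous_on {s..t} x" using motion_onD(1)[OF x] st by (auto intro: continuous_on_subset)
  let ?S = "\<Sum>p\<leftarrow>l. fst p *\<^sub>R h (x s) (snd p)"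
  have K0: "0 \<le> K" unfolding K_def using growth_const_nonneg B0 by simp
  have fr: "set_integrable \<mu> ({s..t} \<times> Lam) (\<lambda>p. h (x s) (q (snd p)))"
    using relaxed_integral_finite_range(1)[OF \<mu> Lam_closed q(1,2,4), where v = "h (x s)" and s = s and t = t] .
  have i: "set_integrable \<mu> ({s..t} \<times> Lam) (\<lambda>p. h (x (fst p)) (snd p))"
    by (rule relaxed_integrable[OF \<mu> compact_Lam cont_rhs[OF cont cx]])
  have "norm (x t - x s - ?S) = norm (LINT p : {s..t} \<times> Lam | \<mu>. h (x (fst p)) (snd p) - h (x s) (q (snd p)))"
    unfolding motion_onD(2)[OF x st] l(3)[symmetric] using set_integral_diff(2)[OF i fr] by simp
  also have "\<dots> \<le> (LINT p : {s..t} \<times> Lam | \<mu>. norm (h (x (fst p)) (snd p) - h (x s) (q (snd p))))"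
    by (rule set_integral_norm_bound[OF set_integral_diff(1)[OF i fr]])
  also have "\<dots> \<le> (LINT p : {s..t} \<times> Lam | \<mu>. \<epsilon> + lip_const B * (K * (t - s)))"
  proof (rule set_integral_mono[OF set_integrable_norm[OF set_integral_diff(1)[OF i fr]]])
    show "set_integrable \<mu> ({s..t} \<times> Lam) (\<lambda>p. \<epsilon> + lip_const B * (K * (t - s)))"
      by (rule relaxed_integrable[OF \<mu> compact_Lam]) simp
    fix p assume p: "p \<in> {s..t} \<times> Lam"
    have "norm (h (x (fst p)) (snd p) - h (x s) (snd p)) \<le> lip_const B * norm (x (fst p) - x s)"
      using p B0 bd by (intro lipschitz) auto
    also have "\<dots> \<le> lip_const B * (K * (t - s))"
    proof (rule mult_left_mono[OF _ lip_const_nonneg])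
      have "norm (x (fst p) - x s) \<le> K * (fst p - s)"
        unfolding K_def by (rule motion_move[OF \<mu> x ab]) (use p st bd in auto)
      also have "\<dots> \<le> K * (t - s)" using p K0 by (intro mult_left_mono) auto
      finally show "norm (x (fst p) - x s) \<le> K * (t - s)" .
    qed
    finally show "norm (h (x (fst p)) (snd p) - h (x s) (q (snd p))) \<le> \<epsilon> + lip_const B * (K * (t - s))"
      using \<epsilon>[OF B0(1), of "snd p"] p
        norm_triangle_ineq[of "h (x (fst p)) (snd p) - h (x s) (snd p)" "h (x s) (snd p) - h (x s) (q (snd p))"] by auto
  qed
  also have "\<dots> = integral {s..t} (\<lambda>_. \<epsilon> + lip_const B * (K * (t - s)))"
    by (rule relaxed_integral_fst[OF \<mu> compact_Lam]) (use ab st in auto)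
  finally have 1: "norm (x t - x s - ?S) \<le> (t - s) * (\<epsilon> + lip_const B * K * (t - s))" using st by (simp add: mult.assoc)
  have 2: "norm (lflow h l (x s) - x s - ?S) \<le> lip_const B * K * (t - s)\<^sup>2"
    unfolding K_def using lflow_first[OF l(1), of "x s" B] B l(2) by simp
  have "lflow h l (x s) - x t = (lflow h l (x s) - x s - ?S) - (x t - x s - ?S)" by simp
  also have "norm \<dots> \<le> norm (lflow h l (x s) - x s - ?S) + norm (x t - x s - ?S)"
    by (rule norm_triangle_ineq4)
  also have "\<dots> \<le> lip_const B * K * (t - s)\<^sup>2 + (t - s) * (\<epsilon> + lip_const B * K * (t - s))"
    using 1 2 by linarith
  also have "\<dots> = (t - s) * (\<epsilon> + 2 * (lip_const B * K) * (t - s))"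
    by (simp add: power2_eq_square algebra_simps)
  finally show ?thesis unfolding K_def .
qed

end

text \<open>The lists are chosen before \<open>h\<close> and \<open>x\<close>: they depend on the
  control alone. This uniformity allows motions of different right-hand sides under one relaxed
  control to be compared along the same lists. The time grid and the rounding of control values are
  refined together.\<close>

lemma relaxed_approximation:
  fixes Lam :: "'a::euclidean_space set"
  assumes \<mu>: "\<mu> \<in> relaxed_controls \<theta> Lam" and Lam: "compact Lam" and ab: "0 \<le> a" "a \<le> b" "b \<le> \<theta>"
  shows "\<exists>l :: nat \<Rightarrow> _. (\<forall>n. steps_in Lam (l n) \<and> duration (l n) = b - a) \<and>
    (\<forall>(h :: 'x::euclidean_space \<Rightarrow> 'a \<Rightarrow> 'x) x. regular_rhs h Lam \<longrightarrow> motion_on Lam h \<mu> a b x \<longrightarrow>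
      (\<lambda>n. lflow h (l n) (x a)) \<longlonglongrightarrow> x b)"
proof -
  have "\<exists>q T. q \<in> borel_measurable borel \<and> finite T \<and> T \<subseteq> Lam \<and> (\<forall>a\<in>Lam. q a \<in> T \<and> dist (q a) a < 1 / real (Suc n))" for n
    by (rule finite_borel_approximation[OF Lam]) simp
  then obtain q T where q: "\<And>n. q n \<in> borel_measurable borel" "\<And>n. finite (T n)" "\<And>n. T n \<subseteq> Lam"
      "\<And>n a. a \<in> Lam \<Longrightarrow> q n a \<in> T n" and qd: "\<And>n a. a \<in> Lam \<Longrightarrow> dist (q n a) a < 1 / real (Suc n)"
    by metis
  define \<delta> where "\<delta> = (\<lambda>n. (b - a) / real (Suc n))"
  have \<delta>: "0 \<le> \<delta> n" for n unfolding \<delta>_def using ab by simp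
  define \<tau> where "\<tau> = (\<lambda>n k. a + real k * \<delta> n)"
  have \<tau>S: "\<tau> n (Suc k) - \<tau> n k = \<delta> n" for n k by (simp add: \<tau>_def algebra_simps)
  have \<tau>b: "\<tau> n (Suc n) = b" for n by (simp add: \<tau>_def \<delta>_def)
  have \<tau>mono: "\<tau> n k \<le> \<tau> n m" if "k \<le> m" for n k m
    using that \<delta>[of n] by (simp add: \<tau>_def mult_right_mono)
  define S where "S = (\<lambda>n k l. steps_in Lam l \<and> duration l = \<tau> n (Suc k) - \<tau> n k \<and>
    (\<forall>v :: 'a \<Rightarrow> 'x. (LINT p : {\<tau> n k..\<tau> n (Suc k)} \<times> Lam | \<mu>. v (q n (snd p))) = (\<Sum>p\<leftarrow>l. fst p *\<^sub>R v (snd p))))"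
  have "\<exists>l. S n k l" if "k \<le> n" for n k
    unfolding S_def
    by (rule relaxed_piecewise[OF \<mu> Lam q])
       (use ab \<delta>[of n] \<tau>mono[of k "Suc k" n] \<tau>mono[of "Suc k" "Suc n" n] \<tau>b[of n] that in \<open>auto simp: \<tau>_def\<close>)
  note ex = this
  define s where "s = (\<lambda>n k. SOME l. S n k l)"
  have "S n k (s n k)" if "k \<le> n" for n k
    unfolding s_def by (rule someI_ex) (rule ex[OF that])
  then have s: "\<And>n k. k \<le> n \<Longrightarrow> steps_in Lam (s n k)" "\<And>n k. k \<le> n \<Longrightarrow> duration (s n k) = \<tau> n (Suc k) - \<tau> n k"
    "\<And>n k (v :: 'a \<Rightarrow> 'x). k \<le> n \<Longrightarrow>
      (LINT p : {\<tau> n k..\<tau> n (Suc k)} \<times> Lam | \<mu>. v (q n (snd p))) = (\<Sum>p\<leftarrow>s n k. fst p *\<^sub>R v (snd p))"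
    by (auto simp: S_def)
  define m where "m = (\<lambda>n k. concat (map (s n) [0..<k]))"
  have mS: "m n (Suc k) = m n k @ s n k" "m n 0 = []" for n k by (auto simp: m_def)
  have m: "steps_in Lam (m n k) \<and> duration (m n k) = \<tau> n k - a" if "k \<le> Suc n" for n k
    using that by (induction k) (use s(1,2) in \<open>auto simp: mS \<tau>_def\<close>)
  have lim: "(\<lambda>n. lflow h (m n (Suc n)) (x a)) \<longlonglongrightarrow> x b"
    if h: "regular_rhs h Lam" and x: "motion_on Lam h \<mu> a b x" for h :: "'x \<Rightarrow> 'a \<Rightarrow> 'x" and x
  proof -
    interpret rhs_system h Lam using h Lam by unfold_locales
    define B where "B = (1 + norm (x a)) * exp (growth_const * (b - a)) - 1"
    have B1: "(1 + norm (x a)) * exp (growth_const * (b - a)) \<le> 1 + B" by (simp add: B_def)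
    have B0: "0 \<le> B" using bound_nonneg[OF B1] ab by auto
    define L where "L = lip_const B"
    define K where "K = growth_const * (1 + B)"
    have LK: "0 \<le> L" "0 \<le> K" using lip_const_nonneg growth_const_nonneg B0 by (auto simp: L_def K_def)
    \<comment> \<open>Discrete Gronwall: each step multiplies the old error by
      \<open>exp (L * \<delta> n)\<close> and adds the one-step error; the claimed product form
      absorbs both.\<close>
    have err: "norm (lflow h (m n k) (x a) - x (\<tau> n k)) \<le> exp (L * (\<tau> n k - a)) * ((\<tau> n k - a) * (\<epsilon> + 2 * (L * K) * \<delta> n))"
      if k: "k \<le> Suc n" and \<epsilon>: "0 \<le> \<epsilon>" "\<And>y a. norm y \<le> B \<Longrightarrow> a \<in> Lam \<Longrightarrow> norm (h y a - h y (q n a)) \<le> \<epsilon>" for n k \<epsilon>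
      using k
    proof (induction k)
      case 0 show ?case by (simp add: mS \<tau>_def)
    next
      case (Suc k)
      let ?s = "\<tau> n k" and ?t = "\<tau> n (Suc k)"
      define c where "c = \<epsilon> + 2 * (L * K) * \<delta> n"
      have c: "0 \<le> c" unfolding c_def using \<epsilon>(1) LK \<delta>[of n] by simp
      have k: "k \<le> n" using Suc by simp
      have st: "a \<le> ?s" "?s \<le> ?t" "?t \<le> b"
        using \<tau>mono[of 0 k n] \<tau>mono[of k "Suc k" n] \<tau>mono[of "Suc k" "Suc n" n] \<tau>b[of n] Suc.prems by (auto simp: \<tau>_def)
      have gr: "(1 + norm y) * exp (growth_const * (?t - ?s)) \<le> 1 + B" if y: "1 + norm y \<le> (1 + norm (x a)) * exp (growth_const * (?s - a))" for y
      proof -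
        have "(1 + norm y) * exp (growth_const * (?t - ?s)) \<le> ((1 + norm (x a)) * exp (growth_const * (?s - a))) * exp (growth_const * (?t - ?s))"
          using y by (intro mult_right_mono) auto
        also have "\<dots> = (1 + norm (x a)) * exp (growth_const * (?t - a))" by (simp add: exp_add[symmetric] algebra_simps)
        also have "\<dots> \<le> (1 + norm (x a)) * exp (growth_const * (b - a))" using st growth_const_nonneg by (auto intro!: mult_left_mono)
        finally show ?thesis using B1 by simp
      qed
      have g1: "(1 + norm (x ?s)) * exp (growth_const * (?t - ?s)) \<le> 1 + B"
        by (rule gr, rule growth_motion(1)[OF \<mu> _ x]) (use ab st in auto)
      have g2: "(1 + norm (lflow h (m n k) (x a))) * exp (growth_const * (?t - ?s)) \<le> 1 + B"
        using lflow_growth[of "m n k" "x a"] m[of k n] k by (intro gr) auto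
      let ?z = "lflow h (m n k) (x a)"
      have "norm (lflow h (s n k) ?z - lflow h (s n k) (x ?s)) \<le> exp (L * (?t - ?s)) * norm (?z - x ?s)"
        using lflow_lipschitz[OF s(1)[OF k], of ?z B "x ?s"] g1 g2 s(2)[OF k] unfolding L_def by simp
      also have "\<dots> \<le> exp (L * (?t - ?s)) * (exp (L * (?s - a)) * ((?s - a) * c))"
        using Suc unfolding c_def by (intro mult_left_mono) auto
      also have "\<dots> = exp (L * (?t - a)) * ((?s - a) * c)" by (simp add: exp_add[symmetric] algebra_simps)
      finally have 1: "norm (lflow h (s n k) ?z - lflow h (s n k) (x ?s)) \<le> exp (L * (?t - a)) * ((?s - a) * c)" .
      have "norm (lflow h (s n k) (x ?s) - x ?t) \<le> (?t - ?s) * c"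
        using piecewise_step_error[OF \<mu> x ab(1) ab(3) st g1 q \<epsilon>(2) s(1)[OF k] s(2)[OF k] s(3)[OF k]]
        unfolding c_def L_def K_def \<tau>S .
      also have "\<dots> \<le> exp (L * (?t - a)) * ((?t - ?s) * c)"
        using st c LK mult_right_mono[of 1 "exp (L * (?t - a))" "(?t - ?s) * c"] by simp
      finally have 2: "norm (lflow h (s n k) (x ?s) - x ?t) \<le> exp (L * (?t - a)) * ((?t - ?s) * c)" .
      have "norm (lflow h (m n (Suc k)) (x a) - x ?t) \<le> exp (L * (?t - a)) * ((?s - a) * c) + exp (L * (?t - a)) * ((?t - ?s) * c)"
        using norm_triangle_ineq[of "lflow h (s n k) ?z - lflow h (s n k) (x ?s)" "lflow h (s n k) (x ?s) - x ?t"] 1 2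
        by (simp add: mS lflow_append)
      also have "\<dots> = exp (L * (?t - a)) * ((?t - a) * c)" by (simp add: algebra_simps)
      finally show ?case unfolding c_def .
    qed
    show ?thesis
    proof (rule metric_LIMSEQ_I)
      fix e :: real assume e: "0 < e"
      define C where "C = exp (L * (b - a)) * (b - a)"
      have C: "0 \<le> C" using ab by (simp add: C_def)
      \<comment> \<open>Makes \<open>C * \<epsilon>\<close> at most \<open>e / 2\<close>; the
        \<open>+ 1\<close> covers \<open>C = 0\<close>, which occurs for
        \<open>a = b\<close>.\<close>
      define \<epsilon> where "\<epsilon> = e / (2 * (C + 1))"
      have \<epsilon>0: "0 < \<epsilon>" using e C by (simp add: \<epsilon>_def)
      have "uniformly_continuous_on (cball 0 B \<times> Lam) (\<lambda>(x, a). h x a)"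
        by (rule compact_uniformly_continuous) (use cont compact_Lam in \<open>auto intro: continuous_on_subset compact_Times\<close>)
      then obtain d where d: "0 < d" "\<And>p p'. p \<in> cball 0 B \<times> Lam \<Longrightarrow> p' \<in> cball 0 B \<times> Lam \<Longrightarrow> dist p' p < d \<Longrightarrow>
          dist ((\<lambda>(x, a). h x a) p') ((\<lambda>(x, a). h x a) p) < \<epsilon>"
        unfolding uniformly_continuous_on_def using \<epsilon>0 by metis
      have "(\<lambda>n. 1 / real (Suc n)) \<longlonglongrightarrow> 0" using LIMSEQ_inverse_real_of_nat by (simp add: inverse_eq_divide)
      then have "\<forall>\<^sub>F n in sequentially. 1 / real (Suc n) < d" using d(1) by (rule order_tendstoD(2))
      moreover have "(\<lambda>n. C * (2 * (L * K) * \<delta> n)) \<longlonglongrightarrow> 0"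
        using tendsto_mult_right_zero[OF LIMSEQ_inverse_real_of_nat, of "C * (2 * (L * K) * (b - a))"]
        unfolding \<delta>_def divide_inverse by (simp only: mult.assoc)
      then have "\<forall>\<^sub>F n in sequentially. C * (2 * (L * K) * \<delta> n) < e / 2" using e by (intro order_tendstoD(2)) auto
      ultimately have "\<forall>\<^sub>F n in sequentially. dist (lflow h (m n (Suc n)) (x a)) (x b) < e"
      proof eventually_elim
        case (elim n)
        have "norm (h y a - h y (q n a)) \<le> \<epsilon>" if "norm y \<le> B" "a \<in> Lam" for y a
        proof -
          have "dist (y, a) (y, q n a) < d" using qd[OF that(2), of n] elim(1) by (simp add: dist_Pair_Pair dist_commute)
          moreover have "(y, q n a) \<in> cball 0 B \<times> Lam" "(y, a) \<in> cball 0 B \<times> Lam" using that q(3,4) by auto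
          ultimately show ?thesis using d(2)[of "(y, q n a)" "(y, a)"] by (simp add: dist_norm)
        qed
        from err[OF order_refl _ this]
        have "norm (lflow h (m n (Suc n)) (x a) - x b) \<le> C * (\<epsilon> + 2 * (L * K) * \<delta> n)"
          using \<epsilon>0 by (simp add: \<tau>b C_def mult.assoc)
        also have "\<dots> < e"
        proof -
          have "C * \<epsilon> \<le> e / 2" using C e by (simp add: \<epsilon>_def field_simps)
          then show ?thesis using elim(2) by (simp add: algebra_simps)
        qed
        finally show ?case by (simp add: dist_norm)
      qed
      then show "\<exists>no. \<forall>n\<ge>no. dist (lflow h (m n (Suc n)) (x a)) (x b) < e" by (simp add: eventually_sequentially)
    qed
  qed
  show ?thesis
    by (rule exI[of _ "\<lambda>n. m n (Suc n)"]) (use m[OF order_refl] \<tau>b lim in auto)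
qed

text \<open>Taking the closure replaces a compactness theorem for relaxed controls.\<close>

definition reach :: "('x::real_normed_vector \<Rightarrow> 'a \<Rightarrow> 'x) \<Rightarrow> 'a set \<Rightarrow> (real \<times> 'x \<times> 'x) set" where
  "reach h Lam = closure {(duration l, x, lflow h l x) |l x. steps_in Lam l}"

lemma closed_reach: "closed (reach h Lam)"
  by (simp add: reach_def)

lemma reach_sequential:
  "(\<tau>, x, z) \<in> reach h Lam \<longleftrightarrow> (\<exists>l X. (\<forall>n::nat. steps_in Lam (l n)) \<and> (\<lambda>n. duration (l n)) \<longlonglongrightarrow> \<tau> \<and>
     X \<longlonglongrightarrow> x \<and> (\<lambda>n. lflow h (l n) (X n)) \<longlonglongrightarrow> z)"
proof
  assume "(\<tau>, x, z) \<in> reach h Lam"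
  then obtain s where s: "\<And>n. s n \<in> {(duration l, x, lflow h l x) |l x. steps_in Lam l}" "s \<longlonglongrightarrow> (\<tau>, x, z)"
    unfolding reach_def closure_sequential by blast
  from s(1) have "\<exists>l x. s n = (duration l, x, lflow h l x) \<and> steps_in Lam l" for n by blast
  then obtain l X where lX: "\<And>n. s n = (duration (l n), X n, lflow h (l n) (X n))" "\<And>n. steps_in Lam (l n)" by metis
  then show "\<exists>l X. (\<forall>n::nat. steps_in Lam (l n)) \<and> (\<lambda>n. duration (l n)) \<longlonglongrightarrow> \<tau> \<and> X \<longlonglongrightarrow> x \<and> (\<lambda>n. lflow h (l n) (X n)) \<longlonglongrightarrow> z"
    using tendsto_fst[OF s(2)] tendsto_fst[OF tendsto_snd[OF s(2)]] tendsto_snd[OF tendsto_snd[OF s(2)]]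
    by (intro exI[of _ l] exI[of _ X]) auto
next
  assume "\<exists>l X. (\<forall>n::nat. steps_in Lam (l n)) \<and> (\<lambda>n. duration (l n)) \<longlonglongrightarrow> \<tau> \<and> X \<longlonglongrightarrow> x \<and> (\<lambda>n. lflow h (l n) (X n)) \<longlonglongrightarrow> z"
  then obtain l X where "\<forall>n::nat. steps_in Lam (l n)" "(\<lambda>n. duration (l n)) \<longlonglongrightarrow> \<tau>" "X \<longlonglongrightarrow> x" "(\<lambda>n. lflow h (l n) (X n)) \<longlonglongrightarrow> z" by blast
  then show "(\<tau>, x, z) \<in> reach h Lam" unfolding reach_def closure_sequential
    by (intro exI[of _ "\<lambda>n. (duration (l n), X n, lflow h (l n) (X n))"]) (auto intro!: tendsto_Pair)
qed

lemma reach_lflow: "steps_in Lam l \<Longrightarrow> (duration l, x, lflow h l x) \<in> reach h Lam"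
  unfolding reach_def using closure_subset by fastforce

lemma reach_0: "(0, x, x) \<in> reach h Lam"
  using reach_lflow[of Lam "[]" x h] by simp

lemma reach_limit:
  assumes "\<And>n::nat. (\<tau> n, x n, z n) \<in> reach h Lam" "\<tau> \<longlonglongrightarrow> \<tau>'" "x \<longlonglongrightarrow> x'" "z \<longlonglongrightarrow> z'"
  shows "(\<tau>', x', z') \<in> reach h Lam"
  by (rule closed_sequentially[OF closed_reach, of "\<lambda>n. (\<tau> n, x n, z n)"]) (auto intro!: tendsto_Pair assms)

context rhs_system
begin

text \<open>These are closed conditions that hold for compositions of flows, hence on the
  closure.\<close>

lemma reach_move:
  assumes "(\<tau>, x, z) \<in> reach h Lam"
  shows "0 \<le> \<tau>" "norm (z - x) \<le> growth_const * ((1 + norm x) * exp (growth_const * \<tau>)) * \<tau>"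
    "1 + norm z \<le> (1 + norm x) * exp (growth_const * \<tau>)"
proof -
  let ?C = "{(\<tau>, x, z). 0 \<le> \<tau> \<and> norm (z - x) \<le> growth_const * ((1 + norm x) * exp (growth_const * \<tau>)) * \<tau> \<and> 1 + norm z \<le> (1 + norm x) * exp (growth_const * \<tau>)}"
  have "closed ?C" unfolding case_prod_beta
    by (intro closed_Collect_conj closed_Collect_le continuous_intros)
  moreover have "{(duration l, x, lflow h l x) |l x. steps_in Lam l} \<subseteq> ?C"
  proof clarify
    fix l :: "(real \<times> 'a) list" and x :: 'x assume l: "steps_in Lam l"
    show "0 \<le> duration l \<and> norm (lflow h l x - x) \<le> growth_const * ((1 + norm x) * exp (growth_const * duration l)) * duration l \<and>
        1 + norm (lflow h l x) \<le> (1 + norm x) * exp (growth_const * duration l)"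
      using lflow_move[OF l, of x "(1 + norm x) * exp (growth_const * duration l) - 1"] duration_nonneg[OF l] lflow_growth[OF l]
      by simp
  qed
  ultimately have "reach h Lam \<subseteq> ?C" unfolding reach_def by (rule closure_minimal[rotated])
  then show "0 \<le> \<tau>" "norm (z - x) \<le> growth_const * ((1 + norm x) * exp (growth_const * \<tau>)) * \<tau>"
    "1 + norm z \<le> (1 + norm x) * exp (growth_const * \<tau>)" using assms by auto
qed

text \<open>For bounded durations the compositions are uniformly Lipschitz on bounded sets, so
  nearby starting points may be exchanged. This is what makes \<open>reach\<close>
  transitive.\<close>

lemma lflow_stable:
  assumes l: "\<And>n::nat. steps_in Lam (l n)" and d: "(\<lambda>n. duration (l n)) \<longlonglongrightarrow> \<tau>"
    and x: "X \<longlonglongrightarrow> x" and y: "Y \<longlonglongrightarrow> x" and z: "(\<lambda>n. lflow h (l n) (X n)) \<longlonglongrightarrow> z"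
  shows "(\<lambda>n. lflow h (l n) (Y n)) \<longlonglongrightarrow> z"
proof -
  obtain T where T: "\<And>n. norm (duration (l n)) \<le> T" using convergent_imp_Bseq[OF convergentI[OF d]] by (auto simp: Bseq_def)
  obtain R where R: "\<And>n. norm (X n) \<le> R" using convergent_imp_Bseq[OF convergentI[OF x]] by (auto simp: Bseq_def)
  obtain S where S: "\<And>n. norm (Y n) \<le> S" using convergent_imp_Bseq[OF convergentI[OF y]] by (auto simp: Bseq_def)
  define B where "B = (1 + max R S) * exp (growth_const * T) - 1"
  have RS: "norm (X n) \<le> max R S" "norm (Y n) \<le> max R S" for n using R[of n] S[of n] by auto
  have g: "(1 + norm w) * exp (growth_const * duration (l n)) \<le> 1 + B" if "norm w \<le> max R S" for w n
    unfolding B_def using that T[of n] growth_const_nonneg order_trans[OF norm_ge_zero that]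
    by (simp, intro mult_mono) (auto intro!: mult_left_mono)
  have "(\<lambda>n. lflow h (l n) (Y n) - lflow h (l n) (X n)) \<longlonglongrightarrow> 0"
  proof (rule Lim_null_comparison)
    have "norm (lflow h (l n) (Y n) - lflow h (l n) (X n)) \<le> exp (lip_const B * T) * norm (Y n - X n)" for n
    proof -
      have "norm (lflow h (l n) (Y n) - lflow h (l n) (X n)) \<le> exp (lip_const B * duration (l n)) * norm (Y n - X n)"
        by (rule lflow_lipschitz[OF l g g]) (rule RS)+
      also have "\<dots> \<le> exp (lip_const B * T) * norm (Y n - X n)"
        using T[of n] lip_const_nonneg[of B] by (intro mult_right_mono) (auto intro!: mult_left_mono)
      finally show ?thesis .
    qed
    then show "\<forall>\<^sub>F n in sequentially. norm (lflow h (l n) (Y n) - lflow h (l n) (X n)) \<le> exp (lip_const B * T) * norm (Y n - X n)" by simp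
    have "(\<lambda>n. exp (lip_const B * T) * norm (Y n - X n)) \<longlonglongrightarrow> exp (lip_const B * T) * norm (x - x)"
      by (intro tendsto_intros x y)
    then show "(\<lambda>n. exp (lip_const B * T) * norm (Y n - X n)) \<longlonglongrightarrow> 0" by simp
  qed
  from tendsto_add[OF this z] show ?thesis by simp
qed

lemma reach_trans:
  assumes "(\<tau>, x, y) \<in> reach h Lam" "(\<tau>', y, z) \<in> reach h Lam"
  shows "(\<tau> + \<tau>', x, z) \<in> reach h Lam"
proof -
  obtain l X where l: "\<And>n::nat. steps_in Lam (l n)" "(\<lambda>n. duration (l n)) \<longlonglongrightarrow> \<tau>" "X \<longlonglongrightarrow> x" "(\<lambda>n. lflow h (l n) (X n)) \<longlonglongrightarrow> y"
    using assms(1) unfolding reach_sequential by blast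
  obtain l' Y where l': "\<And>n::nat. steps_in Lam (l' n)" "(\<lambda>n. duration (l' n)) \<longlonglongrightarrow> \<tau>'" "Y \<longlonglongrightarrow> y" "(\<lambda>n. lflow h (l' n) (Y n)) \<longlonglongrightarrow> z"
    using assms(2) unfolding reach_sequential by blast
  show ?thesis unfolding reach_sequential
    using lflow_stable[OF l'(1,2,3) l(4) l'(4)] l l' tendsto_add[OF l(2) l'(2)]
    by (intro exI[of _ "\<lambda>n. l n @ l' n"] exI[of _ X]) (auto simp: lflow_append)
qed

lemma motion_reach:
  assumes "\<mu> \<in> relaxed_controls \<theta> Lam" "motion_on Lam h \<mu> a b x" "0 \<le> a" "a \<le> b" "b \<le> \<theta>"
  shows "(b - a, x a, x b) \<in> reach h Lam"
proof -
  obtain l :: "nat \<Rightarrow> _" where l: "\<And>n. steps_in Lam (l n)" "\<And>n. duration (l n) = b - a"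
    "\<And>(h :: 'x \<Rightarrow> 'a \<Rightarrow> 'x) x. regular_rhs h Lam \<Longrightarrow> motion_on Lam h \<mu> a b x \<Longrightarrow> (\<lambda>n. lflow h (l n) (x a)) \<longlonglongrightarrow> x b"
    using relaxed_approximation[OF assms(1) compact_Lam assms(3-5), where ?'x = 'x] by blast
  show ?thesis unfolding reach_sequential
    using l(3)[OF regular assms(2)] l(1,2) by (intro exI[of _ l] exI[of _ "\<lambda>_. x a"]) auto
qed

lemma motion_const:
  assumes a: "a \<in> Lam" and T: "0 \<le> d"
  shows "(d, x, flow (\<lambda>x. h x a) d x) \<in> reach h Lam"
  using reach_lflow[of Lam "[(d, a)]" x h] assms by simp

end

section \<open>Commuting flows\<close>

lemma regular_rhs_compose:
  assumes "regular_rhs h Lam" "continuous_on Lam' \<phi>" "\<phi> ` Lam' \<subseteq> Lam"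
  shows "regular_rhs (\<lambda>x a. h x (\<phi> a)) Lam'"
proof -
  have "continuous_on (UNIV \<times> Lam') (\<lambda>p. (\<lambda>(x, a). h x a) (fst p, \<phi> (snd p)))"
  proof (rule continuous_on_compose2[where g = "\<lambda>(x, a). h x a" and t = "UNIV \<times> Lam" and f = "\<lambda>p. (fst p, \<phi> (snd p))"])
    show "continuous_on (UNIV \<times> Lam) (\<lambda>(x, a). h x a)" using assms(1) by (simp add: regular_rhs_def)
    have "continuous_on (UNIV \<times> Lam') (\<lambda>p :: 'a \<times> 'c. \<phi> (snd p))"
      by (rule continuous_on_compose2[OF assms(2)]) (auto intro!: continuous_intros)
    then show "continuous_on (UNIV \<times> Lam') (\<lambda>p :: 'a \<times> 'c. (fst p, \<phi> (snd p)))"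
      by (intro continuous_intros)
    show "(\<lambda>p :: 'a \<times> 'c. (fst p, \<phi> (snd p))) ` (UNIV \<times> Lam') \<subseteq> UNIV \<times> Lam" using assms(3) by auto
  qed
  then have 1: "continuous_on (UNIV \<times> Lam') (\<lambda>(x, a). h x (\<phi> a))" by (simp add: case_prod_beta)
  have \<phi>: "\<phi> a \<in> Lam" if "a \<in> Lam'" for a using that assms(3) by auto
  show ?thesis unfolding regular_rhs_def
  proof (intro conjI 1 allI)
    fix x0
    obtain r L where "r > 0" "\<forall>x\<in>ball x0 r. \<forall>y\<in>ball x0 r. \<forall>a\<in>Lam. norm (h x a - h y a) \<le> L * dist x y"
      using assms(1) unfolding regular_rhs_def by meson
    then show "\<exists>r>0. \<exists>L. \<forall>x\<in>ball x0 r. \<forall>y\<in>ball x0 r. \<forall>a\<in>Lam'. norm (h x (\<phi> a) - h y (\<phi> a)) \<le> L * dist x y"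
      using \<phi> by blast
  next
    obtain c where "\<forall>x. \<forall>a\<in>Lam. norm (h x a) \<le> c * (1 + norm x)"
      using assms(1) unfolding regular_rhs_def by meson
    then show "\<exists>c. \<forall>x. \<forall>a\<in>Lam'. norm (h x (\<phi> a)) \<le> c * (1 + norm x)" using \<phi> by blast
  qed
qed

lemma regular_rhs_scaleR:
  assumes h: "regular_rhs h Lam" and \<psi>: "continuous_on Lam \<psi>" and Lam: "compact Lam"
  shows "regular_rhs (\<lambda>x a. \<psi> a *\<^sub>R h x a) Lam"
proof -
  have "bounded (\<psi> ` Lam)" by (rule compact_imp_bounded[OF compact_continuous_image[OF \<psi> Lam]])
  then obtain C0 where C0: "\<And>a. a \<in> Lam \<Longrightarrow> \<bar>\<psi> a\<bar> \<le> C0" unfolding bounded_iff real_norm_def by blast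
  define C where "C = max C0 0"
  have C: "\<And>a. a \<in> Lam \<Longrightarrow> \<bar>\<psi> a\<bar> \<le> C" "0 \<le> C" using C0 by (force simp: C_def)+
  have s: "norm (\<psi> a *\<^sub>R z) \<le> C * K" if "a \<in> Lam" "norm z \<le> K" for a K and z :: 'a
    using mult_mono[OF C(1)[OF that(1)] that(2) C(2)] by simp
  have c: "continuous_on (UNIV \<times> Lam) (\<lambda>(x, a). \<psi> a *\<^sub>R h x a)"
    using h unfolding regular_rhs_def case_prod_beta
    by (intro continuous_intros continuous_on_compose2[OF \<psi>]) auto
  show ?thesis unfolding regular_rhs_def
  proof (intro conjI allI c)
    fix x0
    obtain r L where "r > 0" "\<forall>x\<in>ball x0 r. \<forall>y\<in>ball x0 r. \<forall>a\<in>Lam. norm (h x a - h y a) \<le> L * dist x y"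
      using h unfolding regular_rhs_def by meson
    then show "\<exists>r>0. \<exists>L. \<forall>x\<in>ball x0 r. \<forall>y\<in>ball x0 r. \<forall>a\<in>Lam. norm (\<psi> a *\<^sub>R h x a - \<psi> a *\<^sub>R h y a) \<le> L * dist x y"
      using s by (intro exI[of _ r] conjI exI[of _ "C * L"])
        (auto simp: scaleR_diff_right[symmetric] mult.assoc simp del: scaleR_diff_right norm_scaleR)
  next
    obtain c where "\<forall>x. \<forall>a\<in>Lam. norm (h x a) \<le> c * (1 + norm x)"
      using h unfolding regular_rhs_def by meson
    then show "\<exists>c. \<forall>x. \<forall>a\<in>Lam. norm (\<psi> a *\<^sub>R h x a) \<le> c * (1 + norm x)"
      using s by (intro exI[of _ "C * c"]) (auto simp: mult.assoc simp del: norm_scaleR)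
  qed
qed

lemma regular_rhs_add:
  assumes "regular_rhs h Lam" "regular_rhs k Lam"
  shows "regular_rhs (\<lambda>x a. h x a + k x a) Lam"
proof -
  have c: "continuous_on (UNIV \<times> Lam) (\<lambda>(x, a). h x a + k x a)"
    using assms unfolding regular_rhs_def case_prod_beta by (intro continuous_intros) auto
  show ?thesis unfolding regular_rhs_def
  proof (intro conjI allI c)
    fix x0
    obtain r L where r: "r > 0" "\<forall>x\<in>ball x0 r. \<forall>y\<in>ball x0 r. \<forall>a\<in>Lam. norm (h x a - h y a) \<le> L * dist x y"
      using assms(1) unfolding regular_rhs_def by meson
    obtain r' L' where r': "r' > 0" "\<forall>x\<in>ball x0 r'. \<forall>y\<in>ball x0 r'. \<forall>a\<in>Lam. norm (k x a - k y a) \<le> L' * dist x y"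
      using assms(2) unfolding regular_rhs_def by meson
    have "norm ((h x a + k x a) - (h y a + k y a)) \<le> (L + L') * dist x y"
      if "x \<in> ball x0 (min r r')" "y \<in> ball x0 (min r r')" "a \<in> Lam" for x y a
    proof -
      have "norm ((h x a - h y a) + (k x a - k y a)) \<le> L * dist x y + L' * dist x y"
        using r(2) r'(2) that by (intro norm_triangle_le add_mono) auto
      then show ?thesis by (simp add: algebra_simps)
    qed
    then show "\<exists>r>0. \<exists>L. \<forall>x\<in>ball x0 r. \<forall>y\<in>ball x0 r. \<forall>a\<in>Lam. norm (h x a + k x a - (h y a + k y a)) \<le> L * dist x y"
      using r(1) r'(1) by (intro exI[of _ "min r r'"] conjI exI[of _ "L + L'"]) auto
  next
    obtain c c' where "\<forall>x. \<forall>a\<in>Lam. norm (h x a) \<le> c * (1 + norm x)" "\<forall>x. \<forall>a\<in>Lam. norm (k x a) \<le> c' * (1 + norm x)"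
      using assms unfolding regular_rhs_def by meson
    then have "norm (h x a + k x a) \<le> (c + c') * (1 + norm x)" if "a \<in> Lam" for x a
      unfolding distrib_right[of c c'] using that by (intro norm_triangle_le add_mono) auto
    then show "\<exists>c. \<forall>x. \<forall>a\<in>Lam. norm (h x a + k x a) \<le> c * (1 + norm x)" by blast
  qed
qed

text \<open>A cap \<open>m\<close> can be applied before or after the supremum. Used with the value
  of \<open>g\<close>, which does not depend on \<open>v\<close>, in exchanging the order of the
  players.\<close>

lemma SUP_min_const:
  fixes \<alpha> :: "'v \<Rightarrow> real"
  assumes "bdd_above (\<alpha> ` Q)" "Q \<noteq> {}"
  shows "(SUP v\<in>Q. min (\<alpha> v) m) = min (SUP v\<in>Q. \<alpha> v) m"
proof (rule antisym)
  show "(SUP v\<in>Q. min (\<alpha> v) m) \<le> min (SUP v\<in>Q. \<alpha> v) m"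
    using assms by (intro cSUP_least) (auto intro!: cSUP_upper min.coboundedI1)
  have bdd: "bdd_above ((\<lambda>v. min (\<alpha> v) m) ` Q)" by (rule bdd_aboveI[of _ m]) auto
  show "min (SUP v\<in>Q. \<alpha> v) m \<le> (SUP v\<in>Q. min (\<alpha> v) m)"
  proof (rule ccontr)
    assume "\<not> ?thesis"
    then have "(SUP v\<in>Q. min (\<alpha> v) m) < (SUP v\<in>Q. \<alpha> v)" "(SUP v\<in>Q. min (\<alpha> v) m) < m" by auto
    then obtain v where v: "v \<in> Q" "(SUP v\<in>Q. min (\<alpha> v) m) < \<alpha> v" using less_cSUP_iff[OF assms(2,1)] by blast
    have "min (\<alpha> v) m \<le> (SUP v\<in>Q. min (\<alpha> v) m)" by (rule cSUP_upper[OF v(1) bdd])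
    then show False using v \<open>(SUP v\<in>Q. min (\<alpha> v) m) < m\<close> by auto
  qed
qed

section \<open>The combined system\<close>

locale augmented =
  fixes P :: "'u::euclidean_space set" and Q :: "'v::euclidean_space set"
    and \<Omega> :: "'w::euclidean_space set"
    and f :: "'x::euclidean_space \<Rightarrow> 'u \<Rightarrow> 'v \<Rightarrow> 'x" and g :: "'x \<Rightarrow> 'w \<Rightarrow> 'x"
  assumes P: "compact P" "P \<noteq> {}" and Q: "compact Q" "Q \<noteq> {}" and Om: "compact \<Omega>" "\<Omega> \<noteq> {}"
    and f_reg: "regular_rhs (\<lambda>x (u, v). f x u v) (P \<times> Q)" and g_reg: "regular_rhs g \<Omega>"
    and commute: "\<forall>u\<in>P. \<forall>v\<in>Q. \<forall>\<omega>\<in>\<Omega>. \<forall>\<tau>1 \<ge> 0. \<forall>\<tau>2 \<ge> 0.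
        flow (\<lambda>x. f x u v) \<tau>1 \<circ> flow (\<lambda>x. g x \<omega>) \<tau>2 = flow (\<lambda>x. g x \<omega>) \<tau>2 \<circ> flow (\<lambda>x. f x u v) \<tau>1"
begin

abbreviation fs :: "'x \<Rightarrow> real \<times> 'u \<times> 'w \<Rightarrow> 'v \<Rightarrow> 'x" where "fs \<equiv> fstar f g"
abbreviation Ps :: "(real \<times> 'u \<times> 'w) set" where "Ps \<equiv> Pstar P \<Omega>"

lemma Ps: "compact Ps" "Ps \<noteq> {}"
  unfolding Pstar_def using P Om by (auto intro!: compact_Times)

lemma regular_slice:
  assumes "regular_rhs (\<lambda>x (a, v). h x a v) (Lam \<times> Q)" "v \<in> Q"
  shows "regular_rhs (\<lambda>x a. h x a v) Lam"
proof -
  have "continuous_on Lam (\<lambda>a. (a, v))" by (intro continuous_intros)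
  moreover have "(\<lambda>a. (a, v)) ` Lam \<subseteq> Lam \<times> Q" using assms(2) by auto
  ultimately show ?thesis using regular_rhs_compose[OF assms(1), of Lam "\<lambda>a. (a, v)"] by simp
qed

lemma fs_joint: "regular_rhs (\<lambda>x (z, v). fs x z v) (Ps \<times> Q)"
proof -
  have 1: "regular_rhs (\<lambda>x p. (case (fst (snd (fst p)), snd p) of (u, v) \<Rightarrow> f x u v)) (Ps \<times> Q)"
    by (rule regular_rhs_compose[OF f_reg, where \<phi> = "\<lambda>p. (fst (snd (fst p)), snd p)"])
       (auto simp: Pstar_def intro!: continuous_intros)
  have 2: "regular_rhs (\<lambda>x p. g x (snd (snd (fst p)))) (Ps \<times> Q)"
    by (rule regular_rhs_compose[OF g_reg]) (auto simp: Pstar_def intro!: continuous_intros)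
  have "regular_rhs (\<lambda>x p. fst (fst p) *\<^sub>R (case (fst (snd (fst p)), snd p) of (u, v) \<Rightarrow> f x u v)
      + (1 - fst (fst p)) *\<^sub>R g x (snd (snd (fst p)))) (Ps \<times> Q)"
    by (intro regular_rhs_add regular_rhs_scaleR 1 2 compact_Times Ps Q continuous_intros)
  then show ?thesis by (simp add: fstar_def case_prod_unfold)
qed

text \<open>This part and the next keep the full control set \<open>Ps\<close> and vanish for values
  of the other kind. They can therefore be driven by the same relaxed control as the combined
  system, as \<open>motion_parts\<close> requires.\<close>

lemma f_part_regular: "v \<in> Q \<Longrightarrow> regular_rhs (\<lambda>x z. fst z *\<^sub>R f x (fst (snd z)) v) Ps"
  by (intro regular_rhs_scaleR regular_rhs_compose[OF regular_slice[OF f_reg]] Ps)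
     (auto simp: Pstar_def intro!: continuous_intros)

lemma g_part_regular: "regular_rhs (\<lambda>x z. (1 - fst z) *\<^sub>R g x (snd (snd z))) Ps"
  by (intro regular_rhs_scaleR regular_rhs_compose[OF g_reg] Ps)
     (auto simp: Pstar_def intro!: continuous_intros)

lemma F_sys: "v \<in> Q \<Longrightarrow> rhs_system (\<lambda>x u. f x u v) P"
  by unfold_locales (auto intro: P regular_slice[OF f_reg])
lemma G_sys: "rhs_system g \<Omega>"
  by unfold_locales (auto intro: Om g_reg)
lemma S_sys: "v \<in> Q \<Longrightarrow> rhs_system (\<lambda>x z. fs x z v) Ps"
  by unfold_locales (auto intro: Ps regular_slice[OF fs_joint])
lemma Fp_sys: "v \<in> Q \<Longrightarrow> rhs_system (\<lambda>x z. fst z *\<^sub>R f x (fst (snd z)) v) Ps"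
  by unfold_locales (auto intro: Ps f_part_regular)
lemma Gp_sys: "rhs_system (\<lambda>x z. (1 - fst z) *\<^sub>R g x (snd (snd z))) Ps"
  by unfold_locales (auto intro: Ps g_part_regular)

text \<open>The switch takes two values, so the infimum over \<open>Ps\<close> is the minimum of an
  infimum over \<open>P\<close> and one over \<open>\<Omega>\<close>. The latter does not depend on
  \<open>v\<close> and passes through the supremum. The bound \<open>C\<close> keeps all real
  suprema and infima meaningful.\<close>

lemma isaacs_fstar:
  assumes "isaacs f P Q" shows "isaacs fs Ps Q"
  unfolding isaacs_def
proof (intro allI)
  fix s x :: 'x
  obtain c where c: "\<forall>x. \<forall>a\<in>Ps \<times> Q. norm ((\<lambda>(z, v). fs x z v) a) \<le> c * (1 + norm x)"
    using fs_joint unfolding regular_rhs_def by meson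
  define C where "C = norm s * (c * (1 + norm x))"
  have bd: "\<bar>s \<bullet> fs x z v\<bar> \<le> C" if "z \<in> Ps" "v \<in> Q" for z v
  proof -
    have "norm (fs x z v) \<le> c * (1 + norm x)" using c that by fastforce
    then show ?thesis unfolding C_def
      by (meson Cauchy_Schwarz_ineq2 mult_left_mono norm_ge_zero order_trans)
  qed
  obtain u0 w0 where u0: "u0 \<in> P" and w0: "w0 \<in> \<Omega>" using P Om by blast
  have a: "\<bar>s \<bullet> f x u v\<bar> \<le> C" if "u \<in> P" "v \<in> Q" for u v
    using bd[of "(1, u, w0)" v] that w0 by (simp add: fstar_def Pstar_def)
  obtain v0 where v0: "v0 \<in> Q" using Q by blast
  have b: "\<bar>s \<bullet> g x w\<bar> \<le> C" if "w \<in> \<Omega>" for w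
    using bd[of "(0, u0, w)" v0] that u0 v0 by (simp add: fstar_def Pstar_def)
  have split: "(INF z\<in>Ps. F z) = min (INF u\<in>P. A u) (INF w\<in>\<Omega>. B w)"
    if F: "\<And>u w. u \<in> P \<Longrightarrow> w \<in> \<Omega> \<Longrightarrow> F (1, u, w) = A u \<and> F (0, u, w) = B w"
      and "\<And>u. u \<in> P \<Longrightarrow> \<bar>A u\<bar> \<le> C" "\<And>w. w \<in> \<Omega> \<Longrightarrow> \<bar>B w\<bar> \<le> C" for F :: "_ \<Rightarrow> real" and A B
  proof -
    have "F ` Ps = A ` P \<union> B ` \<Omega>"
    proof
      show "F ` Ps \<subseteq> A ` P \<union> B ` \<Omega>" using F by (auto simp: Pstar_def)
      show "A ` P \<union> B ` \<Omega> \<subseteq> F ` Ps" using F u0 w0 unfolding Pstar_def by (force simp: image_iff)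
    qed
    moreover have "bdd_below (A ` P)" "bdd_below (B ` \<Omega>)"
      using that by (auto intro!: bdd_belowI[of _ "- C"]) (force simp: abs_le_iff)+
    ultimately show ?thesis using P Om by (simp add: cInf_union_distrib inf_min)
  qed
  define m where "m = (INF w\<in>\<Omega>. s \<bullet> g x w)"
  have "(INF z\<in>Ps. SUP v\<in>Q. s \<bullet> fs x z v) = min (INF u\<in>P. SUP v\<in>Q. s \<bullet> f x u v) m"
    unfolding m_def
  proof (rule split)
    show "(SUP v\<in>Q. s \<bullet> fs x (1, u, w) v) = (SUP v\<in>Q. s \<bullet> f x u v) \<and> (SUP v\<in>Q. s \<bullet> fs x (0, u, w) v) = s \<bullet> g x w" for u w
      using Q by (simp add: fstar_def)
    show "\<bar>SUP v\<in>Q. s \<bullet> f x u v\<bar> \<le> C" if "u \<in> P" for u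
    proof (rule abs_leI)
      show "(SUP v\<in>Q. s \<bullet> f x u v) \<le> C" using a[OF that] Q by (intro cSUP_least) (auto simp: abs_le_iff)
      have "s \<bullet> f x u v0 \<le> (SUP v\<in>Q. s \<bullet> f x u v)"
        using a[OF that] by (intro cSUP_upper v0 bdd_aboveI2[of _ _ C]) (auto simp: abs_le_iff)
      then show "- (SUP v\<in>Q. s \<bullet> f x u v) \<le> C" using a[OF that v0] by simp
    qed
  qed (rule b)
  also have "(INF u\<in>P. SUP v\<in>Q. s \<bullet> f x u v) = (SUP v\<in>Q. INF u\<in>P. s \<bullet> f x u v)"
    using assms by (simp add: isaacs_def)
  also have "min \<dots> m = (SUP v\<in>Q. min (INF u\<in>P. s \<bullet> f x u v) m)"
  proof (rule SUP_min_const[symmetric])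
    show "bdd_above ((\<lambda>v. INF u\<in>P. s \<bullet> f x u v) ` Q)"
    proof (rule bdd_aboveI2)
      fix v assume v: "v \<in> Q"
      have "(INF u\<in>P. s \<bullet> f x u v) \<le> s \<bullet> f x u0 v"
        using a v by (intro cINF_lower u0 bdd_belowI2[of _ "- C"]) (force simp: abs_le_iff)
      also have "\<dots> \<le> C" using a[OF u0 v] by simp
      finally show "(INF u\<in>P. s \<bullet> f x u v) \<le> C" .
    qed
  qed (rule Q)
  also have "\<dots> = (SUP v\<in>Q. INF z\<in>Ps. s \<bullet> fs x z v)"
    unfolding m_def by (intro SUP_cong refl split[symmetric]) (auto simp: fstar_def a b)
  finally show "(INF z\<in>Ps. SUP v\<in>Q. s \<bullet> fs x z v) = (SUP v\<in>Q. INF z\<in>Ps. s \<bullet> fs x z v)" .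
qed

definition f_steps :: "(real \<times> real \<times> 'u \<times> 'w) list \<Rightarrow> (real \<times> 'u) list" where
  "f_steps l = map (\<lambda>(d, \<nu>, u, w). (d, u)) (filter (\<lambda>(d, \<nu>, u, w). \<nu> = 1) l)"
definition g_steps :: "(real \<times> real \<times> 'u \<times> 'w) list \<Rightarrow> (real \<times> 'w) list" where
  "g_steps l = map (\<lambda>(d, \<nu>, u, w). (d, w)) (filter (\<lambda>(d, \<nu>, u, w). \<nu> = 0) l)"

lemma f_g_steps_simps [simp]:
  "f_steps [] = []" "g_steps [] = []"
  "f_steps ((d, 1, u, w) # l) = (d, u) # f_steps l" "g_steps ((d, 1, u, w) # l) = g_steps l"
  "f_steps ((d, 0, u, w) # l) = f_steps l" "g_steps ((d, 0, u, w) # l) = (d, w) # g_steps l"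
  by (simp_all add: f_steps_def g_steps_def)

lemma steps_in_Ps_induct [consumes 1, case_names Nil f g]:
  assumes "steps_in Ps l" and "R []"
    and "\<And>d u w l. 0 \<le> d \<Longrightarrow> u \<in> P \<Longrightarrow> w \<in> \<Omega> \<Longrightarrow> steps_in Ps l \<Longrightarrow> R l \<Longrightarrow> R ((d, 1, u, w) # l)"
    and "\<And>d u w l. 0 \<le> d \<Longrightarrow> u \<in> P \<Longrightarrow> w \<in> \<Omega> \<Longrightarrow> steps_in Ps l \<Longrightarrow> R l \<Longrightarrow> R ((d, 0, u, w) # l)"
  shows "R l"
  using assms(1)
proof (induction l)
  case (Cons p l)
  obtain d \<nu> u w where p: "p = (d, \<nu>, u, w)" by (cases p) auto
  with Cons.prems have "0 \<le> d" "\<nu> = 0 \<or> \<nu> = 1" "u \<in> P" "w \<in> \<Omega>" "steps_in Ps l" by (auto simp: Pstar_def)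
  then show ?case using Cons.IH assms(3,4) p by blast
qed (rule assms(2))

lemma f_g_steps: "steps_in Ps l \<Longrightarrow> steps_in P (f_steps l) \<and> steps_in \<Omega> (g_steps l) \<and> duration (f_steps l) + duration (g_steps l) = duration l"
  by (induction l rule: steps_in_Ps_induct) auto

lemma commute_flow:
  assumes "u \<in> P" "v \<in> Q" "w \<in> \<Omega>" "0 \<le> d" "0 \<le> e"
  shows "flow (\<lambda>x. f x u v) d (flow (\<lambda>x. g x w) e x) = flow (\<lambda>x. g x w) e (flow (\<lambda>x. f x u v) d x)"
  using commute assms unfolding o_def by (metis (no_types, lifting))

lemma commute_lflow1:
  assumes "u \<in> P" "v \<in> Q" "0 \<le> d" "steps_in \<Omega> k"
  shows "flow (\<lambda>x. f x u v) d (lflow g k x) = lflow g k (flow (\<lambda>x. f x u v) d x)"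
  using assms(4) by (induction k arbitrary: x) (use assms(1-3) in \<open>auto simp: commute_flow\<close>)

lemma commute_lflow:
  assumes "v \<in> Q" "steps_in P l" "steps_in \<Omega> k"
  shows "lflow (\<lambda>x u. f x u v) l (lflow g k x) = lflow g k (lflow (\<lambda>x u. f x u v) l x)"
  using assms(2) by (induction l arbitrary: x) (use assms(1,3) in \<open>auto simp: commute_lflow1\<close>)

lemma fs_1 [simp]: "fs x (1, u, w) v = f x u v" and fs_0 [simp]: "fs x (0, u, w) v = g x w"
  by (auto simp: fstar_def)

text \<open>A leading \<open>g\<close>-piece commutes past the \<open>f\<close>-pieces already moved
  to the front of the tail; the orders within the two groups are kept.\<close>

lemma lflow_fs:
  assumes "v \<in> Q" "steps_in Ps l"
  shows "lflow (\<lambda>x z. fs x z v) l x = lflow g (g_steps l) (lflow (\<lambda>x u. f x u v) (f_steps l) x)"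
  using assms(2)
proof (induction l arbitrary: x rule: steps_in_Ps_induct)
  case (g d u w l)
  have "lflow (\<lambda>x z. fs x z v) ((d, 0, u, w) # l) x = lflow g (g_steps l) (lflow (\<lambda>x u. f x u v) (f_steps l) (lflow g [(d, w)] x))"
    using g by simp
  also have "\<dots> = lflow g (g_steps l) (lflow g [(d, w)] (lflow (\<lambda>x u. f x u v) (f_steps l) x))"
    using g f_g_steps[of l] by (subst commute_lflow[OF assms(1)]) auto
  finally show ?case by simp
qed auto

text \<open>Evaluates the switched-off pieces in \<open>lflow_f_part\<close> and
  \<open>lflow_g_part\<close>.\<close>

lemma flow_zero: "0 \<le> d \<Longrightarrow> flow (\<lambda>x. 0) d x = (x :: 'x)"
proof -
  interpret rhs_system "\<lambda>(x :: 'x) (a :: real). 0 :: 'x" "{0}"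
  proof
    show "regular_rhs (\<lambda>(x :: 'x) (a :: real). 0 :: 'x) {0}"
      unfolding regular_rhs_def by (intro conjI allI exI[of _ 1] exI[of _ 0]) (auto simp: case_prod_unfold)
  qed simp
  show "0 \<le> d \<Longrightarrow> flow (\<lambda>x. 0) d x = x"
    using flow_unique[of 0 x "\<lambda>_. x" d] by (auto simp: is_forward_sol_def)
qed

lemma lflow_f_part:
  assumes "steps_in Ps l"
  shows "lflow (\<lambda>x z. fst z *\<^sub>R f x (fst (snd z)) v) l x = lflow (\<lambda>x u. f x u v) (f_steps l) x"
  using assms by (induction l arbitrary: x rule: steps_in_Ps_induct) (auto simp: flow_zero)

lemma lflow_g_part:
  assumes "steps_in Ps l"
  shows "lflow (\<lambda>x z. (1 - fst z) *\<^sub>R g x (snd (snd z))) l x = lflow g (g_steps l) x"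
  using assms by (induction l arbitrary: x rule: steps_in_Ps_induct) (auto simp: flow_zero)

text \<open>All three motions are limits of compositions along the same piecewise constant controls, for which the
  identity is exact by commutation.\<close>

lemma motion_parts:
  assumes v: "v \<in> Q" and \<mu>: "\<mu> \<in> relaxed_controls \<theta> Ps" and ab: "0 \<le> a" "a \<le> b" "b \<le> \<theta>"
    and x: "motion_on Ps (\<lambda>x z. fs x z v) \<mu> a b x"
    and y: "motion_on Ps (\<lambda>x z. fst z *\<^sub>R f x (fst (snd z)) v) \<mu> a b y" "y a = x a"
    and z: "motion_on Ps (\<lambda>x z. (1 - fst z) *\<^sub>R g x (snd (snd z))) \<mu> a b z" "z a = y b"
  shows "z b = x b"
proof -
  obtain l :: "nat \<Rightarrow> _" where l: "\<And>n. steps_in Ps (l n)" "\<And>n. duration (l n) = b - a"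
    "\<And>(h :: 'x \<Rightarrow> _ \<Rightarrow> 'x) x. regular_rhs h Ps \<Longrightarrow> motion_on Ps h \<mu> a b x \<Longrightarrow> (\<lambda>n. lflow h (l n) (x a)) \<longlonglongrightarrow> x b"
    using relaxed_approximation[OF \<mu> Ps(1) ab, where ?'x = 'x] by blast
  interpret S: rhs_system "\<lambda>x z. fs x z v" Ps by (rule S_sys[OF v])
  interpret Fp: rhs_system "\<lambda>x z. fst z *\<^sub>R f x (fst (snd z)) v" Ps by (rule Fp_sys[OF v])
  interpret Gp: rhs_system "\<lambda>x z. (1 - fst z) *\<^sub>R g x (snd (snd z))" Ps by (rule Gp_sys)
  note lx = l(3)[OF S.regular x] and ly = l(3)[OF Fp.regular y(1)] and lz = l(3)[OF Gp.regular z(1)]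
  have "(\<lambda>n. lflow (\<lambda>x z. (1 - fst z) *\<^sub>R g x (snd (snd z))) (l n) (lflow (\<lambda>x z. fst z *\<^sub>R f x (fst (snd z)) v) (l n) (y a))) \<longlonglongrightarrow> z b"
    by (rule Gp.lflow_stable[OF l(1) _ tendsto_const[of "z a"] _ lz, of "b - a"]) (use l(2) ly z(2) in auto)
  then have "(\<lambda>n. lflow (\<lambda>x z. fs x z v) (l n) (x a)) \<longlonglongrightarrow> z b"
    by (simp add: lflow_fs[OF v l(1)] lflow_f_part[OF l(1)] lflow_g_part[OF l(1)] y(2))
  then show ?thesis using lx by (rule LIMSEQ_unique)
qed

end

section \<open>Concatenation of controls\<close>

lemma set_integral_cong_measure:
  fixes F :: "'a \<Rightarrow> 'x::euclidean_space"
  assumes sets: "sets M = sets N" and A: "A \<in> sets M"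
    and eq: "\<And>B. B \<in> sets M \<Longrightarrow> B \<subseteq> A \<Longrightarrow> emeasure M B = emeasure N B"
  shows "(LINT p : A | M. F p) = (LINT p : A | N. F p)"
proof -
  have A': "A \<in> sets N" using A sets by simp
  have i: "A \<inter> space M = A" "A \<inter> space N = A" using A A' sets.sets_into_space by auto
  have "restrict_space M A = restrict_space N A"
  proof (rule measure_eqI)
    show "sets (restrict_space M A) = sets (restrict_space N A)" by (simp add: sets_restrict_space sets)
    fix B assume "B \<in> sets (restrict_space M A)"
    then have "B \<in> sets M" "B \<subseteq> A" using A i by (auto simp: sets_restrict_space_iff)
    then show "emeasure (restrict_space M A) B = emeasure (restrict_space N A) B"
      using eq A A' i by (simp add: emeasure_restrict_space)
  qed
  then show ?thesis
    using integral_restrict_space[of A M F] integral_restrict_space[of A N F] A A' i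
    by (simp add: set_lebesgue_integral_def)
qed

text \<open>Used to splice motions at time \<open>\<xi>\<close>. The instant \<open>\<xi>\<close>
  goes to the first measure; since single instants are null for relaxed controls, the integrals on
  either side are unaffected.\<close>

definition concat_control :: "real \<Rightarrow> (real \<times> 'a::euclidean_space) measure \<Rightarrow> (real \<times> 'a) measure \<Rightarrow> (real \<times> 'a) measure" where
  "concat_control \<xi> \<mu> \<mu>' = measure_of UNIV (sets borel) (\<lambda>B. emeasure \<mu> (B \<inter> {..\<xi>} \<times> UNIV) + emeasure \<mu>' (B \<inter> {\<xi><..} \<times> UNIV))"

lemma strip_borel:
  "{..\<xi>} \<times> UNIV \<in> sets (borel :: (real \<times> 'a::euclidean_space) measure)"
  "{\<xi><..} \<times> UNIV \<in> sets (borel :: (real \<times> 'a::euclidean_space) measure)"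
  by (intro borel_closed borel_open closed_Times open_Times; simp)+

lemma sets_concat: "sets (concat_control \<xi> \<mu> \<mu>') = sets borel"
  unfolding concat_control_def using sets.sigma_sets_eq[of borel] by (simp add: sets_measure_of_conv)

lemma emeasure_concat:
  fixes \<mu> \<mu>' :: "(real \<times> 'a::euclidean_space) measure"
  assumes s: "sets \<mu> = sets borel" "sets \<mu>' = sets borel" and B: "B \<in> sets borel"
  shows "emeasure (concat_control \<xi> \<mu> \<mu>') B = emeasure \<mu> (B \<inter> {..\<xi>} \<times> UNIV) + emeasure \<mu>' (B \<inter> {\<xi><..} \<times> UNIV)"
  unfolding concat_control_def
proof (rule emeasure_measure_of_sigma[of UNIV "sets borel"
      "\<lambda>B. emeasure \<mu> (B \<inter> {..\<xi>} \<times> UNIV) + emeasure \<mu>' (B \<inter> {\<xi><..} \<times> UNIV)"])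
  show "sigma_algebra UNIV (sets (borel :: (real \<times> 'a) measure))"
    using sets.sigma_algebra_axioms[of "borel :: (real \<times> 'a) measure"] by simp
  show "positive (sets borel) (\<lambda>B. emeasure \<mu> (B \<inter> {..\<xi>} \<times> UNIV) + emeasure \<mu>' (B \<inter> {\<xi><..} \<times> UNIV))"
    by (simp add: positive_def)
  show "countably_additive (sets borel) (\<lambda>B. emeasure \<mu> (B \<inter> {..\<xi>} \<times> UNIV) + emeasure \<mu>' (B \<inter> {\<xi><..} \<times> UNIV))"
  proof (rule countably_additiveI)
    fix A :: "nat \<Rightarrow> (real \<times> 'a) set" assume A: "range A \<subseteq> sets borel" "disjoint_family A"
    have *: "(\<Sum>i. emeasure M (A i \<inter> S)) = emeasure M (\<Union> (range A) \<inter> S)"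
      if "sets M = sets borel" "S \<in> sets borel" for M S
    proof -
      have "(\<Sum>i. emeasure M (A i \<inter> S)) = emeasure M (\<Union>i. A i \<inter> S)"
        by (rule suminf_emeasure) (use A that in \<open>auto simp: disjoint_family_on_def\<close>)
      then show ?thesis by simp
    qed
    show "(\<Sum>i. emeasure \<mu> (A i \<inter> {..\<xi>} \<times> UNIV) + emeasure \<mu>' (A i \<inter> {\<xi><..} \<times> UNIV)) =
        emeasure \<mu> (\<Union> (range A) \<inter> {..\<xi>} \<times> UNIV) + emeasure \<mu>' (\<Union> (range A) \<inter> {\<xi><..} \<times> UNIV)"
      by (subst suminf_add[symmetric]) (simp_all add: *[OF s(1) strip_borel(1)] *[OF s(2) strip_borel(2)])
  qed
qed (rule B)

lemma cylinder_borel: "A \<in> sets borel \<Longrightarrow> A \<times> UNIV \<in> sets (borel :: (real \<times> 'a::euclidean_space) measure)"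
  unfolding borel_prod[symmetric] by (rule pair_measureI) auto

lemma relaxed_emeasure:
  "\<mu> \<in> relaxed_controls \<theta> Lam \<Longrightarrow> A \<in> sets borel \<Longrightarrow> emeasure \<mu> (A \<times> UNIV) = emeasure lborel (A \<inter> {0..\<theta>})"
  by (auto simp: relaxed_controls_def)

lemma concat_relaxed:
  assumes \<mu>: "\<mu> \<in> relaxed_controls \<theta> Lam" "\<mu>' \<in> relaxed_controls \<theta> Lam" and Lam: "closed Lam"
  shows "concat_control \<xi> \<mu> \<mu>' \<in> relaxed_controls \<theta> Lam"
  unfolding relaxed_controls_def
proof (intro CollectI conjI ballI)
  note em = emeasure_concat[OF relaxed_sets[OF \<mu>(1)] relaxed_sets[OF \<mu>(2)]]
  show "sets (concat_control \<xi> \<mu> \<mu>') = sets borel" by (rule sets_concat)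
  let ?N = "- ({0..\<theta>} \<times> Lam)"
  have N: "?N \<in> sets borel" using Lam by (auto intro!: borel_open open_Compl closed_Times)
  have "emeasure M (?N \<inter> S) = 0" if "M \<in> relaxed_controls \<theta> Lam" for M S
    using emeasure_mono[of "?N \<inter> S" ?N M] N that relaxed_sets[OF that] by (simp add: relaxed_controls_def)
  then show "emeasure (concat_control \<xi> \<mu> \<mu>') ?N = 0" using \<mu> by (simp only: em[OF N] add_0)
  fix A :: "real set" assume A: "A \<in> sets borel"
  have "emeasure (concat_control \<xi> \<mu> \<mu>') (A \<times> UNIV) = emeasure \<mu> ((A \<inter> {..\<xi>}) \<times> UNIV) + emeasure \<mu>' ((A \<inter> {\<xi><..}) \<times> UNIV)"
    by (simp only: em[OF cylinder_borel[OF A]] Times_Int_Times Int_UNIV_right)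
  also have "\<dots> = emeasure lborel (A \<inter> {..\<xi>} \<inter> {0..\<theta>}) + emeasure lborel (A \<inter> {\<xi><..} \<inter> {0..\<theta>})"
    using A by (simp add: relaxed_emeasure[OF \<mu>(1)] relaxed_emeasure[OF \<mu>(2)])
  also have "\<dots> = emeasure lborel ((A \<inter> {..\<xi>} \<inter> {0..\<theta>}) \<union> (A \<inter> {\<xi><..} \<inter> {0..\<theta>}))"
    using A by (intro plus_emeasure) auto
  also have "(A \<inter> {..\<xi>} \<inter> {0..\<theta>}) \<union> (A \<inter> {\<xi><..} \<inter> {0..\<theta>}) = A \<inter> {0..\<theta>}" by auto
  finally show "emeasure (concat_control \<xi> \<mu> \<mu>') (A \<times> UNIV) = emeasure lborel (A \<inter> {0..\<theta>})" .
qed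

lemma concat_integral:
  fixes F :: "real \<times> 'a::euclidean_space \<Rightarrow> 'x::euclidean_space"
  assumes \<mu>: "\<mu> \<in> relaxed_controls \<theta> Lam" "\<mu>' \<in> relaxed_controls \<theta> Lam" and Lam: "closed Lam"
  shows "t \<le> \<xi> \<Longrightarrow> (LINT p : {s..t} \<times> Lam | concat_control \<xi> \<mu> \<mu>'. F p) = (LINT p : {s..t} \<times> Lam | \<mu>. F p)"
    and "\<xi> \<le> s \<Longrightarrow> (LINT p : {s..t} \<times> Lam | concat_control \<xi> \<mu> \<mu>'. F p) = (LINT p : {s..t} \<times> Lam | \<mu>'. F p)"
proof -
  note em = emeasure_concat[OF relaxed_sets[OF \<mu>(1)] relaxed_sets[OF \<mu>(2)]]
  have A: "{s..t} \<times> Lam \<in> sets borel" using Lam by (auto intro!: borel_closed closed_Times)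
  have null: "emeasure M (B \<inter> {\<xi>} \<times> UNIV) = 0" if "M \<in> relaxed_controls \<theta> Lam" for M B
  proof -
    have "emeasure M ({\<xi>} \<times> UNIV) = 0"
      using relaxed_emeasure[OF that, of "{\<xi>}"] by (simp add: emeasure_lborel_countable)
    then show ?thesis
      using emeasure_mono[of "B \<inter> {\<xi>} \<times> UNIV" "{\<xi>} \<times> UNIV" M] cylinder_borel[of "{\<xi>}"] relaxed_sets[OF that] by simp
  qed
  show "(LINT p : {s..t} \<times> Lam | concat_control \<xi> \<mu> \<mu>'. F p) = (LINT p : {s..t} \<times> Lam | \<mu>. F p)" if "t \<le> \<xi>"
  proof (rule set_integral_cong_measure)
    fix B assume B: "B \<in> sets (concat_control \<xi> \<mu> \<mu>')" "B \<subseteq> {s..t} \<times> Lam"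
    have "B \<inter> {..\<xi>} \<times> UNIV = B" "B \<inter> {\<xi><..} \<times> UNIV = {}" using B that by auto
    then show "emeasure (concat_control \<xi> \<mu> \<mu>') B = emeasure \<mu> B" using B by (simp add: em sets_concat)
  qed (use A \<mu> in \<open>auto simp: sets_concat relaxed_sets\<close>)
  show "(LINT p : {s..t} \<times> Lam | concat_control \<xi> \<mu> \<mu>'. F p) = (LINT p : {s..t} \<times> Lam | \<mu>'. F p)" if "\<xi> \<le> s"
  proof (rule set_integral_cong_measure)
    fix B assume B: "B \<in> sets (concat_control \<xi> \<mu> \<mu>')" "B \<subseteq> {s..t} \<times> Lam"
    then have B': "B \<in> sets borel" by (simp add: sets_concat)
    have 1: "B \<inter> {..\<xi>} \<times> UNIV = B \<inter> {\<xi>} \<times> UNIV" using B that by auto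
    have 2: "B = (B \<inter> {\<xi>} \<times> UNIV) \<union> (B \<inter> {\<xi><..} \<times> UNIV)" using B that by force
    have "emeasure \<mu>' B = emeasure \<mu>' (B \<inter> {\<xi>} \<times> UNIV) + emeasure \<mu>' (B \<inter> {\<xi><..} \<times> UNIV)"
      using B' cylinder_borel[of "{\<xi>}"] strip_borel(2)[of \<xi>]
      by (subst (1) 2, intro plus_emeasure[symmetric]) (auto simp: relaxed_sets[OF \<mu>(2)])
    then show "emeasure (concat_control \<xi> \<mu> \<mu>') B = emeasure \<mu>' B" using B' null[OF \<mu>(1)] null[OF \<mu>(2)] by (simp add: em 1)
  qed (use A \<mu> in \<open>auto simp: sets_concat relaxed_sets\<close>)
qed

lemma (in rhs_system) motion_concat:
  assumes \<mu>: "\<mu> \<in> relaxed_controls \<theta> Lam" "\<mu>' \<in> relaxed_controls \<theta> Lam"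
    and x: "motion_on Lam h \<mu> 0 \<theta> x" and y: "motion_on Lam h \<mu>' 0 \<theta> y"
    and \<xi>: "\<xi> \<in> {0..\<theta>}" "x \<xi> = y \<xi>"
  shows "motion_on Lam h (concat_control \<xi> \<mu> \<mu>') 0 \<theta> (\<lambda>t. if t \<le> \<xi> then x t else y t)"
    (is "motion_on _ _ _ _ _ ?z")
proof -
  note Lam = Lam_closed
  have cz: "continuous_on {0..\<theta>} ?z"
  proof (rule continuous_on_cases_le)
    show "continuous_on {t \<in> {0..\<theta>}. t \<le> \<xi>} x"
      by (rule continuous_on_subset[OF motion_onD(1)[OF x]]) auto
    show "continuous_on {t \<in> {0..\<theta>}. \<xi> \<le> t} y"
      by (rule continuous_on_subset[OF motion_onD(1)[OF y]]) auto
  qed (use \<xi> in auto)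
  have S: "{s..t} \<times> Lam \<in> sets M" if "sets M = sets borel" for s t :: real and M
    using Lam that by (auto intro!: borel_closed closed_Times)
  have le: "?z t - ?z s = (LINT p : {s..t} \<times> Lam | concat_control \<xi> \<mu> \<mu>'. h (?z (fst p)) (snd p))" if "0 \<le> s" "s \<le> t" "t \<le> \<xi>" for s t
  proof -
    have "(LINT p : {s..t} \<times> Lam | concat_control \<xi> \<mu> \<mu>'. h (?z (fst p)) (snd p)) = (LINT p : {s..t} \<times> Lam | \<mu>. h (?z (fst p)) (snd p))"
      by (rule concat_integral(1)[OF \<mu> Lam that(3)])
    also have "\<dots> = (LINT p : {s..t} \<times> Lam | \<mu>. h (x (fst p)) (snd p))"
      by (rule set_lebesgue_integral_cong) (use that S[OF relaxed_sets[OF \<mu>(1)]] in auto)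
    finally show ?thesis using motion_onD(2)[OF x, of s t] that \<xi> by simp
  qed
  have ge: "?z t - ?z s = (LINT p : {s..t} \<times> Lam | concat_control \<xi> \<mu> \<mu>'. h (?z (fst p)) (snd p))" if "\<xi> \<le> s" "s \<le> t" "t \<le> \<theta>" for s t
  proof -
    have zy: "?z r = y r" if "\<xi> \<le> r" for r using that \<xi>(2) by auto
    have "(LINT p : {s..t} \<times> Lam | concat_control \<xi> \<mu> \<mu>'. h (?z (fst p)) (snd p)) = (LINT p : {s..t} \<times> Lam | \<mu>'. h (?z (fst p)) (snd p))"
      by (rule concat_integral(2)[OF \<mu> Lam that(1)])
    also have "\<dots> = (LINT p : {s..t} \<times> Lam | \<mu>'. h (y (fst p)) (snd p))"
    proof (rule set_lebesgue_integral_cong[OF S[OF relaxed_sets[OF \<mu>(2)]]], intro allI impI)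
      fix p :: "real \<times> 'a" assume "p \<in> {s..t} \<times> Lam"
      then have "?z (fst p) = y (fst p)" using that by (intro zy) auto
      then show "h (?z (fst p)) (snd p) = h (y (fst p)) (snd p)" by simp
    qed
    also have "\<dots> = y t - y s" using motion_onD(2)[OF y, of s t] that \<xi> by simp
    also have "\<dots> = ?z t - ?z s" using zy[of s] zy[of t] that by (simp only: order_trans[OF that(1,2)])
    finally show ?thesis ..
  qed
  show ?thesis unfolding motion_on_def
  proof (intro conjI cz allI impI)
    fix s t :: real assume st: "0 \<le> s" "s \<le> t" "t \<le> \<theta>"
    consider "t \<le> \<xi>" | "\<xi> \<le> s" | "s < \<xi>" "\<xi> < t" by linarith
    then show "?z t - ?z s = (LINT p : {s..t} \<times> Lam | concat_control \<xi> \<mu> \<mu>'. h (?z (fst p)) (snd p))"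
    proof cases
      case 3
      have "continuous_on ({s..t} \<times> Lam) (\<lambda>p. h (?z (fst p)) (snd p))"
        by (rule cont_rhs[OF cont]) (use cz st in \<open>auto intro: continuous_on_subset\<close>)
      note split = relaxed_integral_split[OF concat_relaxed[OF \<mu> Lam] compact_Lam this less_imp_le[OF 3(1)] less_imp_le[OF 3(2)], of \<xi>]
      note l = le[OF st(1) less_imp_le[OF 3(1)] order_refl] and g = ge[OF order_refl less_imp_le[OF 3(2)] st(3)]
      have "A - C = (B - C) + (A - B)" for A B C :: 'x by simp
      then have "?z t - ?z s = (?z \<xi> - ?z s) + (?z t - ?z \<xi>)" .
      also have "\<dots> = (LINT p : {s..t} \<times> Lam | concat_control \<xi> \<mu> \<mu>'. h (?z (fst p)) (snd p))"
        unfolding l g by (rule split[symmetric])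
      finally show ?thesis .
    qed (use le ge st in auto)
  qed
qed

section \<open>Rearrangement of controls\<close>

text \<open>A pair may receive a new time \<open>\<kappa>\<close> that depends on the control value.
  The image is again a relaxed control because \<open>\<kappa>\<close> has the distribution of the
  time coordinate.\<close>

lemma relaxed_push:
  fixes Lam :: "'a::euclidean_space set" and Lam' :: "'b::euclidean_space set"
  assumes \<mu>: "\<mu> \<in> relaxed_controls \<theta> Lam" and Lam: "closed Lam" "closed Lam'"
    and \<kappa>: "\<kappa> \<in> borel_measurable \<mu>" "distr \<mu> borel \<kappa> = distr \<mu> borel fst"
    and \<phi>: "continuous_on UNIV \<phi>" "\<phi> ` Lam \<subseteq> Lam'"
  shows "(\<lambda>p. (\<kappa> p, \<phi> (snd p))) \<in> measurable \<mu> borel"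
    and "distr \<mu> borel (\<lambda>p. (\<kappa> p, \<phi> (snd p))) \<in> relaxed_controls \<theta> Lam'"
proof -
  have "(\<lambda>p :: real \<times> 'a. \<phi> (snd p)) \<in> borel_measurable borel"
    by (intro borel_measurable_continuous_onI continuous_on_compose2[OF \<phi>(1)] continuous_intros) auto
  then have m2: "(\<lambda>p. \<phi> (snd p)) \<in> borel_measurable \<mu>"
    by (simp add: measurable_cong_sets[OF relaxed_sets[OF \<mu>] refl])
  show K: "(\<lambda>p. (\<kappa> p, \<phi> (snd p))) \<in> measurable \<mu> borel"
    by (rule borel_measurable_Pair[OF \<kappa>(1) m2])
  let ?K = "\<lambda>p. (\<kappa> p, \<phi> (snd p))"
  have time: "emeasure \<mu> (?K -` (A \<times> UNIV) \<inter> space \<mu>) = emeasure lborel (A \<inter> {0..\<theta>})" if A: "A \<in> sets borel" for A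
  proof -
    have "emeasure \<mu> (?K -` (A \<times> UNIV) \<inter> space \<mu>) = emeasure \<mu> (\<kappa> -` A \<inter> space \<mu>)" by (simp add: vimage_def)
    also have "\<dots> = emeasure (distr \<mu> borel \<kappa>) A" using A by (simp add: emeasure_distr[OF \<kappa>(1)])
    also have "\<dots> = emeasure (density lborel (indicator {0..\<theta>})) A" by (simp only: \<kappa>(2) relaxed_distr_fst[OF \<mu>])
    also have "\<dots> = emeasure lborel (A \<inter> {0..\<theta>})" using A by (simp add: emeasure_restricted Int_commute)
    finally show ?thesis .
  qed
  show "distr \<mu> borel ?K \<in> relaxed_controls \<theta> Lam'"
    unfolding relaxed_controls_def
  proof (intro CollectI conjI ballI)
    fix A :: "real set" assume A: "A \<in> sets borel"
    show "emeasure (distr \<mu> borel ?K) (A \<times> UNIV) = emeasure lborel (A \<inter> {0..\<theta>})"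
      by (subst emeasure_distr[OF K cylinder_borel[OF A]]) (rule time[OF A])
  next
    have N: "- ({0..\<theta>} \<times> Lam') \<in> sets borel" using Lam by (auto intro!: borel_open open_Compl closed_Times)
    have "AE p in \<mu>. ?K p \<notin> - ({0..\<theta>} \<times> Lam')"
    proof -
      have "emeasure \<mu> (?K -` ((- {0..\<theta>}) \<times> UNIV) \<inter> space \<mu>) = 0"
        using time[of "- {0..\<theta>}"] by (simp add: Compl_disjoint2 del: vimage_Times)
      moreover have "?K -` ((- {0..\<theta>}) \<times> UNIV) \<inter> space \<mu> \<in> sets \<mu>"
        by (rule measurable_sets[OF K cylinder_borel]) simp
      ultimately have "AE p in \<mu>. ?K p \<notin> (- {0..\<theta>}) \<times> UNIV"
        by (intro AE_I'[of "?K -` ((- {0..\<theta>}) \<times> UNIV) \<inter> space \<mu>"]) auto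
      with relaxed_AE[OF \<mu> Lam(1)] show ?thesis
        by eventually_elim (use \<phi>(2) in auto)
    qed
    then have "emeasure \<mu> (?K -` (- ({0..\<theta>} \<times> Lam')) \<inter> space \<mu>) = 0"
      by (subst (asm) AE_iff_measurable[OF measurable_sets[OF K N]]) auto
    then show "emeasure (distr \<mu> borel ?K) (- ({0..\<theta>} \<times> Lam')) = 0"
      by (simp only: emeasure_distr[OF K N])
  qed simp
qed

text \<open>\<open>\<kappa>\<close> assigns to each pair of old time and control value its new time.
  Values in \<open>N\<close> are moved monotonically by \<open>\<tau>\<close>, and no other value
  lands strictly between \<open>\<tau> a\<close> and \<open>\<tau> b\<close>; hence the driving
  integral over new times from \<open>\<tau> s\<close> to \<open>\<tau> t\<close> is the old one
  from \<open>s\<close> to \<open>t\<close> restricted to \<open>N\<close>. Seen in old time,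
  \<open>y\<close> follows the system switched off outside \<open>N\<close>.\<close>

lemma motion_time_change:
  fixes h :: "'x::euclidean_space \<Rightarrow> 'b::euclidean_space \<Rightarrow> 'x" and Lam :: "'a::euclidean_space set"
  assumes \<mu>: "\<mu> \<in> relaxed_controls \<theta> Lam" and Lam: "compact Lam" "compact Lam'"
    and h: "continuous_on (UNIV \<times> Lam') (\<lambda>(x, a). h x a)"
    and ab: "0 \<le> a" "b \<le> \<theta>"
    and \<kappa>: "\<kappa> \<in> borel_measurable \<mu>" "distr \<mu> borel \<kappa> = distr \<mu> borel fst"
    and \<phi>: "continuous_on UNIV \<phi>" "\<phi> ` Lam \<subseteq> Lam'"
    and N: "N \<in> sets borel"
    and \<tau>: "continuous_on {a..b} \<tau>" "\<And>s t. a \<le> s \<Longrightarrow> s \<le> t \<Longrightarrow> t \<le> b \<Longrightarrow> \<tau> s \<le> \<tau> t" "a \<le> \<tau> a" "\<tau> b \<le> b"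
    and on: "\<And>r l. r \<in> {a..b} \<Longrightarrow> l \<in> Lam \<Longrightarrow> l \<in> N \<Longrightarrow> \<kappa> (r, l) = \<tau> r"
    and off: "\<And>r l. r \<in> {a..b} \<Longrightarrow> l \<in> Lam \<Longrightarrow> l \<notin> N \<Longrightarrow> \<kappa> (r, l) \<le> \<tau> a \<or> \<tau> b \<le> \<kappa> (r, l)"
    and out: "\<And>r l. r \<notin> {a..b} \<Longrightarrow> \<kappa> (r, l) = r"
    and y: "motion_on Lam' h (distr \<mu> borel (\<lambda>p. (\<kappa> p, \<phi> (snd p)))) 0 \<theta> y"
  shows "motion_on Lam (\<lambda>x l. indicat_real N l *\<^sub>R h x (\<phi> l)) \<mu> a b (\<lambda>t. y (\<tau> t))"
  unfolding motion_on_def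
proof (intro conjI allI impI)
  let ?K = "\<lambda>p. (\<kappa> p, \<phi> (snd p))"
  note cl = compact_imp_closed[OF Lam(1)] compact_imp_closed[OF Lam(2)]
  note K = relaxed_push(1)[OF \<mu> cl \<kappa> \<phi>] and \<mu>' = relaxed_push(2)[OF \<mu> cl \<kappa> \<phi>]
  have \<tau>in: "\<tau> t \<in> {a..b}" if "t \<in> {a..b}" for t
    using \<tau>(2)[of a t] \<tau>(2)[of t b] \<tau>(3,4) that by auto
  show cy: "continuous_on {a..b} (\<lambda>t. y (\<tau> t))"
    by (rule continuous_on_compose2[OF motion_onD(1)[OF y] \<tau>(1)]) (use \<tau>in ab in force)
  fix s t :: real assume st: "a \<le> s" "s \<le> t" "t \<le> b"
  have le: "\<tau> s \<le> \<tau> t" "a \<le> \<tau> s" "\<tau> t \<le> b" using \<tau>(2)[of s t] \<tau>in[of s] \<tau>in[of t] st by auto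
  let ?A = "{\<tau> s..\<tau> t} \<times> Lam'" and ?B = "{s..t} \<times> Lam"
  have cF: "continuous_on ?A (\<lambda>p. h (y (fst p)) (snd p))"
    by (rule cont_rhs[OF h]) (use motion_onD(1)[OF y] le ab in \<open>auto intro: continuous_on_subset\<close>)
  have mF: "(\<lambda>p. indicat_real ?A p *\<^sub>R h (y (fst p)) (snd p)) \<in> borel_measurable borel"
    using cF cl by (intro borel_measurable_continuous_on_indicator) (auto intro!: borel_closed closed_Times)
  have cG: "continuous_on ?B (\<lambda>p. h (y (\<tau> (fst p))) (\<phi> (snd p)))"
  proof -
    have "continuous_on ?B (\<lambda>p. (\<lambda>(x, a). h x a) (y (\<tau> (fst p)), \<phi> (snd p)))"
    proof (rule continuous_on_compose2[OF h])
      have "continuous_on ?B (\<lambda>p. y (\<tau> (fst p)))"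
        by (rule continuous_on_compose2[OF cy]) (use st in \<open>auto intro!: continuous_intros\<close>)
      moreover have "continuous_on ?B (\<lambda>p. \<phi> (snd p))"
        by (rule continuous_on_compose2[OF \<phi>(1)]) (auto intro!: continuous_intros)
      ultimately show "continuous_on ?B (\<lambda>p. (y (\<tau> (fst p)), \<phi> (snd p)))" by (intro continuous_intros)
    qed (use \<phi>(2) in auto)
    then show ?thesis by simp
  qed
  have mG: "(\<lambda>p. indicat_real ?B p *\<^sub>R indicat_real N (snd p) *\<^sub>R h (y (\<tau> (fst p))) (\<phi> (snd p))) \<in> borel_measurable borel"
  proof -
    have 1: "(\<lambda>p. indicat_real ?B p *\<^sub>R h (y (\<tau> (fst p))) (\<phi> (snd p))) \<in> borel_measurable borel"
      using cG cl by (intro borel_measurable_continuous_on_indicator) (auto intro!: borel_closed closed_Times)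
    have "snd \<in> measurable (borel :: (real \<times> 'a) measure) borel"
      by (intro borel_measurable_continuous_onI continuous_intros)
    then have "(\<lambda>p :: real \<times> 'a. indicat_real N (snd p)) \<in> borel_measurable borel"
      by (rule measurable_compose) (use N in simp)
    from borel_measurable_scaleR[OF this 1] show ?thesis by (simp add: mult.commute)
  qed
  have "y (\<tau> t) - y (\<tau> s) = (LINT p : ?A | distr \<mu> borel ?K. h (y (fst p)) (snd p))"
    by (rule motion_onD(2)[OF y]) (use le ab in auto)
  also have "\<dots> = (LINT p | \<mu>. indicat_real ?A (?K p) *\<^sub>R h (y (fst (?K p))) (snd (?K p)))"
    unfolding set_lebesgue_integral_def by (rule integral_distr[OF K mF])
  also have "\<dots> = (LINT p : ?B | \<mu>. indicat_real N (snd p) *\<^sub>R h (y (\<tau> (fst p))) (\<phi> (snd p)))"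
    unfolding set_lebesgue_integral_def
  proof (rule integral_cong_AE)
    show "(\<lambda>p. indicat_real ?A (?K p) *\<^sub>R h (y (fst (?K p))) (snd (?K p))) \<in> borel_measurable \<mu>"
      by (rule measurable_compose[OF K mF])
    show "(\<lambda>p. indicat_real ?B p *\<^sub>R indicat_real N (snd p) *\<^sub>R h (y (\<tau> (fst p))) (\<phi> (snd p))) \<in> borel_measurable \<mu>"
      using mG by (simp add: measurable_cong_sets[OF relaxed_sets[OF \<mu>] refl])
    \<comment> \<open>\<open>\<tau>\<close> may be constant on whole intervals, so many old times
      can share the value \<open>\<tau> s\<close>. For values in \<open>N\<close> they carry no
      mass, because \<open>\<kappa>\<close> has the same atomless distribution as time.\<close>
    have null: "AE p in \<mu>. \<kappa> p \<noteq> c" for c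
    proof -
      have "AE r in distr \<mu> borel fst. r \<noteq> c"
        using relaxed_time_null[OF \<mu>, of c] by (subst AE_distr_iff[OF relaxed_fst_measurable[OF \<mu>]]) auto
      then have "AE r in distr \<mu> borel \<kappa>. r \<noteq> c" by (simp only: \<kappa>(2))
      then show ?thesis by (subst (asm) AE_distr_iff[OF \<kappa>(1)]) auto
    qed
    show "AE p in \<mu>. indicat_real ?A (?K p) *\<^sub>R h (y (fst (?K p))) (snd (?K p)) =
        indicat_real ?B p *\<^sub>R indicat_real N (snd p) *\<^sub>R h (y (\<tau> (fst p))) (\<phi> (snd p))"
      using relaxed_AE[OF \<mu> cl(1)] null[of "\<tau> s"] null[of "\<tau> t"]
    proof eventually_elim
      case (elim p)
      obtain r l where p: "p = (r, l)" by (cases p)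
      have l: "l \<in> Lam" "\<phi> l \<in> Lam'" using elim(1) \<phi>(2) p by auto
      show ?case
      proof (cases "r \<in> {a..b}")
        case False
        then have "\<kappa> (r, l) = r" by (rule out)
        then show ?thesis using False le st p by (auto simp: indicator_def)
      next
        case r: True
        show ?thesis
        proof (cases "l \<in> N")
          case True
          have k: "\<kappa> (r, l) = \<tau> r" using on r l True by blast
          have "\<tau> r \<in> {\<tau> s..\<tau> t} \<longleftrightarrow> r \<in> {s..t}"
          proof
            assume "\<tau> r \<in> {\<tau> s..\<tau> t}"
            then have "\<tau> s < \<tau> r" "\<tau> r < \<tau> t" using elim(2,3) k p by auto
            then show "r \<in> {s..t}" using \<tau>(2)[of r s] \<tau>(2)[of t r] r st by force
          next
            assume "r \<in> {s..t}"
            then show "\<tau> r \<in> {\<tau> s..\<tau> t}" using \<tau>(2)[of s r] \<tau>(2)[of r t] st by auto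
          qed
          then show ?thesis using k p l True by (simp add: indicator_def)
        next
          case False
          have "\<tau> a \<le> \<tau> s" "\<tau> t \<le> \<tau> b" using \<tau>(2)[of a s] \<tau>(2)[of t b] st by auto
          then have "?K p \<notin> ?A" using off[OF r l(1) False] elim(2,3) p by auto
          then show ?thesis using False p by simp
        qed
      qed
    qed
  qed
  finally show "y (\<tau> t) - y (\<tau> s) = (LINT p : ?B | \<mu>. indicat_real N (snd p) *\<^sub>R h (y (\<tau> (fst p))) (\<phi> (snd p)))" .
qed

lemma motion_on_cong_rhs:
  assumes "\<And>x l. l \<in> Lam \<Longrightarrow> h x l = k x l" "closed Lam" "sets \<mu> = sets borel"
  shows "motion_on Lam h \<mu> a b x \<longleftrightarrow> motion_on Lam k \<mu> a b x"
proof -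
  have "(LINT p : {s..t} \<times> Lam | \<mu>. h (x (fst p)) (snd p)) = (LINT p : {s..t} \<times> Lam | \<mu>. k (x (fst p)) (snd p))" for s t
    by (rule set_lebesgue_integral_cong) (use assms in \<open>auto intro!: borel_closed closed_Times\<close>)
  then show ?thesis by (simp add: motion_on_def)
qed

text \<open>\<open>rearranged_time\<close> is the new time of a control value: within \<open>{a..b}\<close>, the values in \<open>N\<close> are played first and the
  remaining ones afterwards.\<close>

definition occupation :: "(real \<times> 'a) measure \<Rightarrow> 'a set \<Rightarrow> real \<Rightarrow> real \<Rightarrow> real" where
  "occupation \<mu> N a t = measure \<mu> ({a..t} \<times> N)"

definition rearranged_time :: "(real \<times> 'a) measure \<Rightarrow> 'a set \<Rightarrow> real \<Rightarrow> real \<Rightarrow> real \<times> 'a \<Rightarrow> real" where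
  "rearranged_time \<mu> N a b p = (if fst p < a \<or> b < fst p then fst p else
     if snd p \<in> N then a + occupation \<mu> N a (fst p) else a + occupation \<mu> N a b + occupation \<mu> (- N) a (fst p))"

locale rearrangement =
  fixes \<theta> :: real and Lam :: "'a::euclidean_space set" and \<mu> N and a b :: real
  assumes \<mu>: "\<mu> \<in> relaxed_controls \<theta> Lam" and N: "N \<in> sets (borel :: 'a measure)" and ab: "0 \<le> a" "a \<le> b" "b \<le> \<theta>"
begin

sublocale finite_measure \<mu> using \<mu> by (rule relaxed_finite)

lemma rect: "A \<in> sets borel \<Longrightarrow> B \<in> sets borel \<Longrightarrow> A \<times> B \<in> sets \<mu>"
  unfolding relaxed_sets[OF \<mu>] borel_prod[symmetric] by (rule pair_measureI)

lemma measure_cylinder: "A \<in> sets borel \<Longrightarrow> measure \<mu> (A \<times> UNIV) = measure lborel (A \<inter> {0..\<theta>})"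
  unfolding measure_def by (simp add: relaxed_emeasure[OF \<mu>])

lemma occupation_mono: "B \<in> sets borel \<Longrightarrow> s \<le> t \<Longrightarrow> occupation \<mu> B c s \<le> occupation \<mu> B c t"
  unfolding occupation_def by (intro finite_measure_mono rect) auto

lemma occupation_nonneg: "0 \<le> occupation \<mu> B c s"
  by (simp add: occupation_def)

lemma occupation_diff:
  assumes "B \<in> sets borel" "c \<le> s" "s \<le> t"
  shows "occupation \<mu> B c t - occupation \<mu> B c s = measure \<mu> ({s<..t} \<times> B)"
proof -
  have "{c..t} \<times> B = {c..s} \<times> B \<union> {s<..t} \<times> B" using assms by auto
  then have "measure \<mu> ({c..t} \<times> B) = measure \<mu> ({c..s} \<times> B) + measure \<mu> ({s<..t} \<times> B)"
    using assms by (simp only:) (intro finite_measure_Union rect; auto)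
  then show ?thesis by (simp add: occupation_def)
qed

lemma occupation_lipschitz:
  assumes "B \<in> sets borel" "c \<le> s" "s \<le> t"
  shows "occupation \<mu> B c t - occupation \<mu> B c s \<le> t - s"
proof -
  have "measure \<mu> ({s<..t} \<times> B) \<le> measure \<mu> ({s<..t} \<times> UNIV)"
    using assms by (intro finite_measure_mono rect) auto
  also have "\<dots> = measure lborel ({s<..t} \<inter> {0..\<theta>})" by (simp add: measure_cylinder)
  also have "\<dots> \<le> measure lborel {s<..t}"
    by (rule measure_mono_fmeasurable) (use assms in \<open>auto simp: fmeasurable_def\<close>)
  also have "\<dots> = t - s" using assms by simp
  finally show ?thesis using occupation_diff[OF assms] by simp
qed

lemma occupation_continuous: "B \<in> sets borel \<Longrightarrow> continuous_on {c..d} (occupation \<mu> B c)"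
proof (rule lipschitz_on_continuous_on[of 1], rule lipschitz_onI)
  fix s t assume B: "B \<in> sets borel" and st: "s \<in> {c..d}" "t \<in> {c..d}"
  show "dist (occupation \<mu> B c s) (occupation \<mu> B c t) \<le> 1 * dist s t"
    using occupation_lipschitz[OF B, of c s t] occupation_lipschitz[OF B, of c t s] occupation_mono[OF B, of s t c] occupation_mono[OF B, of t s c] st
    by (cases "s \<le> t") (auto simp: dist_real_def abs_if)
qed simp

lemma occupation_start: "B \<in> sets borel \<Longrightarrow> occupation \<mu> B c c = 0"
proof -
  assume "B \<in> sets borel"
  have "measure \<mu> ({c} \<times> B) \<le> measure \<mu> ({c} \<times> UNIV)"
    using \<open>B \<in> sets borel\<close> by (intro finite_measure_mono rect) auto
  also have "\<dots> = measure lborel ({c} \<inter> {0..\<theta>})" by (simp add: measure_cylinder)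
  also have "\<dots> = 0" by (simp add: measure_def emeasure_lborel_countable)
  finally have "occupation \<mu> B c c \<le> 0" by (simp add: occupation_def)
  then show ?thesis using occupation_nonneg[of B c c] by linarith
qed

lemma occupation_total:
  assumes "t \<in> {a..b}" shows "occupation \<mu> N a t + occupation \<mu> (- N) a t = t - a"
proof -
  have "measure \<mu> ({a..t} \<times> N) + measure \<mu> ({a..t} \<times> (- N)) = measure \<mu> ({a..t} \<times> N \<union> {a..t} \<times> (- N))"
    using N by (intro finite_measure_Union[symmetric] rect) auto
  also have "{a..t} \<times> N \<union> {a..t} \<times> (- N) = {a..t} \<times> UNIV" by auto
  also have "measure \<mu> \<dots> = measure lborel ({a..t} \<inter> {0..\<theta>})" by (simp add: measure_cylinder)
  also have "{a..t} \<inter> {0..\<theta>} = {a..t}" using ab assms by auto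
  finally show ?thesis using assms by (simp add: occupation_def)
qed

text \<open>Occupation time is continuous and nondecreasing, so it exceeds \<open>r\<close> exactly
  after the last instant \<open>q\<close> where it is at most \<open>r\<close>; the mass of
  \<open>B\<close> after \<open>q\<close> is the total minus \<open>r\<close>. In other words,
  occupation time is uniformly distributed over the values in \<open>B\<close>. The inner
  \<open>max\<close> handles negative \<open>r\<close>.\<close>

lemma occupation_level:
  assumes B: "B \<in> sets borel"
  shows "{t \<in> {a..b}. r < occupation \<mu> B a t} \<times> B \<in> sets \<mu>"
    and "measure \<mu> ({t \<in> {a..b}. r < occupation \<mu> B a t} \<times> B) = max 0 (occupation \<mu> B a b - max 0 r)"
proof -
  have "{t \<in> {a..b}. r < occupation \<mu> B a t} \<times> B \<in> sets \<mu> \<and>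
      measure \<mu> ({t \<in> {a..b}. r < occupation \<mu> B a t} \<times> B) = max 0 (occupation \<mu> B a b - max 0 r)"
  proof -
    consider "r < 0" | "0 \<le> r" "occupation \<mu> B a b \<le> r" | "0 \<le> r" "r < occupation \<mu> B a b" by linarith
    then show ?thesis
    proof cases
      case 1
      then have "{t \<in> {a..b}. r < occupation \<mu> B a t} = {a..b}" using occupation_nonneg[of B a] by (auto intro: less_le_trans)
      then show ?thesis using 1 B occupation_nonneg[of B a b] by (simp add: rect occupation_def)
    next
      case 2
      then have e: "{t \<in> {a..b}. r < occupation \<mu> B a t} = {}" using occupation_mono[OF B, of _ b a] by fastforce
      show ?thesis unfolding e using 2 by simp
    next
      case 3
      define T where "T = {t \<in> {a..b}. occupation \<mu> B a t \<le> r}"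
      have "closed T" unfolding T_def
        by (rule continuous_on_closed_Collect_le) (auto intro!: occupation_continuous B continuous_intros)
      then have "compact ({a..b} \<inter> T)" by (intro compact_Int_closed) auto
      moreover have "{a..b} \<inter> T = T" by (auto simp: T_def)
      ultimately have "compact T" by simp
      moreover have "a \<in> T" using ab 3 occupation_start[OF B, of a] by (auto simp: T_def)
      ultimately obtain q where q: "q \<in> T" "\<And>t. t \<in> T \<Longrightarrow> t \<le> q"
        using compact_attains_sup[of T] by blast
      then have q': "q \<in> {a..b}" "occupation \<mu> B a q \<le> r" by (auto simp: T_def)
      obtain s where s: "q \<le> s" "s \<le> b" "occupation \<mu> B a s = r"
        using IVT'[of "occupation \<mu> B a" q r b] q' 3 continuous_on_subset[OF occupation_continuous[OF B, of a b], of "{q..b}"] by auto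
      have "s \<in> T" using s q' by (auto simp: T_def)
      then have qr: "occupation \<mu> B a q = r" using q(2) s by force
      have eq: "{t \<in> {a..b}. r < occupation \<mu> B a t} = {q<..b}"
      proof
        show "{t \<in> {a..b}. r < occupation \<mu> B a t} \<subseteq> {q<..b}"
        proof
          fix t assume t: "t \<in> {t \<in> {a..b}. r < occupation \<mu> B a t}"
          show "t \<in> {q<..b}" using t occupation_mono[OF B, of t q a] qr by (cases "t \<le> q") auto
        qed
        show "{q<..b} \<subseteq> {t \<in> {a..b}. r < occupation \<mu> B a t}"
        proof
          fix t assume t: "t \<in> {q<..b}"
          then have "t \<notin> T" using q(2)[of t] by auto
          then show "t \<in> {t \<in> {a..b}. r < occupation \<mu> B a t}" using t q' by (auto simp: T_def)
        qed
      qed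
      show ?thesis unfolding eq using occupation_diff[OF B, of a q b] q' qr 3 B by (auto simp: rect)
    qed
  qed
  then show "{t \<in> {a..b}. r < occupation \<mu> B a t} \<times> B \<in> sets \<mu>"
    "measure \<mu> ({t \<in> {a..b}. r < occupation \<mu> B a t} \<times> B) = max 0 (occupation \<mu> B a b - max 0 r)" by auto
qed

lemma rearranged_time_measurable: "rearranged_time \<mu> N a b \<in> borel_measurable \<mu>"
proof -
  have fst: "fst \<in> measurable \<mu> borel" by (rule relaxed_fst_measurable[OF \<mu>])
  have mono: "occupation \<mu> B a \<in> borel_measurable borel" if "B \<in> sets borel" for B
    by (rule borel_measurable_mono) (use occupation_mono[OF that] in \<open>auto simp: mono_def\<close>)
  have 1: "{p \<in> space \<mu>. fst p < a \<or> b < fst p} \<in> sets \<mu>"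
  proof -
    have "{p \<in> space \<mu>. fst p < a \<or> b < fst p} = fst -` ({..<a} \<union> {b<..}) \<inter> space \<mu>" by auto
    also have "\<dots> \<in> sets \<mu>" by (rule measurable_sets[OF fst]) auto
    finally show ?thesis .
  qed
  have 2: "{p \<in> space \<mu>. snd p \<in> N} \<in> sets \<mu>"
  proof -
    have "{p \<in> space \<mu>. snd p \<in> N} = UNIV \<times> N" using relaxed_space[OF \<mu>] by auto
    then show ?thesis using rect[of UNIV N] N by simp
  qed
  have m: "(\<lambda>p. occupation \<mu> B a (fst p)) \<in> borel_measurable \<mu>" if "B \<in> sets borel" for B
    by (rule measurable_compose[OF fst mono[OF that]])
  have "(\<lambda>p. if fst p < a \<or> b < fst p then fst p else
     if snd p \<in> N then a + occupation \<mu> N a (fst p) else a + occupation \<mu> N a b + occupation \<mu> (- N) a (fst p)) \<in> borel_measurable \<mu>"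
    by (intro measurable_If borel_measurable_add m fst 1 2) (use N in auto)
  then show ?thesis by (simp add: rearranged_time_def[abs_def])
qed

text \<open>Compared on half-lines: outside \<open>{a..b}\<close> times are unchanged; inside,
  \<open>occupation_level\<close> gives the masses of the two groups. They add up to the length of
  the part of \<open>{a..b}\<close> above \<open>x\<close>, because the two occupation totals sum to
  \<open>b - a\<close>.\<close>

lemma rearranged_time_distr: "distr \<mu> borel (rearranged_time \<mu> N a b) = distr \<mu> borel fst"
proof (rule measure_eqI_lessThan)
  note fst = relaxed_fst_measurable[OF \<mu>]
  fix x :: real
  have N': "- N \<in> sets borel" using N by auto
  let ?o1 = "occupation \<mu> N a" and ?o0 = "occupation \<mu> (- N) a"
  define A where "A = ({x<..} - {a..b}) \<times> (UNIV :: 'a set)"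
  define A1 where "A1 = {t \<in> {a..b}. x - a < ?o1 t} \<times> N"
  define A0 where "A0 = {t \<in> {a..b}. x - a - ?o1 b < ?o0 t} \<times> (- N)"
  have s: "A \<in> sets \<mu>" "A1 \<in> sets \<mu>" "A0 \<in> sets \<mu>"
    unfolding A_def A1_def A0_def using occupation_level(1)[OF N] occupation_level(1)[OF N'] by (auto intro!: rect)
  have "rearranged_time \<mu> N a b -` {x<..} \<inter> space \<mu> = (A \<union> A1) \<union> A0"
    using relaxed_space[OF \<mu>] unfolding A_def A1_def A0_def rearranged_time_def
    by (auto simp: algebra_simps split: if_splits)
  moreover have "(A \<union> A1) \<inter> A0 = {}" "A \<inter> A1 = {}" unfolding A_def A1_def A0_def by auto
  ultimately have 1: "measure \<mu> (rearranged_time \<mu> N a b -` {x<..} \<inter> space \<mu>) = measure \<mu> A + measure \<mu> A1 + measure \<mu> A0"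
    using s by (simp add: finite_measure_Union)
  have "fst -` {x<..} \<inter> space \<mu> = A \<union> ({x<..} \<inter> {a..b}) \<times> UNIV"
    using relaxed_space[OF \<mu>] unfolding A_def by auto
  moreover have "A \<inter> ({x<..} \<inter> {a..b}) \<times> UNIV = {}" unfolding A_def by auto
  ultimately have 2: "measure \<mu> (fst -` {x<..} \<inter> space \<mu>) = measure \<mu> A + measure \<mu> (({x<..} \<inter> {a..b}) \<times> UNIV)"
    using s by (simp add: finite_measure_Union rect)
  have "measure \<mu> (({x<..} \<inter> {a..b}) \<times> UNIV) = measure lborel (({x<..} \<inter> {a..b}) \<inter> {0..\<theta>})"
    by (simp add: measure_cylinder)
  also have "\<dots> = max 0 (b - max a x)"
  proof -
    consider "x < a" | "a \<le> x" "x \<le> b" | "b < x" by linarith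
    then show ?thesis
    proof cases
      case 1
      then have "({x<..} \<inter> {a..b}) \<inter> {0..\<theta>} = {a..b}" using ab by auto
      then show ?thesis using 1 ab by simp
    next
      case 2
      then have "({x<..} \<inter> {a..b}) \<inter> {0..\<theta>} = {x<..b}" using ab by auto
      then show ?thesis using 2 ab by simp
    next
      case 3
      then have e: "({x<..} \<inter> {a..b}) \<inter> {0..\<theta>} = {}" using ab by auto
      show ?thesis unfolding e using 3 ab by simp
    qed
  qed
  finally have 3: "measure \<mu> (({x<..} \<inter> {a..b}) \<times> UNIV) = max 0 (b - max a x)" .
  have "measure \<mu> A1 + measure \<mu> A0 = max 0 (b - max a x)"
    unfolding A1_def A0_def occupation_level(2)[OF N] occupation_level(2)[OF N']
    using occupation_total[of b] ab occupation_nonneg[of N a b] occupation_nonneg[of "- N" a b] by (auto simp: max_def)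
  with 1 2 3 have "measure \<mu> (rearranged_time \<mu> N a b -` {x<..} \<inter> space \<mu>) = measure \<mu> (fst -` {x<..} \<inter> space \<mu>)" by simp
  then show "emeasure (distr \<mu> borel (rearranged_time \<mu> N a b)) {x<..} = emeasure (distr \<mu> borel fst) {x<..}"
    by (simp add: emeasure_distr[OF rearranged_time_measurable] emeasure_distr[OF fst] emeasure_eq_measure)
  show "emeasure (distr \<mu> borel (rearranged_time \<mu> N a b)) {x<..} < \<infinity>"
    by (simp add: emeasure_distr[OF rearranged_time_measurable] emeasure_eq_measure)
qed auto

end

section \<open>Program absorption operators\<close>

lemma (in rhs_system) motion_unique:
  assumes \<mu>: "\<mu> \<in> relaxed_controls \<theta> Lam" and x: "motion_on Lam h \<mu> 0 \<theta> x" and y: "motion_on Lam h \<mu> 0 \<theta> y"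
    and eq: "x 0 = y 0" and t: "t \<in> {0..\<theta>}"
  shows "x t = y t"
proof -
  define R where "R = (1 + norm (x 0)) * exp (growth_const * \<theta>)"
  have bd: "norm (w r) \<le> R" if "motion_on Lam h \<mu> 0 \<theta> w" "w 0 = x 0" "r \<in> {0..\<theta>}" for w r
  proof -
    have "1 + norm (w r) \<le> (1 + norm (w 0)) * exp (growth_const * (r - 0))"
      by (rule growth_motion(1)[OF \<mu> _ that(1)]) (use that in auto)
    also have "\<dots> \<le> R" unfolding R_def using that growth_const_nonneg by (auto intro!: mult_left_mono)
    finally show ?thesis by simp
  qed
  have "norm (x t - y t) \<le> norm (x 0 - y 0) * exp (lip_const R * (t - 0))"
    by (rule lipschitz_motion(1)[OF \<mu> _ _ _ x y]) (use bd[OF x] bd[OF y] eq t in auto)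
  then show ?thesis using eq by simp
qed

text \<open>The case of \<open>motion_time_change\<close> with time left alone and only control
  values relabelled; the motion of the image control coincides with \<open>x\<close> by
  uniqueness.\<close>

lemma (in rhs_system) motion_push:
  fixes Lam' :: "'b::euclidean_space set"
  assumes \<mu>: "\<mu> \<in> relaxed_controls \<theta> Lam'" and Lam': "compact Lam'"
    and \<phi>: "continuous_on UNIV \<phi>" "\<phi> ` Lam' \<subseteq> Lam" and \<theta>: "0 \<le> \<theta>"
    and k: "regular_rhs k Lam'" "\<And>x l. l \<in> Lam' \<Longrightarrow> k x l = h x (\<phi> l)" and x: "motion_on Lam' k \<mu> 0 \<theta> x"
  shows "\<exists>\<mu>'\<in>relaxed_controls \<theta> Lam. \<exists>y. motion_on Lam h \<mu>' 0 \<theta> y \<and> (\<forall>t\<in>{0..\<theta>}. y t = x t)"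
proof -
  interpret K: rhs_system k Lam' using Lam' k(1) by unfold_locales
  note fst = relaxed_fst_measurable[OF \<mu>]
  let ?\<mu>' = "distr \<mu> borel (\<lambda>p. (fst p, \<phi> (snd p)))"
  have \<mu>': "?\<mu>' \<in> relaxed_controls \<theta> Lam"
    by (rule relaxed_push(2)[OF \<mu> K.Lam_closed Lam_closed fst refl \<phi>])
  obtain y where y: "y 0 = x 0" "motion_on Lam h ?\<mu>' 0 \<theta> y" using motion_exists[OF \<mu>', of 0 "x 0"] \<theta> by auto
  have "motion_on Lam' (\<lambda>x l. indicat_real UNIV l *\<^sub>R h x (\<phi> l)) \<mu> 0 \<theta> (\<lambda>t. y ((\<lambda>t. t) t))"
    by (rule motion_time_change[OF \<mu> Lam' compact_Lam cont order_refl order_refl fst refl \<phi> _ _ _ _ _ _ _ _ y(2)]) (auto intro!: continuous_intros)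
  then have "motion_on Lam' k \<mu> 0 \<theta> y"
    by (subst motion_on_cong_rhs[where k = "\<lambda>x l. indicat_real UNIV l *\<^sub>R h x (\<phi> l)"])
       (auto simp: k(2) K.Lam_closed relaxed_sets[OF \<mu>])
  then have "\<forall>t\<in>{0..\<theta>}. y t = x t"
    using K.motion_unique[where x = y and y = x, OF \<mu> _ x y(1)] by blast
  with \<mu>' y show ?thesis by blast
qed

context augmented
begin

lemma embed_f:
  assumes v: "v \<in> Q" and \<theta>: "0 \<le> \<theta>" and \<mu>: "\<mu> \<in> relaxed_controls \<theta> P" and x: "motion_on P (\<lambda>x u. f x u v) \<mu> 0 \<theta> x"
  shows "\<exists>\<mu>'\<in>relaxed_controls \<theta> Ps. \<exists>y. motion_on Ps (\<lambda>x z. fs x z v) \<mu>' 0 \<theta> y \<and> (\<forall>t\<in>{0..\<theta>}. y t = x t)"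
proof -
  interpret S: rhs_system "\<lambda>x z. fs x z v" Ps by (rule S_sys[OF v])
  interpret F: rhs_system "\<lambda>x u. f x u v" P by (rule F_sys[OF v])
  obtain w0 where "w0 \<in> \<Omega>" using Om by blast
  then show ?thesis
    by (intro S.motion_push[OF \<mu> P(1) _ _ \<theta> F.regular _ x, where \<phi> = "\<lambda>u. (1, u, w0)"])
       (auto intro!: continuous_intros simp: Pstar_def)
qed

lemma embed_g:
  assumes v: "v \<in> Q" and \<theta>: "0 \<le> \<theta>" and \<mu>: "\<mu> \<in> relaxed_controls \<theta> \<Omega>" and x: "motion_on \<Omega> g \<mu> 0 \<theta> x"
  shows "\<exists>\<mu>'\<in>relaxed_controls \<theta> Ps. \<exists>y. motion_on Ps (\<lambda>x z. fs x z v) \<mu>' 0 \<theta> y \<and> (\<forall>t\<in>{0..\<theta>}. y t = x t)"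
proof -
  interpret S: rhs_system "\<lambda>x z. fs x z v" Ps by (rule S_sys[OF v])
  obtain u0 where "u0 \<in> P" using P by blast
  then show ?thesis
    by (intro S.motion_push[OF \<mu> Om(1) _ _ \<theta> g_reg _ x, where \<phi> = "\<lambda>w. (0, u0, w)"])
       (auto intro!: continuous_intros simp: Pstar_def)
qed

text \<open>\<open>\<sigma> t\<close> is the time spent on \<open>f\<close>-values up to
  \<open>t\<close>. The motion \<open>y\<close> plays all \<open>f\<close>-values first, so at time
  \<open>t0 + \<sigma> t\<close> it has used those up to \<open>t\<close>. The
  \<open>g\<close>-values up to \<open>t\<close> fill the remaining times from
  \<open>t0 + \<sigma> t\<close> to \<open>t\<close>, and by \<open>motion_parts\<close> they lead
  to \<open>X t\<close>. So \<open>s\<close> corresponds to \<open>t\<close> through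
  \<open>s = t0 + \<sigma> t\<close>, and \<open>S\<close> belongs to
  \<open>t = \<theta>\<close>.\<close>

lemma motion_rearrange:
  assumes v: "v \<in> Q" and \<mu>: "\<mu> \<in> relaxed_controls \<theta> Ps" and t0: "t0 \<in> {0..\<theta>}"
    and X: "motion_on Ps (\<lambda>x z. fs x z v) \<mu> 0 \<theta> X"
  shows "\<exists>S\<in>{t0..\<theta>}. \<exists>\<mu>f\<in>relaxed_controls \<theta> P. \<exists>y. motion_on P (\<lambda>x u. f x u v) \<mu>f 0 \<theta> y \<and> y t0 = X t0 \<and>
    (\<forall>s\<in>{t0..S}. \<exists>t\<in>{s..\<theta>}. (s = S \<longrightarrow> t = \<theta>) \<and>
      (\<exists>\<mu>g\<in>relaxed_controls \<theta> \<Omega>. \<exists>z. motion_on \<Omega> g \<mu>g 0 \<theta> z \<and> z s = y s \<and> z t = X t))"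
proof -
  interpret F: rhs_system "\<lambda>x u. f x u v" P by (rule F_sys[OF v])
  interpret G: rhs_system g \<Omega> by (rule G_sys)
  define N :: "(real \<times> 'u \<times> 'w) set" where "N = {z. fst z = 1}"
  have "closed N" unfolding N_def by (intro closed_Collect_eq continuous_intros)
  then have N: "N \<in> sets borel" by simp
  then have N': "- N \<in> sets borel" by auto
  interpret R: rearrangement \<theta> Ps \<mu> N t0 \<theta> using \<mu> N t0 by unfold_locales auto
  define \<sigma> where "\<sigma> = occupation \<mu> N t0"
  define \<sigma>' where "\<sigma>' = occupation \<mu> (- N) t0"
  have \<sigma>_mono: "s \<le> t \<Longrightarrow> \<sigma> s \<le> \<sigma> t" and \<sigma>'_mono: "s \<le> t \<Longrightarrow> \<sigma>' s \<le> \<sigma>' t" for s t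
    unfolding \<sigma>_def \<sigma>'_def using R.occupation_mono N N' by auto
  have \<sigma>_pos: "0 \<le> \<sigma> t" "0 \<le> \<sigma>' t" for t unfolding \<sigma>_def \<sigma>'_def by (rule R.occupation_nonneg)+
  have total: "\<sigma> t + \<sigma>' t = t - t0" if "t \<in> {t0..\<theta>}" for t unfolding \<sigma>_def \<sigma>'_def by (rule R.occupation_total[OF that])
  have \<sigma>0: "\<sigma> t0 = 0" "\<sigma>' t0 = 0" unfolding \<sigma>_def \<sigma>'_def using N N' by (auto intro: R.occupation_start)
  have \<sigma>_cont: "continuous_on {t0..t} \<sigma>" "continuous_on {t0..t} \<sigma>'" for t
    unfolding \<sigma>_def \<sigma>'_def using N N' by (auto intro: R.occupation_continuous)
  have \<phi>f: "continuous_on UNIV (\<lambda>z :: real \<times> 'u \<times> 'w. fst (snd z))" "(\<lambda>z. fst (snd z)) ` Ps \<subseteq> P"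
    by (auto intro!: continuous_intros simp: Pstar_def)
  have \<phi>g: "continuous_on UNIV (\<lambda>z :: real \<times> 'u \<times> 'w. snd (snd z))" "(\<lambda>z. snd (snd z)) ` Ps \<subseteq> \<Omega>"
    by (auto intro!: continuous_intros simp: Pstar_def)
  note cl = compact_imp_closed[OF Ps(1)]
  let ?\<mu>f = "distr \<mu> borel (\<lambda>p. (rearranged_time \<mu> N t0 \<theta> p, fst (snd (snd p))))"
  have \<mu>f: "?\<mu>f \<in> relaxed_controls \<theta> P"
    by (rule relaxed_push(2)[OF \<mu> cl F.Lam_closed R.rearranged_time_measurable R.rearranged_time_distr \<phi>f])
  obtain y where y0: "y t0 = X t0" and y: "motion_on P (\<lambda>x u. f x u v) ?\<mu>f 0 \<theta> y"
    using F.motion_exists[OF \<mu>f t0, of "X t0"] by blast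
  have "motion_on Ps (\<lambda>x l. indicat_real N l *\<^sub>R f x (fst (snd l)) v) \<mu> t0 \<theta> (\<lambda>t. y ((\<lambda>t. t0 + \<sigma> t) t))"
  proof (rule motion_time_change[OF \<mu> Ps(1) P(1) F.cont _ order_refl R.rearranged_time_measurable R.rearranged_time_distr \<phi>f N _ _ _ _ _ _ _ y])
    show "continuous_on {t0..\<theta>} (\<lambda>t. t0 + \<sigma> t)" by (intro continuous_intros \<sigma>_cont)
    show "t0 + \<sigma> \<theta> \<le> \<theta>" using total[of \<theta>] \<sigma>_pos(2)[of \<theta>] t0 by auto
    show "rearranged_time \<mu> N t0 \<theta> (r, l) \<le> t0 + \<sigma> t0 \<or> t0 + \<sigma> \<theta> \<le> rearranged_time \<mu> N t0 \<theta> (r, l)"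
      if "r \<in> {t0..\<theta>}" "l \<notin> N" for r l
      using that \<sigma>_pos by (auto simp: rearranged_time_def \<sigma>_def \<sigma>'_def)
  qed (use t0 \<sigma>_mono \<sigma>0 in \<open>auto simp: rearranged_time_def \<sigma>_def\<close>)
  then have "motion_on Ps (\<lambda>x z. fst z *\<^sub>R f x (fst (snd z)) v) \<mu> t0 \<theta> (\<lambda>t. y (t0 + \<sigma> t))"
    by (subst motion_on_cong_rhs[where k = "\<lambda>x l. indicat_real N l *\<^sub>R f x (fst (snd l)) v"])
       (auto simp: cl[unfolded Pstar_def] relaxed_sets[OF \<mu>] N_def indicator_def Pstar_def)
  note y' = this
  \<comment> \<open>For each \<open>t\<close> only the interval up to \<open>t\<close> is
    rearranged. Its \<open>f\<close>-values receive the same new times as in the rearrangement up to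
    \<open>\<theta>\<close>, so the one motion \<open>y\<close> serves every
    \<open>t\<close>.\<close>
  have main: "\<exists>\<mu>g\<in>relaxed_controls \<theta> \<Omega>. \<exists>z. motion_on \<Omega> g \<mu>g 0 \<theta> z \<and> z (t0 + \<sigma> t) = y (t0 + \<sigma> t) \<and> z t = X t"
    if t: "t \<in> {t0..\<theta>}" for t
  proof -
    interpret R2: rearrangement \<theta> Ps \<mu> N t0 t using \<mu> N t0 t by unfold_locales auto
    let ?\<mu>g = "distr \<mu> borel (\<lambda>p. (rearranged_time \<mu> N t0 t p, snd (snd (snd p))))"
    have \<mu>g: "?\<mu>g \<in> relaxed_controls \<theta> \<Omega>"
      by (rule relaxed_push(2)[OF \<mu> cl G.Lam_closed R2.rearranged_time_measurable R2.rearranged_time_distr \<phi>g])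
    have "t0 + \<sigma> t \<in> {0..\<theta>}" using total[OF t] \<sigma>_pos[of t] t t0 by auto
    then obtain z where z0: "z (t0 + \<sigma> t) = y (t0 + \<sigma> t)" and z: "motion_on \<Omega> g ?\<mu>g 0 \<theta> z"
      using G.motion_exists[OF \<mu>g] by blast
    have "motion_on Ps (\<lambda>x l. indicat_real (- N) l *\<^sub>R g x (snd (snd l))) \<mu> t0 t (\<lambda>r. z ((\<lambda>r. t0 + \<sigma> t + \<sigma>' r) r))"
    proof (rule motion_time_change[OF \<mu> Ps(1) Om(1) G.cont _ _ R2.rearranged_time_measurable R2.rearranged_time_distr \<phi>g N' _ _ _ _ _ _ _ z])
      show "continuous_on {t0..t} (\<lambda>r. t0 + \<sigma> t + \<sigma>' r)" by (intro continuous_intros \<sigma>_cont)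
      show "t0 + \<sigma> t + \<sigma>' t \<le> t" using total[OF t] by simp
      show "rearranged_time \<mu> N t0 t (r, l) \<le> t0 + \<sigma> t + \<sigma>' t0 \<or> t0 + \<sigma> t + \<sigma>' t \<le> rearranged_time \<mu> N t0 t (r, l)"
        if "r \<in> {t0..t}" "l \<notin> - N" for r l
        using that \<sigma>0 \<sigma>_mono[of r t] by (auto simp: rearranged_time_def \<sigma>_def)
    qed (use t t0 \<sigma>'_mono \<sigma>_pos in \<open>auto simp: rearranged_time_def \<sigma>_def \<sigma>'_def\<close>)
    then have z': "motion_on Ps (\<lambda>x z. (1 - fst z) *\<^sub>R g x (snd (snd z))) \<mu> t0 t (\<lambda>r. z (t0 + \<sigma> t + \<sigma>' r))"
      by (subst motion_on_cong_rhs[where k = "\<lambda>x l. indicat_real (- N) l *\<^sub>R g x (snd (snd l))"])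
         (auto simp: cl[unfolded Pstar_def] relaxed_sets[OF \<mu>] N_def indicator_def Pstar_def)
    have "z (t0 + \<sigma> t + \<sigma>' t) = X t"
    proof (rule motion_parts[OF v \<mu> _ _ _ _ _ _ z'])
      show "motion_on Ps (\<lambda>x z. fs x z v) \<mu> t0 t X" by (rule motion_on_subset[OF X]) (use t t0 in auto)
      show "motion_on Ps (\<lambda>x z. fst z *\<^sub>R f x (fst (snd z)) v) \<mu> t0 t (\<lambda>t. y (t0 + \<sigma> t))"
        by (rule motion_on_subset[OF y']) (use t in auto)
    qed (use t t0 \<sigma>0 y0 z0 in auto)
    moreover have "t0 + \<sigma> t + \<sigma>' t = t" using total[OF t] by simp
    ultimately show ?thesis using \<mu>g z z0 by auto
  qed
  show ?thesis
  proof (rule bexI[of _ "t0 + \<sigma> \<theta>"], rule bexI[OF _ \<mu>f], rule exI[of _ y], intro conjI y y0 ballI)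
    show "t0 + \<sigma> \<theta> \<in> {t0..\<theta>}" using total[of \<theta>] \<sigma>_pos[of \<theta>] t0 by auto
    fix s assume s: "s \<in> {t0..t0 + \<sigma> \<theta>}"
    \<comment> \<open>\<open>\<sigma>\<close> may be flat, so \<open>s\<close> does not determine
      \<open>t\<close>. For the last value of \<open>s\<close> the choice has to be
      \<open>\<theta>\<close>, where the absorption argument knows \<open>X\<close> to be in the
      target section.\<close>
    have "\<exists>t\<in>{t0..\<theta>}. t0 + \<sigma> t = s \<and> (s = t0 + \<sigma> \<theta> \<longrightarrow> t = \<theta>)"
    proof (cases "s = t0 + \<sigma> \<theta>")
      case False
      have "\<exists>t\<ge>t0. t \<le> \<theta> \<and> \<sigma> t = s - t0"
        by (rule IVT') (use s \<sigma>0 t0 \<sigma>_cont in auto)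
      then obtain t where "t0 \<le> t" "t \<le> \<theta>" "\<sigma> t = s - t0" by blast
      then show ?thesis using False by (intro bexI[of _ t]) auto
    qed (use t0 in auto)
    then obtain t where t: "t \<in> {t0..\<theta>}" "t0 + \<sigma> t = s" "s = t0 + \<sigma> \<theta> \<longrightarrow> t = \<theta>" by blast
    have "t \<in> {s..\<theta>}" using t total[of t] \<sigma>_pos[of t] by auto
    then show "\<exists>t\<in>{s..\<theta>}. (s = t0 + \<sigma> \<theta> \<longrightarrow> t = \<theta>) \<and>
      (\<exists>\<mu>g\<in>relaxed_controls \<theta> \<Omega>. \<exists>z. motion_on \<Omega> g \<mu>g 0 \<theta> z \<and> z s = y s \<and> z t = X t)"
      using main[OF t(1)] t(2,3) by blast
  qed
qed

end

locale augmented_game = augmented P Q \<Omega> f g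
  for P :: "'u::euclidean_space set" and Q :: "'v::euclidean_space set" and \<Omega> :: "'w::euclidean_space set"
    and f :: "'x::euclidean_space \<Rightarrow> 'u \<Rightarrow> 'v \<Rightarrow> 'x" and g :: "'x \<Rightarrow> 'w \<Rightarrow> 'x" +
  fixes \<theta> :: real and M :: "(real \<times> 'x) set"
  assumes theta_pos: "\<theta> > 0" and M_closed: "closed M" and M_sub: "M \<subseteq> {0..\<theta>} \<times> UNIV"
    and M_ctrl: "M = {(t, x). t \<in> {0..\<theta>} \<and>
        (\<exists>x0\<in>sect M \<theta>. \<exists>\<mu>\<in>relaxed_controls \<theta> \<Omega>. \<exists>y.
           is_motion \<theta> \<Omega> g \<theta> x0 \<mu> y \<and> x = y t)}"
begin

abbreviation "Ms \<equiv> {\<theta>} \<times> sect M \<theta>"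

lemma M_iff:
  "(t, x) \<in> M \<longleftrightarrow> t \<in> {0..\<theta>} \<and>
    (\<exists>\<mu>\<in>relaxed_controls \<theta> \<Omega>. \<exists>y. motion_on \<Omega> g \<mu> 0 \<theta> y \<and> y \<theta> \<in> sect M \<theta> \<and> x = y t)"
proof -
  interpret G: rhs_system g \<Omega> by (rule G_sys)
  have \<theta>: "\<theta> \<in> {0..\<theta>}" using theta_pos by simp
  have "(t, x) \<in> M \<longleftrightarrow> t \<in> {0..\<theta>} \<and> (\<exists>x0\<in>sect M \<theta>. \<exists>\<mu>\<in>relaxed_controls \<theta> \<Omega>. \<exists>y. is_motion \<theta> \<Omega> g \<theta> x0 \<mu> y \<and> x = y t)"
    by (subst M_ctrl) auto
  also have "\<dots> \<longleftrightarrow> t \<in> {0..\<theta>} \<and>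
    (\<exists>\<mu>\<in>relaxed_controls \<theta> \<Omega>. \<exists>y. motion_on \<Omega> g \<mu> 0 \<theta> y \<and> y \<theta> \<in> sect M \<theta> \<and> x = y t)"
  proof -
    have "(\<exists>x0\<in>sect M \<theta>. \<exists>y. is_motion \<theta> \<Omega> g \<theta> x0 \<mu> y \<and> x = y t) \<longleftrightarrow>
        (\<exists>y. motion_on \<Omega> g \<mu> 0 \<theta> y \<and> y \<theta> \<in> sect M \<theta> \<and> x = y t)"
      if "\<mu> \<in> relaxed_controls \<theta> \<Omega>" for \<mu>
      by (simp add: G.is_motion_iff[OF that \<theta>]) blast
    then have "(\<exists>\<mu>\<in>relaxed_controls \<theta> \<Omega>. \<exists>x0\<in>sect M \<theta>. \<exists>y. is_motion \<theta> \<Omega> g \<theta> x0 \<mu> y \<and> x = y t) \<longleftrightarrow>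
        (\<exists>\<mu>\<in>relaxed_controls \<theta> \<Omega>. \<exists>y. motion_on \<Omega> g \<mu> 0 \<theta> y \<and> y \<theta> \<in> sect M \<theta> \<and> x = y t)"
      by (rule bex_cong[OF refl])
    then have "(\<exists>x0\<in>sect M \<theta>. \<exists>\<mu>\<in>relaxed_controls \<theta> \<Omega>. \<exists>y. is_motion \<theta> \<Omega> g \<theta> x0 \<mu> y \<and> x = y t) \<longleftrightarrow>
        (\<exists>\<mu>\<in>relaxed_controls \<theta> \<Omega>. \<exists>y. motion_on \<Omega> g \<mu> 0 \<theta> y \<and> y \<theta> \<in> sect M \<theta> \<and> x = y t)"
      by blast
    then show ?thesis by (simp only:)
  qed
  finally show ?thesis .
qed

text \<open>The invariant of the iteration in \<open>W_seq_eq\<close>: its last clause carries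
  membership from a later point of a \<open>g\<close>-motion to an earlier one.\<close>

definition compatible :: "(real \<times> 'x) set \<Rightarrow> bool" where
  "compatible E \<longleftrightarrow> M \<subseteq> E \<and> E \<subseteq> {0..\<theta>} \<times> UNIV \<and>
     (\<forall>\<mu>\<in>relaxed_controls \<theta> \<Omega>. \<forall>z. motion_on \<Omega> g \<mu> 0 \<theta> z \<longrightarrow>
       (\<forall>s t. 0 \<le> s \<longrightarrow> s \<le> t \<longrightarrow> t \<le> \<theta> \<longrightarrow> (t, z t) \<in> E \<longrightarrow> (s, z s) \<in> E))"

text \<open>From \<open>f\<close> to \<open>fs\<close>: after hitting \<open>M\<close> the motion
  continues along \<open>g\<close> to the terminal section, and this continuation lies in
  \<open>M\<close>, hence in \<open>E\<close>. Conversely, the \<open>f\<close>-motion of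
  \<open>motion_rearrange\<close> is stopped at \<open>S\<close>, from where a
  \<open>g\<close>-motion leads to the terminal section; its earlier points lie in \<open>E\<close>
  by backward invariance. Backward invariance of the new set is proved in its
  \<open>fs\<close>-form, where a \<open>g\<close>-motion can be prepended.\<close>

lemma absorb_step:
  assumes E: "compatible E"
  shows "absorb \<theta> Q P f M E = absorb \<theta> Q Ps fs Ms E" (is "?A = ?B") and "compatible (absorb \<theta> Q Ps fs Ms E)"
proof -
  interpret G: rhs_system g \<Omega> by (rule G_sys)
  have ME: "M \<subseteq> E" and ET: "E \<subseteq> {0..\<theta>} \<times> UNIV" using E by (auto simp: compatible_def)
  have inv: "(s, z s) \<in> E"
    if "\<mu> \<in> relaxed_controls \<theta> \<Omega>" "motion_on \<Omega> g \<mu> 0 \<theta> z" "0 \<le> s" "s \<le> t" "t \<le> \<theta>" "(t, z t) \<in> E" for \<mu> z s t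
    using E that unfolding compatible_def by blast
  have \<theta>: "0 \<le> \<theta>" using theta_pos by simp
  have AB: "?A \<subseteq> ?B"
  proof (clarsimp simp: absorb_def)
    fix t0 x0 v
    assume 1: "(t0, x0) \<in> E" and v: "v \<in> Q"
      and 2: "\<forall>v\<in>Q. \<exists>\<mu>\<in>relaxed_controls \<theta> P. \<exists>\<xi>\<in>{t0..\<theta>}. \<exists>x. is_motion \<theta> P (\<lambda>y a. f y a v) t0 x0 \<mu> x \<and>
             x \<xi> \<in> sect M \<xi> \<and> (\<forall>t\<in>{t0..\<xi>}. x t \<in> sect E t)"
    interpret F: rhs_system "\<lambda>x u. f x u v" P by (rule F_sys[OF v])
    interpret S: rhs_system "\<lambda>x z. fs x z v" Ps by (rule S_sys[OF v])
    have t0: "t0 \<in> {0..\<theta>}" using 1 ET by auto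
    from 2 v obtain \<mu> \<xi> x where \<mu>: "\<mu> \<in> relaxed_controls \<theta> P" and \<xi>: "\<xi> \<in> {t0..\<theta>}"
      and x: "is_motion \<theta> P (\<lambda>y a. f y a v) t0 x0 \<mu> x" and hit: "x \<xi> \<in> sect M \<xi>"
      and stay: "\<forall>t\<in>{t0..\<xi>}. x t \<in> sect E t" by meson
    have x0: "x t0 = x0" and xm: "motion_on P (\<lambda>x u. f x u v) \<mu> 0 \<theta> x"
      using x F.is_motion_iff[OF \<mu> t0] by auto
    obtain \<mu>1 X1 where \<mu>1: "\<mu>1 \<in> relaxed_controls \<theta> Ps" and X1: "motion_on Ps (\<lambda>x z. fs x z v) \<mu>1 0 \<theta> X1"
      and X1x: "\<forall>t\<in>{0..\<theta>}. X1 t = x t" using embed_f[OF v \<theta> \<mu> xm] by blast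
    have "(\<xi>, x \<xi>) \<in> M" using hit by (simp add: sect_def)
    then obtain \<mu>g z where \<mu>g: "\<mu>g \<in> relaxed_controls \<theta> \<Omega>" and z: "motion_on \<Omega> g \<mu>g 0 \<theta> z"
      and zF: "z \<theta> \<in> sect M \<theta>" and zx: "x \<xi> = z \<xi>" unfolding M_iff by blast
    obtain \<mu>2 X2 where \<mu>2: "\<mu>2 \<in> relaxed_controls \<theta> Ps" and X2: "motion_on Ps (\<lambda>x z. fs x z v) \<mu>2 0 \<theta> X2"
      and X2z: "\<forall>t\<in>{0..\<theta>}. X2 t = z t" using embed_g[OF v \<theta> \<mu>g z] by blast
    have \<xi>': "\<xi> \<in> {0..\<theta>}" using \<xi> t0 by auto
    let ?X = "\<lambda>t. if t \<le> \<xi> then X1 t else X2 t"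
    let ?\<mu> = "concat_control \<xi> \<mu>1 \<mu>2"
    have X: "motion_on Ps (\<lambda>x z. fs x z v) ?\<mu> 0 \<theta> ?X"
      by (rule S.motion_concat[OF \<mu>1 \<mu>2 X1 X2 \<xi>']) (use X1x X2z zx \<xi>' in auto)
    have \<mu>': "?\<mu> \<in> relaxed_controls \<theta> Ps" by (rule concat_relaxed[OF \<mu>1 \<mu>2 S.Lam_closed])
    have "?X t0 = x0" using X1x x0 t0 \<xi> by auto
    then have m: "is_motion \<theta> Ps (\<lambda>y a. fs y a v) t0 x0 ?\<mu> ?X" using X S.is_motion_iff[OF \<mu>' t0] by auto
    have Xz: "?X t = z t" if "t \<in> {\<xi>..\<theta>}" for t using that X1x X2z zx \<xi>' by auto
    have zM: "(t, z t) \<in> M" if "t \<in> {0..\<theta>}" for t unfolding M_iff using that \<mu>g z zF by blast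
    have "(\<forall>t\<in>{t0..\<theta>}. ?X t \<in> sect E t)"
    proof
      fix t assume t: "t \<in> {t0..\<theta>}"
      show "?X t \<in> sect E t"
      proof (cases "t \<le> \<xi>")
        case True then show ?thesis using stay X1x t t0 by auto
      next
        case False then show ?thesis using Xz[of t] zM[of t] ME t t0 by (auto simp: sect_def)
      qed
    qed
    moreover have "?X \<theta> \<in> sect Ms \<theta>" using Xz[of \<theta>] zF \<xi> by (auto simp: sect_def)
    ultimately show "\<exists>\<mu>\<in>relaxed_controls \<theta> Ps. \<exists>\<xi>\<in>{t0..\<theta>}. \<exists>x. is_motion \<theta> Ps (\<lambda>y a. fs y a v) t0 x0 \<mu> x \<and>
             x \<xi> \<in> sect Ms \<xi> \<and> (\<forall>t\<in>{t0..\<xi>}. x t \<in> sect E t)"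
      using m t0 by (intro bexI[OF _ \<mu>'] bexI[of _ \<theta>] exI[of _ ?X]) auto
  qed
  have BA: "?B \<subseteq> ?A"
  proof (clarsimp simp: absorb_def)
    fix t0 x0 v
    assume 1: "(t0, x0) \<in> E" and v: "v \<in> Q"
      and 2: "\<forall>v\<in>Q. \<exists>\<mu>\<in>relaxed_controls \<theta> Ps. \<exists>\<xi>\<in>{t0..\<theta>}. \<exists>x. is_motion \<theta> Ps (\<lambda>y a. fs y a v) t0 x0 \<mu> x \<and>
             x \<xi> \<in> sect Ms \<xi> \<and> (\<forall>t\<in>{t0..\<xi>}. x t \<in> sect E t)"
    interpret F: rhs_system "\<lambda>x u. f x u v" P by (rule F_sys[OF v])
    interpret S: rhs_system "\<lambda>x z. fs x z v" Ps by (rule S_sys[OF v])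
    have t0: "t0 \<in> {0..\<theta>}" using 1 ET by auto
    from 2 v obtain \<mu> \<xi> X where \<mu>: "\<mu> \<in> relaxed_controls \<theta> Ps" and \<xi>: "\<xi> \<in> {t0..\<theta>}"
      and X: "is_motion \<theta> Ps (\<lambda>y a. fs y a v) t0 x0 \<mu> X" and hit: "X \<xi> \<in> sect Ms \<xi>"
      and stay: "\<forall>t\<in>{t0..\<xi>}. X t \<in> sect E t" by meson
    have X0: "X t0 = x0" and Xm: "motion_on Ps (\<lambda>x z. fs x z v) \<mu> 0 \<theta> X"
      using X S.is_motion_iff[OF \<mu> t0] by auto
    have \<xi>\<theta>: "\<xi> = \<theta>" and XF: "X \<theta> \<in> sect M \<theta>" using hit by (auto simp: sect_def)
    obtain S \<mu>f y where S: "S \<in> {t0..\<theta>}" and \<mu>f: "\<mu>f \<in> relaxed_controls \<theta> P"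
      and y: "motion_on P (\<lambda>x u. f x u v) \<mu>f 0 \<theta> y" "y t0 = X t0"
      and re: "\<And>s. s \<in> {t0..S} \<Longrightarrow> \<exists>t\<in>{s..\<theta>}. (s = S \<longrightarrow> t = \<theta>) \<and>
        (\<exists>\<mu>g\<in>relaxed_controls \<theta> \<Omega>. \<exists>z. motion_on \<Omega> g \<mu>g 0 \<theta> z \<and> z s = y s \<and> z t = X t)"
      using motion_rearrange[OF v \<mu> t0 Xm] by meson
    have "is_motion \<theta> P (\<lambda>y a. f y a v) t0 x0 \<mu>f y" using y X0 F.is_motion_iff[OF \<mu>f t0] by auto
    moreover have "y S \<in> sect M S"
    proof -
      obtain \<mu>g z where "\<mu>g \<in> relaxed_controls \<theta> \<Omega>" "motion_on \<Omega> g \<mu>g 0 \<theta> z" "z S = y S" "z \<theta> = X \<theta>"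
        using re[of S] S by auto
      then have "(S, y S) \<in> M" unfolding M_iff using XF S t0 by (intro conjI bexI[of _ \<mu>g] exI[of _ z]) auto
      then show ?thesis by (simp add: sect_def)
    qed
    moreover have "\<forall>s\<in>{t0..S}. y s \<in> sect E s"
    proof
      fix s assume s: "s \<in> {t0..S}"
      obtain t \<mu>g z where "t \<in> {s..\<theta>}" "\<mu>g \<in> relaxed_controls \<theta> \<Omega>" "motion_on \<Omega> g \<mu>g 0 \<theta> z" "z s = y s" "z t = X t"
        using re[OF s] by blast
      then show "y s \<in> sect E s" using inv[of \<mu>g z s t] stay s t0 \<xi>\<theta> by (auto simp: sect_def)
    qed
    ultimately show "\<exists>\<mu>\<in>relaxed_controls \<theta> P. \<exists>\<xi>\<in>{t0..\<theta>}. \<exists>x. is_motion \<theta> P (\<lambda>y a. f y a v) t0 x0 \<mu> x \<and>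
             x \<xi> \<in> sect M \<xi> \<and> (\<forall>t\<in>{t0..\<xi>}. x t \<in> sect E t)"
      using S \<mu>f by blast
  qed
  show "?A = ?B" using AB BA by (rule antisym)
  show "compatible ?B" unfolding compatible_def
  proof (intro conjI ballI allI impI)
    show "?B \<subseteq> {0..\<theta>} \<times> UNIV" using ET by (auto simp: absorb_def)
    show "M \<subseteq> ?B"
    proof -
      \<comment> \<open>The target is hit at the initial instant, so any control serves.\<close>
      have "M \<subseteq> ?A"
      proof (clarsimp simp: absorb_def, intro conjI ballI)
        fix t0 x0 v assume m: "(t0, x0) \<in> M"
        then show "(t0, x0) \<in> E" using ME by auto
        assume v: "v \<in> Q"
        interpret F: rhs_system "\<lambda>x u. f x u v" P by (rule F_sys[OF v])
        have t0: "t0 \<in> {0..\<theta>}" using m M_sub by auto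
        obtain u0 where "u0 \<in> P" using P by blast
        then have \<mu>: "const_control \<theta> u0 \<in> relaxed_controls \<theta> P" by (rule const_control_relaxed[OF F.Lam_closed])
        obtain x where "x t0 = x0" "motion_on P (\<lambda>x u. f x u v) (const_control \<theta> u0) 0 \<theta> x"
          using F.motion_exists[OF \<mu> t0, of x0] by blast
        then show "\<exists>\<mu>\<in>relaxed_controls \<theta> P. \<exists>\<xi>\<in>{t0..\<theta>}. \<exists>x. is_motion \<theta> P (\<lambda>y a. f y a v) t0 x0 \<mu> x \<and>
             x \<xi> \<in> sect M \<xi> \<and> (\<forall>t\<in>{t0..\<xi>}. x t \<in> sect E t)"
          using F.is_motion_iff[OF \<mu> t0, of x0 x] m ME t0
          by (intro bexI[OF _ \<mu>] bexI[of _ t0] exI[of _ x]) (auto simp: sect_def)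
      qed
      then show ?thesis using \<open>?A = ?B\<close> by simp
    qed
    fix \<mu>g z s t
    assume \<mu>g: "\<mu>g \<in> relaxed_controls \<theta> \<Omega>" and z: "motion_on \<Omega> g \<mu>g 0 \<theta> z"
      and st: "0 \<le> s" "s \<le> t" "t \<le> \<theta>" and B: "(t, z t) \<in> ?B"
    have Et: "(t, z t) \<in> E" using B by (simp add: absorb_def)
    have s\<theta>: "s \<in> {0..\<theta>}" and t\<theta>: "t \<in> {0..\<theta>}" using st by auto
    have Es: "(r, z r) \<in> E" if "0 \<le> r" "r \<le> t" for r using inv[OF \<mu>g z that st(3) Et] .
    show "(s, z s) \<in> ?B"
    proof (clarsimp simp: absorb_def, intro conjI ballI)
      show "(s, z s) \<in> E" using Es st by auto
      fix v assume v: "v \<in> Q"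
      interpret S: rhs_system "\<lambda>x z. fs x z v" Ps by (rule S_sys[OF v])
      have "\<exists>\<mu>\<in>relaxed_controls \<theta> Ps. \<exists>\<xi>\<in>{t..\<theta>}. \<exists>x. is_motion \<theta> Ps (\<lambda>y a. fs y a v) t (z t) \<mu> x \<and>
             x \<xi> \<in> sect Ms \<xi> \<and> (\<forall>t\<in>{t..\<xi>}. x t \<in> sect E t)"
        using B v by (simp add: absorb_def)
      then obtain \<mu>2 \<xi> X2 where \<mu>2: "\<mu>2 \<in> relaxed_controls \<theta> Ps" and \<xi>: "\<xi> \<in> {t..\<theta>}"
        and X2: "is_motion \<theta> Ps (\<lambda>y a. fs y a v) t (z t) \<mu>2 X2" and hit: "X2 \<xi> \<in> sect Ms \<xi>"
        and stay: "\<forall>r\<in>{t..\<xi>}. X2 r \<in> sect E r" by meson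
      have X2t: "X2 t = z t" and X2m: "motion_on Ps (\<lambda>x z. fs x z v) \<mu>2 0 \<theta> X2"
        using X2 S.is_motion_iff[OF \<mu>2 t\<theta>] by auto
      obtain \<mu>1 X1 where \<mu>1: "\<mu>1 \<in> relaxed_controls \<theta> Ps" and X1: "motion_on Ps (\<lambda>x z. fs x z v) \<mu>1 0 \<theta> X1"
        and X1z: "\<forall>t\<in>{0..\<theta>}. X1 t = z t" using embed_g[OF v \<theta> \<mu>g z] by blast
      let ?X = "\<lambda>r. if r \<le> t then X1 r else X2 r"
      let ?\<mu> = "concat_control t \<mu>1 \<mu>2"
      have X: "motion_on Ps (\<lambda>x z. fs x z v) ?\<mu> 0 \<theta> ?X"
        by (rule S.motion_concat[OF \<mu>1 \<mu>2 X1 X2m t\<theta>]) (use X1z X2t t\<theta> in auto)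
      have \<mu>': "?\<mu> \<in> relaxed_controls \<theta> Ps" by (rule concat_relaxed[OF \<mu>1 \<mu>2 S.Lam_closed])
      have "?X s = z s" using X1z s\<theta> st by auto
      then have m: "is_motion \<theta> Ps (\<lambda>y a. fs y a v) s (z s) ?\<mu> ?X" using X S.is_motion_iff[OF \<mu>' s\<theta>] by auto
      have X2': "?X r = X2 r" if "r \<in> {t..\<theta>}" for r using that X1z X2t t\<theta> by auto
      have "\<forall>r\<in>{s..\<xi>}. ?X r \<in> sect E r"
      proof
        fix r assume r: "r \<in> {s..\<xi>}"
        show "?X r \<in> sect E r"
        proof (cases "r \<le> t")
          case True then show ?thesis using Es[of r] X1z r st by (auto simp: sect_def)
        next
          case False then show ?thesis using stay r by auto
        qed
      qed
      moreover have "?X \<xi> \<in> sect Ms \<xi>" using X2'[OF \<xi>] hit by (simp only:)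
      ultimately show "\<exists>\<mu>\<in>relaxed_controls \<theta> Ps. \<exists>\<xi>\<in>{s..\<theta>}. \<exists>x. is_motion \<theta> Ps (\<lambda>y a. fs y a v) s (z s) \<mu> x \<and>
             x \<xi> \<in> sect Ms \<xi> \<and> (\<forall>t\<in>{s..\<xi>}. x t \<in> sect E t)"
        using m \<xi> st by (intro bexI[OF _ \<mu>'] bexI[of _ \<xi>] exI[of _ ?X]) auto
    qed
  qed
qed

lemma W_seq_eq: "W_seq \<theta> Q P f M k = W_seq \<theta> Q Ps fs Ms k"
proof -
  have "W_seq \<theta> Q P f M k = W_seq \<theta> Q Ps fs Ms k \<and> compatible (W_seq \<theta> Q Ps fs Ms k)"
  proof (induction k)
    case 0
    show ?case using M_sub by (auto simp: W_seq_def compatible_def)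
  next
    case (Suc k)
    then show ?case using absorb_step[of "W_seq \<theta> Q Ps fs Ms k"] by (simp add: W_seq_def)
  qed
  then show ?thesis ..
qed

end

section \<open>Stable sets and step-by-step motions\<close>

locale game =
  fixes \<theta> :: real and P :: "'u::euclidean_space set" and Q :: "'v::euclidean_space set"
    and h :: "'x::euclidean_space \<Rightarrow> 'u \<Rightarrow> 'v \<Rightarrow> 'x" and M :: "(real \<times> 'x) set"
  assumes theta_pos: "\<theta> > 0" and P: "compact P" "P \<noteq> {}" and Q: "compact Q" "Q \<noteq> {}"
    and h_reg: "regular_rhs (\<lambda>x (u, v). h x u v) (P \<times> Q)"
    and M_closed: "closed M" and M_sub: "M \<subseteq> {0..\<theta>} \<times> UNIV"
begin

text \<open>Treating both players as one control provides growth and Lipschitz constants uniform in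
  \<open>v\<close>, also when \<open>v\<close> varies in time.\<close>

sublocale J: rhs_system "\<lambda>x (u, v). h x u v" "P \<times> Q"
  by unfold_locales (auto intro: h_reg compact_Times P Q)

abbreviation hv where "hv v \<equiv> \<lambda>x u. h x u v"

lemma hv_sys: "v \<in> Q \<Longrightarrow> rhs_system (hv v) P"
proof
  assume v: "v \<in> Q"
  have "continuous_on P (\<lambda>u. (u, v))" by (intro continuous_intros)
  moreover have "(\<lambda>u. (u, v)) ` P \<subseteq> P \<times> Q" using v by auto
  ultimately show "regular_rhs (hv v) P" using regular_rhs_compose[OF h_reg, of P "\<lambda>u. (u, v)"] by simp
qed (rule P)

definition lift :: "'v \<Rightarrow> (real \<times> 'u) list \<Rightarrow> (real \<times> 'u \<times> 'v) list" where
  "lift v l = map (\<lambda>(d, u). (d, u, v)) l"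

lemma lift:
  "steps_in P l \<Longrightarrow> v \<in> Q \<Longrightarrow> steps_in (P \<times> Q) (lift v l)" "duration (lift v l) = duration l"
  "lflow (\<lambda>x (u, v). h x u v) (lift v l) x = lflow (hv v) l x"
proof -
  show "steps_in P l \<Longrightarrow> v \<in> Q \<Longrightarrow> steps_in (P \<times> Q) (lift v l)"
    by (induction l) (auto simp: lift_def)
  show "duration (lift v l) = duration l" by (induction l) (auto simp: lift_def)
  show "lflow (\<lambda>x (u, v). h x u v) (lift v l) x = lflow (hv v) l x"
    by (induction l arbitrary: x) (auto simp: lift_def)
qed

lemma reach_lift:
  assumes "v \<in> Q" "(\<tau>, x, z) \<in> reach (hv v) P"
  shows "(\<tau>, x, z) \<in> reach (\<lambda>x (u, v). h x u v) (P \<times> Q)"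
proof -
  obtain l X where "\<And>n::nat. steps_in P (l n)" "(\<lambda>n. duration (l n)) \<longlonglongrightarrow> \<tau>" "X \<longlonglongrightarrow> x" "(\<lambda>n. lflow (hv v) (l n) (X n)) \<longlonglongrightarrow> z"
    using assms(2) unfolding reach_sequential by blast
  then show ?thesis unfolding reach_sequential
    by (intro exI[of _ "\<lambda>n. lift v (l n)"] exI[of _ X]) (auto simp: lift assms(1))
qed

text \<open>Compositions move \<open>w\<close> by their frozen Euler sum up to a quadratic error,
  and each summand has inner product at least its duration times \<open>m\<close>. The bound
  survives the limit; the strict inequality on \<open>B\<close> makes the growth budget hold for all
  late members of the sequence.\<close>

lemma reach_inner_ge:
  assumes v: "v \<in> Q" and r: "(\<tau>, w, w') \<in> reach (hv v) P" and B: "(1 + norm w) * exp (J.growth_const * \<tau>) < 1 + B"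
    and m: "\<And>u. u \<in> P \<Longrightarrow> m \<le> s \<bullet> h w u v"
  shows "\<tau> * m - norm s * (J.lip_const B * (J.growth_const * (1 + B)) * \<tau>\<^sup>2) \<le> s \<bullet> (w' - w)"
proof -
  interpret V: rhs_system "hv v" P by (rule hv_sys[OF v])
  obtain l X where l: "\<And>n::nat. steps_in P (l n)" "(\<lambda>n. duration (l n)) \<longlonglongrightarrow> \<tau>" "X \<longlonglongrightarrow> w" "(\<lambda>n. lflow (hv v) (l n) (X n)) \<longlonglongrightarrow> w'"
    using r unfolding reach_sequential by blast
  have lim: "(\<lambda>n. lflow (hv v) (l n) w) \<longlonglongrightarrow> w'"
    by (rule V.lflow_stable[OF l(1,2,3) tendsto_const l(4)])
  have "(\<lambda>n. (1 + norm w) * exp (J.growth_const * duration (l n))) \<longlonglongrightarrow> (1 + norm w) * exp (J.growth_const * \<tau>)"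
    by (intro tendsto_intros l)
  then have ev: "\<forall>\<^sub>F n in sequentially. (1 + norm w) * exp (J.growth_const * duration (l n)) < 1 + B"
    using B by (rule order_tendstoD(2))
  have sum: "duration k * m \<le> s \<bullet> (\<Sum>p\<leftarrow>k. fst p *\<^sub>R h w (snd p) v)" if "steps_in P k" for k
    using that
  proof (induction k)
    case (Cons p k)
    have "fst p * m \<le> fst p * (s \<bullet> h w (snd p) v)" using Cons.prems m by (intro mult_left_mono) auto
    then show ?case using Cons by (auto simp: inner_add_right algebra_simps)
  qed simp
  show ?thesis
  proof (rule tendsto_le)
    show "(\<lambda>n. s \<bullet> (lflow (hv v) (l n) w - w)) \<longlonglongrightarrow> s \<bullet> (w' - w)" by (intro tendsto_intros lim)
    show "(\<lambda>n. duration (l n) * m - norm s * (J.lip_const B * (J.growth_const * (1 + B)) * (duration (l n))\<^sup>2)) \<longlonglongrightarrow>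
       \<tau> * m - norm s * (J.lip_const B * (J.growth_const * (1 + B)) * \<tau>\<^sup>2)" by (intro tendsto_intros l)
    show "\<forall>\<^sub>F n in sequentially. duration (l n) * m - norm s * (J.lip_const B * (J.growth_const * (1 + B)) * (duration (l n))\<^sup>2) \<le> s \<bullet> (lflow (hv v) (l n) w - w)"
      using ev
    proof eventually_elim
      case (elim n)
      define S where "S = (\<Sum>p\<leftarrow>l n. fst p *\<^sub>R h w (snd p) v)"
      have "(\<Sum>p\<leftarrow>lift v (l n). fst p *\<^sub>R (case snd p of (u, v) \<Rightarrow> h w u v)) = S"
        unfolding S_def lift_def by (induction "l n" arbitrary: n) (auto simp: o_def case_prod_beta)
      then have "norm (lflow (hv v) (l n) w - w - S) \<le> J.lip_const B * (J.growth_const * (1 + B)) * (duration (l n))\<^sup>2"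
        using J.lflow_first[OF lift(1)[OF l(1)[of n] v], of w B] elim by (simp add: lift(2,3))
      then have "norm s * norm (lflow (hv v) (l n) w - w - S) \<le> norm s * (J.lip_const B * (J.growth_const * (1 + B)) * (duration (l n))\<^sup>2)"
        by (rule mult_left_mono) simp
      moreover have "- (norm s * norm (lflow (hv v) (l n) w - w - S)) \<le> s \<bullet> (lflow (hv v) (l n) w - w - S)"
        using Cauchy_Schwarz_ineq2[of s "lflow (hv v) (l n) w - w - S"] by linarith
      moreover have "s \<bullet> (lflow (hv v) (l n) w - w) = s \<bullet> S + s \<bullet> (lflow (hv v) (l n) w - w - S)"
        by (simp add: inner_diff_right)
      moreover have "duration (l n) * m \<le> s \<bullet> S" unfolding S_def by (rule sum[OF l(1)])
      ultimately show ?case by linarith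
    qed
  qed simp
qed

text \<open>Minimizers are chosen at the finitely many nodes of a net of \<open>Q\<close>, and
  \<open>v\<close> is rounded to a node. Uniform continuity costs half of \<open>\<eta>\<close> in
  passing to the node and half in coming back.\<close>

lemma measurable_near_argmin:
  fixes \<phi> :: "'u \<Rightarrow> 'v \<Rightarrow> real"
  assumes \<phi>: "continuous_on (P \<times> Q) (\<lambda>(u, v). \<phi> u v)" and \<eta>: "0 < \<eta>"
  shows "\<exists>U. U \<in> borel_measurable borel \<and> (\<forall>v\<in>Q. U v \<in> P \<and> (\<forall>u\<in>P. \<phi> (U v) v \<le> \<phi> u v + \<eta>))"
proof -
  have "uniformly_continuous_on (P \<times> Q) (\<lambda>(u, v). \<phi> u v)"
    by (intro compact_uniformly_continuous \<phi> compact_Times P Q)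
  then obtain d where d: "0 < d" "\<And>p p'. p \<in> P \<times> Q \<Longrightarrow> p' \<in> P \<times> Q \<Longrightarrow> dist p' p < d \<Longrightarrow>
      dist ((\<lambda>(u, v). \<phi> u v) p') ((\<lambda>(u, v). \<phi> u v) p) < \<eta> / 2"
    unfolding uniformly_continuous_on_def using \<eta> by (metis half_gt_zero)
  have d': "\<bar>\<phi> u v' - \<phi> u v\<bar> < \<eta> / 2" if "u \<in> P" "v \<in> Q" "v' \<in> Q" "dist v' v < d" for u v v'
    using d(2)[of "(u, v)" "(u, v')"] that by (simp add: dist_Pair_Pair dist_real_def)
  obtain q T where q: "q \<in> borel_measurable borel" "finite T" "T \<subseteq> Q" "\<And>v. v \<in> Q \<Longrightarrow> q v \<in> T" "\<And>v. v \<in> Q \<Longrightarrow> dist (q v) v < d"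
    using finite_borel_approximation[OF Q(1) d(1)] by blast
  have "\<exists>u\<in>P. \<forall>u'\<in>P. \<phi> u t \<le> \<phi> u' t" if "t \<in> Q" for t
  proof (rule continuous_attains_inf[OF P])
    have "continuous_on P (\<lambda>u. (\<lambda>(u, v). \<phi> u v) (u, t))"
      by (rule continuous_on_compose2[OF \<phi>]) (use that in \<open>auto intro!: continuous_intros\<close>)
    then show "continuous_on P (\<lambda>u. \<phi> u t)" by simp
  qed
  then obtain b where b: "\<And>t. t \<in> Q \<Longrightarrow> b t \<in> P" "\<And>t u'. t \<in> Q \<Longrightarrow> u' \<in> P \<Longrightarrow> \<phi> (b t) t \<le> \<phi> u' t" by metis
  define U where "U = (\<lambda>v. \<Sum>t\<in>T. indicat_real {t} (q v) *\<^sub>R b t)"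
  have "U \<in> borel_measurable borel" unfolding U_def using q(1) by measurable
  moreover have "U v \<in> P \<and> (\<forall>u\<in>P. \<phi> (U v) v \<le> \<phi> u v + \<eta>)" if v: "v \<in> Q" for v
  proof -
    have "U v = (\<Sum>t\<in>T. if t = q v then b t else 0)"
      unfolding U_def by (intro sum.cong) (auto simp: indicator_def)
    then have U: "U v = b (q v)" using q(2) q(4)[OF v] by simp
    have qv: "q v \<in> Q" using q(3) q(4)[OF v] by auto
    have "\<phi> (U v) v \<le> \<phi> u v + \<eta>" if u: "u \<in> P" for u
      using b(2)[OF qv u] d'[OF u v qv q(5)[OF v]] d'[OF b(1)[OF qv] v qv q(5)[OF v]] unfolding U by linarith
    then show ?thesis using b(1)[OF qv] U by auto
  qed
  ultimately show ?thesis by blast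
qed

text \<open>Weaker than the usual stability of a bridge: only the position at time \<open>s\<close>, not the motion leading to it,
  is required to lie in \<open>E\<close>.\<close>

definition stable :: "(real \<times> 'x) set \<Rightarrow> bool" where
  "stable E \<longleftrightarrow> closed E \<and> E \<subseteq> {0..\<theta>} \<times> UNIV \<and> sect E \<theta> \<subseteq> sect M \<theta> \<and>
     (\<forall>t x. (t, x) \<in> E \<longrightarrow> (\<forall>v\<in>Q. \<forall>s\<in>{t..\<theta>}.
        (\<exists>\<xi>\<in>{t..s}. \<exists>z. (\<xi>, z) \<in> M \<and> (\<xi> - t, x, z) \<in> reach (hv v) P) \<or>
        (\<exists>z. (s, z) \<in> E \<and> (s - t, x, z) \<in> reach (hv v) P)))"

end

lemma partition_nth:
  assumes "is_partition t0 \<theta> ts"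
  shows "0 < length ts" "ts ! 0 = t0" "ts ! (length ts - 1) = \<theta>"
    "i < j \<Longrightarrow> j < length ts \<Longrightarrow> ts ! i < ts ! j"
  using assms by (auto simp: is_partition_def hd_conv_nth last_conv_nth sorted_wrt_iff_nth_less)

lemma partition_range:
  assumes "is_partition t0 \<theta> ts" "k < length ts" shows "ts ! k \<in> {t0..\<theta>}"
proof -
  have "ts ! 0 \<le> ts ! k" using partition_nth(4)[OF assms(1), of 0 k] assms(2) by (cases "k = 0") auto
  moreover have "ts ! k \<le> ts ! (length ts - 1)"
  proof (cases "k = length ts - 1")
    case False
    then have "k < length ts - 1" "length ts - 1 < length ts" using assms(2) by linarith+
    then show ?thesis using partition_nth(4)[OF assms(1)] by (meson less_imp_le)
  qed simp
  ultimately show ?thesis using partition_nth[OF assms(1)] by simp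
qed

lemma mesh_ge: "k + 1 < length ts \<Longrightarrow> ts ! (k + 1) - ts ! k \<le> mesh ts"
proof -
  assume k: "k + 1 < length ts"
  have "{ts ! (k + 1) - ts ! k | k. k + 1 < length ts} = (\<lambda>k. ts ! (k + 1) - ts ! k) ` {k. k + 1 < length ts}" by auto
  moreover have "finite {k. k + 1 < length ts}" by (rule finite_subset[of _ "{..<length ts}"]) auto
  ultimately have "finite (insert 0 {ts ! (k + 1) - ts ! k | k. k + 1 < length ts})" by simp
  then show ?thesis unfolding mesh_def using k by (intro Max_ge) auto
qed

context game
begin

context
  fixes U t0 x0 v ts x
  assumes U: "counterstrategy P Q U" and pt: "is_partition t0 \<theta> ts" and v: "admissible_v t0 \<theta> Q v"
    and x: "step_motion h U t0 x0 v ts x" and t0: "0 \<le> t0"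
begin

lemma step_piece:
  assumes k: "k + 1 < length ts" and st: "ts ! k \<le> s" "s \<le> t" "t \<le> ts ! (k + 1)"
  shows "((\<lambda>r. h (x r) (U (ts ! k) (x (ts ! k)) (v r)) (v r)) has_integral (x t - x s)) {s..t}"
proof -
  let ?F = "\<lambda>r. h (x r) (U (ts ! k) (x (ts ! k)) (v r)) (v r)"
  have hi: "(?F has_integral (x q - x (ts ! k))) {ts ! k..q}" if "q \<in> {ts ! k..ts ! (k + 1)}" for q
    using x k that unfolding step_motion_def by blast
  have "?F integrable_on {ts ! k..t}" using hi[of t] st by (intro has_integral_integrable) auto
  then have i: "?F integrable_on {s..t}" by (rule integrable_on_subinterval) (use st in auto)
  have "integral {ts ! k..s} ?F + integral {s..t} ?F = integral {ts ! k..t} ?F"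
    by (rule Henstock_Kurzweil_Integration.integral_combine) (use st \<open>?F integrable_on {ts ! k..t}\<close> in auto)
  then have "integral {s..t} ?F = x t - x s"
    using hi[of s] hi[of t] st by (simp add: integral_unique algebra_simps)
  then show ?thesis using i by (metis integrable_integral)
qed

lemma step_control:
  assumes k: "k + 1 < length ts" and r: "ts ! k \<le> r" "r \<le> ts ! (k + 1)"
  shows "v r \<in> Q" "U (ts ! k) (x (ts ! k)) (v r) \<in> P"
proof -
  have "r \<in> {t0..\<theta>}" using partition_range[OF pt, of k] partition_range[OF pt, of "k + 1"] k r by auto
  then show "v r \<in> Q" using v by (auto simp: admissible_v_def)
  then show "U (ts ! k) (x (ts ! k)) (v r) \<in> P" using U by (auto simp: counterstrategy_def)
qed

lemma step_rhs_bound: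
  assumes k: "k + 1 < length ts" and r: "ts ! k \<le> r" "r \<le> ts ! (k + 1)"
  shows "norm (h (x r) (U (ts ! k) (x (ts ! k)) (v r)) (v r)) \<le> J.growth_const * (1 + norm (x r))"
  using J.growth[of "(U (ts ! k) (x (ts ! k)) (v r), v r)" "x r"] step_control[OF assms] by auto

text \<open>The second player's control is only measurable, so the integrand need not be continuous;
  \<open>x\<close> is continuous as an indefinite integral, which is what Gronwall requires.\<close>

lemma step_piece_growth:
  assumes k: "k + 1 < length ts" and t: "ts ! k \<le> t" "t \<le> ts ! (k + 1)"
  shows "1 + norm (x t) \<le> (1 + norm (x (ts ! k))) * exp (J.growth_const * (t - ts ! k))"
proof -
  let ?F = "\<lambda>r. h (x r) (U (ts ! k) (x (ts ! k)) (v r)) (v r)"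
  have "?F integrable_on {ts ! k..ts ! (k + 1)}"
    using step_piece[OF k, of "ts ! k" "ts ! (k + 1)"] t by (intro has_integral_integrable) auto
  then have "continuous_on {ts ! k..ts ! (k + 1)} (\<lambda>q. x (ts ! k) + integral {ts ! k..q} ?F)"
    by (intro continuous_intros indefinite_integral_continuous_1)
  moreover have "x (ts ! k) + integral {ts ! k..q} ?F = x q" if "q \<in> {ts ! k..ts ! (k + 1)}" for q
    using step_piece[OF k, of "ts ! k" q] that by (simp add: integral_unique)
  ultimately have cx: "continuous_on {ts ! k..ts ! (k + 1)} x" by (rule continuous_on_eq)
  show ?thesis
  proof (rule gronwall[where b = "ts ! (k + 1)"])
    show "continuous_on {ts ! k..ts ! (k + 1)} (\<lambda>t. 1 + norm (x t))" by (intro continuous_intros cx)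
    show "0 \<le> J.growth_const" by (rule J.growth_const_nonneg)
    fix q assume q: "q \<in> {ts ! k..ts ! (k + 1)}"
    have i: "(?F has_integral (x q - x (ts ! k))) {ts ! k..q}" by (rule step_piece[OF k]) (use q in auto)
    have "norm (integral {ts ! k..q} ?F) \<le> integral {ts ! k..q} (\<lambda>r. J.growth_const * (1 + norm (x r)))"
    proof (rule integral_norm_bound_integral)
      show "?F integrable_on {ts ! k..q}" using i by (rule has_integral_integrable)
      show "(\<lambda>r. J.growth_const * (1 + norm (x r))) integrable_on {ts ! k..q}"
        using q by (intro integrable_continuous_interval continuous_intros continuous_on_subset[OF cx]) auto
    qed (use step_rhs_bound[OF k] q in auto)
    then have "norm (x q - x (ts ! k)) \<le> J.growth_const * integral {ts ! k..q} (\<lambda>r. 1 + norm (x r))"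
      using i by (simp add: integral_unique)
    then show "1 + norm (x q) \<le> 1 + norm (x (ts ! k)) + J.growth_const * integral {ts ! k..q} (\<lambda>r. 1 + norm (x r))"
      using norm_triangle_ineq2[of "x q" "x (ts ! k)"] by linarith
  qed (use t in auto)
qed

text \<open>With the joint growth constant the bound is independent of partition, strategy and
  control, as the later limits over partitions need. Successive pieces are chained by multiplying
  exponentials.\<close>

lemma step_growth:
  assumes t: "t \<in> {t0..\<theta>}"
  shows "1 + norm (x t) \<le> (1 + norm x0) * exp (J.growth_const * \<theta>)"
proof -
  have "\<forall>t\<in>{t0..ts ! k}. 1 + norm (x t) \<le> (1 + norm x0) * exp (J.growth_const * (t - t0))" if "k < length ts" for k
    using that
  proof (induction k)
    case 0
    then show ?case using partition_nth[OF pt] x by (auto simp: step_motion_def)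
  next
    case (Suc k)
    show ?case
    proof
      fix t assume t: "t \<in> {t0..ts ! Suc k}"
      show "1 + norm (x t) \<le> (1 + norm x0) * exp (J.growth_const * (t - t0))"
      proof (cases "t \<le> ts ! k")
        case True then show ?thesis using Suc t by auto
      next
        case False
        have tk: "t0 \<le> ts ! k" using partition_range[OF pt, of k] Suc.prems by auto
        have "1 + norm (x t) \<le> (1 + norm (x (ts ! k))) * exp (J.growth_const * (t - ts ! k))"
          by (rule step_piece_growth) (use Suc.prems False t in auto)
        also have "\<dots> \<le> ((1 + norm x0) * exp (J.growth_const * (ts ! k - t0))) * exp (J.growth_const * (t - ts ! k))"
          using Suc tk by (intro mult_right_mono) auto
        also have "\<dots> = (1 + norm x0) * exp (J.growth_const * (t - t0))" by (simp add: exp_add[symmetric] algebra_simps)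
        finally show ?thesis .
      qed
    qed
  qed
  from this[of "length ts - 1"] have "1 + norm (x t) \<le> (1 + norm x0) * exp (J.growth_const * (t - t0))"
    using partition_nth[OF pt] t by auto
  also have "\<dots> \<le> (1 + norm x0) * exp (J.growth_const * \<theta>)"
    using t t0 J.growth_const_nonneg by (intro mult_left_mono) (auto intro!: mult_left_mono)
  finally show ?thesis .
qed

lemma step_lipschitz:
  assumes B: "(1 + norm x0) * exp (J.growth_const * \<theta>) \<le> 1 + B" and st: "t0 \<le> s" "s \<le> t" "t \<le> \<theta>"
  shows "norm (x t - x s) \<le> J.growth_const * (1 + B) * (t - s)"
proof -
  have bd: "norm (x r) \<le> B" if "r \<in> {t0..\<theta>}" for r using step_growth[OF that] B by linarith
  have B0: "0 \<le> B" using order_trans[OF norm_ge_zero bd, of s] st by auto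
  have piece: "norm (x t - x s) \<le> J.growth_const * (1 + B) * (t - s)"
    if k: "k + 1 < length ts" and st: "ts ! k \<le> s" "s \<le> t" "t \<le> ts ! (k + 1)" for k s t
  proof -
    have in_range: "r \<in> {t0..\<theta>}" if "r \<in> {s..t}" for r
      using partition_range[OF pt, of k] partition_range[OF pt, of "k + 1"] k that st by auto
    have "norm (x t - x s) \<le> J.growth_const * (1 + B) * measure lborel (cbox s t)"
    proof (rule has_integral_bound)
      show "((\<lambda>r. h (x r) (U (ts ! k) (x (ts ! k)) (v r)) (v r)) has_integral (x t - x s)) (cbox s t)"
        using step_piece[OF k st] by simp
      fix r assume r: "r \<in> cbox s t"
      have "norm (h (x r) (U (ts ! k) (x (ts ! k)) (v r)) (v r)) \<le> J.growth_const * (1 + norm (x r))"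
        by (rule step_rhs_bound[OF k]) (use r st in auto)
      also have "\<dots> \<le> J.growth_const * (1 + B)" using bd[OF in_range] r J.growth_const_nonneg by (intro mult_left_mono) auto
      finally show "norm (h (x r) (U (ts ! k) (x (ts ! k)) (v r)) (v r)) \<le> J.growth_const * (1 + B)" .
    qed (use B0 J.growth_const_nonneg in auto)
    then show ?thesis using st by simp
  qed
  have "\<forall>s t. t0 \<le> s \<longrightarrow> s \<le> t \<longrightarrow> t \<le> ts ! k \<longrightarrow> norm (x t - x s) \<le> J.growth_const * (1 + B) * (t - s)" if "k < length ts" for k
    using that
  proof (induction k)
    case 0
    show ?case
    proof (intro allI impI)
      fix s t assume "t0 \<le> s" "s \<le> t" "t \<le> ts ! 0"
      then have "s = t" using partition_nth(2)[OF pt] by simp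
      then show "norm (x t - x s) \<le> J.growth_const * (1 + B) * (t - s)" by simp
    qed
  next
    case (Suc k)
    show ?case
    proof (intro allI impI)
      fix s t assume st: "t0 \<le> s" "s \<le> t" "t \<le> ts ! Suc k"
      have tk: "t0 \<le> ts ! k" using partition_range[OF pt, of k] Suc.prems by auto
      consider "t \<le> ts ! k" | "ts ! k \<le> s" | "s < ts ! k" "ts ! k < t" by linarith
      then show "norm (x t - x s) \<le> J.growth_const * (1 + B) * (t - s)"
      proof cases
        case 3
        have "norm (x t - x (ts ! k)) \<le> J.growth_const * (1 + B) * (t - ts ! k)"
          by (rule piece[of k]) (use Suc.prems st 3 in auto)
        moreover have "norm (x (ts ! k) - x s) \<le> J.growth_const * (1 + B) * (ts ! k - s)" using Suc st 3 by auto
        ultimately show ?thesis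
          using norm_triangle_ineq[of "x t - x (ts ! k)" "x (ts ! k) - x s"] by (simp add: algebra_simps)
      qed (use Suc st piece[of k s t] in auto)
    qed
  qed
  from this[of "length ts - 1"] show ?thesis using partition_nth[OF pt] st by auto
qed

end

end

section \<open>Extremal aiming\<close>

context game
begin

lemma hv_inner_continuous: "continuous_on (P \<times> Q) (\<lambda>(u, v). s \<bullet> h x u v)"
proof -
  have "continuous_on (P \<times> Q) (\<lambda>p. (case p of (u, v) \<Rightarrow> h x u v))"
    by (rule J.cont_comp) (auto intro!: continuous_intros)
  then show ?thesis by (simp add: case_prod_unfold continuous_intros)
qed

text \<open>At \<open>s = 0\<close> the permitted error vanishes, but then every control is optimal;
  otherwise the error is positive and the net argument applies.\<close>

lemma ex_aim:
  fixes x :: 'x and s :: 'x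
  shows "\<exists>U. U \<in> borel_measurable borel \<and> (\<forall>v\<in>Q. U v \<in> P \<and> (\<forall>u\<in>P. s \<bullet> h x (U v) v \<le> s \<bullet> h x u v + (norm s)\<^sup>2))"
proof (cases "s = 0")
  case True
  obtain u0 where "u0 \<in> P" using P by blast
  then show ?thesis using True by (intro exI[of _ "\<lambda>_. u0"]) auto
next
  case False
  then show ?thesis using measurable_near_argmin[OF hv_inner_continuous, of "(norm s)\<^sup>2" s x] by auto
qed

text \<open>\<open>s\<close> will be the displacement from a point of the stable set to
  \<open>x\<close>; the first player answers \<open>v\<close> so as to reduce it nearly as fast as
  possible.\<close>

definition aim :: "'x \<Rightarrow> 'x \<Rightarrow> 'v \<Rightarrow> 'u" where
  "aim x s = (SOME U. U \<in> borel_measurable borel \<and>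
     (\<forall>v\<in>Q. U v \<in> P \<and> (\<forall>u\<in>P. s \<bullet> h x (U v) v \<le> s \<bullet> h x u v + (norm s)\<^sup>2)))"

lemma aim:
  "aim x s \<in> borel_measurable borel" "v \<in> Q \<Longrightarrow> aim x s v \<in> P"
  "v \<in> Q \<Longrightarrow> u \<in> P \<Longrightarrow> s \<bullet> h x (aim x s v) v \<le> s \<bullet> h x u v + (norm s)\<^sup>2"
proof -
  have "aim x s \<in> borel_measurable borel \<and>
     (\<forall>v\<in>Q. aim x s v \<in> P \<and> (\<forall>u\<in>P. s \<bullet> h x (aim x s v) v \<le> s \<bullet> h x u v + (norm s)\<^sup>2))"
    unfolding aim_def by (rule someI_ex[OF ex_aim])
  then show "aim x s \<in> borel_measurable borel" "v \<in> Q \<Longrightarrow> aim x s v \<in> P"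
    "v \<in> Q \<Longrightarrow> u \<in> P \<Longrightarrow> s \<bullet> h x (aim x s v) v \<le> s \<bullet> h x u v + (norm s)\<^sup>2" by auto
qed

text \<open>\<open>c\<close> is the value of the local game \<open>max\<^sub>v min\<^sub>u\<close> in the direction \<open>s\<close>. The error \<open>(norm s)\<^sup>2\<close> of the
  approximate minimizer vanishes with the distance, so it does not spoil the estimate of \<open>aim_step\<close>; an exact
  minimizer would need measurable selection.\<close>

lemma ex_local_value:
  fixes x s :: 'x
  shows "\<exists>c. \<exists>v\<in>Q. (\<forall>v'\<in>Q. s \<bullet> h x (aim x s v') v' \<le> c + (norm s)\<^sup>2) \<and> (\<forall>u\<in>P. c - (norm s)\<^sup>2 \<le> s \<bullet> h x u v)"
proof -
  define \<alpha> where "\<alpha> = (\<lambda>v. INF u\<in>P. s \<bullet> h x u v)"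
  define C where "C = norm s * (J.growth_const * (1 + norm x))"
  have bd: "\<bar>s \<bullet> h x u v\<bar> \<le> C" if "u \<in> P" "v \<in> Q" for u v
  proof -
    have "norm (h x u v) \<le> J.growth_const * (1 + norm x)" using J.growth[of "(u, v)" x] that by simp
    then show ?thesis unfolding C_def by (meson Cauchy_Schwarz_ineq2 mult_left_mono norm_ge_zero order_trans)
  qed
  have bb: "bdd_below ((\<lambda>u. s \<bullet> h x u v) ` P)" if "v \<in> Q" for v
    using bd that by (intro bdd_belowI2[of _ "- C"]) (force simp: abs_le_iff)
  have \<alpha>_le: "\<alpha> v \<le> s \<bullet> h x u v" if "u \<in> P" "v \<in> Q" for u v
    unfolding \<alpha>_def using bb that by (intro cINF_lower) auto
  obtain u0 where u0: "u0 \<in> P" using P by blast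
  have \<alpha>bd: "bdd_above (\<alpha> ` Q)"
  proof (rule bdd_aboveI2)
    fix v assume "v \<in> Q"
    then show "\<alpha> v \<le> C" using \<alpha>_le[OF u0] bd[OF u0] by (meson abs_le_D1 order_trans)
  qed
  define c where "c = (SUP v\<in>Q. \<alpha> v)"
  have 1: "s \<bullet> h x (aim x s v') v' \<le> c + (norm s)\<^sup>2" if "v' \<in> Q" for v'
  proof -
    have "s \<bullet> h x (aim x s v') v' - (norm s)\<^sup>2 \<le> \<alpha> v'"
      unfolding \<alpha>_def using aim(3)[OF that] P by (intro cINF_greatest) (auto simp: algebra_simps)
    also have "\<alpha> v' \<le> c" unfolding c_def by (rule cSUP_upper[OF that \<alpha>bd])
    finally show ?thesis by simp
  qed
  have "\<exists>v\<in>Q. c - (norm s)\<^sup>2 \<le> \<alpha> v"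
  proof (cases "s = 0")
    case True
    then have "\<alpha> v = 0" for v unfolding \<alpha>_def using P by simp
    moreover have "c = 0" unfolding c_def using calculation Q by simp
    ultimately show ?thesis using Q by auto
  next
    case False
    then have "c - (norm s)\<^sup>2 < c" by simp
    then obtain v where "v \<in> Q" "c - (norm s)\<^sup>2 < \<alpha> v"
      unfolding c_def using less_cSUP_iff[OF Q(2) \<alpha>bd] by blast
    then show ?thesis by (auto intro: less_imp_le)
  qed
  then obtain v where "v \<in> Q" "c - (norm s)\<^sup>2 \<le> \<alpha> v" by blast
  then show ?thesis using 1 \<alpha>_le by (intro exI[of _ c] bexI[of _ v]) (auto intro: order_trans)
qed

text \<open>The actual motion is compared with one provided by stability under a fictitious control
  \<open>v'\<close>, a nearly optimal choice of the second player in direction \<open>s\<close>.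
  Aiming keeps the rate of \<open>x\<close> along \<open>s\<close> below about \<open>c\<close>,
  while every answer to \<open>v'\<close> has rate at least about \<open>c\<close>. The values
  cancel, and only terms of the order of the squared distance and of the squared step
  remain.\<close>

lemma aim_step:
  assumes E: "stable E" and xw: "(\<tau>, w) \<in> E" "norm (x \<tau> - w) \<le> 1" and \<tau>: "0 \<le> \<tau>" "\<tau> \<le> \<tau>'" "\<tau>' \<le> \<theta>"
    and v: "\<And>r. r \<in> {\<tau>..\<tau>'} \<Longrightarrow> v r \<in> Q"
    and x: "((\<lambda>r. h (x r) (aim (x \<tau>) (x \<tau> - w) (v r)) (v r)) has_integral (x \<tau>' - x \<tau>)) {\<tau>..\<tau>'}"
    and mv: "\<And>r. r \<in> {\<tau>..\<tau>'} \<Longrightarrow> norm (x r - x \<tau>) \<le> K * (r - \<tau>)" "\<And>r. r \<in> {\<tau>..\<tau>'} \<Longrightarrow> norm (x r) \<le> B"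
    and B: "(1 + norm w) * exp (J.growth_const * \<theta>) < 1 + B" and K: "K = J.growth_const * (1 + B)" and L: "L = J.lip_const B"
  shows "(\<exists>\<xi>\<in>{\<tau>..\<tau>'}. \<exists>z. (\<xi>, z) \<in> M \<and> norm (x \<xi> - z) \<le> norm (x \<tau> - w) + 2 * K * (\<tau>' - \<tau>)) \<or>
    (\<exists>w'. (\<tau>', w') \<in> E \<and> (norm (x \<tau>' - w'))\<^sup>2 \<le>
      exp ((2 * L + 4) * (\<tau>' - \<tau>)) * (norm (x \<tau> - w))\<^sup>2 + (4 * L * K + 4 * K\<^sup>2) * (\<tau>' - \<tau>)\<^sup>2)"
proof -
  define s where "s = x \<tau> - w"
  define \<delta> where "\<delta> = \<tau>' - \<tau>"
  have \<delta>: "0 \<le> \<delta>" "\<delta> \<le> \<theta>" using \<tau> by (auto simp: \<delta>_def)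
  obtain c v' where v': "v' \<in> Q" "\<And>v. v \<in> Q \<Longrightarrow> s \<bullet> h (x \<tau>) (aim (x \<tau>) s v) v \<le> c + (norm s)\<^sup>2"
    "\<And>u. u \<in> P \<Longrightarrow> c - (norm s)\<^sup>2 \<le> s \<bullet> h (x \<tau>) u v'"
    using ex_local_value[of s "x \<tau>"] by blast
  have L0: "0 \<le> L" unfolding L by (rule J.lip_const_nonneg)
  have xB: "norm (x \<tau>) \<le> B" using mv(2)[of \<tau>] \<tau> by auto
  have B0: "0 \<le> B" using order_trans[OF norm_ge_zero xB] .
  have K0: "0 \<le> K" unfolding K using J.growth_const_nonneg B0 by simp
  have Bt: "(1 + norm w) * exp (J.growth_const * t) < 1 + B" if "t \<le> \<theta>" for t
  proof -
    have "(1 + norm w) * exp (J.growth_const * t) \<le> (1 + norm w) * exp (J.growth_const * \<theta>)"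
      using that J.growth_const_nonneg by (intro mult_left_mono) (auto intro!: mult_left_mono)
    then show ?thesis using B by linarith
  qed
  have wB: "norm w \<le> B" using Bt[of 0] theta_pos by simp
  have reach_mv: "norm (z - w) \<le> K * t" if "(t, w, z) \<in> reach (hv v') P" "t \<le> \<theta>" for t z
  proof -
    have r: "(t, w, z) \<in> reach (\<lambda>x (u, v). h x u v) (P \<times> Q)" by (rule reach_lift[OF v'(1) that(1)])
    have "norm (z - w) \<le> J.growth_const * ((1 + norm w) * exp (J.growth_const * t)) * t" by (rule J.reach_move(2)[OF r])
    also have "\<dots> \<le> K * t"
      unfolding K using Bt[OF that(2)] J.reach_move(1)[OF r] J.growth_const_nonneg by (intro mult_right_mono mult_left_mono) auto
    finally show ?thesis .
  qed
  have "(\<exists>\<xi>\<in>{\<tau>..\<tau>'}. \<exists>z. (\<xi>, z) \<in> M \<and> (\<xi> - \<tau>, w, z) \<in> reach (hv v') P) \<or>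
        (\<exists>z. (\<tau>', z) \<in> E \<and> (\<tau>' - \<tau>, w, z) \<in> reach (hv v') P)"
    using E xw(1) v'(1) \<tau> unfolding stable_def by auto
  then show ?thesis
  proof
    assume "\<exists>\<xi>\<in>{\<tau>..\<tau>'}. \<exists>z. (\<xi>, z) \<in> M \<and> (\<xi> - \<tau>, w, z) \<in> reach (hv v') P"
    then obtain \<xi> z where \<xi>: "\<xi> \<in> {\<tau>..\<tau>'}" "(\<xi>, z) \<in> M" "(\<xi> - \<tau>, w, z) \<in> reach (hv v') P" by blast
    have "norm (x \<xi> - z) \<le> norm (x \<xi> - x \<tau>) + norm (x \<tau> - w) + norm (z - w)"
      using norm_triangle_ineq4[of "(x \<xi> - x \<tau>) + (x \<tau> - w)" "z - w"] norm_triangle_ineq[of "x \<xi> - x \<tau>" "x \<tau> - w"] by simp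
    moreover have "norm (x \<xi> - x \<tau>) \<le> K * (\<tau>' - \<tau>)"
      using mv(1)[OF \<xi>(1)] \<xi>(1) K0 mult_left_mono[of "\<xi> - \<tau>" "\<tau>' - \<tau>" K] by auto
    moreover have "norm (z - w) \<le> K * (\<tau>' - \<tau>)"
      using reach_mv[OF \<xi>(3)] \<xi>(1) \<tau> K0 mult_left_mono[of "\<xi> - \<tau>" "\<tau>' - \<tau>" K] by auto
    ultimately have "norm (x \<xi> - z) \<le> norm (x \<tau> - w) + 2 * K * (\<tau>' - \<tau>)" by linarith
    then show ?thesis using \<xi> by blast
  next
    assume "\<exists>z. (\<tau>', z) \<in> E \<and> (\<tau>' - \<tau>, w, z) \<in> reach (hv v') P"
    then obtain w' where w': "(\<tau>', w') \<in> E" "(\<delta>, w, w') \<in> reach (hv v') P" unfolding \<delta>_def by blast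
    define dx where "dx = x \<tau>' - x \<tau>"
    define dw where "dw = w' - w"
    have dx: "norm dx \<le> K * \<delta>" using mv(1)[of \<tau>'] \<tau> by (simp add: dx_def \<delta>_def)
    have dw: "norm dw \<le> K * \<delta>" unfolding dw_def using reach_mv[OF w'(2)] \<delta> by simp
    \<comment> \<open>The distance bound 1 makes the second-order errors independent of
      \<open>s\<close>.\<close>
    have n1: "norm s * (L * K * \<delta>\<^sup>2) \<le> L * K * \<delta>\<^sup>2"
      using xw(2) L0 K0 mult_right_mono[of "norm s" 1 "L * K * \<delta>\<^sup>2"] by (simp add: s_def)
    have up: "s \<bullet> dx \<le> \<delta> * (c + (norm s)\<^sup>2) + L * K * \<delta>\<^sup>2"
    proof -
      have "((\<lambda>r. s \<bullet> h (x r) (aim (x \<tau>) s (v r)) (v r)) has_integral (s \<bullet> dx)) {\<tau>..\<tau>'}"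
        using has_integral_linear[OF x bounded_linear_inner_right[of s]] by (simp add: o_def dx_def s_def)
      moreover have "((\<lambda>r. c + (norm s)\<^sup>2 + norm s * (L * (K * \<delta>))) has_integral ((c + (norm s)\<^sup>2 + norm s * (L * (K * \<delta>))) * \<delta>)) {\<tau>..\<tau>'}"
        using has_integral_const_real[of "c + (norm s)\<^sup>2 + norm s * (L * (K * \<delta>))" \<tau> \<tau>'] \<tau> by (simp add: \<delta>_def mult.commute)
      ultimately have "s \<bullet> dx \<le> (c + (norm s)\<^sup>2 + norm s * (L * (K * \<delta>))) * \<delta>"
      proof (rule has_integral_le)
        fix r assume r: "r \<in> {\<tau>..\<tau>'}"
        let ?u = "aim (x \<tau>) s (v r)"
        have u: "?u \<in> P" "v r \<in> Q" using aim(2) v[OF r] by auto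
        have "norm (h (x r) ?u (v r) - h (x \<tau>) ?u (v r)) \<le> L * norm (x r - x \<tau>)"
          unfolding L using J.lipschitz[OF mv(2)[OF r] xB, of "(?u, v r)"] u by simp
        also have "\<dots> \<le> L * (K * \<delta>)"
          using mv(1)[OF r] r K0 L0 mult_left_mono[of "r - \<tau>" \<delta> K] by (intro mult_left_mono) (auto simp: \<delta>_def)
        finally have "norm s * norm (h (x r) ?u (v r) - h (x \<tau>) ?u (v r)) \<le> norm s * (L * (K * \<delta>))"
          by (rule mult_left_mono) simp
        moreover have "s \<bullet> (h (x r) ?u (v r) - h (x \<tau>) ?u (v r)) \<le> norm s * norm (h (x r) ?u (v r) - h (x \<tau>) ?u (v r))"
          by (rule norm_cauchy_schwarz)
        moreover have "s \<bullet> h (x \<tau>) ?u (v r) \<le> c + (norm s)\<^sup>2" by (rule v'(2)[OF u(2)])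
        ultimately show "s \<bullet> h (x r) ?u (v r) \<le> c + (norm s)\<^sup>2 + norm s * (L * (K * \<delta>))"
          by (simp add: inner_diff_right)
      qed
      also have "\<dots> = \<delta> * (c + (norm s)\<^sup>2) + norm s * (L * K * \<delta>\<^sup>2)" by (simp add: power2_eq_square algebra_simps)
      finally show ?thesis using n1 by linarith
    qed
    have lo: "\<delta> * (c - (norm s)\<^sup>2 - L * (norm s)\<^sup>2) - L * K * \<delta>\<^sup>2 \<le> s \<bullet> dw"
    proof -
      have "c - (norm s)\<^sup>2 - L * (norm s)\<^sup>2 \<le> s \<bullet> h w u v'" if u: "u \<in> P" for u
      proof -
        have "norm (h (x \<tau>) u v' - h w u v') \<le> L * norm s"
          unfolding L s_def using J.lipschitz[OF xB wB, of "(u, v')"] u v'(1) by simp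
        then have "norm s * norm (h (x \<tau>) u v' - h w u v') \<le> norm s * (L * norm s)" by (rule mult_left_mono) simp
        moreover have "s \<bullet> (h (x \<tau>) u v' - h w u v') \<le> norm s * norm (h (x \<tau>) u v' - h w u v')" by (rule norm_cauchy_schwarz)
        moreover have "norm s * (L * norm s) = L * (norm s)\<^sup>2" by (simp add: power2_eq_square)
        ultimately show ?thesis using v'(3)[OF u] by (simp add: inner_diff_right)
      qed
      from reach_inner_ge[OF v'(1) w'(2) Bt[OF \<delta>(2)] this]
      show ?thesis using n1 unfolding dw_def L[symmetric] K[symmetric] by linarith
    qed
    have "x \<tau>' - w' = s + (dx - dw)" by (simp add: s_def dx_def dw_def)
    then have "(norm (x \<tau>' - w'))\<^sup>2 = (norm s)\<^sup>2 + 2 * (s \<bullet> dx - s \<bullet> dw) + (norm (dx - dw))\<^sup>2"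
      by (simp add: power2_norm_eq_inner inner_add_left inner_add_right inner_diff_right inner_commute)
    \<comment> \<open>The coefficient \<open>2 + L\<close> collects the two near-optimality errors
      and the cost of freezing at \<open>x \<tau>\<close> instead of \<open>w\<close>. The last
      square bounds \<open>dx - dw\<close>, each part being at most
      \<open>K * \<delta>\<close>.\<close>
    also have "\<dots> \<le> (norm s)\<^sup>2 + 2 * (\<delta> * (2 + L) * (norm s)\<^sup>2 + 2 * (L * K * \<delta>\<^sup>2)) + (2 * K * \<delta>)\<^sup>2"
    proof (intro add_mono mult_left_mono order_refl)
      show "s \<bullet> dx - s \<bullet> dw \<le> \<delta> * (2 + L) * (norm s)\<^sup>2 + 2 * (L * K * \<delta>\<^sup>2)"
        using up lo by (simp add: algebra_simps)
      show "(norm (dx - dw))\<^sup>2 \<le> (2 * K * \<delta>)\<^sup>2"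
        using norm_triangle_ineq4[of dx dw] dx dw by (intro power_mono) auto
    qed simp
    also have "\<dots> = (1 + (2 * L + 4) * \<delta>) * (norm s)\<^sup>2 + (4 * L * K + 4 * K\<^sup>2) * \<delta>\<^sup>2"
      by (simp add: power2_eq_square algebra_simps)
    also have "\<dots> \<le> exp ((2 * L + 4) * \<delta>) * (norm s)\<^sup>2 + (4 * L * K + 4 * K\<^sup>2) * \<delta>\<^sup>2"
      by (intro add_mono mult_right_mono exp_ge_add_one_self order_refl) simp
    finally show ?thesis using w'(1) unfolding s_def \<delta>_def by blast
  qed
qed

text \<open>Unless the target has nearly been hit, the squared distance to the set at the nodes
  stays of the order of the mesh, and the terminal section of the set lies in the target. So
  approximate hits occur in any case; compactness of the time interval and closedness of
  \<open>M\<close> make them exact for a limit motion.\<close>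

lemma stable_subset_solvability:
  assumes E: "stable E"
  shows "E \<subseteq> solvability_set \<theta> P Q h M"
proof (rule subsetI)
  fix p assume p: "p \<in> E"
  obtain t0 x0 where p0: "p = (t0, x0)" by (cases p)
  have t0: "t0 \<in> {0..\<theta>}" using E p p0 by (auto simp: stable_def)
  define cp where "cp = (\<lambda>t x. closest_point (sect E t) x)"
  \<comment> \<open>Where the section is empty the closest point is arbitrary, but
    \<open>aim\<close> still returns admissible controls; the induction below guarantees a point of
    the section at each node of the motions considered.\<close>
  define U where "U = (\<lambda>t x. aim x (x - cp t x))"
  have sc: "closed (sect E t)" for t
  proof -
    have "sect E t = (\<lambda>x. (t, x)) -` E" by (auto simp: sect_def)
    then show ?thesis using E by (auto simp: stable_def intro!: closed_vimage continuous_intros)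
  qed
  have U: "counterstrategy P Q U"
    unfolding counterstrategy_def U_def using aim(1,2) by (auto intro: measurable_restrict_space1)
  have cp: "(t, cp t x) \<in> E" "norm (x - cp t x) \<le> norm (x - w)" if "(t, w) \<in> E" for t x w
    using closest_point_in_set[OF sc, of t x] closest_point_le[OF sc, of w t x] that
    by (auto simp: cp_def sect_def dist_norm)
  \<comment> \<open>Chosen for points \<open>w\<close> at distance at most 1 from the motion:
    \<open>1 + norm w\<close> is at most 2 plus the norm of the motion, and growth over a further
    time \<open>\<theta>\<close> gives the outer exponential.\<close>
  define B where "B = (2 + (1 + norm x0) * exp (J.growth_const * \<theta>)) * exp (J.growth_const * \<theta>)"
  define K where "K = J.growth_const * (1 + B)"
  define L where "L = J.lip_const B"
  define A where "A = 2 * L + 4"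
  define A' where "A' = 4 * L * K + 4 * K\<^sup>2"
  have e1: "1 \<le> exp (J.growth_const * \<theta>)" using J.growth_const_nonneg theta_pos by simp
  have B0: "0 \<le> B" by (simp add: B_def)
  have L0: "0 \<le> L" unfolding L_def by (rule J.lip_const_nonneg)
  have K0: "0 \<le> K" unfolding K_def using J.growth_const_nonneg B0 by simp
  have A0: "0 \<le> A" "0 \<le> A'" using L0 K0 by (auto simp: A_def A'_def)
  have B1: "(1 + norm x0) * exp (J.growth_const * \<theta>) \<le> 1 + B"
    unfolding B_def using mult_left_mono[OF e1, of "2 + (1 + norm x0) * exp (J.growth_const * \<theta>)"] by simp
  \<comment> \<open>The first term bounds the distance at the nodes, the second what both motions
    can move within one step of length at most \<open>\<eta>\<close>.\<close>
  define \<rho> where "\<rho> = (\<lambda>\<eta>. sqrt (exp (A * \<theta>) * A' * \<eta> * \<theta>) + 2 * K * \<eta>)"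
  have main: "\<exists>\<xi>\<in>{t0..\<theta>}. \<exists>z. (\<xi>, z) \<in> M \<and> norm (x \<xi> - z) \<le> \<rho> \<eta>"
    if pt: "is_partition t0 \<theta> ts" and v: "admissible_v t0 \<theta> Q v" and x: "step_motion h U t0 x0 v ts x"
      and \<eta>: "mesh ts \<le> \<eta>" "0 \<le> \<eta>" "exp (A * \<theta>) * A' * \<eta> * \<theta> \<le> 1" for ts v x \<eta>
  proof (rule ccontr)
    assume neg: "\<not> ?thesis"
    note t00 = t0[THEN atLeastAtMost_iff[THEN iffD1], THEN conjunct1]
    note growth = step_growth[OF U pt v x t00] and lip = step_lipschitz[OF U pt v x t00 B1]
    have xB: "norm (x r) \<le> B" if "r \<in> {t0..\<theta>}" for r using growth[OF that] B1 by linarith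
    have bound: "norm (x r - w) \<le> 1 \<Longrightarrow> (1 + norm w) * exp (J.growth_const * \<theta>) < 1 + B" if "r \<in> {t0..\<theta>}" for r w
    proof -
      assume "norm (x r - w) \<le> 1"
      then have "1 + norm w \<le> 2 + norm (x r)" using norm_triangle_ineq3[of w "x r"] by (simp add: norm_minus_commute)
      also have "\<dots> \<le> 2 + (1 + norm x0) * exp (J.growth_const * \<theta>)" using growth[OF that] by simp
      finally have "(1 + norm w) * exp (J.growth_const * \<theta>) \<le> B" unfolding B_def by (intro mult_right_mono) auto
      then show ?thesis by simp
    qed
    \<comment> \<open>One factor of the squared step in \<open>aim_step\<close> is bounded by
      \<open>\<eta>\<close>; the errors then accumulate to \<open>\<eta>\<close> times the elapsed
      time, up to the exponential factor.\<close>
    have "\<exists>w. (ts ! k, w) \<in> E \<and> (norm (x (ts ! k) - w))\<^sup>2 \<le> exp (A * (ts ! k - t0)) * A' * \<eta> * (ts ! k - t0)"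
      if "k < length ts" for k
      using that
    proof (induction k)
      case 0
      then show ?case using partition_nth[OF pt] x p p0 by (intro exI[of _ x0]) (auto simp: step_motion_def)
    next
      case (Suc k)
      let ?\<tau> = "ts ! k" and ?\<tau>' = "ts ! Suc k"
      obtain w0 where w0: "(?\<tau>, w0) \<in> E" "(norm (x ?\<tau> - w0))\<^sup>2 \<le> exp (A * (?\<tau> - t0)) * A' * \<eta> * (?\<tau> - t0)"
        using Suc by auto
      define w where "w = cp ?\<tau> (x ?\<tau>)"
      have \<tau>: "?\<tau> \<in> {t0..\<theta>}" "?\<tau>' \<in> {t0..\<theta>}" "?\<tau> < ?\<tau>'"
        using partition_range[OF pt] partition_nth(4)[OF pt, of k "Suc k"] Suc.prems by auto
      have w: "(?\<tau>, w) \<in> E" unfolding w_def by (rule cp(1)[OF w0(1)])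
      have "norm (x ?\<tau> - w) \<le> norm (x ?\<tau> - w0)" unfolding w_def by (rule cp(2)[OF w0(1)])
      then have "(norm (x ?\<tau> - w))\<^sup>2 \<le> (norm (x ?\<tau> - w0))\<^sup>2" by (rule power_mono) simp
      with w0(2) have w2: "(norm (x ?\<tau> - w))\<^sup>2 \<le> exp (A * (?\<tau> - t0)) * A' * \<eta> * (?\<tau> - t0)" by linarith
      also have "\<dots> \<le> exp (A * \<theta>) * A' * \<eta> * \<theta>"
        using \<tau> t0 A0 \<eta>(2) by (intro mult_mono) (auto intro!: mult_left_mono)
      finally have w3: "(norm (x ?\<tau> - w))\<^sup>2 \<le> exp (A * \<theta>) * A' * \<eta> * \<theta>" .
      then have "(norm (x ?\<tau> - w))\<^sup>2 \<le> 1" using \<eta>(3) by linarith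
      then have wle: "norm (x ?\<tau> - w) \<le> 1" using power2_le_imp_le[of "norm (x ?\<tau> - w)" 1] by simp
      have k: "k + 1 < length ts" using Suc.prems by simp
      have \<delta>: "?\<tau>' - ?\<tau> \<le> \<eta>" using mesh_ge[OF k] \<eta>(1) by simp
      have st: "(\<exists>\<xi>\<in>{?\<tau>..?\<tau>'}. \<exists>z. (\<xi>, z) \<in> M \<and> norm (x \<xi> - z) \<le> norm (x ?\<tau> - w) + 2 * K * (?\<tau>' - ?\<tau>)) \<or>
        (\<exists>w'. (?\<tau>', w') \<in> E \<and> (norm (x ?\<tau>' - w'))\<^sup>2 \<le>
          exp ((2 * L + 4) * (?\<tau>' - ?\<tau>)) * (norm (x ?\<tau> - w))\<^sup>2 + (4 * L * K + 4 * K\<^sup>2) * (?\<tau>' - ?\<tau>)\<^sup>2)"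
      proof (rule aim_step[where x = x and v = v and B = B, OF E w wle])
        show "((\<lambda>r. h (x r) (aim (x ?\<tau>) (x ?\<tau> - w) (v r)) (v r)) has_integral (x ?\<tau>' - x ?\<tau>)) {?\<tau>..?\<tau>'}"
          using step_piece[OF U pt v x t00 k, of ?\<tau> ?\<tau>'] \<tau> by (simp add: U_def w_def)
        show "v r \<in> Q" if "r \<in> {?\<tau>..?\<tau>'}" for r using step_control(1)[OF U pt v x t00 k] that by simp
        show "norm (x r - x ?\<tau>) \<le> K * (r - ?\<tau>)" if "r \<in> {?\<tau>..?\<tau>'}" for r
          unfolding K_def by (rule lip) (use that \<tau> in auto)
        show "norm (x r) \<le> B" if "r \<in> {?\<tau>..?\<tau>'}" for r by (rule xB) (use that \<tau> in auto)
        show "(1 + norm w) * exp (J.growth_const * \<theta>) < 1 + B" by (rule bound[OF \<tau>(1) wle])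
      qed (use \<tau> t0 in \<open>auto simp: K_def L_def\<close>)
      have nohit: "\<not> (\<exists>\<xi>\<in>{?\<tau>..?\<tau>'}. \<exists>z. (\<xi>, z) \<in> M \<and> norm (x \<xi> - z) \<le> norm (x ?\<tau> - w) + 2 * K * (?\<tau>' - ?\<tau>))"
      proof
        assume "\<exists>\<xi>\<in>{?\<tau>..?\<tau>'}. \<exists>z. (\<xi>, z) \<in> M \<and> norm (x \<xi> - z) \<le> norm (x ?\<tau> - w) + 2 * K * (?\<tau>' - ?\<tau>)"
        then obtain \<xi> z where "\<xi> \<in> {?\<tau>..?\<tau>'}" "(\<xi>, z) \<in> M" "norm (x \<xi> - z) \<le> norm (x ?\<tau> - w) + 2 * K * (?\<tau>' - ?\<tau>)" by blast
        moreover have "norm (x ?\<tau> - w) \<le> sqrt (exp (A * \<theta>) * A' * \<eta> * \<theta>)" using w3 by (rule real_le_rsqrt)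
        moreover have "2 * K * (?\<tau>' - ?\<tau>) \<le> 2 * K * \<eta>" using \<delta> K0 by (intro mult_left_mono) auto
        ultimately show False using neg \<tau> unfolding \<rho>_def by fastforce
      qed
      from st nohit obtain w' where w': "(?\<tau>', w') \<in> E" "(norm (x ?\<tau>' - w'))\<^sup>2 \<le>
          exp (A * (?\<tau>' - ?\<tau>)) * (norm (x ?\<tau> - w))\<^sup>2 + A' * (?\<tau>' - ?\<tau>)\<^sup>2" unfolding A_def A'_def by blast
      have "exp (A * (?\<tau>' - ?\<tau>)) * (norm (x ?\<tau> - w))\<^sup>2 \<le> exp (A * (?\<tau>' - ?\<tau>)) * (exp (A * (?\<tau> - t0)) * A' * \<eta> * (?\<tau> - t0))"
        using w2 by (intro mult_left_mono) auto
      also have "\<dots> = exp (A * (?\<tau>' - t0)) * A' * \<eta> * (?\<tau> - t0)"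
        by (simp add: mult.assoc[symmetric] exp_add[symmetric]) (simp add: algebra_simps)
      finally have 1: "exp (A * (?\<tau>' - ?\<tau>)) * (norm (x ?\<tau> - w))\<^sup>2 \<le> exp (A * (?\<tau>' - t0)) * A' * \<eta> * (?\<tau> - t0)" .
      have "A' * (?\<tau>' - ?\<tau>)\<^sup>2 = 1 * A' * (?\<tau>' - ?\<tau>) * (?\<tau>' - ?\<tau>)" by (simp add: power2_eq_square)
      also have "\<dots> \<le> exp (A * (?\<tau>' - t0)) * A' * \<eta> * (?\<tau>' - ?\<tau>)"
        using A0 \<tau> \<delta> \<eta>(2) by (intro mult_mono) auto
      finally have 2: "A' * (?\<tau>' - ?\<tau>)\<^sup>2 \<le> exp (A * (?\<tau>' - t0)) * A' * \<eta> * (?\<tau>' - ?\<tau>)" .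
      have "(norm (x ?\<tau>' - w'))\<^sup>2 \<le> exp (A * (?\<tau>' - t0)) * A' * \<eta> * (?\<tau> - t0) + exp (A * (?\<tau>' - t0)) * A' * \<eta> * (?\<tau>' - ?\<tau>)"
        using w'(2) 1 2 by linarith
      also have "\<dots> = exp (A * (?\<tau>' - t0)) * A' * \<eta> * (?\<tau>' - t0)" by (simp add: algebra_simps)
      finally show ?case using w'(1) by blast
    qed
    from this[of "length ts - 1"] obtain w where w: "(\<theta>, w) \<in> E" "(norm (x \<theta> - w))\<^sup>2 \<le> exp (A * (\<theta> - t0)) * A' * \<eta> * (\<theta> - t0)"
      using partition_nth[OF pt] by auto
    note w(2)
    also have "exp (A * (\<theta> - t0)) * A' * \<eta> * (\<theta> - t0) \<le> exp (A * \<theta>) * A' * \<eta> * \<theta>"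
      using t0 A0 \<eta>(2) by (intro mult_mono) (auto intro!: mult_left_mono)
    finally have "norm (x \<theta> - w) \<le> sqrt (exp (A * \<theta>) * A' * \<eta> * \<theta>)" by (rule real_le_rsqrt)
    moreover have "0 \<le> 2 * K * \<eta>" using K0 \<eta>(2) by simp
    moreover have "(\<theta>, w) \<in> M" using E w(1) by (auto simp: stable_def sect_def)
    ultimately show False using neg t0 unfolding \<rho>_def by fastforce
  qed
  have "\<exists>\<xi>\<in>{t0..\<theta>}. (\<xi>, x \<xi>) \<in> M" if cm: "constructive_motion \<theta> Q h U t0 x0 x" for x
  proof -
    from cm obtain tss vs xs where s: "\<And>j::nat. is_partition t0 \<theta> (tss j)" "\<And>j. admissible_v t0 \<theta> Q (vs j)"
       "\<And>j. step_motion h U t0 x0 (vs j) (tss j) (xs j)" and mesh: "(\<lambda>j. mesh (tss j)) \<longlonglongrightarrow> 0"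
      and ul: "uniform_limit {t0..\<theta>} xs x sequentially" unfolding constructive_motion_def by blast
    define \<eta> where "\<eta> = (\<lambda>j. max 0 (mesh (tss j)))"
    have \<eta>0: "\<eta> \<longlonglongrightarrow> 0" unfolding \<eta>_def using tendsto_max[OF tendsto_const[of 0] mesh] by simp
    have "(\<lambda>j. exp (A * \<theta>) * A' * \<eta> j * \<theta>) \<longlonglongrightarrow> exp (A * \<theta>) * A' * 0 * \<theta>" by (intro tendsto_intros \<eta>0)
    then have ev: "\<forall>\<^sub>F j in sequentially. exp (A * \<theta>) * A' * \<eta> j * \<theta> < 1" by (rule order_tendstoD(2)) simp
    then obtain N where N: "\<And>j. j \<ge> N \<Longrightarrow> exp (A * \<theta>) * A' * \<eta> j * \<theta> < 1" by (auto simp: eventually_sequentially)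
    have "\<exists>\<xi> z. \<xi> \<in> {t0..\<theta>} \<and> (\<xi>, z) \<in> M \<and> norm (xs (j + N) \<xi> - z) \<le> \<rho> (\<eta> (j + N))" for j
      using main[OF s(1)[of "j + N"] s(2)[of "j + N"] s(3)[of "j + N"], of "\<eta> (j + N)"] N[of "j + N"]
      by (auto simp: \<eta>_def)
    then obtain \<Xi> Z where XZ: "\<And>j. \<Xi> j \<in> {t0..\<theta>}" "\<And>j. (\<Xi> j, Z j) \<in> M"
      "\<And>j. norm (xs (j + N) (\<Xi> j) - Z j) \<le> \<rho> (\<eta> (j + N))" by metis
    obtain \<xi> r where \<xi>: "\<xi> \<in> {t0..\<theta>}" and r: "strict_mono r" "(\<Xi> \<circ> r) \<longlonglongrightarrow> \<xi>"
      using compact_Icc[of t0 \<theta>] XZ(1) unfolding compact_def by meson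
    have "continuous_on {t0..\<theta>} x"
    proof (rule uniform_limit_theorem[OF _ ul])
      have "continuous_on {t0..\<theta>} (xs j)" for j
      proof (rule lipschitz_on_continuous_on[of K], rule lipschitz_onI)
        fix a b assume ab: "a \<in> {t0..\<theta>}" "b \<in> {t0..\<theta>}"
        note l = step_lipschitz[OF U s(1)[of j] s(2)[of j] s(3)[of j] _ B1, folded K_def]
        show "dist (xs j a) (xs j b) \<le> K * dist a b"
          using l[of a b] l[of b a] ab t0 by (cases "a \<le> b") (auto simp: dist_norm norm_minus_commute)
      qed (rule K0)
      then show "\<forall>\<^sub>F j in sequentially. continuous_on {t0..\<theta>} (xs j)" by simp
    qed simp
    then have xl: "(\<lambda>j. x (\<Xi> (r j))) \<longlonglongrightarrow> x \<xi>"
      using continuous_on_tendsto_compose[OF _ r(2) \<xi>] XZ(1) by (auto simp: o_def)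
    have N': "filterlim (\<lambda>j. r j + N) sequentially sequentially"
      using filterlim_subseq[OF r(1)] by (rule filterlim_at_top_mono) simp
    have "(\<lambda>j. \<rho> (\<eta> (r j + N))) \<longlonglongrightarrow> \<rho> 0"
      unfolding \<rho>_def using filterlim_compose[OF \<eta>0 N'] by (intro tendsto_intros)
    then have r0: "(\<lambda>j. \<rho> (\<eta> (r j + N))) \<longlonglongrightarrow> 0" by (simp add: \<rho>_def)
    have "(\<lambda>j. xs (r j + N) (\<Xi> (r j)) - Z (r j)) \<longlonglongrightarrow> 0"
      by (rule Lim_null_comparison[OF _ r0]) (use XZ(3) in auto)
    moreover have "(\<lambda>j. xs (r j + N) (\<Xi> (r j)) - x (\<Xi> (r j))) \<longlonglongrightarrow> 0"
    proof (rule tendstoI)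
      fix e :: real assume "0 < e"
      then have "\<forall>\<^sub>F j in sequentially. \<forall>t\<in>{t0..\<theta>}. dist (xs j t) (x t) < e" using uniform_limitD[OF ul] by blast
      then have "\<forall>\<^sub>F j in sequentially. \<forall>t\<in>{t0..\<theta>}. dist (xs (r j + N) t) (x t) < e"
        using N' by (rule eventually_compose_filterlim)
      then show "\<forall>\<^sub>F j in sequentially. dist (xs (r j + N) (\<Xi> (r j)) - x (\<Xi> (r j))) 0 < e"
        by eventually_elim (use XZ(1) in \<open>auto simp: dist_norm\<close>)
    qed
    ultimately have "(\<lambda>j. x (\<Xi> (r j)) + (xs (r j + N) (\<Xi> (r j)) - x (\<Xi> (r j))) - (xs (r j + N) (\<Xi> (r j)) - Z (r j))) \<longlonglongrightarrow> x \<xi> + 0 - 0"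
      by (intro tendsto_intros xl)
    moreover have "a + (b - a) - (b - c) = c" for a b c :: 'x by simp
    ultimately have zl: "(\<lambda>j. Z (r j)) \<longlonglongrightarrow> x \<xi>" by (simp only: diff_zero add_0_right)
    have "(\<lambda>j. (\<Xi> (r j), Z (r j))) \<longlonglongrightarrow> (\<xi>, x \<xi>)"
      by (rule tendsto_Pair[OF _ zl]) (use r(2) in \<open>simp add: o_def\<close>)
    then have "(\<xi>, x \<xi>) \<in> M" by (rule closed_sequentially[OF M_closed, rotated]) (rule XZ(2))
    then show ?thesis using \<xi> by blast
  qed
  then show "p \<in> solvability_set \<theta> P Q h M" unfolding solvability_set_def p0 using U t0 by blast
qed

end

section \<open>Evasion\<close>

text \<open>A recursive form of the mesh bound, including strict increase, so that it unfolds
  together with \<open>evades\<close>.\<close>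

fun mesh_less :: "real \<Rightarrow> real list \<Rightarrow> bool" where
  "mesh_less \<epsilon> (a # b # ts) \<longleftrightarrow> a < b \<and> b - a < \<epsilon> \<and> mesh_less \<epsilon> (b # ts)"
| "mesh_less \<epsilon> ts \<longleftrightarrow> True"

lemma mesh_less_mono: "mesh_less \<epsilon> ts \<Longrightarrow> \<epsilon> \<le> \<epsilon>' \<Longrightarrow> mesh_less \<epsilon>' ts"
  by (induction \<epsilon> ts rule: mesh_less.induct) auto

lemma mesh_less_nth:
  "(\<And>k. k + 1 < length ts \<Longrightarrow> ts ! k < ts ! (k + 1) \<and> ts ! (k + 1) - ts ! k < \<epsilon>) \<Longrightarrow> mesh_less \<epsilon> ts"
proof (induction \<epsilon> ts rule: mesh_less.induct)
  case (1 \<epsilon> a b ts)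
  have "mesh_less \<epsilon> (b # ts)"
  proof (rule 1(1))
    fix k assume "k + 1 < length (b # ts)"
    then show "(b # ts) ! k < (b # ts) ! (k + 1) \<and> (b # ts) ! (k + 1) - (b # ts) ! k < \<epsilon>"
      using 1(2)[of "Suc k"] by simp
  qed
  then show ?case using 1(2)[of 0] by simp
qed auto

lemma mesh_less_le_last: "mesh_less \<epsilon> (a # ts) \<Longrightarrow> a \<le> last (a # ts)"
  by (induction ts arbitrary: a) force+

text \<open>A partition must increase strictly, so the degenerate interval gets the one-element
  list; otherwise there are \<open>n + 1\<close> equal steps.\<close>

definition uniform_partition :: "real \<Rightarrow> real \<Rightarrow> nat \<Rightarrow> real list" where
  "uniform_partition a b n = (if a = b then [a] else map (\<lambda>i. a + real i * ((b - a) / real (Suc n))) [0..<Suc (Suc n)])"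

lemma uniform_partition:
  assumes "a \<le> b"
  shows "is_partition a b (uniform_partition a b n)" "mesh (uniform_partition a b n) \<in> {0..(b - a) / real (Suc n)}"
    and "(b - a) / real (Suc n) < \<epsilon> \<Longrightarrow> mesh_less \<epsilon> (uniform_partition a b n)"
proof -
  let ?ts = "uniform_partition a b n" and ?d = "(b - a) / real (Suc n)"
  have diff: "?ts ! k < ?ts ! (k + 1) \<and> ?ts ! (k + 1) - ?ts ! k = ?d" if "k + 1 < length ?ts" for k
  proof (cases "a = b")
    case False
    then have d: "0 < ?d" using assms by simp
    have "k + 1 < Suc (Suc n)" using that False by (simp add: uniform_partition_def)
    then have "?ts ! k = a + real k * ?d" "?ts ! (k + 1) = a + real (k + 1) * ?d"
      unfolding uniform_partition_def using False by (simp_all del: upt_Suc)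
    moreover have "real (k + 1) * e = real k * e + e" for e :: real by (simp add: distrib_right)
    note this[of ?d]
    ultimately show ?thesis using d by linarith
  qed (use that in \<open>simp add: uniform_partition_def\<close>)
  show "is_partition a b ?ts"
  proof (cases "a = b")
    case False
    then have d: "0 < ?d" using assms by simp
    have "hd ?ts = a" using False by (simp add: uniform_partition_def hd_map upt_rec del: upt_Suc)
    moreover have "last ?ts = b" using False by (simp add: uniform_partition_def)
    moreover have "sorted_wrt (<) ?ts"
    proof -
      have "a + real i * ?d < a + real j * ?d" if "i < j" for i j :: nat
        using mult_strict_right_mono[OF _ d, of "real i" "real j"] that by linarith
      then show ?thesis using False unfolding uniform_partition_def by (simp add: sorted_wrt_iff_nth_less del: upt_Suc)
    qed
    moreover have "?ts \<noteq> []" using False by (simp add: uniform_partition_def)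
    ultimately show ?thesis by (simp add: is_partition_def)
  qed (simp add: is_partition_def uniform_partition_def)
  have S: "{?ts ! (k + 1) - ?ts ! k | k. k + 1 < length ?ts} \<subseteq> {?d}" using diff by auto
  then have f: "finite (insert 0 {?ts ! (k + 1) - ?ts ! k | k. k + 1 < length ?ts})" by (meson finite.intros finite_subset)
  have "mesh ?ts \<le> ?d" unfolding mesh_def
    using f S assms by (subst Max_le_iff) auto
  moreover have "0 \<le> mesh ?ts" unfolding mesh_def using f by (intro Max_ge) auto
  ultimately show "mesh ?ts \<in> {0..?d}" by simp
  show "?d < \<epsilon> \<Longrightarrow> mesh_less \<epsilon> ?ts" using diff by (intro mesh_less_nth) simp
qed

section \<open>The discretized evasion game\<close>

context game
begin

definition far :: "real \<Rightarrow> real \<Rightarrow> 'x \<Rightarrow> bool" where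
  "far \<epsilon> t x \<longleftrightarrow> (\<forall>p\<in>M. \<epsilon> \<le> dist (t, x) p)"

text \<open>The second player announces a constant \<open>v\<close> and the first answers with a
  constant \<open>u\<close>: the information pattern of a counterstrategy facing a control that is
  constant on the interval. Distance is demanded during whole intervals, since motions may hit the
  target between nodes.\<close>

fun evades :: "real \<Rightarrow> real list \<Rightarrow> 'x \<Rightarrow> bool" where
  "evades \<epsilon> [] x \<longleftrightarrow> True"
| "evades \<epsilon> [t] x \<longleftrightarrow> far \<epsilon> t x"
| "evades \<epsilon> (a # b # ts) x \<longleftrightarrow> (\<exists>v\<in>Q. \<forall>u\<in>P. (\<forall>s\<in>{a..b}. far \<epsilon> s (flow (\<lambda>y. h y u v) (s - a) x)) \<and>
     evades \<epsilon> (b # ts) (flow (\<lambda>y. h y u v) (b - a) x))"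

lemma far_mono: "far \<epsilon> t x \<Longrightarrow> \<epsilon>' \<le> \<epsilon> \<Longrightarrow> far \<epsilon>' t x"
  unfolding far_def by (meson order_trans)

lemma evades_mono: "evades \<epsilon> ts x \<Longrightarrow> \<epsilon>' \<le> \<epsilon> \<Longrightarrow> evades \<epsilon>' ts x"
proof (induction \<epsilon> ts x rule: evades.induct)
  case (3 \<epsilon> a b ts x)
  then show ?case by simp (meson far_mono)
qed (auto intro: far_mono)

definition partition_from :: "real \<Rightarrow> real \<Rightarrow> real list \<Rightarrow> bool" where
  "partition_from \<epsilon> t ts \<longleftrightarrow> ts \<noteq> [] \<and> hd ts = t \<and> last ts = \<theta> \<and> mesh_less \<epsilon> ts"

text \<open>One \<open>\<epsilon>\<close> bounds both the mesh and the required distance; hence the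
  sets shrink with \<open>\<epsilon>\<close> and a single limit treats both.\<close>

definition unevaded :: "real \<Rightarrow> (real \<times> 'x) set" where
  "unevaded \<epsilon> = {(t, x). t \<in> {0..\<theta>} \<and> (\<exists>ts. partition_from \<epsilon> t ts \<and> \<not> evades \<epsilon> ts x)}"

text \<open>The closures are taken before the intersection, so positions that only limits of
  starting points reveal belong to it. This gives closedness and suits the compactness argument of
  \<open>bridge_step\<close>.\<close>

definition bridge :: "(real \<times> 'x) set" where
  "bridge = (\<Inter>\<epsilon>\<in>{0<..}. closure (unevaded \<epsilon>))"

lemma unevaded_mono: "\<epsilon> \<le> \<epsilon>' \<Longrightarrow> unevaded \<epsilon> \<subseteq> unevaded \<epsilon>'"
  unfolding unevaded_def partition_from_def using mesh_less_mono evades_mono by blast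

text \<open>The same \<open>v\<close> is offered on every interval. At each node the failure of
  evasion supplies an answer \<open>u\<close>, and play goes on until the target is approached or
  the interval containing \<open>s\<close> is reached, whose left node is then less than the mesh
  bound before \<open>s\<close>. At \<open>s = \<theta>\<close> the list ends, where failure of
  evasion means closeness to the target.\<close>

lemma play:
  assumes v: "v \<in> Q"
  shows "partition_from \<epsilon> t ts \<Longrightarrow> \<not> evades \<epsilon> ts x \<Longrightarrow> 0 \<le> t \<Longrightarrow> t \<le> s \<Longrightarrow> s \<le> \<theta> \<Longrightarrow>
    (\<exists>\<xi>\<in>{t..s}. \<exists>z. \<not> far \<epsilon> \<xi> z \<and> (\<xi> - t, x, z) \<in> reach (hv v) P) \<or>
    (s < \<theta> \<and> (\<exists>r\<in>{t..s}. s < r + \<epsilon> \<and> (\<exists>z. (r, z) \<in> unevaded \<epsilon> \<and> (r - t, x, z) \<in> reach (hv v) P)))"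
proof (induction \<epsilon> ts x arbitrary: t rule: evades.induct)
  case (1 \<epsilon> x)
  then show ?case by (simp add: partition_from_def)
next
  case (2 \<epsilon> a x)
  then have "t = \<theta>" "s = \<theta>" "a = \<theta>" by (auto simp: partition_from_def)
  then show ?case using 2 reach_0[of x "hv v" P] by (intro disjI1 bexI[of _ t] exI[of _ x]) auto
next
  case (3 \<epsilon> a b ts x)
  interpret V: rhs_system "hv v" P by (rule hv_sys[OF v])
  have ab: "a = t" "a < b" "b - a < \<epsilon>" and tl: "partition_from \<epsilon> b (b # ts)" using 3(2) by (auto simp: partition_from_def)
  have b\<theta>: "b \<le> \<theta>" using mesh_less_le_last[of \<epsilon> b ts] tl by (simp add: partition_from_def)
  show ?case
  proof (cases "s < b")
    case True
    have "(t, x) \<in> unevaded \<epsilon>" unfolding unevaded_def using 3(2-6) by (auto simp del: evades.simps)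
    then show ?thesis using True b\<theta> ab 3(5) reach_0[of x "hv v" P]
      by (intro disjI2 conjI bexI[of _ t] exI[of _ x]) auto
  next
    case False
    have "\<forall>v\<in>Q. \<exists>u\<in>P. (\<exists>s\<in>{a..b}. \<not> far \<epsilon> s (flow (\<lambda>y. h y u v) (s - a) x)) \<or>
      \<not> evades \<epsilon> (b # ts) (flow (\<lambda>y. h y u v) (b - a) x)" using 3(3) by simp
    with v obtain u where u: "u \<in> P" and alt: "(\<exists>s\<in>{a..b}. \<not> far \<epsilon> s (flow (\<lambda>y. h y u v) (s - a) x)) \<or>
      \<not> evades \<epsilon> (b # ts) (flow (\<lambda>y. h y u v) (b - a) x)" by blast
    from alt show ?thesis
    proof
      assume "\<exists>s\<in>{a..b}. \<not> far \<epsilon> s (flow (\<lambda>y. h y u v) (s - a) x)"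
      then obtain s1 where "s1 \<in> {a..b}" "\<not> far \<epsilon> s1 (flow (\<lambda>y. h y u v) (s1 - a) x)" by blast
      then show ?thesis using V.motion_const[OF u, of "s1 - a" x] ab False
        by (intro disjI1 bexI[of _ s1] exI[of _ "flow (\<lambda>y. h y u v) (s1 - a) x"]) auto
    next
      let ?y = "flow (\<lambda>y. h y u v) (b - a) x"
      assume "\<not> evades \<epsilon> (b # ts) ?y"
      from 3(1)[OF v u tl this] ab 3(4,6) False
      have IH: "(\<exists>\<xi>\<in>{b..s}. \<exists>z. \<not> far \<epsilon> \<xi> z \<and> (\<xi> - b, ?y, z) \<in> reach (hv v) P) \<or>
        (s < \<theta> \<and> (\<exists>r\<in>{b..s}. s < r + \<epsilon> \<and> (\<exists>z. (r, z) \<in> unevaded \<epsilon> \<and> (r - b, ?y, z) \<in> reach (hv v) P)))"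
        by auto
      have tr: "(r - t, x, z) \<in> reach (hv v) P" if "(r - b, ?y, z) \<in> reach (hv v) P" for r z
        using V.reach_trans[OF V.motion_const[OF u, of "b - a" x] that] ab by simp
      from IH show ?thesis
      proof
        assume "\<exists>\<xi>\<in>{b..s}. \<exists>z. \<not> far \<epsilon> \<xi> z \<and> (\<xi> - b, ?y, z) \<in> reach (hv v) P"
        then obtain \<xi> z where "\<xi> \<in> {b..s}" "\<not> far \<epsilon> \<xi> z" "(\<xi> - b, ?y, z) \<in> reach (hv v) P" by blast
        then show ?thesis using tr ab by (intro disjI1 bexI[of _ \<xi>] exI[of _ z]) auto
      next
        assume "s < \<theta> \<and> (\<exists>r\<in>{b..s}. s < r + \<epsilon> \<and> (\<exists>z. (r, z) \<in> unevaded \<epsilon> \<and> (r - b, ?y, z) \<in> reach (hv v) P))"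
        then obtain r z where "s < \<theta>" "r \<in> {b..s}" "s < r + \<epsilon>" "(r, z) \<in> unevaded \<epsilon>" "(r - b, ?y, z) \<in> reach (hv v) P" by blast
        then show ?thesis using tr ab by (intro disjI2 conjI bexI[of _ r] exI[of _ z]) auto
      qed
    qed
  qed
qed

text \<open>From starting points tending to \<open>(t, x)\<close> the game is played with mesh and
  distance tending to 0. Growth bounds make the stopping times and positions converge along a
  subsequence, and \<open>reach\<close> is closed under such limits.\<close>

lemma bridge_step:
  assumes D: "(t, x) \<in> bridge" and v: "v \<in> Q" and s: "t \<le> s" "s \<le> \<theta>" "t < s \<or> s = \<theta>"
  shows "(\<exists>\<xi>\<in>{t..s}. \<exists>z. (\<xi>, z) \<in> M \<and> (\<xi> - t, x, z) \<in> reach (hv v) P) \<or>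
    (s < \<theta> \<and> (\<exists>z. (s, z) \<in> bridge \<and> (s - t, x, z) \<in> reach (hv v) P))"
proof -
  interpret V: rhs_system "hv v" P by (rule hv_sys[OF v])
  define \<epsilon> where "\<epsilon> = (\<lambda>n. 1 / real (Suc n))"
  have \<epsilon>: "0 < \<epsilon> n" for n by (simp add: \<epsilon>_def)
  have \<epsilon>0: "\<epsilon> \<longlonglongrightarrow> 0" unfolding \<epsilon>_def using LIMSEQ_inverse_real_of_nat by (simp add: inverse_eq_divide)
  have "\<exists>\<tau> y \<xi> z. dist (\<tau>, y) (t, x) < \<epsilon> n \<and> 0 \<le> \<tau> \<and> \<xi> \<in> {\<tau>..s} \<and> (\<xi> - \<tau>, y, z) \<in> reach (hv v) P \<and>
    (\<not> far (\<epsilon> n) \<xi> z \<or> (s < \<theta> \<and> s < \<xi> + \<epsilon> n \<and> (\<xi>, z) \<in> unevaded (\<epsilon> n)))" for n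
  proof -
    \<comment> \<open>Ensures \<open>\<tau> \<le> s\<close>: for \<open>t < s\<close> the start is
      within \<open>s - t\<close> of \<open>t\<close>, and for \<open>s = \<theta>\<close> every
      start qualifies.\<close>
    define d where "d = (if t < s then min (\<epsilon> n) (s - t) else \<epsilon> n)"
    have d: "0 < d" "d \<le> \<epsilon> n" using \<epsilon>[of n] by (auto simp: d_def)
    have "(t, x) \<in> closure (unevaded (\<epsilon> n))" using D \<epsilon>[of n] by (auto simp: bridge_def)
    then obtain \<tau> y where y: "(\<tau>, y) \<in> unevaded (\<epsilon> n)" "dist (\<tau>, y) (t, x) < d"
      using d(1) unfolding closure_approachable by (metis surj_pair)
    then obtain ts where ts: "0 \<le> \<tau>" "\<tau> \<le> \<theta>" "partition_from (\<epsilon> n) \<tau> ts" "\<not> evades (\<epsilon> n) ts y" by (auto simp: unevaded_def)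
    have "dist \<tau> t < d" using y(2) dist_fst_le[of "(\<tau>, y)" "(t, x)"] by simp
    then have "\<tau> \<le> s" using s ts(2) unfolding d_def dist_real_def by (cases "t < s") auto
    from play[OF v ts(3,4,1) this s(2)]
    obtain \<xi> z where "\<xi> \<in> {\<tau>..s}" "(\<xi> - \<tau>, y, z) \<in> reach (hv v) P"
      "\<not> far (\<epsilon> n) \<xi> z \<or> (s < \<theta> \<and> s < \<xi> + \<epsilon> n \<and> (\<xi>, z) \<in> unevaded (\<epsilon> n))" by blast
    moreover have "dist (\<tau>, y) (t, x) < \<epsilon> n" using y(2) d(2) by simp
    ultimately show ?thesis using ts(1) by blast
  qed
  then obtain \<tau> y \<xi> z where near: "\<And>n. dist (\<tau> n, y n) (t, x) < \<epsilon> n" and \<tau>: "\<And>n. 0 \<le> \<tau> n" and \<xi>: "\<And>n. \<xi> n \<in> {\<tau> n..s}"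
    and rch: "\<And>n. (\<xi> n - \<tau> n, y n, z n) \<in> reach (hv v) P"
    and alt: "\<And>n. \<not> far (\<epsilon> n) (\<xi> n) (z n) \<or> (s < \<theta> \<and> s < \<xi> n + \<epsilon> n \<and> (\<xi> n, z n) \<in> unevaded (\<epsilon> n))"
    by metis
  have lim: "(\<lambda>n. (\<tau> n, y n)) \<longlonglongrightarrow> (t, x)"
    unfolding tendsto_dist_iff[of _ "(t, x)"]
    by (rule Lim_null_comparison[OF _ \<epsilon>0]) (use near in \<open>auto intro!: always_eventually less_imp_le\<close>)
  have \<tau>l: "\<tau> \<longlonglongrightarrow> t" and yl: "y \<longlonglongrightarrow> x" using tendsto_fst[OF lim] tendsto_snd[OF lim] by simp_all
  define R where "R = (2 + norm x) * exp (V.growth_const * \<theta>)"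
  have zR: "norm (z n) \<le> R" for n
  proof -
    have "norm (y n - x) < 1"
    proof -
      have "dist (y n) x < \<epsilon> n" using near[of n] dist_snd_le[of "(\<tau> n, y n)" "(t, x)"] by simp
      moreover have "\<epsilon> n \<le> 1" by (simp add: \<epsilon>_def)
      ultimately show ?thesis by (simp add: dist_norm)
    qed
    then have "norm (y n) \<le> 1 + norm x" using norm_triangle_ineq2[of "y n" x] by linarith
    have "1 + norm (z n) \<le> (1 + norm (y n)) * exp (V.growth_const * (\<xi> n - \<tau> n))" by (rule V.reach_move(3)[OF rch])
    also have "\<dots> \<le> (2 + norm x) * exp (V.growth_const * \<theta>)"
      using \<open>norm (y n) \<le> 1 + norm x\<close> \<xi>[of n] \<tau>[of n] s V.growth_const_nonneg by (intro mult_mono) (auto intro!: mult_left_mono)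
    finally show ?thesis by (simp add: R_def)
  qed
  have "(\<xi> n, z n) \<in> {0..\<theta>} \<times> cball 0 R" for n using \<xi>[of n] \<tau>[of n] s zR[of n] by auto
  moreover have "compact ({0..\<theta>} \<times> cball (0 :: 'x) R)" by (intro compact_Times) auto
  ultimately obtain p r where p: "strict_mono r" "((\<lambda>n. (\<xi> n, z n)) \<circ> r) \<longlonglongrightarrow> p"
    unfolding compact_def by meson
  obtain \<xi>' z' where p': "p = (\<xi>', z')" by (cases p)
  have pl: "(\<lambda>n. (\<xi> (r n), z (r n))) \<longlonglongrightarrow> (\<xi>', z')" using p(2) p' by (simp add: o_def)
  have \<xi>l: "(\<lambda>n. \<xi> (r n)) \<longlonglongrightarrow> \<xi>'" and zl: "(\<lambda>n. z (r n)) \<longlonglongrightarrow> z'" using tendsto_fst[OF pl] tendsto_snd[OF pl] by auto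
  have \<tau>r: "(\<lambda>n. \<tau> (r n)) \<longlonglongrightarrow> t" and yr: "(\<lambda>n. y (r n)) \<longlonglongrightarrow> x" and \<epsilon>r: "(\<lambda>n. \<epsilon> (r n)) \<longlonglongrightarrow> 0"
    using LIMSEQ_subseq_LIMSEQ[OF \<tau>l p(1)] LIMSEQ_subseq_LIMSEQ[OF yl p(1)] LIMSEQ_subseq_LIMSEQ[OF \<epsilon>0 p(1)]
    by (auto simp: o_def)
  have re: "(\<xi>' - t, x, z') \<in> reach (hv v) P"
    by (rule reach_limit[of "\<lambda>n. \<xi> (r n) - \<tau> (r n)" "\<lambda>n. y (r n)" "\<lambda>n. z (r n)"])
       (auto intro!: tendsto_intros \<xi>l \<tau>r yr zl rch)
  have \<xi>': "t \<le> \<xi>'" "\<xi>' \<le> s"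
    using LIMSEQ_le[OF \<tau>r \<xi>l] LIMSEQ_le_const2[OF \<xi>l, of s] \<xi> by fastforce+
  show ?thesis
  \<comment> \<open>If closeness to the target recurs, the limit lies in the closed set
    \<open>M\<close>. Otherwise the stopping points are eventually unevaded nodes shortly before
    \<open>s\<close>, so the limit is at time \<open>s\<close> and in the bridge.\<close>
  proof (cases "\<exists>\<^sub>F n in sequentially. \<not> far (\<epsilon> (r n)) (\<xi> (r n)) (z (r n))")
    case True
    have "(\<xi>', z') \<in> closure M" unfolding closure_approachable
    proof (intro allI impI)
      fix e :: real assume "0 < e"
      then have "\<forall>\<^sub>F n in sequentially. dist (\<xi> (r n), z (r n)) (\<xi>', z') < e / 2" "\<forall>\<^sub>F n in sequentially. \<epsilon> (r n) < e / 2"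
        using tendstoD[OF pl, of "e / 2"] order_tendstoD(2)[OF \<epsilon>r, of "e / 2"] by auto
      then have "\<forall>\<^sub>F n in sequentially. dist (\<xi> (r n), z (r n)) (\<xi>', z') < e / 2 \<and> \<epsilon> (r n) < e / 2"
        by (rule eventually_conj)
      from frequently_eventually_conj[OF True this] obtain n where
        n: "\<not> far (\<epsilon> (r n)) (\<xi> (r n)) (z (r n))" "dist (\<xi> (r n), z (r n)) (\<xi>', z') < e / 2" "\<epsilon> (r n) < e / 2"
        using frequently_ex by blast
      then obtain m where m: "m \<in> M" "dist (\<xi> (r n), z (r n)) m < \<epsilon> (r n)" by (auto simp: far_def not_le)
      have "dist m (\<xi>', z') < e" using n m dist_triangle[of m "(\<xi>', z')" "(\<xi> (r n), z (r n))"] by (simp add: dist_commute)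
      then show "\<exists>m\<in>M. dist m (\<xi>', z') < e" using m(1) by blast
    qed
    then have "(\<xi>', z') \<in> M" using M_closed by simp
    then show ?thesis using re \<xi>' by (intro disjI1 bexI[of _ \<xi>']) auto
  next
    case False
    then have ev: "\<forall>\<^sub>F n in sequentially. s < \<theta> \<and> s < \<xi> (r n) + \<epsilon> (r n) \<and> (\<xi> (r n), z (r n)) \<in> unevaded (\<epsilon> (r n))"
      unfolding not_frequently by (rule eventually_mono) (use alt in auto)
    then have s\<theta>: "s < \<theta>" using eventually_happens'[OF sequentially_bot] by fastforce
    have "s \<le> \<xi>' + 0"
      by (rule tendsto_lowerbound[OF tendsto_add[OF \<xi>l \<epsilon>r]]) (use ev in \<open>auto elim: eventually_mono\<close>)
    then have "\<xi>' = s" using \<xi>' by simp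
    moreover have "(\<xi>', z') \<in> closure (unevaded e)" if "0 < e" for e
    proof (rule Lim_in_closed_set[OF closed_closure _ sequentially_bot pl])
      have "\<forall>\<^sub>F n in sequentially. \<epsilon> (r n) < e" using order_tendstoD(2)[OF \<epsilon>r that] .
      with ev show "\<forall>\<^sub>F n in sequentially. (\<xi> (r n), z (r n)) \<in> closure (unevaded e)"
      proof eventually_elim
        case (elim n)
        then show ?case using unevaded_mono[of "\<epsilon> (r n)" e] closure_subset by auto
      qed
    qed
    ultimately have "(s, z') \<in> bridge" by (auto simp: bridge_def)
    then show ?thesis using re s\<theta> \<open>\<xi>' = s\<close> by blast
  qed
qed

lemma bridge_subset: "bridge \<subseteq> {0..\<theta>} \<times> UNIV"
proof -
  have "bridge \<subseteq> closure (unevaded 1)" by (auto simp: bridge_def)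
  also have "\<dots> \<subseteq> {0..\<theta>} \<times> UNIV"
    by (rule closure_minimal) (auto simp: unevaded_def intro: closed_Times)
  finally show ?thesis .
qed

text \<open>At the terminal time \<open>bridge_step\<close> leaves only the target alternative, and
  zero duration cannot move the point. The case \<open>s = t < \<theta>\<close>, outside its scope,
  holds by staying in place.\<close>

lemma stable_bridge: "stable bridge"
  unfolding stable_def
proof (intro conjI allI impI ballI bridge_subset)
  show "closed bridge" unfolding bridge_def by (intro closed_INT ballI closed_closure)
  show "sect bridge \<theta> \<subseteq> sect M \<theta>"
  proof
    fix x assume "x \<in> sect bridge \<theta>"
    then have x: "(\<theta>, x) \<in> bridge" by (simp add: sect_def)
    obtain v where v: "v \<in> Q" using Q by blast
    interpret V: rhs_system "hv v" P by (rule hv_sys[OF v])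
    obtain z where "(\<theta>, z) \<in> M" "(0, x, z) \<in> reach (hv v) P" using bridge_step[OF x v, of \<theta>] by auto
    then show "x \<in> sect M \<theta>" using V.reach_move(2)[of 0 x z] by (simp add: sect_def)
  qed
  fix t x v s assume D: "(t, x) \<in> bridge" and v: "v \<in> Q" and s: "s \<in> {t..\<theta>}"
  show "(\<exists>\<xi>\<in>{t..s}. \<exists>z. (\<xi>, z) \<in> M \<and> (\<xi> - t, x, z) \<in> reach (hv v) P) \<or>
        (\<exists>z. (s, z) \<in> bridge \<and> (s - t, x, z) \<in> reach (hv v) P)"
  proof (cases "t < s \<or> s = \<theta>")
    case True then show ?thesis using bridge_step[OF D v _ _ True] s by auto
  next
    case False
    then have "s = t" using s by auto
    then show ?thesis using D reach_0[of x "hv v" P] by auto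
  qed
qed

section \<open>Evasion against a given counterstrategy\<close>

lemma flow_has_integral:
  assumes v: "v \<in> Q" and u: "u \<in> P" and ab: "a \<le> b"
  shows "((\<lambda>s. h (flow (\<lambda>y. h y u v) (s - a) x) u v) has_integral (flow (\<lambda>y. h y u v) (b - a) x - x)) {a..b}"
proof -
  interpret V: rhs_system "hv v" P by (rule hv_sys[OF v])
  let ?y = "\<lambda>s. flow (\<lambda>y. h y u v) s x"
  have "((\<lambda>s. h (?y (s - a)) u v) has_integral ((\<lambda>s. ?y (s - a)) b - (\<lambda>s. ?y (s - a)) a)) {a..b}"
  proof (rule fundamental_theorem_of_calculus[OF ab])
    fix s assume s: "s \<in> {a..b}"
    have "(?y has_vector_derivative h (?y (s - a)) u v) (at (s - a) within {0..})"
      using V.flow_sol[OF u, of x] s by (simp add: is_forward_sol_def)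
    then have "(?y has_vector_derivative h (?y (s - a)) u v) (at (s - a) within (\<lambda>s. s - a) ` {a..b})"
      by (rule has_vector_derivative_within_subset) auto
    then have "(?y \<circ> (\<lambda>s. s - a) has_vector_derivative 1 *\<^sub>R h (?y (s - a)) u v) (at s within {a..b})"
    proof (rule vector_diff_chain_within[rotated])
      show "((\<lambda>s. s - a) has_vector_derivative 1) (at s within {a..b})" by (auto intro!: derivative_eq_intros)
    qed
    then show "((\<lambda>s. ?y (s - a)) has_vector_derivative h (?y (s - a)) u v) (at s within {a..b})" by (simp add: o_def)
  qed
  then show ?thesis using V.flow_0[OF u] by simp
qed

lemma evading_motion:
  assumes U: "counterstrategy P Q U"
  shows "evades \<epsilon> ts x \<Longrightarrow> partition_from \<epsilon>' a ts \<Longrightarrow>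
    \<exists>v y. v \<in> borel_measurable lebesgue \<and> (\<forall>t. v t \<in> Q) \<and> step_motion h U a x v ts y \<and> (\<forall>s\<in>{a..\<theta>}. far \<epsilon> s (y s))"
proof (induction \<epsilon> ts x arbitrary: a rule: evades.induct)
  case (1 \<epsilon> x)
  then show ?case by (simp add: partition_from_def)
next
  case (2 \<epsilon> b x)
  obtain v0 where "v0 \<in> Q" using Q by blast
  moreover have "a = \<theta>" "b = \<theta>" using 2 by (auto simp: partition_from_def)
  ultimately show ?case using 2(1) by (intro exI[of _ "\<lambda>_. v0"] exI[of _ "\<lambda>_. x"]) (auto simp: step_motion_def)
next
  case (3 \<epsilon> c b ts x)
  have ab: "c = a" "a < b" and tl: "partition_from \<epsilon>' b (b # ts)" using 3(3) by (auto simp: partition_from_def)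
  obtain v0 where v0: "v0 \<in> Q" and ev: "\<And>u. u \<in> P \<Longrightarrow> (\<forall>s\<in>{a..b}. far \<epsilon> s (flow (\<lambda>y. h y u v0) (s - a) x)) \<and>
     evades \<epsilon> (b # ts) (flow (\<lambda>y. h y u v0) (b - a) x)" using 3(2) ab by auto
  define u where "u = U a x v0"
  have u: "u \<in> P" using U v0 by (auto simp: counterstrategy_def u_def)
  interpret V: rhs_system "hv v0" P by (rule hv_sys[OF v0])
  let ?y = "\<lambda>s. flow (\<lambda>y. h y u v0) (s - a) x"
  from 3(1)[OF v0 u, of b] ev[OF u] tl ab obtain v' y' where
    v': "v' \<in> borel_measurable lebesgue" "\<And>t. v' t \<in> Q" and y': "step_motion h U b (?y b) v' (b # ts) y'"
    and f': "\<forall>s\<in>{b..\<theta>}. far \<epsilon> s (y' s)" by auto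
  define v where "v = (\<lambda>t. if t < b then v0 else v' t)"
  define y where "y = (\<lambda>t. if t < b then ?y t else y' t)"
  have y'b: "y' b = ?y b" using y' by (simp add: step_motion_def)
  have yle: "y t = ?y t" if "t \<le> b" for t using that y'b by (auto simp: y_def)
  have ya: "y a = x" using yle[of a] ab V.flow_0[OF u] by simp
  have bge: "b \<le> (b # ts) ! k" if "k < length (b # ts)" for k
    using tl that
  proof (induction k)
    case (Suc k)
    have "(b # ts) ! k < (b # ts) ! Suc k"
      using Suc.prems
    proof (induction ts arbitrary: b k)
      case (Cons c ts)
      then show ?case by (cases k) (auto simp: partition_from_def split: if_splits)
    qed simp
    then show ?case using Suc by simp
  qed simp
  have "step_motion h U a x v (c # b # ts) y" unfolding step_motion_def
  proof (intro conjI allI impI ballI)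
    show "y a = x" by (rule ya)
    fix k t assume k: "k + 1 < length (c # b # ts)" and t: "t \<in> {(c # b # ts) ! k..(c # b # ts) ! (k + 1)}"
    show "((\<lambda>s. h (y s) (U ((c # b # ts) ! k) (y ((c # b # ts) ! k)) (v s)) (v s)) has_integral y t - y ((c # b # ts) ! k)) {(c # b # ts) ! k..t}"
    proof (cases k)
      case 0
      then have t: "a \<le> t" "t \<le> b" using t ab by auto
      have "((\<lambda>s. h (?y s) u v0) has_integral (?y t - x)) {a..t}" by (rule flow_has_integral[OF v0 u t(1)])
      \<comment> \<open>At the right end \<open>b\<close> the control already belongs to the tail;
        one point does not affect the integral.\<close>
      then have "((\<lambda>s. h (y s) (U a x (v s)) (v s)) has_integral (?y t - x)) {a..t}"
        by (rule has_integral_spike_finite[of "{b}", rotated 2]) (use t in \<open>auto simp: y_def v_def u_def\<close>)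
      then show ?thesis using 0 ab yle[OF t(2)] ya by simp
    next
      case (Suc j)
      let ?c = "(b # ts) ! j"
      have j: "j + 1 < length (b # ts)" using k Suc by simp
      have cb: "b \<le> ?c" by (rule bge) (use j in simp)
      have t': "t \<in> {?c..(b # ts) ! (j + 1)}" using t Suc by simp
      have "\<forall>k. k + 1 < length (b # ts) \<longrightarrow> (\<forall>t\<in>{(b # ts) ! k..(b # ts) ! (k + 1)}.
        ((\<lambda>s. h (y' s) (U ((b # ts) ! k) (y' ((b # ts) ! k)) (v' s)) (v' s)) has_integral (y' t - y' ((b # ts) ! k))) {(b # ts) ! k..t})"
        by (rule y'[unfolded step_motion_def, THEN conjunct2])
      from this[rule_format, OF j t']
      have 1: "((\<lambda>s. h (y' s) (U ?c (y' ?c) (v' s)) (v' s)) has_integral y' t - y' ?c) {?c..t}" .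
      have eq: "y s = y' s" "v s = v' s" if "?c \<le> s" for s using cb that by (auto simp: y_def v_def)
      have "((\<lambda>s. h (y s) (U ?c (y' ?c) (v s)) (v s)) has_integral y' t - y' ?c) {?c..t}"
      proof (rule has_integral_eq[OF _ 1])
        fix s assume "s \<in> {?c..t}"
        then have "?c \<le> s" by simp
        then show "h (y' s) (U ?c (y' ?c) (v' s)) (v' s) = h (y s) (U ?c (y' ?c) (v s)) (v s)" by (simp only: eq)
      qed
      moreover have "y ?c = y' ?c" "y t = y' t" using eq(1)[of ?c] eq(1)[of t] t' by auto
      ultimately have "((\<lambda>s. h (y s) (U ?c (y ?c) (v s)) (v s)) has_integral y t - y ?c) {?c..t}" by (simp only:)
      then show ?thesis using Suc by simp
    qed
  qed
  moreover have "v \<in> borel_measurable lebesgue" unfolding v_def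
    using v'(1) by (intro measurable_If) (auto simp: pred_def)
  moreover have "\<forall>t. v t \<in> Q" using v0 v'(2) by (simp add: v_def)
  moreover have "\<forall>s\<in>{a..\<theta>}. far \<epsilon> s (y s)" using ev[OF u] f' by (auto simp: y_def)
  ultimately show ?case by blast
qed

text \<open>Outside the bridge, evasion at a fixed distance succeeds for all sufficiently fine
  partitions. The evading motions against the given strategy are uniformly bounded and
  equi-Lipschitz, so a subsequence converges to a constructive motion, which therefore misses the
  target.\<close>

lemma solvability_subset_bridge: "solvability_set \<theta> P Q h M \<subseteq> bridge"
proof
  fix p assume p: "p \<in> solvability_set \<theta> P Q h M"
  obtain t0 x0 where p0: "p = (t0, x0)" by (cases p)
  from p p0 obtain U where t0: "t0 \<in> {0..\<theta>}" and U: "counterstrategy P Q U"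
    and win: "\<And>x. constructive_motion \<theta> Q h U t0 x0 x \<Longrightarrow> \<exists>\<xi>\<in>{t0..\<theta>}. (\<xi>, x \<xi>) \<in> M"
    unfolding solvability_set_def by blast
  show "p \<in> bridge"
  proof (rule ccontr)
    assume "p \<notin> bridge"
    then obtain \<epsilon> where \<epsilon>: "0 < \<epsilon>" "p \<notin> closure (unevaded \<epsilon>)" by (auto simp: bridge_def)
    then have "p \<notin> unevaded \<epsilon>" using closure_subset by blast
    then have ev: "\<And>ts. partition_from \<epsilon> t0 ts \<Longrightarrow> evades \<epsilon> ts x0" using t0 p0 by (auto simp: unevaded_def)
    let ?ts = "uniform_partition t0 \<theta>"
    have t0': "t0 \<le> \<theta>" "0 \<le> t0" using t0 by auto
    have lim: "(\<lambda>n. (\<theta> - t0) / real (Suc n)) \<longlonglongrightarrow> 0"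
      using tendsto_mult_right_zero[OF LIMSEQ_inverse_real_of_nat, of "\<theta> - t0"] by (simp add: divide_inverse)
    then have "\<forall>\<^sub>F n in sequentially. (\<theta> - t0) / real (Suc n) < \<epsilon>" using \<epsilon>(1) by (rule order_tendstoD(2))
    then obtain N where N: "\<And>n. n \<ge> N \<Longrightarrow> (\<theta> - t0) / real (Suc n) < \<epsilon>" by (auto simp: eventually_sequentially)
    have "\<exists>v y. v \<in> borel_measurable lebesgue \<and> (\<forall>t. v t \<in> Q) \<and> step_motion h U t0 x0 v (?ts (j + N)) y \<and> (\<forall>s\<in>{t0..\<theta>}. far \<epsilon> s (y s))" for j
    proof -
      have "partition_from \<epsilon> t0 (?ts (j + N))"
        using uniform_partition(1,3)[OF t0'(1), of "j + N"] N[of "j + N"] by (auto simp: partition_from_def is_partition_def)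
      then show ?thesis using evading_motion[OF U ev] by blast
    qed
    then obtain v y where v: "\<And>j. v j \<in> borel_measurable lebesgue" "\<And>j t. v j t \<in> Q"
      and y: "\<And>j. step_motion h U t0 x0 (v j) (?ts (j + N)) (y j)" and f: "\<And>j s. s \<in> {t0..\<theta>} \<Longrightarrow> far \<epsilon> s (y j s)"
      by metis
    have adm: "admissible_v t0 \<theta> Q (v j)" for j using v by (simp add: admissible_v_def)
    note pt = uniform_partition(1)[OF t0'(1)]
    define B where "B = (1 + norm x0) * exp (J.growth_const * \<theta>)"
    have bd: "norm (y j s) \<le> B" if "s \<in> {t0..\<theta>}" for j s
      using step_growth[OF U pt adm y[of j] t0'(2) that] unfolding B_def by linarith
    define K where "K = J.growth_const * (1 + B)"
    have K0: "0 \<le> K" using J.growth_const_nonneg by (simp add: K_def B_def)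
    have lip: "norm (y j s - y j t) \<le> K * \<bar>s - t\<bar>" if "s \<in> {t0..\<theta>}" "t \<in> {t0..\<theta>}" for j s t
      using step_lipschitz[OF U pt adm y t0'(2), of B s t j] step_lipschitz[OF U pt adm y t0'(2), of B t s j] that
      by (cases "s \<le> t") (auto simp: K_def B_def norm_minus_commute)
    obtain x k where k: "strict_mono (k :: nat \<Rightarrow> nat)"
      and ul: "\<And>e. 0 < e \<Longrightarrow> \<exists>N. \<forall>n s. n \<ge> N \<and> s \<in> {t0..\<theta>} \<longrightarrow> norm (y (k n) s - x s) < e"
    proof (rule Arzela_Ascoli[of "{t0..\<theta>}" y B])
      fix s e :: real assume s: "s \<in> {t0..\<theta>}" and e: "0 < e"
      show "\<exists>d. 0 < d \<and> (\<forall>n t. t \<in> {t0..\<theta>} \<and> norm (s - t) < d \<longrightarrow> norm (y n s - y n t) < e)"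
      proof (intro exI[of _ "e / (K + 1)"] conjI allI impI)
        show "0 < e / (K + 1)" using e K0 by simp
        fix n t assume t: "t \<in> {t0..\<theta>} \<and> norm (s - t) < e / (K + 1)"
        have "norm (y n s - y n t) \<le> K * \<bar>s - t\<bar>" using lip s t by blast
        also have "\<dots> \<le> (K + 1) * \<bar>s - t\<bar>" by (intro mult_right_mono) auto
        also have "\<dots> < e" using t K0 by (simp add: field_simps)
        finally show "norm (y n s - y n t) < e" .
      qed
    qed (use bd in auto)
    have "constructive_motion \<theta> Q h U t0 x0 x" unfolding constructive_motion_def
    proof (intro exI conjI allI)
      show "is_partition t0 \<theta> (?ts (k j + N))" "admissible_v t0 \<theta> Q (v (k j))" "step_motion h U t0 x0 (v (k j)) (?ts (k j + N)) (y (k j))" for j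
        by (rule pt adm y)+
      have "(\<lambda>n. mesh (?ts n)) \<longlonglongrightarrow> 0"
        by (rule Lim_null_comparison[OF _ lim]) (use uniform_partition(2)[OF t0'(1)] in \<open>auto simp del: of_nat_Suc\<close>)
      moreover have "filterlim (\<lambda>j. k j + N) sequentially sequentially"
        using filterlim_subseq[OF k] by (rule filterlim_at_top_mono) simp
      ultimately show "(\<lambda>j. mesh (?ts (k j + N))) \<longlonglongrightarrow> 0" by (rule filterlim_compose)
      show "uniform_limit {t0..\<theta>} (\<lambda>j. y (k j)) x sequentially"
        unfolding uniform_limit_sequentially_iff dist_norm using ul by blast
    qed
    from win[OF this] obtain \<xi> where \<xi>: "\<xi> \<in> {t0..\<theta>}" "(\<xi>, x \<xi>) \<in> M" by blast
    from ul[OF \<epsilon>(1)] obtain n where "norm (y (k n) \<xi> - x \<xi>) < \<epsilon>" using \<xi>(1) by blast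
    moreover have "\<epsilon> \<le> dist (\<xi>, y (k n) \<xi>) (\<xi>, x \<xi>)" using f[OF \<xi>(1), of "k n"] \<xi>(2) by (auto simp: far_def)
    ultimately show False by (simp add: dist_Pair_Pair dist_norm)
  qed
qed

text \<open>Since every stable set lies in the solvability set, \<open>bridge\<close> is also the
  largest stable set.\<close>

theorem solvability_eq_bridge: "solvability_set \<theta> P Q h M = bridge"
  using solvability_subset_bridge stable_subset_solvability[OF stable_bridge] by (rule antisym)

end

section \<open>Solvability sets\<close>

lemma local_sol_shift:
  assumes y: "local_sol F T y" and t: "0 \<le> t" "t + d \<le> T"
  shows "local_sol F d (\<lambda>r. y (t + r))"
  unfolding local_sol_def
proof
  fix r assume r: "r \<in> {0..d}"
  have "(y has_vector_derivative F (y (t + r))) (at (t + r) within {0..T})"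
    using y r t by (simp add: local_sol_def)
  then have "(y has_vector_derivative F (y (t + r))) (at (t + r) within (\<lambda>r. t + r) ` {0..d})"
    by (rule has_vector_derivative_within_subset) (use t in auto)
  then have "(y \<circ> (\<lambda>r. t + r) has_vector_derivative 1 *\<^sub>R F (y (t + r))) (at r within {0..d})"
  proof (rule vector_diff_chain_within[rotated])
    show "((\<lambda>r. t + r) has_vector_derivative 1) (at r within {0..d})" by (auto intro!: derivative_eq_intros)
  qed
  then show "((\<lambda>r. y (t + r)) has_vector_derivative F (y (t + r))) (at r within {0..d})" by (simp add: o_def)
qed

text \<open>The target is hit at once. Together with \<open>solvability_eq_bridge\<close> this
  places the target inside the bridge.\<close>

lemma (in game) stable_target: "stable M"
  unfolding stable_def using M_closed M_sub reach_0 by fastforce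

context augmented
begin

lemma reach_f_fs:
  assumes v: "v \<in> Q" and r: "(\<tau>, x, z) \<in> reach (\<lambda>x u. f x u v) P"
  shows "(\<tau>, x, z) \<in> reach (\<lambda>x z. fs x z v) Ps"
proof -
  obtain w0 where w0: "w0 \<in> \<Omega>" using Om by blast
  let ?m = "map (\<lambda>(d, u). (d, 1 :: real, u, w0))"
  have "steps_in P l \<Longrightarrow> steps_in Ps (?m l)" "duration (?m l) = duration l"
    "lflow (\<lambda>x z. fs x z v) (?m l) x = lflow (\<lambda>x u. f x u v) l x" for l x
    by (induction l arbitrary: x) (use w0 in \<open>auto simp: Pstar_def\<close>)
  moreover obtain l X where "\<And>n::nat. steps_in P (l n)" "(\<lambda>n. duration (l n)) \<longlonglongrightarrow> \<tau>" "X \<longlonglongrightarrow> x"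
    "(\<lambda>n. lflow (\<lambda>x u. f x u v) (l n) (X n)) \<longlonglongrightarrow> z" using r unfolding reach_sequential by blast
  ultimately show ?thesis unfolding reach_sequential by (intro exI[of _ "\<lambda>n. ?m (l n)"] exI[of _ X]) simp
qed

lemma reach_g_fs:
  assumes v: "v \<in> Q" and r: "(\<tau>, x, z) \<in> reach g \<Omega>"
  shows "(\<tau>, x, z) \<in> reach (\<lambda>x z. fs x z v) Ps"
proof -
  obtain u0 where u0: "u0 \<in> P" using P by blast
  let ?m = "map (\<lambda>(d, w). (d, 0 :: real, u0, w))"
  have "steps_in \<Omega> l \<Longrightarrow> steps_in Ps (?m l)" "duration (?m l) = duration l"
    "lflow (\<lambda>x z. fs x z v) (?m l) x = lflow g l x" for l x
    by (induction l arbitrary: x) (use u0 in \<open>auto simp: Pstar_def\<close>)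
  moreover obtain l X where "\<And>n::nat. steps_in \<Omega> (l n)" "(\<lambda>n. duration (l n)) \<longlonglongrightarrow> \<tau>" "X \<longlonglongrightarrow> x"
    "(\<lambda>n. lflow g (l n) (X n)) \<longlonglongrightarrow> z" using r unfolding reach_sequential by blast
  ultimately show ?thesis unfolding reach_sequential by (intro exI[of _ "\<lambda>n. ?m (l n)"] exI[of _ X]) simp
qed

text \<open>In the approximating lists the \<open>g\<close>-pieces already run and those inside the
  new combined piece are all moved behind its \<open>f\<close>-pieces. The share of \<open>f\<close>
  in the duration varies along the sequence, so \<open>\<sigma>\<close> and the intermediate point
  are found by compactness.\<close>

lemma reach_rearrange:
  assumes v: "v \<in> Q" and r1: "(a, y, z) \<in> reach g \<Omega>" and r2: "(\<delta>, z, z') \<in> reach (\<lambda>x z. fs x z v) Ps"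
  shows "\<exists>\<sigma>\<in>{0..\<delta>}. \<exists>y'. (\<sigma>, y, y') \<in> reach (\<lambda>x u. f x u v) P \<and> (a + \<delta> - \<sigma>, y', z') \<in> reach g \<Omega>"
proof -
  interpret S: rhs_system "\<lambda>x z. fs x z v" Ps by (rule S_sys[OF v])
  interpret F: rhs_system "\<lambda>x u. f x u v" P by (rule F_sys[OF v])
  obtain l Z where l: "\<And>n::nat. steps_in Ps (l n)" "(\<lambda>n. duration (l n)) \<longlonglongrightarrow> \<delta>" "Z \<longlonglongrightarrow> z"
    "(\<lambda>n. lflow (\<lambda>x z. fs x z v) (l n) (Z n)) \<longlonglongrightarrow> z'" using r2 unfolding reach_sequential by blast
  obtain k Y where k: "\<And>n::nat. steps_in \<Omega> (k n)" "(\<lambda>n. duration (k n)) \<longlonglongrightarrow> a" "Y \<longlonglongrightarrow> y"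
    "(\<lambda>n. lflow g (k n) (Y n)) \<longlonglongrightarrow> z" using r1 unfolding reach_sequential by blast
  define y' where "y' = (\<lambda>n. lflow (\<lambda>x u. f x u v) (f_steps (l n)) (Y n))"
  define \<sigma> where "\<sigma> = (\<lambda>n. duration (f_steps (l n)))"
  have fg: "steps_in P (f_steps (l n))" "steps_in \<Omega> (g_steps (l n))" "\<sigma> n + duration (g_steps (l n)) = duration (l n)" for n
    using f_g_steps[OF l(1)[of n]] by (auto simp: \<sigma>_def)
  have \<sigma>: "0 \<le> \<sigma> n" "\<sigma> n \<le> duration (l n)" for n
    using duration_nonneg[OF fg(1)[of n]] duration_nonneg[OF fg(2)[of n]] fg(3)[of n] by (auto simp: \<sigma>_def)
  have "(\<lambda>n. lflow (\<lambda>x z. fs x z v) (l n) (lflow g (k n) (Y n))) \<longlonglongrightarrow> z'"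
    by (rule S.lflow_stable[OF l(1,2,3) k(4) l(4)])
  moreover have "lflow (\<lambda>x z. fs x z v) (l n) (lflow g (k n) (Y n)) = lflow g (k n @ g_steps (l n)) (y' n)" for n
    unfolding lflow_fs[OF v l(1)] commute_lflow[OF v fg(1) k(1)] lflow_append y'_def ..
  ultimately have zl: "(\<lambda>n. lflow g (k n @ g_steps (l n)) (y' n)) \<longlonglongrightarrow> z'" by simp
  obtain T where T: "\<And>n. norm (duration (l n)) \<le> T" using convergent_imp_Bseq[OF convergentI[OF l(2)]] by (auto simp: Bseq_def)
  obtain R where R: "\<And>n. norm (Y n) \<le> R" using convergent_imp_Bseq[OF convergentI[OF k(3)]] by (auto simp: Bseq_def)
  have yb: "norm (y' n) \<le> (1 + R) * exp (F.growth_const * T)" for n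
  proof -
    have "1 + norm (y' n) \<le> (1 + norm (Y n)) * exp (F.growth_const * \<sigma> n)"
      unfolding y'_def \<sigma>_def by (rule F.lflow_growth[OF fg(1)])
    also have "\<dots> \<le> (1 + R) * exp (F.growth_const * T)"
      using R[of n] T[of n] \<sigma>[of n] F.growth_const_nonneg order_trans[OF norm_ge_zero R] by (intro mult_mono) (auto intro!: mult_left_mono)
    finally show ?thesis by simp
  qed
  have "(\<sigma> n, y' n) \<in> {0..T} \<times> cball 0 ((1 + R) * exp (F.growth_const * T))" for n
    using yb[of n] \<sigma>[of n] T[of n] by auto
  moreover have "compact ({0..T} \<times> cball (0 :: 'x) ((1 + R) * exp (F.growth_const * T)))" by (intro compact_Times) auto
  ultimately obtain p r where r: "strict_mono r" "((\<lambda>n. (\<sigma> n, y' n)) \<circ> r) \<longlonglongrightarrow> p"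
    unfolding compact_def by meson
  obtain \<sigma>' y0 where p: "p = (\<sigma>', y0)" by (cases p)
  have pl: "(\<lambda>n. (\<sigma> (r n), y' (r n))) \<longlonglongrightarrow> (\<sigma>', y0)" using r(2) p by (simp add: o_def)
  have \<sigma>l: "(\<lambda>n. \<sigma> (r n)) \<longlonglongrightarrow> \<sigma>'" and yl: "(\<lambda>n. y' (r n)) \<longlonglongrightarrow> y0" using tendsto_fst[OF pl] tendsto_snd[OF pl] by simp_all
  have sub: "(\<lambda>n. X (r n)) \<longlonglongrightarrow> L" if "X \<longlonglongrightarrow> L" for X :: "nat \<Rightarrow> 'b::topological_space" and L
    using LIMSEQ_subseq_LIMSEQ[OF that r(1)] by (simp add: o_def)
  have "(\<sigma>', y, y0) \<in> reach (\<lambda>x u. f x u v) P"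
    by (rule reach_limit[OF _ \<sigma>l sub[OF k(3)] yl]) (unfold \<sigma>_def y'_def, rule reach_lflow[OF fg(1)])
  moreover have "(a + \<delta> - \<sigma>', y0, z') \<in> reach g \<Omega>"
  proof (rule reach_limit[OF _ _ yl sub[OF zl]])
    show "(duration (k (r n) @ g_steps (l (r n))), y' (r n), lflow g (k (r n) @ g_steps (l (r n))) (y' (r n))) \<in> reach g \<Omega>" for n
      by (rule reach_lflow) (use k(1) fg(2) in simp)
    have "duration (g_steps (l n)) = duration (l n) - \<sigma> n" for n using fg(3)[of n] by linarith
    then show "(\<lambda>n. duration (k (r n) @ g_steps (l (r n)))) \<longlonglongrightarrow> a + \<delta> - \<sigma>'"
      using tendsto_diff[OF tendsto_add[OF sub[OF k(2)] sub[OF l(2)]] \<sigma>l] by (simp add: add_diff_eq)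
  qed
  moreover have "0 \<le> \<sigma>'" by (rule LIMSEQ_le_const[OF \<sigma>l]) (use \<sigma> in auto)
  moreover have "\<sigma>' \<le> \<delta>" by (rule LIMSEQ_le[OF \<sigma>l sub[OF l(2)]]) (use \<sigma> in auto)
  ultimately show ?thesis by auto
qed

end

section \<open>Transfer of stable sets between the two systems\<close>

context augmented_game
begin

lemma target_closed: "closed (sect M \<theta>)"
proof -
  have "sect M \<theta> = (\<lambda>x. (\<theta>, x)) -` M" by (auto simp: sect_def)
  then show ?thesis using M_closed by (auto intro!: closed_vimage continuous_intros)
qed

sublocale A: game \<theta> P Q f M
  by unfold_locales (rule theta_pos P Q f_reg M_closed M_sub)+

sublocale B: game \<theta> Ps Q fs Ms
  using theta_pos by unfold_locales (auto intro!: Ps Q fs_joint closed_Times target_closed)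

text \<open>Prepending the constant piece to a \<open>g\<close>-motion that ends in
  \<open>sect M \<theta>\<close> gives another such motion, now passing through \<open>x\<close> at
  time \<open>t\<close>; by \<open>M_iff\<close> its positions are in \<open>M\<close>.\<close>

lemma target_backward_flow:
  assumes w: "w \<in> \<Omega>" and t: "0 \<le> t" "0 \<le> d" "t + d \<le> \<theta>" and m: "(t + d, flow (\<lambda>x. g x w) d x) \<in> M"
  shows "(t, x) \<in> M"
proof -
  interpret G: rhs_system g \<Omega> by (rule G_sys)
  obtain \<mu> y where \<mu>: "\<mu> \<in> relaxed_controls \<theta> \<Omega>" and y: "motion_on \<Omega> g \<mu> 0 \<theta> y" "y \<theta> \<in> sect M \<theta>" "flow (\<lambda>x. g x w) d x = y (t + d)"
    using m unfolding M_iff by blast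
  note c = const_control_relaxed[OF G.Lam_closed w, of \<theta>]
  obtain x1 where x1: "x1 t = x" "motion_on \<Omega> g (const_control \<theta> w) 0 \<theta> x1" using G.motion_exists[OF c, of t x] t by auto
  have "local_sol (\<lambda>x. g x w) \<theta> x1" using x1(2) G.local_sol_iff_motion[OF w] by blast
  then have "local_sol (\<lambda>x. g x w) d (\<lambda>r. x1 (t + r))" by (rule local_sol_shift) (use t in auto)
  from G.local_sol_unique[OF w this forward_sol_local[OF G.flow_sol[OF w, of x]], of d]
  have eq: "x1 (t + d) = y (t + d)" using x1(1) t y(3) by (simp add: G.flow_0[OF w])
  have td: "t + d \<in> {0..\<theta>}" using t by auto
  let ?z = "\<lambda>r. if r \<le> t + d then x1 r else y r"
  have "motion_on \<Omega> g (concat_control (t + d) (const_control \<theta> w) \<mu>) 0 \<theta> ?z"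
    by (rule G.motion_concat[OF c \<mu> x1(2) y(1) td eq])
  moreover have "?z \<theta> \<in> sect M \<theta>"
  proof (cases "\<theta> \<le> t + d")
    case True
    then have "t + d = \<theta>" using t by simp
    then show ?thesis using eq y(2) by simp
  qed (use y(2) in simp)
  moreover have "?z t = x" using x1 t by simp
  moreover have "t \<in> {0..\<theta>}" using t by simp
  ultimately show ?thesis
    unfolding M_iff using concat_relaxed[OF c \<mu> G.Lam_closed, of "t + d"]
    by (intro conjI bexI[of _ "concat_control (t + d) (const_control \<theta> w) \<mu>"] exI[of _ ?z]) simp_all
qed

lemma target_backward_lflow:
  "steps_in \<Omega> l \<Longrightarrow> 0 \<le> t \<Longrightarrow> t + duration l \<le> \<theta> \<Longrightarrow> (t + duration l, lflow g l x) \<in> M \<Longrightarrow> (t, x) \<in> M"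
proof (induction l arbitrary: t x)
  case (Cons p l)
  have d: "0 \<le> duration l" using Cons.prems(1) duration_nonneg[of \<Omega> l] by simp
  have "(t + fst p, flow (\<lambda>y. g y (snd p)) (fst p) x) \<in> M"
    by (rule Cons.IH) (use Cons.prems in \<open>simp_all add: add.assoc\<close>)
  then show ?case by (rule target_backward_flow[rotated 4]) (use Cons.prems d in simp_all)
qed simp

lemma target_forward_reach:
  assumes "(\<xi>, z) \<in> M" "\<xi> \<le> s" "s \<le> \<theta>"
  shows "\<exists>z'. (s, z') \<in> M \<and> (s - \<xi>, z, z') \<in> reach g \<Omega>"
proof -
  interpret G: rhs_system g \<Omega> by (rule G_sys)
  obtain \<mu> y where \<mu>: "\<mu> \<in> relaxed_controls \<theta> \<Omega>" and y: "motion_on \<Omega> g \<mu> 0 \<theta> y" "y \<theta> \<in> sect M \<theta>" "z = y \<xi>" and \<xi>: "\<xi> \<in> {0..\<theta>}"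
    using assms(1) unfolding M_iff by blast
  have "motion_on \<Omega> g \<mu> \<xi> s y" by (rule motion_on_subset[OF y(1)]) (use \<xi> assms in auto)
  then have "(s - \<xi>, y \<xi>, y s) \<in> reach g \<Omega>" by (rule G.motion_reach[OF \<mu>]) (use \<xi> assms in auto)
  moreover have "(s, y s) \<in> M" unfolding M_iff using \<mu> y \<xi> assms by auto
  ultimately show ?thesis using y(3) by blast
qed

text \<open>The approximating end points only tend to \<open>z\<close> and need not lie in the
  target. So the lists are run backwards from \<open>z\<close> itself: the points obtained lie in
  \<open>M\<close> by \<open>target_backward_lflow\<close>, and they tend to \<open>x\<close> by
  stability of the reversed flows.\<close>

lemma target_backward_reach:
  assumes r: "(\<theta> - t, x, z) \<in> reach g \<Omega>" and z: "z \<in> sect M \<theta>" and t: "0 \<le> t"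
  shows "(t, x) \<in> M"
proof -
  interpret G: rhs_system g \<Omega> by (rule G_sys)
  interpret N: rhs_system "\<lambda>x a. - g x a" \<Omega> by (rule G.rhs_system_uminus)
  define \<tau> where "\<tau> = \<theta> - t"
  have \<tau>: "0 \<le> \<tau>" using G.reach_move(1)[OF r] by (simp add: \<tau>_def)
  obtain l X where l: "\<And>n::nat. steps_in \<Omega> (l n)" "(\<lambda>n. duration (l n)) \<longlonglongrightarrow> \<tau>" "X \<longlonglongrightarrow> x"
    "(\<lambda>n. lflow g (l n) (X n)) \<longlonglongrightarrow> z" using r unfolding reach_sequential \<tau>_def by blast
  \<comment> \<open>The excess over \<open>\<tau>\<close> is cut from the front, since otherwise
    running backwards from \<open>\<theta>\<close> could pass below time 0. It tends to 0, so the
    shortened lists still start near \<open>x\<close>.\<close>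
  define e where "e = (\<lambda>n. max 0 (duration (l n) - \<tau>))"
  have e0: "e \<longlonglongrightarrow> 0"
    unfolding e_def using tendsto_max[OF tendsto_const[of 0] tendsto_diff[OF l(2) tendsto_const[of \<tau>]]] by simp
  have e: "0 \<le> e n" "e n \<le> duration (l n)" for n
    using duration_nonneg[OF l(1)[of n]] \<tau> by (auto simp: e_def)
  have "\<exists>l1 l2. steps_in \<Omega> l1 \<and> steps_in \<Omega> l2 \<and> duration l1 = e n \<and> duration l2 = duration (l n) - e n \<and>
     (\<forall>x. lflow g (l n) x = lflow g l2 (lflow g l1 x))" for n
    by (rule G.lflow_split[OF l(1) e])
  then obtain l1 l2 where s: "\<And>n. steps_in \<Omega> (l1 n)" "\<And>n. steps_in \<Omega> (l2 n)" "\<And>n. duration (l1 n) = e n"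
    "\<And>n. duration (l2 n) = duration (l n) - e n" "\<And>n x. lflow g (l n) x = lflow g (l2 n) (lflow g (l1 n) x)" by metis
  define Y where "Y = (\<lambda>n. lflow g (l1 n) (X n))"
  have Y: "Y \<longlonglongrightarrow> x"
  proof -
    have "(\<lambda>n. lflow g (l1 n) (X n) - X n) \<longlonglongrightarrow> 0"
    proof (rule Lim_null_comparison)
      show "\<forall>\<^sub>F n in sequentially. norm (lflow g (l1 n) (X n) - X n) \<le> G.growth_const * ((1 + norm (X n)) * exp (G.growth_const * e n)) * e n"
        using G.reach_move(2)[OF reach_lflow[OF s(1)]] by (simp add: s(3))
      have "(\<lambda>n. G.growth_const * ((1 + norm (X n)) * exp (G.growth_const * e n)) * e n) \<longlonglongrightarrow> G.growth_const * ((1 + norm x) * exp (G.growth_const * 0)) * 0"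
        by (intro tendsto_intros l(3) e0)
      then show "(\<lambda>n. G.growth_const * ((1 + norm (X n)) * exp (G.growth_const * e n)) * e n) \<longlonglongrightarrow> 0" by simp
    qed
    from tendsto_add[OF this l(3)] show ?thesis by (simp add: Y_def)
  qed
  have d2: "(\<lambda>n. duration (l2 n)) \<longlonglongrightarrow> \<tau>" using tendsto_diff[OF l(2) e0] by (simp add: s(4))
  have zl: "(\<lambda>n. lflow g (l2 n) (Y n)) \<longlonglongrightarrow> z" using l(4) by (simp add: s(5) Y_def)
  define w where "w = (\<lambda>n. lflow (\<lambda>x a. - g x a) (rev (l2 n)) z)"
  have "w \<longlonglongrightarrow> x" unfolding w_def
  proof (rule N.lflow_stable[OF _ _ zl tendsto_const])
    show "(\<lambda>n. duration (rev (l2 n))) \<longlonglongrightarrow> \<tau>" using d2 by simp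
    show "(\<lambda>n. lflow (\<lambda>x a. - g x a) (rev (l2 n)) (lflow g (l2 n) (Y n))) \<longlonglongrightarrow> x"
      using Y by (simp add: G.lflow_uminus_lflow[OF s(2)])
  qed (simp add: s(2))
  have "(\<theta> - duration (l2 n), w n) \<in> M" for n
  proof (rule target_backward_lflow[OF s(2)])
    have "duration (l2 n) \<le> \<tau>" by (simp add: s(4) e_def)
    then show "0 \<le> \<theta> - duration (l2 n)" using t by (simp add: \<tau>_def)
    have "lflow g (l2 n) (w n) = z" unfolding w_def by (rule G.lflow_lflow_uminus[OF s(2)])
    then show "(\<theta> - duration (l2 n) + duration (l2 n), lflow g (l2 n) (w n)) \<in> M" using z by (simp add: sect_def)
  qed simp
  moreover have "(\<lambda>n. (\<theta> - duration (l2 n), w n)) \<longlonglongrightarrow> (\<theta> - \<tau>, x)"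
    by (intro tendsto_intros d2 \<open>w \<longlonglongrightarrow> x\<close>)
  ultimately have "(\<theta> - \<tau>, x) \<in> M" by (rule closed_sequentially[OF M_closed])
  then show ?thesis by (simp add: \<tau>_def)
qed

text \<open>The bridge of the original game is stable for the combined one: once \<open>M\<close> is
  hit, \<open>target_forward_reach\<close> continues along \<open>g\<close> inside \<open>M\<close>
  up to the required instant, a motion open to the combined system. Hence the second alternative of
  stability always holds.\<close>

lemma solvability_subset: "solvability_set \<theta> P Q f M \<subseteq> solvability_set \<theta> Ps Q fs Ms"
proof -
  have D: "A.stable A.bridge" by (rule A.stable_bridge)
  have MD: "M \<subseteq> A.bridge"
    using A.stable_subset_solvability[OF A.stable_target] A.solvability_eq_bridge by simp
  have "B.stable A.bridge" unfolding B.stable_def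
  proof (intro conjI allI impI ballI)
    show "closed A.bridge" "A.bridge \<subseteq> {0..\<theta>} \<times> UNIV" "sect A.bridge \<theta> \<subseteq> sect Ms \<theta>"
      using D by (auto simp: A.stable_def sect_def)
    fix t x v s assume tx: "(t, x) \<in> A.bridge" and v: "v \<in> Q" and s: "s \<in> {t..\<theta>}"
    interpret S: rhs_system "\<lambda>x z. fs x z v" Ps by (rule S_sys[OF v])
    have "(\<exists>\<xi>\<in>{t..s}. \<exists>z. (\<xi>, z) \<in> M \<and> (\<xi> - t, x, z) \<in> reach (\<lambda>x u. f x u v) P) \<or>
        (\<exists>z. (s, z) \<in> A.bridge \<and> (s - t, x, z) \<in> reach (\<lambda>x u. f x u v) P)"
      using D tx v s unfolding A.stable_def by blast
    then have "\<exists>z. (s, z) \<in> A.bridge \<and> (s - t, x, z) \<in> reach (\<lambda>x z. fs x z v) Ps"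
    proof
      assume "\<exists>\<xi>\<in>{t..s}. \<exists>z. (\<xi>, z) \<in> M \<and> (\<xi> - t, x, z) \<in> reach (\<lambda>x u. f x u v) P"
      then obtain \<xi> z where \<xi>: "\<xi> \<in> {t..s}" "(\<xi>, z) \<in> M" "(\<xi> - t, x, z) \<in> reach (\<lambda>x u. f x u v) P" by blast
      obtain z' where z': "(s, z') \<in> M" "(s - \<xi>, z, z') \<in> reach g \<Omega>"
        using target_forward_reach[OF \<xi>(2), of s] \<xi>(1) s by auto
      have "(\<xi> - t + (s - \<xi>), x, z') \<in> reach (\<lambda>x z. fs x z v) Ps"
        by (rule S.reach_trans[OF reach_f_fs[OF v \<xi>(3)] reach_g_fs[OF v z'(2)]])
      then show ?thesis using z'(1) MD by auto
    next
      assume "\<exists>z. (s, z) \<in> A.bridge \<and> (s - t, x, z) \<in> reach (\<lambda>x u. f x u v) P"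
      then show ?thesis using reach_f_fs[OF v] by blast
    qed
    then show "(\<exists>\<xi>\<in>{t..s}. \<exists>z. (\<xi>, z) \<in> Ms \<and> (\<xi> - t, x, z) \<in> reach (\<lambda>x z. fs x z v) Ps) \<or>
        (\<exists>z. (s, z) \<in> A.bridge \<and> (s - t, x, z) \<in> reach (\<lambda>x z. fs x z v) Ps)" ..
  qed
  then show ?thesis using B.stable_subset_solvability A.solvability_eq_bridge by simp
qed

text \<open>Moving a bridge of the combined system backwards along motions of \<open>g\<close> makes it a bridge
  of the original system.\<close>

definition pulled_back :: "(real \<times> 'x) set" where
  "pulled_back = {(t, x). 0 \<le> t \<and> (\<exists>\<tau> z. (t + \<tau>, z) \<in> B.bridge \<and> (\<tau>, x, z) \<in> reach g \<Omega>)}"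

text \<open>\<open>\<tau>\<close> is at most \<open>\<theta>\<close> and \<open>z\<close> is bounded
  by the growth estimate, so a convergent subsequence of the witnesses supplies witnesses for the
  limit.\<close>

lemma closed_pulled_back: "closed pulled_back"
proof (unfold closed_sequential_limits, intro allI impI, elim conjE)
  interpret G: rhs_system g \<Omega> by (rule G_sys)
  fix p :: "nat \<Rightarrow> real \<times> 'x" and q assume p: "\<forall>n. p n \<in> pulled_back" and lim: "p \<longlonglongrightarrow> q"
  define t where "t n = fst (p n)" for n
  define x where "x n = snd (p n)" for n
  have tl: "t \<longlonglongrightarrow> fst q" and xl: "x \<longlonglongrightarrow> snd q" unfolding t_def x_def by (intro tendsto_intros lim)+
  have "\<exists>\<tau> z. (t n + \<tau>, z) \<in> B.bridge \<and> (\<tau>, x n, z) \<in> reach g \<Omega>" for n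
    using spec[OF p, of n] unfolding t_def x_def by (auto simp: pulled_back_def case_prod_unfold)
  then obtain \<tau> z where \<tau>: "\<And>n. (t n + \<tau> n, z n) \<in> B.bridge" "\<And>n. (\<tau> n, x n, z n) \<in> reach g \<Omega>" by metis
  have t0: "0 \<le> t n" for n using spec[OF p, of n] unfolding t_def by (auto simp: pulled_back_def)
  have \<tau>b: "0 \<le> \<tau> n" "\<tau> n \<le> \<theta>" for n
    using G.reach_move(1)[OF \<tau>(2)[of n]] \<tau>(1)[of n] B.bridge_subset t0[of n] by auto
  obtain R where R: "\<And>n. norm (x n) \<le> R" using convergent_imp_Bseq[OF convergentI[OF xl]] by (auto simp: Bseq_def)
  have zb: "norm (z n) \<le> (1 + R) * exp (G.growth_const * \<theta>)" for n
  proof -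
    have "1 + norm (z n) \<le> (1 + norm (x n)) * exp (G.growth_const * \<tau> n)" by (rule G.reach_move(3)[OF \<tau>(2)])
    also have "\<dots> \<le> (1 + R) * exp (G.growth_const * \<theta>)"
      using R[of n] \<tau>b[of n] G.growth_const_nonneg order_trans[OF norm_ge_zero R] by (intro mult_mono) (auto intro!: mult_left_mono)
    finally show ?thesis by simp
  qed
  have "(\<tau> n, z n) \<in> {0..\<theta>} \<times> cball 0 ((1 + R) * exp (G.growth_const * \<theta>))" for n using \<tau>b[of n] zb[of n] by auto
  moreover have "compact ({0..\<theta>} \<times> cball (0 :: 'x) ((1 + R) * exp (G.growth_const * \<theta>)))" by (intro compact_Times) auto
  ultimately obtain p' r where r: "strict_mono r" "((\<lambda>n. (\<tau> n, z n)) \<circ> r) \<longlonglongrightarrow> p'" unfolding compact_def by meson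
  obtain \<tau>' z' where p': "p' = (\<tau>', z')" by (cases p')
  have pl: "(\<lambda>n. (\<tau> (r n), z (r n))) \<longlonglongrightarrow> (\<tau>', z')" using r(2) p' by (simp add: o_def)
  have \<tau>l: "(\<lambda>n. \<tau> (r n)) \<longlonglongrightarrow> \<tau>'" and zl: "(\<lambda>n. z (r n)) \<longlonglongrightarrow> z'" using tendsto_fst[OF pl] tendsto_snd[OF pl] by simp_all
  have sub: "(\<lambda>n. X (r n)) \<longlonglongrightarrow> L" if "X \<longlonglongrightarrow> L" for X :: "nat \<Rightarrow> 'b::topological_space" and L
    using LIMSEQ_subseq_LIMSEQ[OF that r(1)] by (simp add: o_def)
  have "(\<tau>', snd q, z') \<in> reach g \<Omega>" by (rule reach_limit[OF _ \<tau>l sub[OF xl] zl]) (rule \<tau>(2))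
  moreover have "(fst q + \<tau>', z') \<in> B.bridge"
  proof (rule closed_sequentially)
    show "closed B.bridge" using B.stable_bridge by (simp add: B.stable_def)
    show "(\<lambda>n. (t (r n) + \<tau> (r n), z (r n))) \<longlonglongrightarrow> (fst q + \<tau>', z')" by (intro tendsto_intros sub[OF tl] \<tau>l zl)
  qed (rule \<tau>(1))
  moreover have "0 \<le> fst q" by (rule LIMSEQ_le_const[OF tl]) (use t0 in auto)
  ultimately show "q \<in> pulled_back" unfolding pulled_back_def by (auto simp: case_prod_unfold)
qed

text \<open>\<open>Ms\<close> lives at time \<open>\<theta>\<close> only, so hitting it by time
  \<open>s\<close> forces the hitting instant to be \<open>s\<close>; as \<open>Ms\<close> lies in
  the bridge, both alternatives of stability give the same conclusion.\<close>

lemma combined_bridge_step: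
  assumes D: "(t, x) \<in> B.bridge" and v: "v \<in> Q" and s: "t \<le> s" "s \<le> \<theta>"
  shows "\<exists>z. (s, z) \<in> B.bridge \<and> (s - t, x, z) \<in> reach (\<lambda>x z. fs x z v) Ps"
proof -
  have MD: "Ms \<subseteq> B.bridge"
    using B.stable_subset_solvability[OF B.stable_target] B.solvability_eq_bridge by simp
  have "s \<in> {t..\<theta>}" using s by simp
  then have "(\<exists>\<xi>\<in>{t..s}. \<exists>z. (\<xi>, z) \<in> Ms \<and> (\<xi> - t, x, z) \<in> reach (\<lambda>x z. fs x z v) Ps) \<or>
        (\<exists>z. (s, z) \<in> B.bridge \<and> (s - t, x, z) \<in> reach (\<lambda>x z. fs x z v) Ps)"
    using B.stable_bridge D v unfolding B.stable_def by blast
  then show ?thesis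
  proof
    assume "\<exists>\<xi>\<in>{t..s}. \<exists>z. (\<xi>, z) \<in> Ms \<and> (\<xi> - t, x, z) \<in> reach (\<lambda>x z. fs x z v) Ps"
    then obtain \<xi> z where "\<xi> \<in> {t..s}" "(\<xi>, z) \<in> Ms" "(\<xi> - t, x, z) \<in> reach (\<lambda>x z. fs x z v) Ps" by blast
    moreover from this have "\<xi> = s" using s by auto
    ultimately show ?thesis using MD by blast
  qed
qed

lemma combined_bridge_end:
  assumes "(\<theta>, x) \<in> B.bridge" shows "x \<in> sect M \<theta>"
proof -
  have "sect B.bridge \<theta> \<subseteq> sect Ms \<theta>" using B.stable_bridge unfolding B.stable_def by blast
  moreover have "x \<in> sect B.bridge \<theta>" using assms unfolding sect_def[of B.bridge] by simp
  ultimately have "x \<in> sect Ms \<theta>" by blast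
  then show ?thesis unfolding sect_def[of Ms] by simp
qed

lemma stable_pulled_back: "A.stable pulled_back"
  unfolding A.stable_def
proof (intro conjI allI impI ballI closed_pulled_back)
  interpret G: rhs_system g \<Omega> by (rule G_sys)
  show "pulled_back \<subseteq> {0..\<theta>} \<times> UNIV"
    using G.reach_move(1) B.bridge_subset by (fastforce simp: pulled_back_def)
  show "sect pulled_back \<theta> \<subseteq> sect M \<theta>"
  proof
    fix x assume "x \<in> sect pulled_back \<theta>"
    then obtain \<tau> z where \<tau>: "(\<theta> + \<tau>, z) \<in> B.bridge" "(\<tau>, x, z) \<in> reach g \<Omega>"
      unfolding sect_def[of pulled_back] by (auto simp: pulled_back_def)
    then have "\<tau> = 0" using G.reach_move(1)[OF \<tau>(2)] B.bridge_subset by auto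
    then have "z = x" using G.reach_move(2)[OF \<tau>(2)] by simp
    then show "x \<in> sect M \<theta>" using \<tau>(1) \<open>\<tau> = 0\<close> by (intro combined_bridge_end) simp
  qed
  fix t x v s assume E: "(t, x) \<in> pulled_back" and v: "v \<in> Q" and s: "s \<in> {t..\<theta>}"
  interpret F: rhs_system "\<lambda>x u. f x u v" P by (rule F_sys[OF v])
  obtain \<tau> z where t0: "0 \<le> t" and \<tau>: "(t + \<tau>, z) \<in> B.bridge" "(\<tau>, x, z) \<in> reach g \<Omega>" using E by (auto simp: pulled_back_def)
  \<comment> \<open>Elements of \<open>C\<close> are rearranged pieces of motions: time \<open>\<sigma>\<close> along \<open>f\<close>, then along \<open>g\<close> up to time \<open>s'\<close>. One that
    maximizes \<open>\<sigma> + s'\<close> has \<open>t + \<sigma> = s\<close> or \<open>s' = \<theta>\<close>, since otherwise it could be prolonged.\<close>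
  define R1 where "R1 = (1 + norm x) * exp (F.growth_const * \<theta>)"
  define R2 where "R2 = (1 + R1) * exp (G.growth_const * \<theta>)"
  define K where "K = {0..\<theta>} \<times> {0..\<theta>} \<times> cball (0::'x) R1 \<times> cball (0::'x) R2"
  define C where "C = K \<inter> ({p. t + fst p \<le> s} \<inter> ((\<lambda>p. (fst p, x, fst (snd (snd p)))) -` reach (\<lambda>x u. f x u v) P \<inter>
     ((\<lambda>p. (fst (snd p) - t - fst p, fst (snd (snd p)), snd (snd (snd p)))) -` reach g \<Omega> \<inter>
      (\<lambda>p. (fst (snd p), snd (snd (snd p)))) -` B.bridge)))"
  \<comment> \<open>The growth bounds place every tuple with the listed properties inside
    \<open>K\<close>, which is what makes their set compact.\<close>
  have C_iff: "(\<sigma>, s', y, z') \<in> C \<longleftrightarrow> 0 \<le> \<sigma> \<and> t + \<sigma> \<le> s \<and> (\<sigma>, x, y) \<in> reach (\<lambda>x u. f x u v) P \<and>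
     (s' - t - \<sigma>, y, z') \<in> reach g \<Omega> \<and> (s', z') \<in> B.bridge" for \<sigma> s' y z'
  proof -
    have "(\<sigma>, s', y, z') \<in> K" if c: "0 \<le> \<sigma>" "t + \<sigma> \<le> s" "(\<sigma>, x, y) \<in> reach (\<lambda>x u. f x u v) P"
      "(s' - t - \<sigma>, y, z') \<in> reach g \<Omega>" "(s', z') \<in> B.bridge"
    proof -
      have s': "s' \<in> {0..\<theta>}" using c(5) B.bridge_subset by auto
      have "1 + norm y \<le> (1 + norm x) * exp (F.growth_const * \<sigma>)" by (rule F.reach_move(3)[OF c(3)])
      also have "\<dots> \<le> R1" unfolding R1_def using c s t0 F.growth_const_nonneg by (intro mult_left_mono) (auto intro!: mult_left_mono)
      finally have y: "norm y \<le> R1" by simp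
      have "1 + norm z' \<le> (1 + norm y) * exp (G.growth_const * (s' - t - \<sigma>))" by (rule G.reach_move(3)[OF c(4)])
      also have "\<dots> \<le> R2" unfolding R2_def
        using c s' t0 y G.growth_const_nonneg order_trans[OF norm_ge_zero y] by (intro mult_mono) (auto intro!: mult_left_mono)
      finally show ?thesis using y c s s' t0 by (simp add: K_def)
    qed
    then show ?thesis by (auto simp: C_def K_def)
  qed
  have "compact K" unfolding K_def by (intro compact_Times) auto
  moreover have "closed B.bridge" using B.stable_bridge by (simp add: B.stable_def)
  ultimately have "compact C" unfolding C_def
    by (intro compact_Int_closed closed_Int closed_vimage closed_reach closed_Collect_le continuous_intros)
  moreover have "(0, t + \<tau>, x, z) \<in> C" unfolding C_iff using s \<tau> by (auto intro: reach_0)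
  moreover have "continuous_on C (\<lambda>p. fst p + fst (snd p))" by (intro continuous_intros)
  ultimately obtain p where p: "p \<in> C" "\<And>q. q \<in> C \<Longrightarrow> fst q + fst (snd q) \<le> fst p + fst (snd p)"
    using continuous_attains_sup[of C "\<lambda>p. fst p + fst (snd p)"] by blast
  obtain \<sigma> s' y z' where p': "p = (\<sigma>, s', y, z')" by (cases p) auto
  have c: "0 \<le> \<sigma>" "t + \<sigma> \<le> s" "(\<sigma>, x, y) \<in> reach (\<lambda>x u. f x u v) P" "(s' - t - \<sigma>, y, z') \<in> reach g \<Omega>" "(s', z') \<in> B.bridge"
    using p(1) C_iff unfolding p' by auto
  have s'\<theta>: "s' \<le> \<theta>" using c(5) B.bridge_subset by auto
  consider "s' = \<theta>" | "t + \<sigma> = s" | "s' < \<theta>" "t + \<sigma> < s" using s'\<theta> c(2) by linarith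
  then show "(\<exists>\<xi>\<in>{t..s}. \<exists>z. (\<xi>, z) \<in> M \<and> (\<xi> - t, x, z) \<in> reach (\<lambda>x u. f x u v) P) \<or>
      (\<exists>z. (s, z) \<in> pulled_back \<and> (s - t, x, z) \<in> reach (\<lambda>x u. f x u v) P)"
  proof cases
    case 1
    have "z' \<in> sect M \<theta>" using c(5) 1 by (intro combined_bridge_end) simp
    then have "(t + \<sigma>, y) \<in> M"
      by (rule target_backward_reach[rotated]) (use c 1 t0 in \<open>auto simp: algebra_simps\<close>)
    then show ?thesis using c by (intro disjI1 bexI[of _ "t + \<sigma>"] exI[of _ y]) auto
  next
    case 2
    have "(s, y) \<in> pulled_back" unfolding pulled_back_def
      using c 2 t0 by (auto intro!: exI[of _ "s' - t - \<sigma>"] exI[of _ z'])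
    then show ?thesis using c(3) 2 by (intro disjI2 exI[of _ y]) auto
  next
    case 3
    \<comment> \<open>The largest step that respects both bounds. Moving on in the combined bridge
      by \<open>\<delta>\<close> and rearranging raises \<open>\<sigma> + s'\<close> by
      \<open>\<sigma>1 + \<delta>\<close>, which is positive, against maximality.\<close>
    define \<delta> where "\<delta> = min (s - t - \<sigma>) (\<theta> - s')"
    have \<delta>: "0 < \<delta>" "\<delta> \<le> s - t - \<sigma>" "s' + \<delta> \<le> \<theta>" using 3 by (auto simp: \<delta>_def)
    obtain z'' where z'': "(s' + \<delta>, z'') \<in> B.bridge" "(\<delta>, z', z'') \<in> reach (\<lambda>x z. fs x z v) Ps"
      using combined_bridge_step[OF c(5) v, of "s' + \<delta>"] \<delta> by auto
    obtain \<sigma>1 y' where \<sigma>1: "\<sigma>1 \<in> {0..\<delta>}" "(\<sigma>1, y, y') \<in> reach (\<lambda>x u. f x u v) P" "(s' - t - \<sigma> + \<delta> - \<sigma>1, y', z'') \<in> reach g \<Omega>"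
      using reach_rearrange[OF v c(4) z''(2)] by blast
    have "(\<sigma> + \<sigma>1, s' + \<delta>, y', z'') \<in> C"
      unfolding C_iff using c \<sigma>1 \<delta> z''(1) F.reach_trans[OF c(3) \<sigma>1(2)] by (auto simp: algebra_simps)
    from p(2)[OF this] show ?thesis using \<sigma>1(1) \<delta>(1) by (simp add: p')
  qed
qed

lemma solvability_eq: "solvability_set \<theta> P Q f M = solvability_set \<theta> Ps Q fs Ms"
proof
  have "B.bridge \<subseteq> pulled_back"
    using B.bridge_subset reach_0[of _ g \<Omega>] by (fastforce simp: pulled_back_def intro: exI[of _ "0::real"])
  then show "solvability_set \<theta> Ps Q fs Ms \<subseteq> solvability_set \<theta> P Q f M"
    using A.stable_subset_solvability[OF stable_pulled_back] B.solvability_eq_bridge by simp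
qed (rule solvability_subset)

end

theorem theorem1:
  fixes \<theta> :: real
    and P :: "'u::euclidean_space set" and Q :: "'v::euclidean_space set"
    and \<Omega> :: "'w::euclidean_space set"
    and f :: "'x::euclidean_space \<Rightarrow> 'u \<Rightarrow> 'v \<Rightarrow> 'x"
    and g :: "'x \<Rightarrow> 'w \<Rightarrow> 'x"
    and M :: "(real \<times> 'x) set"
  assumes theta_pos: "\<theta> > 0"
    and P: "compact P" "P \<noteq> {}" and Q: "compact Q" "Q \<noteq> {}"
    and Om: "compact \<Omega>" "\<Omega> \<noteq> {}"
    and f_reg: "regular_rhs (\<lambda>x (u, v). f x u v) (P \<times> Q)"
    and g_reg: "regular_rhs g \<Omega>"
    and M_closed: "closed M"
    and M_sub: "M \<subseteq> {0..\<theta>} \<times> UNIV"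
    and M_ctrl: "M = {(t, x). t \<in> {0..\<theta>} \<and>
        (\<exists>x0\<in>sect M \<theta>. \<exists>\<mu>\<in>relaxed_controls \<theta> \<Omega>. \<exists>y.
           is_motion \<theta> \<Omega> g \<theta> x0 \<mu> y \<and> x = y t)}"
    and commute: "\<forall>u\<in>P. \<forall>v\<in>Q. \<forall>\<omega>\<in>\<Omega>. \<forall>\<tau>1 \<ge> 0. \<forall>\<tau>2 \<ge> 0.
        flow (\<lambda>x. f x u v) \<tau>1 \<circ> flow (\<lambda>x. g x \<omega>) \<tau>2 = flow (\<lambda>x. g x \<omega>) \<tau>2 \<circ> flow (\<lambda>x. f x u v) \<tau>1"
  shows "(\<forall>k. W_seq \<theta> Q P f M k = W_seq \<theta> Q (Pstar P \<Omega>) (fstar f g) ({\<theta>} \<times> sect M \<theta>) k)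
     \<and> solvability_set \<theta> P Q f M = solvability_set \<theta> (Pstar P \<Omega>) Q (fstar f g) ({\<theta>} \<times> sect M \<theta>)
     \<and> (isaacs f P Q \<longrightarrow> isaacs (fstar f g) (Pstar P \<Omega>) Q)"
proof -
  interpret augmented_game P Q \<Omega> f g \<theta> M
    by unfold_locales (rule P Q Om f_reg g_reg commute theta_pos M_closed M_sub M_ctrl)+
  show ?thesis using W_seq_eq solvability_eq isaacs_fstar by blast
qed

end
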